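(* Let $0<p<2$ and let $q=q(p):=\frac{2p}{2-p}$. Assume that there exists a sequence $(\rho_j)_{j\ge 1}$ of positive numbers such that $$\sup_{x\in D}\sum_{j\ge 1}\rho_j|\psi_j(x)|<\infty \qquad\text{and}\qquad (\rho_j^{-1})_{j\ge 1}\in \ell^q(\mathbb{N}).$$ Then the solution map $y\mapsto u(y)$ belongs to $L^k(U,V,\gamma)$ for all $0\le k<\infty$ (that is, it is measurable with values in $V$ and $\int_U\|u(y)\|_V^k\,d\gamma(y)<\infty$). Moreover, the sequence $(\|u_\nu\|_V)_{\nu\in\mathcal{F}}$ of norms of the Hermite coefficients of $u$ belongs to $\ell^p(\mathcal{F})$. In particular, best $n$-term Hermite approximations converge in $L^2(U,V,\gamma)$ with rate $n^{-s}$, where $s=\frac1p-\frac12=\frac1q$: there is a constant $C$ such that $\|u-u_{\Lambda_n}\|_{L^2(U,V,\gamma)}\le C n^{-s}$ for all $n\ge 1$, where $u_{\Lambda_n}:=\sum_{\nu\in\Lambda_n}u_\nu H_\nu$ and $\Lambda_n$ is a set of indices corresponding to the $n$ largest values of $\|u_\nu\|_V$.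
   Context: $D\subset\mathbb{R}^d$ is a bounded Lipschitz domain, $V:=H^1_0(D)$ with norm $\|v\|_V:=\|\nabla v\|_{L^2(D)}$, and $f\in H^{-1}(D)$ is fixed. $(\psi_j)_{j\ge1}$ is a given sequence of functions in $L^\infty(D)$ (suprema over $x\in D$ of pointwise expressions in the $\psi_j$ are understood up to null sets). $U:=\mathbb{R}^{\mathbb{N}}$, $\mathbb{N}=\{1,2,\dots\}$, is equipped with the $\sigma$-algebra generated by the Borel cylinders and with $\gamma$, the countable product of standard Gaussian measures $\mathcal{N}(0,1)$ on $\mathbb{R}$. For $y=(y_j)_{j\ge1}\in U$ set $b(y):=\sum_{j\ge1}y_j\psi_j$ whenever this series converges in $L^\infty(D)$, set $a(y):=\exp(b(y))$, and let $u(y)\in V$ be the unique weak solution of $-\mathrm{div}(a(y)\nabla u(y))=f$ in $D$ with homogeneous Dirichlet boundary conditions, i.e. $\int_D a(y)\nabla u(y)\cdot\nabla v\,dx=\langle f,v\rangle$ for all $v\in V$. The map $y\mapsto u(y)$ need only be defined for $\gamma$-almost every $y$; measurability into a Banach space means strong (Bochner) measurability, i.e. being an almost everywhere pointwise limit of simple functions. $\mathcal{F}$ is the countable set of finitely supported sequences $\nu=(\nu_j)_{j\ge1}$ of nonnegative integers. $H_k$ are the univariate Hermite polynomials normalized in $L^2(\mathbb{R},g\,dt)$, where $g(t)=(2\pi)^{-1/2}e^{-t^2/2}$, i.e. $H_k=\frac{(-1)^k}{\sqrt{k!}}\frac{g^{(k)}}{g}$; $H_\nu(y):=\prod_{j\ge1}H_{\nu_j}(y_j)$;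 and $u_\nu:=\int_U u(y)H_\nu(y)\,d\gamma(y)\in V$. *)

theory Defs
  imports "HOL-Probability.Probability" "HOL-Probability.Essential_Supremum"
begin

section \<open>The Hilbert space of square-integrable functions\<close>

(* Square-integrable functions on R^d, identified when equal almost everywhere.  L2(D) is
   the subspace of classes vanishing outside D, so one type serves every domain D. *)

definition sq_int :: "('a::euclidean_space \<Rightarrow> 'b::euclidean_space) \<Rightarrow> bool" where
  "sq_int f \<longleftrightarrow> f \<in> borel_measurable lebesgue \<and> integrable lebesgue (\<lambda>x. (norm (f x))\<^sup>2)"

lemma sq_intD [measurable_dest]: "sq_int f \<Longrightarrow> f \<in> borel_measurable lebesgue"
  and sq_int_integrable: "sq_int f \<Longrightarrow> integrable lebesgue (\<lambda>x. (norm (f x))\<^sup>2)"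
  by (simp_all add: sq_int_def)

lemma sq_int_zero [simp]: "sq_int (\<lambda>x. 0)"
  by (simp add: sq_int_def)

lemma sq_int_scaleR: "sq_int f \<Longrightarrow> sq_int (\<lambda>x. c *\<^sub>R f x)"
  by (auto simp: sq_int_def power_mult_distrib)

lemma norm_add_sq_le: "(norm (a + b :: 'a::real_inner))\<^sup>2 \<le> 2 * (norm a)\<^sup>2 + 2 * (norm b)\<^sup>2"
proof -
  have "(norm (a + b))\<^sup>2 + (norm (a - b))\<^sup>2 = 2 * (norm a)\<^sup>2 + 2 * (norm b)\<^sup>2"
    by (simp add: power2_norm_eq_inner inner_simps inner_commute)
  then show ?thesis
    by (smt (verit) zero_le_power2)
qed

lemma sq_int_add:
  assumes "sq_int f" "sq_int g" shows "sq_int (\<lambda>x. f x + g x)"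
proof -
  note [measurable] = sq_intD[OF assms(1)] sq_intD[OF assms(2)]
  have "integrable lebesgue (\<lambda>x. (norm (f x + g x))\<^sup>2)"
    by (rule Bochner_Integration.integrable_bound
          [where f = "\<lambda>x. 2 * (norm (f x))\<^sup>2 + 2 * (norm (g x))\<^sup>2"])
       (use assms in \<open>auto simp: sq_int_integrable norm_add_sq_le\<close>)
  then show ?thesis
    by (simp add: sq_int_def)
qed

lemma sq_int_minus: "sq_int f \<Longrightarrow> sq_int (\<lambda>x. - f x)"
  using sq_int_scaleR[of f "-1"] by simp

lemma sq_int_diff: "sq_int f \<Longrightarrow> sq_int g \<Longrightarrow> sq_int (\<lambda>x. f x - g x)"
  using sq_int_add[of f "\<lambda>x. - g x"] sq_int_minus[of g] by simp

lemma sq_int_inner: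
  assumes "sq_int f" "sq_int g" shows "integrable lebesgue (\<lambda>x. f x \<bullet> g x)"
proof (rule Bochner_Integration.integrable_bound
          [where f = "\<lambda>x. (norm (f x))\<^sup>2 + (norm (g x))\<^sup>2"])
  note [measurable] = sq_intD[OF assms(1)] sq_intD[OF assms(2)]
  show "(\<lambda>x. f x \<bullet> g x) \<in> borel_measurable lebesgue"
    by measurable
  have "\<bar>a \<bullet> b\<bar> \<le> (norm a)\<^sup>2 + (norm b)\<^sup>2" for a b :: 'b
  proof -
    have "2 * (norm a * norm b) \<le> (norm a)\<^sup>2 + (norm b)\<^sup>2"
      using sum_squares_bound[of "norm a" "norm b"] by (simp add: algebra_simps)
    moreover have "0 \<le> norm a * norm b"
      by simp
    ultimately show ?thesis
      using Cauchy_Schwarz_ineq2[of a b] by linarith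
  qed
  then show "AE x in lebesgue. norm (f x \<bullet> g x) \<le> norm ((norm (f x))\<^sup>2 + (norm (g x))\<^sup>2)"
    by (simp add: sum_power2_ge_zero)
qed (use assms in \<open>simp add: sq_int_integrable\<close>)

definition L2_rel :: "('a::euclidean_space \<Rightarrow> 'b::euclidean_space) \<Rightarrow> ('a \<Rightarrow> 'b) \<Rightarrow> bool" where
  "L2_rel f g \<longleftrightarrow> sq_int f \<and> sq_int g \<and> (AE x in lebesgue. f x = g x)"

quotient_type (overloaded) ('a, 'b) L2 =
  "'a::euclidean_space \<Rightarrow> 'b::euclidean_space" / partial: L2_rel
proof (rule part_equivpI)
  show "\<exists>x :: 'a \<Rightarrow> 'b. L2_rel x x"
    by (rule exI[of _ "\<lambda>x. 0"]) (simp add: L2_rel_def)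
  show "symp L2_rel"
    by (auto simp: L2_rel_def symp_def elim: eventually_mono)
  show "transp L2_rel"
    by (auto simp: L2_rel_def transp_def elim: eventually_elim2)
qed

instantiation L2 :: (euclidean_space, euclidean_space) real_inner
begin

lift_definition zero_L2 :: "('a, 'b) L2" is "\<lambda>x. 0"
  by (simp add: L2_rel_def)

lift_definition plus_L2 :: "('a, 'b) L2 \<Rightarrow> ('a, 'b) L2 \<Rightarrow> ('a, 'b) L2" is "\<lambda>f g x. f x + g x"
  by (auto simp: L2_rel_def sq_int_add elim: eventually_elim2)

lift_definition minus_L2 :: "('a, 'b) L2 \<Rightarrow> ('a, 'b) L2 \<Rightarrow> ('a, 'b) L2" is "\<lambda>f g x. f x - g x"
  by (auto simp: L2_rel_def sq_int_diff elim: eventually_elim2)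

lift_definition uminus_L2 :: "('a, 'b) L2 \<Rightarrow> ('a, 'b) L2" is "\<lambda>f x. - f x"
  by (auto simp: L2_rel_def sq_int_minus elim: eventually_mono)

lift_definition scaleR_L2 :: "real \<Rightarrow> ('a, 'b) L2 \<Rightarrow> ('a, 'b) L2" is "\<lambda>c f x. c *\<^sub>R f x"
  by (auto simp: L2_rel_def sq_int_scaleR elim: eventually_mono)

lift_definition inner_L2 :: "('a, 'b) L2 \<Rightarrow> ('a, 'b) L2 \<Rightarrow> real"
  is "\<lambda>f g. LINT x|lebesgue. f x \<bullet> g x"
  by (rule integral_cong_AE)
     (auto simp: L2_rel_def intro: sq_intD borel_measurable_inner elim: eventually_elim2)

definition norm_L2 :: "('a, 'b) L2 \<Rightarrow> real" where "norm_L2 F = sqrt (F \<bullet> F)"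
definition sgn_L2 :: "('a, 'b) L2 \<Rightarrow> ('a, 'b) L2" where "sgn_L2 F = inverse (norm F) *\<^sub>R F"
definition dist_L2 :: "('a, 'b) L2 \<Rightarrow> ('a, 'b) L2 \<Rightarrow> real" where "dist_L2 F G = norm (F - G)"
definition uniformity_L2 :: "(('a, 'b) L2 \<times> ('a, 'b) L2) filter" where
  "uniformity_L2 = (INF e\<in>{0<..}. principal {(x, y). dist x y < e})"
definition open_L2 :: "('a, 'b) L2 set \<Rightarrow> bool" where
  "open_L2 U = (\<forall>x\<in>U. \<forall>\<^sub>F (x', y) in uniformity. x' = x \<longrightarrow> y \<in> U)"

instance
proof
  fix F G H :: "('a, 'b) L2" and r s :: real
  show "F + G + H = F + (G + H)"
    by transfer (auto simp: L2_rel_def sq_int_add add.assoc)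
  show "F + G = G + F"
    by transfer (auto simp: L2_rel_def sq_int_add add.commute)
  show "0 + F = F"
    by transfer (auto simp: L2_rel_def)
  show "- F + F = 0"
    by transfer (auto simp: L2_rel_def)
  show "F - G = F + - G"
    by transfer (auto simp: L2_rel_def sq_int_diff)
  show "r *\<^sub>R (F + G) = r *\<^sub>R F + r *\<^sub>R G"
    by transfer (auto simp: L2_rel_def sq_int_add sq_int_scaleR scaleR_add_right)
  show "(r + s) *\<^sub>R F = r *\<^sub>R F + s *\<^sub>R F"
    by transfer (auto simp: L2_rel_def sq_int_add sq_int_scaleR scaleR_add_left)
  show "r *\<^sub>R s *\<^sub>R F = (r * s) *\<^sub>R F"
    by transfer (auto simp: L2_rel_def sq_int_scaleR)
  show "1 *\<^sub>R F = F"
    by transfer (auto simp: L2_rel_def)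
  show "dist F G = norm (F - G)" by (rule dist_L2_def)
  show "sgn F = inverse (norm F) *\<^sub>R F" by (rule sgn_L2_def)
  show "uniformity = (INF e\<in>{0<..}. principal {(x, y). dist x (y :: ('a, 'b) L2) < e})"
    by (rule uniformity_L2_def)
  show "open U = (\<forall>x\<in>U. \<forall>\<^sub>F (x', y) in uniformity. x' = x \<longrightarrow> y \<in> U)" for U :: "('a, 'b) L2 set"
    by (rule open_L2_def)
  show "F \<bullet> G = G \<bullet> F"
    by transfer (simp add: inner_commute)
  show "(F + G) \<bullet> H = F \<bullet> H + G \<bullet> H"
    by transfer (simp add: L2_rel_def inner_add_left sq_int_inner)
  show "r *\<^sub>R F \<bullet> G = r * (F \<bullet> G)"
    by transfer simp
  show "0 \<le> F \<bullet> F"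
    by transfer simp
  show "(F \<bullet> F = 0) = (F = 0)"
  proof transfer
    fix f :: "'a \<Rightarrow> 'b"
    assume "L2_rel f f"
    then have f: "sq_int f" by (simp add: L2_rel_def)
    then show "((LINT x|lebesgue. f x \<bullet> f x) = 0) = L2_rel f (\<lambda>x. 0)"
      by (subst integral_nonneg_eq_0_iff_AE) (auto simp: L2_rel_def sq_int_inner)
  qed
  show "norm F = sqrt (F \<bullet> F)" by (rule norm_L2_def)
qed

end

lemma norm_L2_abs: "sq_int f \<Longrightarrow> (norm (abs_L2 f))\<^sup>2 = (LINT x|lebesgue. (norm (f x))\<^sup>2)"
  by (simp add: power2_norm_eq_inner inner_L2.abs_eq L2_rel_def)

lemma sq_int_rep_L2: "sq_int (rep_L2 F)"
  by (metis L2_rel_def Quotient3_L2 Quotient3_rep_reflp)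

lemma abs_rep_L2 [simp]: "abs_L2 (rep_L2 F) = F"
  by (simp add: Quotient3_L2 Quotient3_abs_rep[OF Quotient3_L2])

lemma abs_L2_diff: "sq_int f \<Longrightarrow> sq_int g \<Longrightarrow> abs_L2 f - abs_L2 g = abs_L2 (\<lambda>x. f x - g x)"
  by (simp add: minus_L2.abs_eq L2_rel_def)

lemma abs_L2_add: "sq_int f \<Longrightarrow> sq_int g \<Longrightarrow> abs_L2 f + abs_L2 g = abs_L2 (\<lambda>x. f x + g x)"
  by (simp add: plus_L2.abs_eq L2_rel_def)

lemma abs_L2_scaleR: "sq_int f \<Longrightarrow> c *\<^sub>R abs_L2 f = abs_L2 (\<lambda>x. c *\<^sub>R f x)"
  by (simp add: scaleR_L2.abs_eq L2_rel_def)

lemma nn_integral_L2_abs: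
  assumes "sq_int f"
  shows "(\<integral>\<^sup>+x. ennreal ((norm (f x))\<^sup>2) \<partial>lebesgue) = ennreal ((norm (abs_L2 f))\<^sup>2)"
  using assms by (subst nn_integral_eq_integral) (simp_all add: sq_int_integrable norm_L2_abs)

lemma L2_fast_Cauchy_convergent:
  fixes X :: "nat \<Rightarrow> ('a::euclidean_space, 'b::euclidean_space) L2"
  assumes fast: "\<And>n. norm (X (Suc n) - X n) \<le> (1/2) ^ n" and "Cauchy X"
  shows "convergent X"
proof -
  define f where "f n = rep_L2 (X n)" for n
  have f: "sq_int (f n)" and X: "X n = abs_L2 (f n)" for n
    by (simp_all add: f_def sq_int_rep_L2)
  note [measurable] = sq_intD[OF f]
  have diff: "(\<integral>\<^sup>+x. ennreal ((norm (f m x - f n x))\<^sup>2) \<partial>lebesgue) = ennreal ((norm (X m - X n))\<^sup>2)" for m n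
    using nn_integral_L2_abs[OF sq_int_diff[OF f f, of m n]] by (simp add: X abs_L2_diff f)
  define g where "g n x = f (Suc n) x - f n x" for n x
  have [measurable]: "g n \<in> borel_measurable lebesgue" for n
    unfolding g_def by measurable
  have g_int: "(\<integral>\<^sup>+x. ennreal (2 ^ n * (norm (g n x))\<^sup>2) \<partial>lebesgue) \<le> ennreal ((1/2) ^ n)" for n
  proof -
    have "(\<integral>\<^sup>+x. ennreal (2 ^ n * (norm (g n x))\<^sup>2) \<partial>lebesgue)
        = ennreal (2 ^ n) * (\<integral>\<^sup>+x. ennreal ((norm (g n x))\<^sup>2) \<partial>lebesgue)"
      by (subst nn_integral_cmult[symmetric]) (auto simp: ennreal_mult)
    also have "\<dots> = ennreal (2 ^ n * (norm (X (Suc n) - X n))\<^sup>2)"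
      by (simp add: g_def diff ennreal_mult)
    also have "\<dots> \<le> ennreal (2 ^ n * ((1/2) ^ n)\<^sup>2)"
      by (intro ennreal_leI mult_left_mono power_mono fast) auto
    also have "2 ^ n * ((1/2) ^ n)\<^sup>2 = (1/2 :: real) ^ n"
      by (simp add: power2_eq_square power_one_over)
    finally show ?thesis .
  qed
  have "(\<integral>\<^sup>+x. (\<Sum>n. ennreal (2 ^ n * (norm (g n x))\<^sup>2)) \<partial>lebesgue)
      = (\<Sum>n. \<integral>\<^sup>+x. ennreal (2 ^ n * (norm (g n x))\<^sup>2) \<partial>lebesgue)"
    by (rule nn_integral_suminf) simp
  also have "\<dots> \<le> (\<Sum>n. ennreal ((1/2) ^ n))"
    by (intro suminf_le g_int) auto
  also have "\<dots> = ennreal (\<Sum>n. (1/2) ^ n)"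
    by (rule suminf_ennreal2) (auto intro: summable_geometric)
  finally have "(\<integral>\<^sup>+x. (\<Sum>n. ennreal (2 ^ n * (norm (g n x))\<^sup>2)) \<partial>lebesgue) \<noteq> \<infinity>"
    by (auto simp: top_unique)
  then have AE_fin: "AE x in lebesgue. (\<Sum>n. ennreal (2 ^ n * (norm (g n x))\<^sup>2)) \<noteq> \<infinity>"
    by (intro nn_integral_PInf_AE) auto
  have AE_conv: "AE x in lebesgue. convergent (\<lambda>n. f n x)"
    using AE_fin
  proof eventually_elim
    case (elim x)
    have sm: "summable (\<lambda>n. 2 ^ n * (norm (g n x))\<^sup>2)"
      by (rule summable_suminf_not_top) (use elim in auto)
    then obtain K where K: "\<And>n. norm (2 ^ n * (norm (g n x))\<^sup>2) \<le> K"
      using BseqE[OF summable_imp_Bseq[OF sm]] by blast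
    have bd: "norm (g n x) \<le> sqrt K * (1 / sqrt 2) ^ n" for n
    proof -
      have "(norm (g n x))\<^sup>2 \<le> K * (1/2) ^ n"
        using K[of n] by (simp add: field_simps power_one_over)
      then have "sqrt ((norm (g n x))\<^sup>2) \<le> sqrt (K * (1/2) ^ n)"
        by (rule real_sqrt_le_mono)
      then show ?thesis
        by (simp add: real_sqrt_mult real_sqrt_power real_sqrt_divide)
    qed
    have "summable (\<lambda>n. sqrt K * (1 / sqrt 2) ^ n)"
      by (intro summable_mult summable_geometric) auto
    then have "summable (\<lambda>n. g n x)"
      by (rule summable_comparison_test'[where N=0]) (use bd in auto)
    then have "convergent (\<lambda>n. \<Sum>i<n. g i x)"
      by (simp add: summable_iff_convergent)
    moreover have "(\<Sum>i<n. g i x) = f n x - f 0 x" for n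
      unfolding g_def by (rule sum_lessThan_telescope)
    ultimately have "convergent (\<lambda>n. f n x - f 0 x)"
      by simp
    then have "convergent (\<lambda>n. (f n x - f 0 x) + f 0 x)"
      by (intro convergent_add convergent_const)
    then show ?case by simp
  qed
  define h where "h x = lim (\<lambda>n. f n x)" for x
  have [measurable]: "h \<in> borel_measurable lebesgue"
    unfolding h_def by measurable
  have AE_lim: "AE x in lebesgue. (\<lambda>n. f n x) \<longlonglongrightarrow> h x"
    using AE_conv by eventually_elim (simp add: h_def convergent_LIMSEQ_iff)
  have tail: "(\<integral>\<^sup>+x. ennreal ((norm (h x - f n x))\<^sup>2) \<partial>lebesgue) \<le> ennreal (e\<^sup>2)"
    if N: "\<And>m. m \<ge> N \<Longrightarrow> norm (X m - X n) \<le> e" for N n e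
  proof -
    have "(\<integral>\<^sup>+x. ennreal ((norm (h x - f n x))\<^sup>2) \<partial>lebesgue)
        = (\<integral>\<^sup>+x. liminf (\<lambda>m. ennreal ((norm (f m x - f n x))\<^sup>2)) \<partial>lebesgue)"
    proof (rule nn_integral_cong_AE)
      show "AE x in lebesgue. ennreal ((norm (h x - f n x))\<^sup>2)
          = liminf (\<lambda>m. ennreal ((norm (f m x - f n x))\<^sup>2))"
        using AE_lim
      proof eventually_elim
        case (elim x)
        have "(\<lambda>m. ennreal ((norm (f m x - f n x))\<^sup>2)) \<longlonglongrightarrow> ennreal ((norm (h x - f n x))\<^sup>2)"
          by (intro tendsto_ennrealI tendsto_power tendsto_norm tendsto_diff elim tendsto_const)
        from lim_imp_Liminf[OF _ this] show ?case
          by simp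
      qed
    qed
    also have "\<dots> \<le> liminf (\<lambda>m. \<integral>\<^sup>+x. ennreal ((norm (f m x - f n x))\<^sup>2) \<partial>lebesgue)"
      by (rule nn_integral_liminf) simp
    also have "\<dots> = liminf (\<lambda>m. ennreal ((norm (X m - X n))\<^sup>2))"
      by (simp add: diff)
    also have "\<dots> \<le> liminf (\<lambda>m::nat. ennreal (e\<^sup>2))"
    proof (rule Liminf_mono)
      show "\<forall>\<^sub>F m in sequentially. ennreal ((norm (X m - X n))\<^sup>2) \<le> ennreal (e\<^sup>2)"
        using eventually_ge_at_top[of N]
        by eventually_elim (intro ennreal_leI power_mono N, auto)
    qed
    also have "\<dots> = ennreal (e\<^sup>2)"
      by (simp add: Liminf_const)
    finally show ?thesis .
  qed
  have CX: "\<exists>N. \<forall>m\<ge>N. \<forall>n\<ge>N. norm (X m - X n) < e" if "e > 0" for e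
    using \<open>Cauchy X\<close> that by (auto simp: Cauchy_iff)
  have sq: "sq_int (\<lambda>x. h x - f n x)" if "\<And>m. m \<ge> N \<Longrightarrow> norm (X m - X n) \<le> e" for N n e
    unfolding sq_int_def
    using tail[OF that] by (auto intro!: integrableI_bounded simp: less_top[symmetric] top_unique)
  obtain N where N: "\<And>m. m \<ge> N \<Longrightarrow> norm (X m - X N) \<le> 1"
    using CX[of 1] by (meson less_imp_le order_refl zero_less_one)
  have "sq_int (\<lambda>x. (h x - f N x) + f N x)"
    by (intro sq_int_add f sq[OF N])
  then have h: "sq_int h" by simp
  have "X \<longlonglongrightarrow> abs_L2 h"
  proof (rule LIMSEQ_I)
    fix e :: real assume "e > 0"
    then obtain N where N: "\<And>m n. m \<ge> N \<Longrightarrow> n \<ge> N \<Longrightarrow> norm (X m - X n) < e / 2"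
      using CX[of "e / 2"] by auto
    show "\<exists>no. \<forall>n\<ge>no. norm (X n - abs_L2 h) < e"
    proof (intro exI allI impI)
      fix n assume "n \<ge> N"
      have "ennreal ((norm (abs_L2 (\<lambda>x. h x - f n x)))\<^sup>2) \<le> ennreal ((e / 2)\<^sup>2)"
        by (subst nn_integral_L2_abs[symmetric, OF sq_int_diff[OF h f]])
           (rule tail[of N], use N \<open>n \<ge> N\<close> in \<open>auto intro: less_imp_le\<close>)
      then have "(norm (abs_L2 h - X n))\<^sup>2 \<le> (e / 2)\<^sup>2"
        by (simp add: X abs_L2_diff h f)
      then have "norm (abs_L2 h - X n) \<le> e / 2"
        using \<open>e > 0\<close> by (simp add: power2_le_iff_abs_le)
      then show "norm (X n - abs_L2 h) < e"
        using \<open>e > 0\<close> by (simp add: norm_minus_commute)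
    qed
  qed
  then show ?thesis by (auto simp: convergent_def)
qed

instance L2 :: (euclidean_space, euclidean_space) complete_space
proof
  fix X :: "nat \<Rightarrow> ('a, 'b) L2"
  assume X: "Cauchy X"
  have "\<exists>r. \<forall>n. (\<forall>m\<ge>r n. \<forall>k\<ge>r n. norm (X m - X k) < (1/2) ^ n) \<and> r n < r (Suc n)"
  proof (rule dependent_nat_choice)
    show "\<exists>x. \<forall>m\<ge>x. \<forall>k\<ge>x. norm (X m - X k) < (1/2) ^ 0"
      using X by (auto simp: Cauchy_iff)
    fix x n
    obtain M where M: "\<forall>m\<ge>M. \<forall>k\<ge>M. norm (X m - X k) < (1/2) ^ Suc n"
      using X[unfolded Cauchy_iff, rule_format, of "(1/2) ^ Suc n"] by auto
    show "\<exists>y. (\<forall>m\<ge>y. \<forall>k\<ge>y. norm (X m - X k) < (1/2) ^ Suc n) \<and> x < y"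
      by (rule exI[of _ "max M (Suc x)"]) (use M in auto)
  qed
  then obtain r where r: "\<And>n m k. m \<ge> r n \<Longrightarrow> k \<ge> r n \<Longrightarrow> norm (X m - X k) < (1/2) ^ n"
    and r': "\<And>n. r n < r (Suc n)"
    by blast
  have mono: "strict_mono r"
    using r' by (rule strict_monoI_Suc)
  have "norm ((X \<circ> r) (Suc n) - (X \<circ> r) n) \<le> (1/2) ^ n" for n
    using r[of n "r (Suc n)" "r n"] r'[of n] by simp
  moreover have "Cauchy (X \<circ> r)"
    using X mono by (rule Cauchy_subseq_Cauchy)
  ultimately have "convergent (X \<circ> r)"
    by (rule L2_fast_Cauchy_convergent)
  then show "convergent X"
    using Cauchy_converges_subseq[OF X mono] by (auto simp: convergent_def)
qed

instance L2 :: (euclidean_space, euclidean_space) banach ..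

lemma second_countable_of_dense:
  fixes S :: "'v::metric_space set"
  assumes S: "countable S" "closure S = UNIV"
  shows "\<exists>B :: 'v set set. countable B \<and> open = generate_topology B"
proof -
  define B where "B = (\<lambda>(s, n). ball s (inverse (real (Suc n)))) ` (S \<times> UNIV)"
  have "countable B"
    unfolding B_def using S(1) by (intro countable_image countable_SIGMA) auto
  moreover have "open U \<longleftrightarrow> generate_topology B U" for U
  proof
    assume "open U"
    have "U = \<Union>{V \<in> B. V \<subseteq> U}"
    proof (intro equalityI subsetI)
      fix x assume "x \<in> U"
      then obtain e where e: "e > 0" "ball x e \<subseteq> U"
        using \<open>open U\<close> open_contains_ball by blast
      obtain n where n: "inverse (real (Suc n)) < e / 2"
        using reals_Archimedean[of "e / 2"] e by auto
      have "x \<in> closure S" using S(2) by simp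
      then obtain s where s: "s \<in> S" "dist s x < inverse (real (Suc n))"
        unfolding closure_approachable by (meson inverse_positive_iff_positive of_nat_0_less_iff zero_less_Suc)
      have "ball s (inverse (real (Suc n))) \<subseteq> ball x e"
      proof
        fix z assume "z \<in> ball s (inverse (real (Suc n)))"
        then have "dist s z < e / 2" "dist x s < e / 2"
          using n s by (auto simp: dist_commute)
        then show "z \<in> ball x e"
          using dist_triangle[of x z s] by simp
      qed
      moreover have "ball s (inverse (real (Suc n))) \<in> B"
        unfolding B_def using s(1) by (intro image_eqI[of _ _ "(s, n)"]) auto
      moreover have "x \<in> ball s (inverse (real (Suc n)))"
        using s(2) by simp
      ultimately show "x \<in> \<Union>{V \<in> B. V \<subseteq> U}"
        using e(2) by blast
    qed blast
    moreover have "generate_topology B (\<Union>{V \<in> B. V \<subseteq> U})"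
      by (rule generate_topology.UN) (blast intro: generate_topology.Basis)
    ultimately show "generate_topology B U" by simp
  next
    assume "generate_topology B U"
    then show "open U"
      by (induction) (auto simp: B_def)
  qed
  ultimately show ?thesis by blast
qed

lemma countable_dense_of_span:
  fixes E :: "'v::real_normed_vector set"
  assumes E: "countable E" "closure (span E) = UNIV"
  shows "\<exists>S :: 'v set. countable S \<and> closure S = UNIV"
proof -
  define F :: "(rat \<times> 'v) list \<Rightarrow> 'v"
    where "F xs = sum_list (map (\<lambda>(q, e). real_of_rat q *\<^sub>R e) xs)" for xs
  define S where "S = F ` lists (UNIV \<times> E)"
  have "countable S"
    unfolding S_def using E(1) by (intro countable_image countable_lists countable_SIGMA) auto
  have "x \<in> closure S" if "x \<in> span E" for x
    using that
  proof (induction rule: span_induct_alt)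
    case base
    have "F [] \<in> S" unfolding S_def by (rule imageI) simp
    then show ?case using closure_subset by (auto simp: F_def)
  next
    case (step c x y)
    obtain Y where Y: "\<And>n. Y n \<in> S" "Y \<longlonglongrightarrow> y"
      using step unfolding closure_sequential by blast
    have "c \<in> closure \<rat>" by (simp add: Rats_closure_real)
    then obtain C where C: "\<And>n::nat. C n \<in> \<rat>" "C \<longlonglongrightarrow> c"
      unfolding closure_sequential by blast
    have "C n *\<^sub>R x + Y n \<in> S" for n
    proof -
      obtain q where q: "C n = real_of_rat q"
        using C(1)[of n] by (auto simp: Rats_def)
      obtain xs where xs: "xs \<in> lists (UNIV \<times> E)" "Y n = F xs"
        using Y(1)[of n] by (auto simp: S_def)
      have "C n *\<^sub>R x + Y n = F ((q, x) # xs)"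
        by (simp add: F_def q xs(2))
      then show ?thesis
        unfolding S_def using xs(1) step(1) by (intro image_eqI[of _ _ "(q, x) # xs"]) auto
    qed
    moreover have "(\<lambda>n. C n *\<^sub>R x + Y n) \<longlonglongrightarrow> c *\<^sub>R x + y"
      by (intro tendsto_intros C Y)
    ultimately show ?case
      unfolding closure_sequential by (intro exI[of _ "\<lambda>n. C n *\<^sub>R x + Y n"]) simp
  qed
  then have "closure (span E) \<subseteq> closure S"
    by (intro closure_minimal) auto
  with \<open>countable S\<close> E(2) show ?thesis by blast
qed

lemma subspace_closure:
  fixes V :: "'v::real_normed_vector set"
  assumes "subspace V" shows "subspace (closure V)"
proof (rule subspaceI)
  show "0 \<in> closure V"
    using subspace_0[OF assms] closure_subset by blast
next
  fix x y assume "x \<in> closure V" "y \<in> closure V"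
  then obtain X Y where "\<And>n. X n \<in> V" "X \<longlonglongrightarrow> x" "\<And>n. Y n \<in> V" "Y \<longlonglongrightarrow> y"
    unfolding closure_sequential by blast
  then have "\<forall>n. X n + Y n \<in> V" "(\<lambda>n. X n + Y n) \<longlonglongrightarrow> x + y"
    using subspace_add[OF assms] by (auto intro: tendsto_add)
  then show "x + y \<in> closure V"
    unfolding closure_sequential by (intro exI[of _ "\<lambda>n. X n + Y n"]) simp
next
  fix c x assume "x \<in> closure V"
  then obtain X where "\<And>n. X n \<in> V" "X \<longlonglongrightarrow> x"
    unfolding closure_sequential by blast
  then have "\<forall>n. c *\<^sub>R X n \<in> V" "(\<lambda>n. c *\<^sub>R X n) \<longlonglongrightarrow> c *\<^sub>R x"
    using subspace_scale[OF assms] by (auto intro: tendsto_intros)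
  then show "c *\<^sub>R x \<in> closure V"
    unfolding closure_sequential by (intro exI[of _ "\<lambda>n. c *\<^sub>R X n"]) simp
qed

lemma sq_int_indicator:
  assumes A: "A \<in> lmeasurable" shows "sq_int (\<lambda>x. indicator A x *\<^sub>R b)"
proof -
  have [measurable]: "A \<in> sets lebesgue" using A by (rule fmeasurableD)
  have "integrable lebesgue (\<lambda>x. indicator A x * (norm b)\<^sup>2)"
    using A by (simp add: lmeasurable_iff_integrable)
  also have "(\<lambda>x. indicator A x * (norm b)\<^sup>2) = (\<lambda>x. (norm (indicator A x *\<^sub>R b))\<^sup>2)"
    by (auto simp: indicator_def)
  finally show ?thesis by (simp add: sq_int_def)
qed

lemma abs_L2_sum:
  "finite I \<Longrightarrow> (\<And>i. i \<in> I \<Longrightarrow> sq_int (g i)) \<Longrightarrow>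
    sq_int (\<lambda>x. \<Sum>i\<in>I. g i x) \<and> abs_L2 (\<lambda>x. \<Sum>i\<in>I. g i x) = (\<Sum>i\<in>I. abs_L2 (g i))"
  by (induction I rule: finite_induct) (auto simp: sq_int_add abs_L2_add[symmetric] zero_L2_def)

instance L2 :: (euclidean_space, euclidean_space) second_countable_topology
proof
  obtain \<B> :: "'a set set" where \<B>: "countable \<B>" "topological_basis \<B>"
    using ex_countable_basis by blast
  define \<W> where "\<W> = {\<Union>\<C> |\<C>. finite \<C> \<and> \<C> \<subseteq> \<B>} \<inter> lmeasurable"
  define ind :: "'a set \<Rightarrow> 'b \<Rightarrow> ('a, 'b) L2"
    where "ind A b = abs_L2 (\<lambda>x. indicator A x *\<^sub>R b)" for A b
  define E where "E = (\<lambda>(W, b). ind W b) ` (\<W> \<times> Basis)"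
  have "countable {\<Union>\<C> |\<C>. finite \<C> \<and> \<C> \<subseteq> \<B>}"
    using countable_Collect_finite_subset[OF \<B>(1)] by (simp add: setcompr_eq_image)
  then have "countable \<W>"
    unfolding \<W>_def by blast
  then have "countable E"
    unfolding E_def by (intro countable_image countable_SIGMA) (auto intro: countable_finite)
  define T where "T = closure (span E)"
  have T: "subspace T" "closed T"
    unfolding T_def by (simp_all add: subspace_closure)
  have ind_basis: "ind A b \<in> T" if A: "A \<in> lmeasurable" and b: "b \<in> Basis" for A b
  proof -
    have "\<exists>w\<in>span E. dist w (ind A b) < e" if "e > 0" for e
    proof -
      define d where "d = e\<^sup>2 / 2"
      have "d > 0" using that by (simp add: d_def)
      obtain U where U: "open U" "A \<subseteq> U" "U - A \<in> lmeasurable" "emeasure lebesgue (U - A) < ennreal d"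
        using sets_lebesgue_outer_open[of A d] A \<open>d > 0\<close> by (auto dest: fmeasurableD)
      have UA: "measure lebesgue (U - A) < d"
        using U(3,4) \<open>d > 0\<close> by (simp add: emeasure_eq_measure2 ennreal_less_iff)
      have Um: "U \<in> lmeasurable"
        using fmeasurable.Un[OF A U(3)] U(2) by (simp add: Un_absorb1)
      obtain \<D> where \<D>: "\<D> \<subseteq> \<B>" "\<Union>\<D> = U"
        using \<B>(2) U(1) by (auto simp: topological_basis_def)
      have "\<exists>W\<in>\<W>. W \<subseteq> U \<and> measure lebesgue (U - W) < d"
      proof (cases "\<D> = {}")
        case True
        then show ?thesis
          using \<D> \<open>d > 0\<close> by (intro bexI[of _ "{}"]) (auto simp: \<W>_def intro!: exI[of _ "{}"])
      next
        case False
        define W where "W n = (\<Union>i\<le>n. from_nat_into \<D> i)" for n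
        have c: "countable \<D>" using \<D>(1) \<B>(1) by (rule countable_subset)
        have mem: "from_nat_into \<D> i \<in> \<D>" for i
          by (rule from_nat_into[OF False])
        have op: "open (from_nat_into \<D> i)" for i
          using mem[of i] \<D>(1) \<B>(2) topological_basis_open by blast
        have Wl: "W n \<in> lmeasurable" for n
        proof (rule fmeasurableI2[OF Um])
          show "W n \<subseteq> U" unfolding W_def using mem \<D>(2) by blast
          show "W n \<in> sets lebesgue"
            unfolding W_def using op by (auto intro!: sets.finite_UN)
        qed
        have "(\<lambda>n. measure lebesgue (W n)) \<longlonglongrightarrow> measure lebesgue (\<Union>n. W n)"
        proof (rule Lim_measure_incseq)
          show "incseq W" unfolding W_def by (intro incseq_SucI UN_mono) auto
          show "range W \<subseteq> sets lebesgue" using Wl by (auto dest: fmeasurableD)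
          have "(\<Union>n. W n) \<subseteq> U" unfolding W_def using mem \<D>(2) by blast
          then show "emeasure lebesgue (\<Union>n. W n) \<noteq> \<infinity>"
            using emeasure_mono[of "\<Union>n. W n" U lebesgue] Um
            by (auto simp: fmeasurable_def top_unique)
        qed
        moreover have "(\<Union>n. W n) = U"
        proof -
          have "(\<Union>n. W n) = (\<Union>i. from_nat_into \<D> i)" unfolding W_def by blast
          also have "\<dots> = U" using range_from_nat_into[OF False c] \<D>(2) by simp
          finally show ?thesis .
        qed
        ultimately have "(\<lambda>n. measure lebesgue (W n)) \<longlonglongrightarrow> measure lebesgue U" by simp
        then have "\<forall>\<^sub>F n in sequentially. measure lebesgue (W n) > measure lebesgue U - d"
          using \<open>d > 0\<close> by (intro order_tendstoD) auto
        then obtain n where n: "measure lebesgue (W n) > measure lebesgue U - d"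
          using eventually_sequentially by auto
        have WU: "W n \<subseteq> U" unfolding W_def using mem \<D>(2) by blast
        have "measure lebesgue (U - W n) = measure lebesgue U - measure lebesgue (W n)"
          using Um Wl[of n] WU by (intro measurable_measure_Diff) (auto dest: fmeasurableD)
        moreover have "W n \<in> \<W>"
        proof -
          have "\<exists>\<C>. W n = \<Union>\<C> \<and> finite \<C> \<and> \<C> \<subseteq> \<B>"
            by (rule exI[of _ "from_nat_into \<D> ` {..n}"]) (use mem \<D>(1) in \<open>auto simp: W_def\<close>)
          then show ?thesis unfolding \<W>_def using Wl by blast
        qed
        ultimately show ?thesis using n WU by (intro bexI[of _ "W n"]) auto
      qed
      then obtain W where W: "W \<in> \<W>" "W \<subseteq> U" "measure lebesgue (U - W) < d" by blast
      have Wl: "W \<in> lmeasurable" using W(1) by (simp add: \<W>_def)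
      have sq: "sq_int (\<lambda>x. indicator W x *\<^sub>R b)" "sq_int (\<lambda>x. indicator A x *\<^sub>R b)"
        by (intro sq_int_indicator Wl A)+
      have UWl: "U - W \<in> lmeasurable" using Um Wl by (rule fmeasurable.Diff)
      have "(dist (ind W b) (ind A b))\<^sup>2
          = (LINT x|lebesgue. (norm (indicator W x *\<^sub>R b - indicator A x *\<^sub>R b))\<^sup>2)"
        unfolding dist_norm ind_def abs_L2_diff[OF sq] by (rule norm_L2_abs[OF sq_int_diff[OF sq]])
      also have "\<dots> \<le> (LINT x|lebesgue. indicator (U - A) x + indicator (U - W) x)"
      proof (rule integral_mono)
        show "integrable lebesgue (\<lambda>x. (norm (indicator W x *\<^sub>R b - indicator A x *\<^sub>R b))\<^sup>2)"
          by (rule sq_int_integrable[OF sq_int_diff[OF sq]])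
        show "integrable lebesgue (\<lambda>x. indicator (U - A) x + indicator (U - W) x :: real)"
          using U(3) UWl by (intro Bochner_Integration.integrable_add) (simp_all add: lmeasurable_iff_integrable)
        show "(norm (indicator W x *\<^sub>R b - indicator A x *\<^sub>R b))\<^sup>2
            \<le> indicator (U - A) x + indicator (U - W) x" for x
          using b U(2) W(2) by (auto simp: indicator_def)
      qed
      also have "\<dots> = measure lebesgue (U - A) + measure lebesgue (U - W)"
        using U(3) UWl by (subst Bochner_Integration.integral_add) (simp_all add: lmeasurable_iff_integrable)
      also have "\<dots> < e\<^sup>2"
        using UA W(3) by (simp add: d_def)
      finally have "dist (ind W b) (ind A b) < e"
        using that by (simp add: power2_less_imp_less)
      moreover have "ind W b \<in> span E"
        by (rule span_base) (use W(1) b in \<open>auto simp: E_def\<close>)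
      ultimately show ?thesis by blast
    qed
    then show ?thesis unfolding T_def closure_approachable by blast
  qed
  have ind_T: "ind A y \<in> T" if A: "A \<in> lmeasurable" for A y
  proof -
    have "ind A y = abs_L2 (\<lambda>x. \<Sum>b\<in>Basis. (y \<bullet> b) *\<^sub>R (indicator A x *\<^sub>R b))"
    proof -
      have "indicator A x *\<^sub>R y = (\<Sum>b\<in>Basis. (y \<bullet> b) *\<^sub>R (indicator A x *\<^sub>R b))" for x
        by (subst euclidean_representation[symmetric, of y])
           (simp add: scaleR_sum_right mult.commute del: euclidean_representation)
      then show ?thesis by (simp add: ind_def)
    qed
    also have "\<dots> = (\<Sum>b\<in>Basis. (y \<bullet> b) *\<^sub>R ind A b)"
      unfolding ind_def abs_L2_scaleR[OF sq_int_indicator[OF A]]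
      by (rule abs_L2_sum[THEN conjunct2])
         (intro finite_Basis, rule sq_int_scaleR[OF sq_int_indicator[OF A]])
    also have "\<dots> \<in> T"
      by (intro subspace_sum subspace_scale T ind_basis A)
    finally show ?thesis .
  qed
  have "G \<in> T" for G
  proof -
    define f where "f = rep_L2 G"
    have f: "sq_int f" and G: "G = abs_L2 f" by (simp_all add: f_def sq_int_rep_L2)
    note [measurable] = sq_intD[OF f]
    obtain s where s: "\<And>i. simple_function lebesgue (s i)" "\<And>x. (\<lambda>i. s i x) \<longlonglongrightarrow> f x"
        "\<And>i x. norm (s i x) \<le> 2 * norm (f x)"
      using borel_measurable_implies_sequence_metric[OF sq_intD[OF f], of 0]
      unfolding norm_conv_dist[symmetric] space_completion space_lborel space_borel by blast
    have [measurable]: "s i \<in> borel_measurable lebesgue" for i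
      by (rule borel_measurable_simple_function[OF s(1)])
    have sq: "sq_int (s i)" for i
    proof -
      have le: "(norm (s i x))\<^sup>2 \<le> 4 * (norm (f x))\<^sup>2" for x
        using power_mono[OF s(3)[of i x] norm_ge_zero, of 2] by (simp add: power_mult_distrib)
      have "integrable lebesgue (\<lambda>x. (norm (s i x))\<^sup>2)"
      proof (rule Bochner_Integration.integrable_bound)
        show "integrable lebesgue (\<lambda>x. 4 * (norm (f x))\<^sup>2)"
          using sq_int_integrable[OF f] by simp
        show "AE x in lebesgue. norm ((norm (s i x))\<^sup>2) \<le> norm (4 * (norm (f x))\<^sup>2)"
          by (rule AE_I2) (simp add: le)
      qed simp
      then show ?thesis by (simp add: sq_int_def)
    qed
    have sT: "abs_L2 (s i) \<in> T" for i
    proof -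
      define A where "A y = s i -` {y}" for y
      define Y where "Y = range (s i) - {0}"
      have fin: "finite Y" using s(1)[of i] by (simp add: Y_def simple_function_def)
      have Al: "A y \<in> lmeasurable" if "y \<in> Y" for y
      proof -
        have y: "y \<noteq> 0" using that by (simp add: Y_def)
        have [measurable]: "A y \<in> sets lebesgue"
          using simple_functionD(2)[OF s(1)[of i], of "{y}"] by (simp add: A_def)
        have "integrable lebesgue (indicator (A y) :: 'a \<Rightarrow> real)"
          by (rule Bochner_Integration.integrable_bound[where f = "\<lambda>x. (norm (s i x))\<^sup>2 / (norm y)\<^sup>2"])
             (use sq_int_integrable[OF sq[of i]] y in \<open>auto simp: A_def indicator_def\<close>)
        then show ?thesis by (simp add: lmeasurable_iff_integrable)
      qed
      have "s i x = (\<Sum>y\<in>Y. indicator (A y) x *\<^sub>R y)" for x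
      proof -
        have "(\<Sum>y\<in>Y. indicator (A y) x *\<^sub>R y) = (\<Sum>y\<in>Y. if y = s i x then y else 0)"
          by (intro sum.cong) (auto simp: A_def)
        also have "\<dots> = s i x"
          using fin by (auto simp: Y_def)
        finally show ?thesis by simp
      qed
      then have "s i = (\<lambda>x. \<Sum>y\<in>Y. indicator (A y) x *\<^sub>R y)" by blast
      then have "abs_L2 (s i) = abs_L2 (\<lambda>x. \<Sum>y\<in>Y. indicator (A y) x *\<^sub>R y)" by simp
      also have "\<dots> = (\<Sum>y\<in>Y. ind (A y) y)"
        unfolding ind_def by (rule abs_L2_sum[THEN conjunct2]) (auto simp: fin intro: sq_int_indicator Al)
      also have "\<dots> \<in> T"
        by (intro subspace_sum T ind_T Al)
      finally show ?thesis .
    qed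
    have "(\<lambda>i. LINT x|lebesgue. (norm (s i x - f x))\<^sup>2) \<longlonglongrightarrow> (LINT (x::'a)|lebesgue. (0::real))"
    proof (rule integral_dominated_convergence[where w = "\<lambda>x. 9 * (norm (f x))\<^sup>2"])
      show "integrable lebesgue (\<lambda>x. 9 * (norm (f x))\<^sup>2)"
        using sq_int_integrable[OF f] by simp
      show "AE x in lebesgue. (\<lambda>i. (norm (s i x - f x))\<^sup>2) \<longlonglongrightarrow> 0"
      proof (rule AE_I2)
        fix x
        have "(\<lambda>i. (norm (s i x - f x))\<^sup>2) \<longlonglongrightarrow> (norm (f x - f x))\<^sup>2"
          by (intro tendsto_intros s)
        then show "(\<lambda>i. (norm (s i x - f x))\<^sup>2) \<longlonglongrightarrow> 0" by simp
      qed
      have le: "norm (s i x - f x) \<le> 3 * norm (f x)" for i x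
        using norm_triangle_ineq4[of "s i x" "f x"] s(3)[of i x] by linarith
      have "norm ((norm (s i x - f x))\<^sup>2) \<le> 9 * (norm (f x))\<^sup>2" for i x
        using power_mono[OF le[of i x] norm_ge_zero, of 2] by (simp add: power_mult_distrib)
      then show "AE x in lebesgue. norm ((norm (s i x - f x))\<^sup>2) \<le> 9 * (norm (f x))\<^sup>2" for i
        by (intro AE_I2)
    qed simp_all
    then have "(\<lambda>i. (norm (abs_L2 (s i) - G))\<^sup>2) \<longlonglongrightarrow> 0"
      by (simp add: G abs_L2_diff[OF sq f] norm_L2_abs[OF sq_int_diff[OF sq f]])
    then have "(\<lambda>i. sqrt ((norm (abs_L2 (s i) - G))\<^sup>2)) \<longlonglongrightarrow> sqrt 0"
      by (rule tendsto_real_sqrt)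
    then have "(\<lambda>i. abs_L2 (s i)) \<longlonglongrightarrow> G"
      by (simp add: LIM_zero_iff tendsto_norm_zero_iff)
    with T(2) sT show "G \<in> T"
      by (rule closed_sequentially)
  qed
  then have "closure (span E) = UNIV" by (auto simp: T_def)
  from countable_dense_of_span[OF \<open>countable E\<close> this]
  obtain S :: "('a, 'b) L2 set" where "countable S" "closure S = UNIV"
    by blast
  then show "\<exists>B :: ('a, 'b) L2 set set. countable B \<and> open = generate_topology B"
    by (rule second_countable_of_dense)
qed


section \<open>Lipschitz domains, \<open>H\<^sup>1\<^sub>0(D)\<close> and its dual\<close>

(* Near each boundary point and after a rotation, D is the strict epigraph of a Lipschitz
   function h on the hyperplane orthogonal to the unit vector e. *)
definition bounded_lipschitz_domain :: "'a::euclidean_space set \<Rightarrow> bool" where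
  "bounded_lipschitz_domain D \<longleftrightarrow>
     open D \<and> connected D \<and> D \<noteq> {} \<and> bounded D \<and>
     (\<forall>z\<in>frontier D. \<exists>r>0. \<exists>e h L. norm e = 1 \<and> L-lipschitz_on {x. x \<bullet> e = 0} h \<and>
        D \<inter> ball z r = {x \<in> ball z r. h (x - (x \<bullet> e) *\<^sub>R e) < x \<bullet> e})"

fun continuously_differentiable :: "nat \<Rightarrow> ('a::euclidean_space \<Rightarrow> real) \<Rightarrow> bool" where
  "continuously_differentiable 0 \<phi> \<longleftrightarrow> continuous_on UNIV \<phi>"
| "continuously_differentiable (Suc k) \<phi> \<longleftrightarrow>
     (\<forall>x. \<phi> differentiable (at x)) \<and>
     (\<forall>i\<in>Basis. continuously_differentiable k (\<lambda>x. frechet_derivative \<phi> (at x) i))"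

definition test_function :: "'a::euclidean_space set \<Rightarrow> ('a \<Rightarrow> real) \<Rightarrow> bool" where
  "test_function D \<phi> \<longleftrightarrow>
     (\<forall>k. continuously_differentiable k \<phi>) \<and>
     compact (closure {x. \<phi> x \<noteq> 0}) \<and> closure {x. \<phi> x \<noteq> 0} \<subseteq> D"

(* A Sobolev function v is stored as the pair (v, grad v).  The product norm on this type is
   the H1 norm. *)
type_synonym 'a H1 = "('a, real) L2 \<times> ('a, 'a) L2"

(* Closure of the test functions in the H1 norm; elements are extended by zero outside D. *)
definition H10 :: "'a::euclidean_space set \<Rightarrow> 'a H1 set" where
  "H10 D = closure {(abs_L2 \<phi>, abs_L2 g) |\<phi> g. test_function D \<phi> \<and> (\<forall>x. GDERIV \<phi> x :> g x)}"

(* The L2 norm of the gradient; it is taken over R^d, but gradients of elements of H10 D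
   vanish outside D. *)
definition V_norm :: "'a::euclidean_space H1 \<Rightarrow> real" where
  "V_norm v = norm (snd v)"

definition H_minus1 :: "'a::euclidean_space set \<Rightarrow> ('a H1 \<Rightarrow> real) set" where
  "H_minus1 D = {f. (\<forall>v\<in>H10 D. \<forall>w\<in>H10 D. f (v + w) = f v + f w) \<and>
     (\<forall>c. \<forall>v\<in>H10 D. f (c *\<^sub>R v) = c * f v) \<and>
     (\<exists>C. \<forall>v\<in>H10 D. \<bar>f v\<bar> \<le> C * V_norm v)}"


section \<open>The parametric diffusion problem\<close>

definition Linf_norm :: "'a::euclidean_space set \<Rightarrow> ('a \<Rightarrow> real) \<Rightarrow> ennreal" where
  "Linf_norm D g = esssup (lebesgue_on D) (\<lambda>x. ennreal \<bar>g x\<bar>)"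

definition Linf :: "'a::euclidean_space set \<Rightarrow> ('a \<Rightarrow> real) set" where
  "Linf D = {g \<in> borel_measurable (lebesgue_on D). Linf_norm D g < \<infinity>}"

definition Linf_sums :: "'a::euclidean_space set \<Rightarrow> (nat \<Rightarrow> 'a \<Rightarrow> real) \<Rightarrow> ('a \<Rightarrow> real) \<Rightarrow> bool" where
  "Linf_sums D F b \<longleftrightarrow>
     b \<in> Linf D \<and> (\<lambda>n. Linf_norm D (\<lambda>x. (\<Sum>j<n. F j x) - b x)) \<longlonglongrightarrow> 0"

(* Sequences indexed by 1, 2, ... are indexed by 0, 1, ... throughout. *)
definition log_field_converges ::
    "'a::euclidean_space set \<Rightarrow> (nat \<Rightarrow> 'a \<Rightarrow> real) \<Rightarrow> (nat \<Rightarrow> real) \<Rightarrow> bool" where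
  "log_field_converges D \<psi> y \<longleftrightarrow> (\<exists>b. Linf_sums D (\<lambda>j x. y j * \<psi> j x) b)"

(* A representative of the limit, which is determined up to null sets. *)
definition log_field ::
    "'a::euclidean_space set \<Rightarrow> (nat \<Rightarrow> 'a \<Rightarrow> real) \<Rightarrow> (nat \<Rightarrow> real) \<Rightarrow> 'a \<Rightarrow> real" where
  "log_field D \<psi> y = (SOME b. Linf_sums D (\<lambda>j x. y j * \<psi> j x) b)"

definition diffusion ::
    "'a::euclidean_space set \<Rightarrow> (nat \<Rightarrow> 'a \<Rightarrow> real) \<Rightarrow> (nat \<Rightarrow> real) \<Rightarrow> 'a \<Rightarrow> real" where
  "diffusion D \<psi> y x = exp (log_field D \<psi> y x)"

definition weak_solution ::
    "'a::euclidean_space set \<Rightarrow> ('a \<Rightarrow> real) \<Rightarrow> ('a H1 \<Rightarrow> real) \<Rightarrow> 'a H1 \<Rightarrow> bool" where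
  "weak_solution D a f w \<longleftrightarrow> w \<in> H10 D \<and>
     (\<forall>v\<in>H10 D. (LINT x:D|lebesgue. a x * (rep_L2 (snd w) x \<bullet> rep_L2 (snd v) x)) = f v)"

(* The value 0 where the series defining the coefficient diverges is a dummy. *)
definition solution ::
    "'a::euclidean_space set \<Rightarrow> (nat \<Rightarrow> 'a \<Rightarrow> real) \<Rightarrow> ('a H1 \<Rightarrow> real) \<Rightarrow> (nat \<Rightarrow> real) \<Rightarrow> 'a H1" where
  "solution D \<psi> f y =
     (if log_field_converges D \<psi> y then THE w. weak_solution D (diffusion D \<psi> y) f w else 0)"


section \<open>Gaussian measure and Hermite expansions\<close>

definition gaussian_seq :: "(nat \<Rightarrow> real) measure" where
  "gaussian_seq = PiM UNIV (\<lambda>_. density lborel std_normal_density)"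

(* Since the H1 type is second countable, Borel measurability coincides with being a
   pointwise limit of simple functions. *)
definition Lk :: "'a::euclidean_space set \<Rightarrow> real \<Rightarrow> ((nat \<Rightarrow> real) \<Rightarrow> 'a H1) set" where
  "Lk D k = {w \<in> borel_measurable gaussian_seq. (AE y in gaussian_seq. w y \<in> H10 D) \<and>
     (\<integral>\<^sup>+y. ennreal (V_norm (w y) powr k) \<partial>gaussian_seq) < \<infinity>}"

definition gauss_L2_norm :: "((nat \<Rightarrow> real) \<Rightarrow> 'a::euclidean_space H1) \<Rightarrow> real" where
  "gauss_L2_norm w = sqrt (LINT y|gaussian_seq. (V_norm (w y))\<^sup>2)"

definition hermite :: "nat \<Rightarrow> real \<Rightarrow> real" where
  "hermite k t =
     (-1) ^ k / sqrt (fact k) * ((deriv ^^ k) std_normal_density t / std_normal_density t)"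

definition multi_idx :: "(nat \<Rightarrow> nat) set" where
  "multi_idx = {\<nu>. finite {j. \<nu> j \<noteq> 0}}"

(* The factors outside the support of \<nu> are hermite 0 = 1. *)
definition hermite_prod :: "(nat \<Rightarrow> nat) \<Rightarrow> (nat \<Rightarrow> real) \<Rightarrow> real" where
  "hermite_prod \<nu> y = (\<Prod>j | \<nu> j \<noteq> 0. hermite (\<nu> j) (y j))"

definition hermite_coeff :: "((nat \<Rightarrow> real) \<Rightarrow> 'a::euclidean_space H1) \<Rightarrow> (nat \<Rightarrow> nat) \<Rightarrow> 'a H1" where
  "hermite_coeff u \<nu> = (LINT y|gaussian_seq. hermite_prod \<nu> y *\<^sub>R u y)"

definition hermite_sum ::
    "((nat \<Rightarrow> real) \<Rightarrow> 'a::euclidean_space H1) \<Rightarrow> (nat \<Rightarrow> nat) set \<Rightarrow> (nat \<Rightarrow> real) \<Rightarrow> 'a H1" where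
  "hermite_sum u \<Lambda> y = (\<Sum>\<nu>\<in>\<Lambda>. hermite_prod \<nu> y *\<^sub>R hermite_coeff u \<nu>)"

definition n_largest :: "((nat \<Rightarrow> nat) \<Rightarrow> real) \<Rightarrow> nat \<Rightarrow> (nat \<Rightarrow> nat) set \<Rightarrow> bool" where
  "n_largest c n \<Lambda> \<longleftrightarrow> \<Lambda> \<subseteq> multi_idx \<and> finite \<Lambda> \<and> card \<Lambda> = n \<and>
     (\<forall>\<nu>\<in>\<Lambda>. \<forall>\<mu>\<in>multi_idx - \<Lambda>. c \<mu> \<le> c \<nu>)"

end

theory Submission
  imports Defs "HOL-Real_Asymp.Real_Asymp"
begin

text \<open>Formal parametric derivatives of the solution up to a fixed order \<open>r\<close> in each variable satisfy
  a recursion obtained from the Leibniz rule.  Testing it with the derivatives themselves gives a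
  weighted energy estimate as soon as the rescaled weights \<open>\<rho>\<^sub>j\<close> make \<open>\<Sum>j. \<rho>\<^sub>j * \<bar>\<psi>\<^sub>j\<bar>\<close> small.  Gaussian
  integration by parts turns the coefficients of these derivatives into multiples of those of the
  solution, so Bessel's inequality yields \<open>\<Sum>\<nu>. b\<^sub>\<nu> * \<parallel>u\<^sub>\<nu>\<parallel>\<^sup>2 < \<infinity>\<close>, where \<open>b\<^sub>\<nu>\<close> is, up to constants, the product
  over the support of \<open>\<nu>\<close> of powers of \<open>\<rho>\<^sub>j\<close> and \<open>\<nu>\<^sub>j\<close>.  If \<open>r\<close> is large compared with \<open>1 / q\<close>, then
  \<open>b\<^sub>\<nu> powr (- q / 2)\<close> is summable, and Hoelder's inequality gives membership in \<open>\<ell>\<^sup>p\<close>.  Completeness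
  of the Hermite polynomials (Parseval) and the decay of the rearranged coefficients give the rate.\<close>

text \<open>The coefficient exp(b(y)) is controlled only by exp(K * \<open>size y\<close>) and its
  reciprocal, where \<open>size y\<close> is the supremum of |y_j| / rho_j, so no ellipticity bound
  is uniform in y. Estimates therefore live on the full-measure set \<open>good\<close> and carry
  factors exp(k * \<open>size y\<close>), whose integrals are finite because 1 / rho_j is in l^q.
  The unknown is the gradient of u rather than u: by Poincare the gradients form a closed subspace
  of L2, the V norm becomes the plain norm, and the equation involves only a multiplication
  operator, so that dependence on y can be differentiated in operator norm. The order r per variable
  must be finite because the factors 1 + rho_j |psi_j|, taken r times for each variable, must
  multiply to at most 3/2; the excess 1/2 over 1 is what allows the mixed terms to be absorbed. So r
  is fixed first, by 4 \<le> r * q, which turns a factor n^r of the weights into at most n^(-2)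
  after raising to the power -q/2; the sequence rho is scaled down afterwards, which costs only a
  constant in the l^q sum.\<close>

lemma quadratic_nonneg_imp_zero:
  fixes A B :: real
  assumes "\<And>t. 0 \<le> t * t * A + 2 * t * B"
  shows "B = 0"
proof (rule ccontr)
  assume "B \<noteq> 0"
  \<comment> \<open>M is positive and exceeds A, so at t = -B/M the quadratic part stays below half
    of the linear one and the value is less than -B^2/M.\<close>
  define M where "M = \<bar>A\<bar> + 1"
  have "M > 0" "A < M" by (auto simp: M_def)
  have "0 \<le> (- B / M) * (- B / M) * A + 2 * (- B / M) * B" by (rule assms)
  then have "0 \<le> M * M * ((- B / M) * (- B / M) * A + 2 * (- B / M) * B)"
    using \<open>M > 0\<close> by (intro mult_nonneg_nonneg) auto
  also have "\<dots> = B * B * A - 2 * M * (B * B)"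
    using \<open>M > 0\<close> by (simp add: field_simps)
  also have "\<dots> < B * B * M - 2 * M * (B * B)"
    using \<open>A < M\<close> \<open>B \<noteq> 0\<close> by (intro diff_strict_right_mono mult_strict_left_mono) (auto simp: zero_less_mult_iff linorder_neq_iff)
  also have "\<dots> = - (M * (B * B))" by (simp add: algebra_simps)
  also have "\<dots> \<le> 0" using \<open>M > 0\<close> by simp
  finally show False by simp
qed

text \<open>The solution is the limit of a minimizing sequence of the energy
  \<^term>\<open>B x x / 2 - l x\<close>, which is Cauchy by the parallelogram identity.\<close>

lemma symmetric_lax_milgram:
  fixes G :: "'h::{real_inner,complete_space} set" and B :: "'h \<Rightarrow> 'h \<Rightarrow> real"
  assumes G: "subspace G" "closed G"
    and B: "bounded_bilinear B" "\<And>x y. B x y = B y x"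
    and co: "c > 0" "\<And>x. x \<in> G \<Longrightarrow> c * (norm x)\<^sup>2 \<le> B x x"
    and l: "\<And>x y. x \<in> G \<Longrightarrow> y \<in> G \<Longrightarrow> l (x + y) = l x + l y"
      "\<And>r x. x \<in> G \<Longrightarrow> l (r *\<^sub>R x) = r * l x"
      "\<And>x. x \<in> G \<Longrightarrow> \<bar>l x\<bar> \<le> C * norm x"
  shows "\<exists>w\<in>G. \<forall>v\<in>G. B w v = l v"
proof -
  interpret B: bounded_bilinear B by fact
  define J where "J x = B x x - 2 * l x" for x
  \<comment> \<open>Completing the square: c |x|^2 - 2 C |x| \<ge> -C^2 / c.\<close>
  have J_lb: "- (C\<^sup>2 / c) \<le> J x" if "x \<in> G" for x
  proof -
    have "0 \<le> (c * norm x - C)\<^sup>2 / c" using co by simp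
    also have "(c * norm x - C)\<^sup>2 / c = c * (norm x)\<^sup>2 - 2 * (C * norm x) + C\<^sup>2 / c"
      using co(1) by (simp add: power2_eq_square field_simps)
    finally show ?thesis
      using co(2)[OF that] l(3)[OF that] by (auto simp: J_def abs_le_iff)
  qed
  have bdd: "bdd_below (J ` G)" using J_lb by (meson bdd_belowI2)
  define d where "d = Inf (J ` G)"
  have d_le: "d \<le> J x" if "x \<in> G" for x
    unfolding d_def using bdd that by (intro cInf_lower) auto
  have "\<exists>x\<in>G. J x < d + 1 / Suc n" for n
  proof -
    have "\<exists>z\<in>J ` G. z < d + 1 / Suc n"
      using bdd subspace_0[OF G(1)] unfolding d_def
      by (intro cInf_lessD) auto
    then show ?thesis by auto
  qed
  then obtain X where X: "\<And>n. X n \<in> G" "\<And>n. J (X n) < d + 1 / Suc n" by metis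
  \<comment> \<open>At the midpoint m the linear terms cancel and J x + J y - 2 J m = B (x - y) (x -
    y) / 2, while J m \<ge> d.\<close>
  have Bc: "c * (norm (x - y))\<^sup>2 \<le> 2 * (J x - d) + 2 * (J y - d)" if "x \<in> G" "y \<in> G" for x y
  proof -
    let ?m = "(1/2) *\<^sub>R (x + y)"
    have m: "?m \<in> G" using that G(1) by (auto intro: subspace_add subspace_scale)
    have "l ?m = (l x + l y) / 2"
      using l(2)[of "x + y" "1/2"] l(1)[OF that] that G(1) by (auto intro: subspace_add)
    moreover have "B ?m ?m = (B x x + 2 * B x y + B y y) / 4"
      unfolding B.add_left B.add_right B.scaleR_left B.scaleR_right B(2)[of y x] real_scaleR_def
      by argo
    moreover have "B (x - y) (x - y) = B x x - 2 * B x y + B y y"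
      by (simp add: B.diff_left B.diff_right B(2)[of y x])
    moreover have "c * (norm (x - y))\<^sup>2 \<le> B (x - y) (x - y)"
      using that G(1) by (intro co subspace_diff)
    moreover have "d \<le> J ?m" by (rule d_le[OF m])
    ultimately show ?thesis by (simp add: J_def field_simps)
  qed
  have "Cauchy X"
  proof (rule CauchyI)
    fix e :: real assume "e > 0"
    obtain N where N: "4 / Suc N < c * e\<^sup>2"
      using reals_Archimedean[of "c * e\<^sup>2 / 4"] \<open>e > 0\<close> co(1) by (auto simp: field_simps)
    have "norm (X m - X n) < e" if "m \<ge> N" "n \<ge> N" for m n
    proof -
      have inv: "1 / real (Suc m) \<le> 1 / Suc N" "1 / real (Suc n) \<le> 1 / Suc N"
        using that by (auto simp: field_simps)
      have "c * (norm (X m - X n))\<^sup>2 < c * e\<^sup>2"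
        using Bc[OF X(1) X(1), of m n] X(2)[of m] X(2)[of n] inv N by argo
      then show ?thesis using co(1) \<open>e > 0\<close> by (simp add: power2_less_imp_less)
    qed
    then show "\<exists>M. \<forall>m\<ge>M. \<forall>n\<ge>M. norm (X m - X n) < e" by blast
  qed
  then obtain w where w: "X \<longlonglongrightarrow> w" using Cauchy_convergent convergent_def by blast
  have wG: "w \<in> G" using G(2) X(1) w by (rule closed_sequentially)
  have l_lim: "(\<lambda>n. l (X n)) \<longlonglongrightarrow> l w"
  proof (rule LIM_zero_cancel, rule tendsto_0_le[where K = C])
    show "(\<lambda>n. norm (X n - w)) \<longlonglongrightarrow> 0" using w by (simp add: LIM_zero tendsto_norm_zero)
    have "l (X n) - l w = l (X n - w)" for n
      using l(1)[OF subspace_diff[OF G(1) X(1)[of n] wG] wG] by simp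
    then show "\<forall>\<^sub>F n in sequentially. norm (l (X n) - l w) \<le> norm (norm (X n - w)) * C"
      using l(3)[OF subspace_diff[OF G(1) X(1) wG]] by (intro always_eventually) (auto simp: mult.commute)
  qed
  have "(\<lambda>n. J (X n)) \<longlonglongrightarrow> J w"
    unfolding J_def by (intro tendsto_diff tendsto_mult B.tendsto w l_lim tendsto_const)
  moreover have "(\<lambda>n. d + 1 / Suc n) \<longlonglongrightarrow> d + 0"
    by (intro tendsto_add tendsto_const LIMSEQ_Suc lim_1_over_n)
  ultimately have "J w \<le> d"
    using X(2) by (intro LIMSEQ_le[of "\<lambda>n. J (X n)" "J w" "\<lambda>n. d + 1 / Suc n" d]) (auto intro: less_imp_le)
  have "B w v = l v" if v: "v \<in> G" for v
  proof -
    \<comment> \<open>Along w + t v the functional J is a quadratic polynomial in t with its minimum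
      at t = 0, so its linear coefficient vanishes.\<close>
    have "0 \<le> t * t * B v v + 2 * t * (B w v - l v)" for t
    proof -
      have "J w \<le> J (w + t *\<^sub>R v)"
        using \<open>J w \<le> d\<close> d_le[OF subspace_add[OF G(1) wG subspace_scale[OF G(1) v]], of t] by linarith
      also have "l (w + t *\<^sub>R v) = l w + t * l v"
        using wG v G(1) by (simp add: l subspace_scale)
      ultimately show ?thesis
        by (simp add: J_def B.add_left B.add_right B.scaleR_left B.scaleR_right B(2)[of v w] l wG v G(1) subspace_scale algebra_simps)
    qed
    from quadratic_nonneg_imp_zero[OF this] show ?thesis by simp
  qed
  with wG show ?thesis by blast
qed

lemma orthogonal_projection_exists:
  fixes G :: "'h::{real_inner,complete_space} set"
  assumes "subspace G" "closed G"
  shows "\<exists>p\<in>G. \<forall>v\<in>G. p \<bullet> v = w \<bullet> v"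
  by (rule symmetric_lax_milgram[where c = 1 and C = "norm w"])
     (use assms Cauchy_Schwarz_ineq2[of w] in
       \<open>auto simp: bounded_bilinear_inner inner_commute inner_add_right power2_norm_eq_inner\<close>)

text \<open>Let p be the projection of the integral w onto G. Then w - p is orthogonal to almost
  every F y, hence to w itself, and also to p; so w = p. This is what places the Hermite
  coefficients of the solution in \<open>H10 D\<close>.\<close>

lemma integral_in_closed_subspace:
  fixes G :: "'h::{real_inner,complete_space,banach,second_countable_topology} set"
  assumes G: "subspace G" "closed G" and F: "integrable M F" "AE y in M. F y \<in> G"
  shows "(LINT y|M. F y) \<in> G"
proof -
  let ?w = "LINT y|M. F y"
  obtain p where p: "p \<in> G" "\<And>v. v \<in> G \<Longrightarrow> p \<bullet> v = ?w \<bullet> v"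
    using orthogonal_projection_exists[OF G, of ?w] by blast
  have orth: "(?w - p) \<bullet> v = 0" if "v \<in> G" for v
    using p(2)[OF that] by (simp add: inner_diff_left)
  have "?w \<bullet> (?w - p) = (LINT y|M. F y \<bullet> (?w - p))"
    using F by simp
  also have "\<dots> = (LINT y|M. 0)"
    by (rule integral_cong_AE) (use F orth in \<open>auto simp: inner_commute\<close>)
  finally have "(?w - p) \<bullet> (?w - p) = 0"
    using orth[OF p(1)] by (simp add: inner_diff_right inner_commute)
  then show ?thesis using p(1) by simp
qed

text \<open>With the base point at 0 the resolvent identity can be divided by the increment h and
  passed to the limit directly.\<close>

lemma has_vector_derivative_at_0_iff:
  "(f has_vector_derivative D) (at 0) \<longleftrightarrow> ((\<lambda>h. (1 / h) *\<^sub>R (f h - f 0)) \<longlongrightarrow> D) (at 0)"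
proof -
  have "(f has_vector_derivative D) (at 0) \<longleftrightarrow>
      ((\<lambda>h. norm (f h - f 0 - h *\<^sub>R D) / norm h) \<longlongrightarrow> 0) (at 0)"
    unfolding has_vector_derivative_def has_derivative_at
    using bounded_linear_scaleR_left[of D] by simp
  also have "\<dots> \<longleftrightarrow> ((\<lambda>h. norm ((1 / h) *\<^sub>R (f h - f 0) - D)) \<longlongrightarrow> 0) (at 0)"
  proof (rule filterlim_cong[OF refl refl], unfold eventually_at_filter, rule always_eventually, intro allI impI)
    fix h :: real assume "h \<noteq> 0"
    then have "(1 / h) *\<^sub>R (f h - f 0) - D = (1 / h) *\<^sub>R (f h - f 0 - h *\<^sub>R D)"
      by (simp add: scaleR_diff_right)
    then show "norm (f h - f 0 - h *\<^sub>R D) / norm h = norm ((1 / h) *\<^sub>R (f h - f 0) - D)"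
      by simp
  qed
  also have "\<dots> \<longleftrightarrow> ((\<lambda>h. (1 / h) *\<^sub>R (f h - f 0)) \<longlongrightarrow> D) (at 0)"
    unfolding tendsto_norm_zero_iff by (rule LIM_zero_iff)
  finally show ?thesis .
qed

section \<open>Solution operators of coercive problems\<close>

definition coercive_on :: "'h::real_inner set \<Rightarrow> real \<Rightarrow> ('h \<Rightarrow>\<^sub>L 'h) \<Rightarrow> bool" where
  "coercive_on G m A \<longleftrightarrow> 0 < m \<and> (\<forall>x y. A x \<bullet> y = x \<bullet> A y) \<and> (\<forall>x\<in>G. m * (norm x)\<^sup>2 \<le> A x \<bullet> x)"

text \<open>With G the space of gradients, A multiplication by the diffusion coefficient and F
  representing the functional, w is the gradient of the weak solution. Only test vectors in G enter,
  so A need not map G into itself.\<close>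

definition solves :: "'h::real_inner set \<Rightarrow> ('h \<Rightarrow>\<^sub>L 'h) \<Rightarrow> 'h \<Rightarrow> 'h \<Rightarrow> bool" where
  "solves G A F w \<longleftrightarrow> w \<in> G \<and> (\<forall>v\<in>G. A w \<bullet> v = F \<bullet> v)"

text \<open>The inverse of the compression of A to G, as an operator so that its dependence on A can
  be measured in operator norm. It is meaningful for coercive A, by
  \<open>bounded_linear_the_solves\<close>.\<close>

definition solve :: "'h::real_inner set \<Rightarrow> ('h \<Rightarrow>\<^sub>L 'h) \<Rightarrow> 'h \<Rightarrow>\<^sub>L 'h" where
  "solve G A = Blinfun (\<lambda>F. THE w. solves G A F w)"

lemma coercive_onD:
  assumes "coercive_on G m A"
  shows "0 < m" "A x \<bullet> y = x \<bullet> A y" "x \<in> G \<Longrightarrow> m * (norm x)\<^sup>2 \<le> A x \<bullet> x"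
  using assms by (auto simp: coercive_on_def)

locale closed_subspace =
  fixes G :: "'h::{real_inner,complete_space} set"
  assumes subspace_G: "subspace G" and closed_G: "closed G"
begin

lemma solves_unique:
  assumes A: "coercive_on G m A" and w: "solves G A F w" "solves G A F w'"
  shows "w = w'"
proof -
  have d: "w - w' \<in> G" using w subspace_G by (auto simp: solves_def subspace_diff)
  have "A (w - w') \<bullet> (w - w') = 0"
    using w d by (simp add: solves_def blinfun.diff_right inner_diff_left)
  with coercive_onD(1)[OF A] coercive_onD(3)[OF A d] show ?thesis
    by (simp add: mult_le_0_iff)
qed

lemma solves_exists:
  assumes A: "coercive_on G m A"
  shows "\<exists>w. solves G A F w"
proof -
  have "bounded_bilinear (\<lambda>x y. A x \<bullet> y)"
    by (rule bounded_bilinear.comp[OF bounded_bilinear_inner blinfun.bounded_linear_right bounded_linear_ident])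
  moreover have "A x \<bullet> y = A y \<bullet> x" for x y
    using coercive_onD(2)[OF A, of x y] by (simp add: inner_commute)
  ultimately have "\<exists>w\<in>G. \<forall>v\<in>G. A w \<bullet> v = F \<bullet> v"
    by (intro symmetric_lax_milgram[OF subspace_G closed_G, where c = m and C = "norm F"])
       (use coercive_onD[OF A] in \<open>auto simp: inner_add_right Cauchy_Schwarz_ineq2\<close>)
  then show ?thesis by (auto simp: solves_def)
qed

lemma the_solves:
  assumes A: "coercive_on G m A"
  shows "solves G A F (THE w. solves G A F w)"
  using solves_exists[OF A, of F] solves_unique[OF A, of F] by (metis (mono_tags, lifting) theI)

lemma solves_norm_le:
  assumes A: "coercive_on G m A" and w: "solves G A F w"
  shows "norm w \<le> norm F / m"
proof -
  have "m * (norm w)\<^sup>2 \<le> A w \<bullet> w" using w coercive_onD(3)[OF A, of w] by (auto simp: solves_def)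
  also have "\<dots> = F \<bullet> w" using w by (auto simp: solves_def)
  also have "\<dots> \<le> norm F * norm w" by (rule norm_cauchy_schwarz)
  finally have "norm w * (m * norm w) \<le> norm w * norm F"
    by (simp add: power2_eq_square mult_ac)
  then have "m * norm w \<le> norm F"
    by (cases "norm w = 0") (use mult_left_le_imp_le[of "norm w"] in auto)
  then show ?thesis using coercive_onD(1)[OF A] by (simp add: field_simps)
qed

lemma bounded_linear_the_solves:
  assumes A: "coercive_on G m A"
  shows "bounded_linear (\<lambda>F. THE w. solves G A F w)" (is "bounded_linear ?L")
proof (rule bounded_linear_intro[where K = "1 / m"])
  note L = the_solves[OF A]
  fix x y r
  show "?L (x + y) = ?L x + ?L y"
    using L[of x] L[of y]
    by (intro solves_unique[OF A L])
       (auto simp: solves_def blinfun.add_right inner_add_left intro: subspace_add[OF subspace_G])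
  show "?L (r *\<^sub>R x) = r *\<^sub>R ?L x"
    using L[of x] by (intro solves_unique[OF A L])
       (auto simp: solves_def blinfun.scaleR_right intro: subspace_scale[OF subspace_G])
  show "norm (?L x) \<le> norm x * (1 / m)"
    using solves_norm_le[OF A L] by simp
qed

lemma solves_solve: "coercive_on G m A \<Longrightarrow> solves G A F (solve G A F)"
  unfolding solve_def by (simp add: bounded_linear_Blinfun_apply bounded_linear_the_solves the_solves)

lemma solve_eqI: "coercive_on G m A \<Longrightarrow> solves G A F w \<Longrightarrow> solve G A F = w"
  using solves_solve solves_unique by blast

lemma solve_in_G: "coercive_on G m A \<Longrightarrow> solve G A F \<in> G"
  using solves_solve by (auto simp: solves_def)

lemma inner_solve: "coercive_on G m A \<Longrightarrow> v \<in> G \<Longrightarrow> A (solve G A F) \<bullet> v = F \<bullet> v"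
  using solves_solve by (auto simp: solves_def)

lemma norm_solve_le:
  assumes A: "coercive_on G m A" shows "norm (solve G A) \<le> 1 / m"
  by (rule norm_blinfun_bound)
     (use coercive_onD(1)[OF A] solves_norm_le[OF A solves_solve[OF A]] in auto)

text \<open>The solution w for A' satisfies A w . v = (F - (A' - A) w) . v for v in G. Uniqueness
  for A then gives the analogue of A'^-1 - A^-1 = -A^-1 (A' - A) A'^-1 for the compressed
  problem.\<close>

lemma resolvent_identity:
  assumes A: "coercive_on G m A" and A': "coercive_on G m' A'"
  shows "solve G A' - solve G A = - (solve G A o\<^sub>L (A' - A) o\<^sub>L solve G A')"
proof (rule blinfun_eqI)
  fix F
  let ?w = "solve G A' F"
  have "solve G A (F - (A' - A) ?w) = ?w"
    by (rule solve_eqI[OF A])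
       (use solves_solve[OF A', of F] in \<open>auto simp: solves_def blinfun.diff_left inner_diff_left\<close>)
  then show "(solve G A' - solve G A) F = (- (solve G A o\<^sub>L (A' - A) o\<^sub>L solve G A')) F"
    by (simp add: blinfun.bilinear_simps algebra_simps)
qed

lemma norm_solve_diff_le:
  assumes A: "coercive_on G m A" and A': "coercive_on G m' A'"
  shows "norm (solve G A' - solve G A) \<le> norm (A' - A) / (m * m')"
proof -
  have "norm (solve G A' - solve G A) \<le> norm (solve G A) * norm (A' - A) * norm (solve G A')"
    unfolding resolvent_identity[OF A A'] norm_minus_cancel
    by (rule order_trans[OF norm_blinfun_compose mult_right_mono[OF norm_blinfun_compose norm_ge_zero]])
  also have "\<dots> \<le> (1 / m) * norm (A' - A) * (1 / m')"
    using coercive_onD(1)[OF A] coercive_onD(1)[OF A']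
    by (intro mult_mono norm_solve_le A A') auto
  finally show ?thesis by simp
qed

lemma solve_tendsto:
  assumes A: "\<forall>\<^sub>F t in F. coercive_on G m (A t)" and A0: "coercive_on G m' A0" and lim: "(A \<longlongrightarrow> A0) F"
  shows "((\<lambda>t. solve G (A t)) \<longlongrightarrow> solve G A0) F"
proof (rule LIM_zero_cancel, rule tendsto_0_le)
  show "((\<lambda>t. norm (A t - A0)) \<longlongrightarrow> 0) F" using lim by (simp add: LIM_zero tendsto_norm_zero)
  show "\<forall>\<^sub>F t in F. norm (solve G (A t) - solve G A0) \<le> norm (norm (A t - A0)) * (1 / (m' * m))"
    using A by eventually_elim (use norm_solve_diff_le[OF A0] in simp)
qed

text \<open>Divide the resolvent identity by h. Continuity of \<open>solve G (A h)\<close> at h = 0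
  requires coercivity constants bounded below near 0, which is the purpose of
  \<open>m0\<close>.\<close>

lemma solve_has_vector_derivative:
  assumes A: "\<And>h. coercive_on G (m h) (A h)" and m: "\<And>h. \<bar>h\<bar> \<le> 1 \<Longrightarrow> m0 \<le> m h" "0 < m0"
    and der: "(A has_vector_derivative A') (at 0)"
  shows "((\<lambda>h. solve G (A h)) has_vector_derivative - (solve G (A 0) o\<^sub>L A' o\<^sub>L solve G (A 0))) (at 0)"
proof -
  have A0: "(A \<longlongrightarrow> A 0) (at 0)"
    using has_vector_derivative_continuous[OF der] by (simp add: continuous_at)
  have L0: "((\<lambda>h. solve G (A h)) \<longlongrightarrow> solve G (A 0)) (at 0)"
  proof (rule LIM_zero_cancel, rule tendsto_0_le)
    show "((\<lambda>t. norm (A t - A 0)) \<longlongrightarrow> 0) (at 0)" using A0 by (simp add: LIM_zero tendsto_norm_zero)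
    have "norm (solve G (A h) - solve G (A 0)) \<le> norm (norm (A h - A 0)) * (1 / (m0 * m0))" if "\<bar>h\<bar> < 1" for h
    proof -
      have "m0 \<le> m h" "m0 \<le> m 0" using that by (auto intro: m)
      then have "norm (A h - A 0) / (m 0 * m h) \<le> norm (A h - A 0) / (m0 * m0)"
        using m(2) by (intro divide_left_mono mult_mono mult_pos_pos) auto
      with norm_solve_diff_le[OF A[of 0] A[of h]] show ?thesis by simp
    qed
    then show "\<forall>\<^sub>F h in at 0. norm (solve G (A h) - solve G (A 0)) \<le> norm (norm (A h - A 0)) * (1 / (m0 * m0))"
      by (auto simp: eventually_at intro!: exI[of _ "1::real"])
  qed
  have "((\<lambda>h. - (solve G (A 0) o\<^sub>L ((1 / h) *\<^sub>R (A h - A 0)) o\<^sub>L solve G (A h))) \<longlongrightarrow>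
      - (solve G (A 0) o\<^sub>L A' o\<^sub>L solve G (A 0))) (at 0)"
    by (intro tendsto_minus bounded_bilinear.tendsto[OF bounded_bilinear_blinfun_compose]
        tendsto_const L0 der[unfolded has_vector_derivative_at_0_iff])
  moreover have "(1 / h) *\<^sub>R (solve G (A h) - solve G (A 0)) =
      - (solve G (A 0) o\<^sub>L ((1 / h) *\<^sub>R (A h - A 0)) o\<^sub>L solve G (A h))" for h
    unfolding resolvent_identity[OF A[of 0] A[of h]]
    by (rule blinfun_eqI) (simp add: blinfun.bilinear_simps)
  ultimately show ?thesis unfolding has_vector_derivative_at_0_iff by simp
qed

end

section \<open>Multiplication operators\<close>

text \<open>The bound is an explicit real number valid on the whole space, since it is reused as an
  operator norm bound for \<open>mult_L2\<close>.\<close>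

definition ess_bounded :: "('a::euclidean_space \<Rightarrow> real) \<Rightarrow> real \<Rightarrow> bool" where
  "ess_bounded g c \<longleftrightarrow> 0 \<le> c \<and> g \<in> borel_measurable lebesgue \<and> (AE x in lebesgue. \<bar>g x\<bar> \<le> c)"

lemma ess_boundedD:
  assumes "ess_bounded g c"
  shows "0 \<le> c" "g \<in> borel_measurable lebesgue" "AE x in lebesgue. \<bar>g x\<bar> \<le> c"
  using assms by (auto simp: ess_bounded_def)

lemma ess_bounded_const: "ess_bounded (\<lambda>x. k) \<bar>k\<bar>"
  by (simp add: ess_bounded_def)

lemma ess_bounded_add: "ess_bounded g c \<Longrightarrow> ess_bounded h d \<Longrightarrow> ess_bounded (\<lambda>x. g x + h x) (c + d)"
  unfolding ess_bounded_def by (auto elim: eventually_elim2)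

lemma ess_bounded_cmult: "ess_bounded g c \<Longrightarrow> ess_bounded (\<lambda>x. k * g x) (\<bar>k\<bar> * c)"
  unfolding ess_bounded_def by (auto simp: abs_mult mult_left_mono elim: eventually_mono)

lemma ess_bounded_diff: "ess_bounded g c \<Longrightarrow> ess_bounded h d \<Longrightarrow> ess_bounded (\<lambda>x. g x - h x) (c + d)"
  using ess_bounded_add[OF _ ess_bounded_cmult[of h d "-1"]] by simp

lemma ess_bounded_mult: "ess_bounded g c \<Longrightarrow> ess_bounded h d \<Longrightarrow> ess_bounded (\<lambda>x. g x * h x) (c * d)"
  unfolding ess_bounded_def by (auto simp: abs_mult intro!: mult_mono elim!: eventually_elim2)

lemma L2_eqI:
  assumes "sq_int f" "sq_int g" "AE x in lebesgue. f x = g x"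
  shows "abs_L2 f = abs_L2 g"
  using assms Quotient3_rel_abs[OF Quotient3_L2] unfolding L2_rel_def by blast

lemma rep_abs_L2: "sq_int f \<Longrightarrow> AE x in lebesgue. rep_L2 (abs_L2 f) x = f x"
  using Quotient3_rep_abs[OF Quotient3_L2, of f] by (auto simp: L2_rel_def)

lemma rep_L2_add: "AE x in lebesgue. rep_L2 (F + G) x = rep_L2 F x + rep_L2 G x"
  using rep_abs_L2[OF sq_int_add[OF sq_int_rep_L2 sq_int_rep_L2], of F G]
    abs_L2_add[OF sq_int_rep_L2 sq_int_rep_L2, of F G] by simp

lemma rep_L2_scaleR: "AE x in lebesgue. rep_L2 (c *\<^sub>R F) x = c *\<^sub>R rep_L2 F x"
  using rep_abs_L2[OF sq_int_scaleR[OF sq_int_rep_L2], of c F]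
    abs_L2_scaleR[OF sq_int_rep_L2, of c F] by simp

lemma inner_L2_abs: "sq_int f \<Longrightarrow> sq_int g \<Longrightarrow> abs_L2 f \<bullet> abs_L2 g = (LINT x|lebesgue. f x \<bullet> g x)"
  by (simp add: inner_L2.abs_eq L2_rel_def)

lemma inner_L2_rep: "F \<bullet> G = (LINT x|lebesgue. rep_L2 F x \<bullet> rep_L2 G x)"
  using inner_L2_abs[OF sq_int_rep_L2 sq_int_rep_L2, of F G] by simp

lemma sq_int_mult:
  assumes g: "ess_bounded g c" and f: "sq_int f"
  shows "sq_int (\<lambda>x. g x *\<^sub>R f x)"
proof -
  note [measurable] = sq_intD[OF f] ess_boundedD(2)[OF g]
  have "integrable lebesgue (\<lambda>x. (norm (g x *\<^sub>R f x))\<^sup>2)"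
  proof (rule Bochner_Integration.integrable_bound)
    show "integrable lebesgue (\<lambda>x. c\<^sup>2 * (norm (f x))\<^sup>2)"
      using sq_int_integrable[OF f] by simp
    show "AE x in lebesgue. norm ((norm (g x *\<^sub>R f x))\<^sup>2) \<le> norm (c\<^sup>2 * (norm (f x))\<^sup>2)"
      using ess_boundedD(3)[OF g]
      by eventually_elim (simp add: power_mult_distrib mult_right_mono abs_le_square_iff[symmetric])
  qed simp
  then show ?thesis by (simp add: sq_int_def)
qed

definition mult_L2 :: "('a \<Rightarrow> real) \<Rightarrow> ('a::euclidean_space, 'b::euclidean_space) L2 \<Rightarrow>\<^sub>L ('a, 'b) L2" where
  "mult_L2 g = Blinfun (\<lambda>F. abs_L2 (\<lambda>x. g x *\<^sub>R rep_L2 F x))"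

lemma
  assumes g: "ess_bounded g c"
  shows norm_abs_L2_mult: "norm (abs_L2 (\<lambda>x. g x *\<^sub>R rep_L2 F x)) \<le> c * norm (F :: ('a::euclidean_space, 'b::euclidean_space) L2)"
    and bounded_linear_abs_L2_mult: "bounded_linear (\<lambda>F :: ('a, 'b) L2. abs_L2 (\<lambda>x. g x *\<^sub>R rep_L2 F x))"
proof -
  note sq = sq_int_mult[OF g sq_int_rep_L2]
  have le: "norm (abs_L2 (\<lambda>x. g x *\<^sub>R rep_L2 F x)) \<le> c * norm F" for F :: "('a, 'b) L2"
  proof -
    have "(norm (abs_L2 (\<lambda>x. g x *\<^sub>R rep_L2 F x)))\<^sup>2 = (LINT x|lebesgue. (norm (g x *\<^sub>R rep_L2 F x))\<^sup>2)"
      by (rule norm_L2_abs[OF sq])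
    also have "\<dots> \<le> (LINT x|lebesgue. c\<^sup>2 * (norm (rep_L2 F x))\<^sup>2)"
    proof (rule integral_mono_AE)
      show "AE x in lebesgue. (norm (g x *\<^sub>R rep_L2 F x))\<^sup>2 \<le> c\<^sup>2 * (norm (rep_L2 F x))\<^sup>2"
        using ess_boundedD(3)[OF g]
        by eventually_elim (simp add: power_mult_distrib mult_right_mono abs_le_square_iff[symmetric])
    qed (use sq_int_integrable[OF sq] sq_int_integrable[OF sq_int_rep_L2] in auto)
    also have "\<dots> = (c * norm F)\<^sup>2"
      using norm_L2_abs[OF sq_int_rep_L2, of F] by (simp add: power_mult_distrib)
    finally show ?thesis
      using ess_boundedD(1)[OF g] by (simp add: power2_le_iff_abs_le)
  qed
  show "norm (abs_L2 (\<lambda>x. g x *\<^sub>R rep_L2 F x)) \<le> c * norm F" by (rule le)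
  show "bounded_linear (\<lambda>F :: ('a, 'b) L2. abs_L2 (\<lambda>x. g x *\<^sub>R rep_L2 F x))"
  proof (rule bounded_linear_intro[where K = c])
    fix F H :: "('a, 'b) L2" and r :: real
    show "abs_L2 (\<lambda>x. g x *\<^sub>R rep_L2 (F + H) x)
        = abs_L2 (\<lambda>x. g x *\<^sub>R rep_L2 F x) + abs_L2 (\<lambda>x. g x *\<^sub>R rep_L2 H x)"
      unfolding abs_L2_add[OF sq sq] using rep_L2_add[of F H]
      by (intro L2_eqI sq_int_add sq) (auto simp: scaleR_add_right elim: eventually_mono)
    show "abs_L2 (\<lambda>x. g x *\<^sub>R rep_L2 (r *\<^sub>R F) x) = r *\<^sub>R abs_L2 (\<lambda>x. g x *\<^sub>R rep_L2 F x)"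
      unfolding abs_L2_scaleR[OF sq] using rep_L2_scaleR[of r F]
      by (intro L2_eqI sq_int_scaleR sq) (auto simp: mult_ac elim: eventually_mono)
    show "norm (abs_L2 (\<lambda>x. g x *\<^sub>R rep_L2 F x)) \<le> norm F * c"
      using le[of F] by (simp add: mult.commute)
  qed
qed

lemma mult_L2_apply: "ess_bounded g c \<Longrightarrow> mult_L2 g F = abs_L2 (\<lambda>x. g x *\<^sub>R rep_L2 F x)"
  unfolding mult_L2_def by (simp add: bounded_linear_Blinfun_apply bounded_linear_abs_L2_mult)

lemma rep_mult_L2: "ess_bounded g c \<Longrightarrow> AE x in lebesgue. rep_L2 (mult_L2 g F) x = g x *\<^sub>R rep_L2 F x"
  by (simp add: mult_L2_apply rep_abs_L2 sq_int_mult sq_int_rep_L2)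

lemma norm_mult_L2_le: "ess_bounded g c \<Longrightarrow> norm (mult_L2 g) \<le> c"
  by (rule norm_blinfun_bound) (simp_all add: ess_boundedD(1) mult_L2_apply norm_abs_L2_mult)

lemma inner_mult_L2:
  assumes g: "ess_bounded g c"
  shows "mult_L2 g F \<bullet> H = (LINT x|lebesgue. g x * (rep_L2 F x \<bullet> rep_L2 H x))"
  using inner_L2_abs[OF sq_int_mult[OF g sq_int_rep_L2] sq_int_rep_L2, of F H]
  by (simp add: mult_L2_apply[OF g])

lemma integrable_mult_L2:
  assumes g: "ess_bounded g c"
  shows "integrable lebesgue (\<lambda>x. g x * (rep_L2 F x \<bullet> rep_L2 H x))"
  using sq_int_inner[OF sq_int_mult[OF g sq_int_rep_L2] sq_int_rep_L2, of F H] by simp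

lemma mult_L2_add:
  assumes g: "ess_bounded g c" and h: "ess_bounded h d"
  shows "mult_L2 (\<lambda>x. g x + h x) = mult_L2 g + mult_L2 h"
  by (rule blinfun_eqI)
     (simp add: mult_L2_apply[OF g] mult_L2_apply[OF h] mult_L2_apply[OF ess_bounded_add[OF g h]] blinfun.add_left
        abs_L2_add sq_int_mult[OF g] sq_int_mult[OF h] sq_int_rep_L2 scaleR_add_left)

lemma mult_L2_cmult:
  assumes g: "ess_bounded g c"
  shows "mult_L2 (\<lambda>x. k * g x) = k *\<^sub>R mult_L2 g"
  by (rule blinfun_eqI)
     (simp add: mult_L2_apply[OF g] mult_L2_apply[OF ess_bounded_cmult[OF g]] blinfun.scaleR_left
        abs_L2_scaleR sq_int_mult[OF g] sq_int_rep_L2)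

lemma mult_L2_diff:
  assumes g: "ess_bounded g c" and h: "ess_bounded h d"
  shows "mult_L2 (\<lambda>x. g x - h x) = mult_L2 g - mult_L2 h"
  by (simp add: mult_L2_add[OF g ess_bounded_cmult[OF h, of "-1"], simplified] mult_L2_cmult[OF h, of "-1", simplified])

lemma coercive_on_mult_L2:
  assumes a: "ess_bounded a c" "AE x in lebesgue. m \<le> a x" "0 < m"
  shows "coercive_on G m (mult_L2 a)"
  unfolding coercive_on_def
proof (intro conjI allI ballI)
  fix F H
  show "mult_L2 a F \<bullet> H = F \<bullet> mult_L2 a H"
    unfolding inner_commute[of F "mult_L2 a H"] inner_mult_L2[OF a(1)]
    by (intro Bochner_Integration.integral_cong refl) (metis inner_commute)
  have "m * (norm F)\<^sup>2 = (LINT x|lebesgue. m * (rep_L2 F x \<bullet> rep_L2 F x))"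
    by (simp add: power2_norm_eq_inner inner_L2_rep)
  also have "\<dots> \<le> (LINT x|lebesgue. a x * (rep_L2 F x \<bullet> rep_L2 F x))"
    by (rule integral_mono_AE)
       (use a(2) integrable_mult_L2[OF a(1)] sq_int_inner[OF sq_int_rep_L2 sq_int_rep_L2]
         in \<open>auto elim!: eventually_mono intro!: mult_right_mono\<close>)
  finally show "m * (norm F)\<^sup>2 \<le> mult_L2 a F \<bullet> F"
    by (simp add: inner_mult_L2[OF a(1)])
qed (rule a)

lemma abs_exp_remainder_le: "\<bar>exp t - 1 - t\<bar> \<le> t\<^sup>2 * exp \<bar>t\<bar>" for t :: real
proof -
  obtain s where s: "\<bar>s\<bar> \<le> \<bar>t\<bar>" "exp t = (\<Sum>m<2. t ^ m / fact m) + exp s / fact 2 * t ^ 2"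
    using Maclaurin_exp_le[of t 2] by auto
  have "\<bar>exp t - 1 - t\<bar> = exp s / 2 * t\<^sup>2"
    using s(2) by (simp add: numeral_2_eq_2)
  also have "\<dots> \<le> exp \<bar>t\<bar> * t\<^sup>2"
  proof (rule mult_right_mono)
    have "exp s \<le> exp \<bar>t\<bar>" using s(1) by simp
    then show "exp s / 2 \<le> exp \<bar>t\<bar>" using exp_ge_zero[of s] by linarith
  qed simp
  finally show ?thesis by (simp add: mult.commute)
qed

lemma ess_bounded_exp:
  assumes "ess_bounded b c"
  shows "ess_bounded (\<lambda>x. exp (b x)) (exp c)" "AE x in lebesgue. exp (- c) \<le> exp (b x)"
  using assms by (auto simp: ess_bounded_def elim: eventually_mono)

text \<open>The error of the difference quotient is multiplication by g (exp (h p) - 1 - h p) / h.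
  By Taylor's formula this is essentially at most |h| c d^2 exp d for |h| < 1, so the derivative
  exists in operator norm.\<close>

lemma mult_L2_exp_has_vector_derivative:
  assumes g: "ess_bounded g c" and p: "ess_bounded p d"
  shows "((\<lambda>h. mult_L2 (\<lambda>x. g x * exp (h * p x))) has_vector_derivative mult_L2 (\<lambda>x. g x * p x)) (at 0)"
proof -
  let ?M = "\<lambda>h. mult_L2 (\<lambda>x. g x * exp (h * p x))"
  let ?D = "mult_L2 (\<lambda>x. g x * p x)"
  have bd: "ess_bounded (\<lambda>x. g x * exp (h * p x)) (c * exp (\<bar>h\<bar> * d))" for h
    by (intro ess_bounded_mult g ess_bounded_exp ess_bounded_cmult p)
  note gp = ess_bounded_mult[OF g p]
  have "norm ((1 / h) *\<^sub>R (?M h - ?M 0) - ?D) \<le> \<bar>h\<bar> * (c * d\<^sup>2 * exp d)" if h: "h \<noteq> 0" "\<bar>h\<bar> < 1" for h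
  proof -
    have "(1 / h) *\<^sub>R (?M h - ?M 0) - ?D
        = mult_L2 (\<lambda>x. (1 / h) * (g x * exp (h * p x) - g x * exp (0 * p x)) - g x * p x)"
      by (simp only: mult_L2_diff[OF bd bd] mult_L2_diff[OF ess_bounded_cmult[OF ess_bounded_diff[OF bd bd]] gp]
          mult_L2_cmult[OF ess_bounded_diff[OF bd bd]])
    also have "norm \<dots> \<le> \<bar>h\<bar> * (c * d\<^sup>2 * exp d)"
    proof (rule norm_mult_L2_le, unfold ess_bounded_def, intro conjI)
      note [measurable] = ess_boundedD(2)[OF g] ess_boundedD(2)[OF p]
      show "(\<lambda>x. 1 / h * (g x * exp (h * p x) - g x * exp (0 * p x)) - g x * p x) \<in> borel_measurable lebesgue"
        by measurable
      show "0 \<le> \<bar>h\<bar> * (c * d\<^sup>2 * exp d)" using ess_boundedD(1)[OF g] by simp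
      show "AE x in lebesgue. \<bar>1 / h * (g x * exp (h * p x) - g x * exp (0 * p x)) - g x * p x\<bar> \<le> \<bar>h\<bar> * (c * d\<^sup>2 * exp d)"
        using ess_boundedD(3)[OF g] ess_boundedD(3)[OF p]
      proof eventually_elim
        case (elim x)
        have hp: "\<bar>h * p x\<bar> \<le> \<bar>h\<bar> * d" "\<bar>h\<bar> * d \<le> d"
          using elim h ess_boundedD(1)[OF p] by (auto simp: abs_mult mult_left_mono mult_left_le_one_le)
        have "1 / h * (g x * exp (h * p x) - g x * exp (0 * p x)) - g x * p x
            = g x * ((exp (h * p x) - 1 - h * p x) / h)"
          using h by (simp add: field_simps)
        also have "\<bar>\<dots>\<bar> \<le> c * ((h * p x)\<^sup>2 * exp \<bar>h * p x\<bar> / \<bar>h\<bar>)"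
          unfolding abs_mult[of "g x"] abs_divide
          by (intro mult_mono elim ess_boundedD(1)[OF g] divide_right_mono abs_exp_remainder_le[of "h * p x"]) auto
        also have "\<dots> \<le> c * ((\<bar>h\<bar> * d)\<^sup>2 * exp d / \<bar>h\<bar>)"
          using hp h ess_boundedD(1)[OF g] ess_boundedD(1)[OF p]
          by (intro mult_left_mono divide_right_mono mult_mono) (auto simp: abs_le_square_iff[symmetric])
        also have "\<dots> = \<bar>h\<bar> * (c * d\<^sup>2 * exp d)"
          using h by (simp add: field_simps power2_eq_square)
        finally show ?case .
      qed
    qed
    finally show ?thesis .
  qed
  then have "\<forall>\<^sub>F h in at 0. norm ((1 / h) *\<^sub>R (?M h - ?M 0) - ?D) \<le> norm h * (c * d\<^sup>2 * exp d)"
    by (auto simp: eventually_at intro!: exI[of _ "1::real"])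
  then show ?thesis unfolding has_vector_derivative_at_0_iff
    by (rule LIM_zero_cancel[OF tendsto_0_le[where f = "\<lambda>h. h", OF tendsto_ident_at]])
qed

section \<open>Test functions and the Poincare inequality\<close>

lemma test_functionD:
  assumes "test_function D \<phi>"
  obtains K where "compact K" "K \<subseteq> D" "\<And>x. x \<notin> K \<Longrightarrow> \<phi> x = 0"
  using assms closure_subset[of "{x. \<phi> x \<noteq> 0}"] unfolding test_function_def by blast

lemma test_function_continuous: "test_function D \<phi> \<Longrightarrow> continuous_on UNIV \<phi>"
  unfolding test_function_def by (metis continuously_differentiable.simps(1))

lemma GDERIV_frechet_derivative:
  "GDERIV \<phi> x :> g \<Longrightarrow> frechet_derivative \<phi> (at x) i = i \<bullet> g"
  unfolding gderiv_def using frechet_derivative_at by metis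

lemma test_function_gradient_continuous:
  assumes "test_function D \<phi>" "\<And>x. GDERIV \<phi> x :> g x"
  shows "continuous_on UNIV g"
proof -
  have "continuously_differentiable (Suc 0) \<phi>"
    using assms unfolding test_function_def by blast
  then have "continuous_on UNIV (\<lambda>x. frechet_derivative \<phi> (at x) i)" if "i \<in> Basis" for i
    using that by simp
  then have "continuous_on UNIV (\<lambda>x. g x \<bullet> i)" if "i \<in> Basis" for i
    using that by (simp add: GDERIV_frechet_derivative[OF assms(2)] inner_commute)
  then have "\<And>i. i \<in> Basis \<Longrightarrow> continuous_on UNIV (\<lambda>x. (g x \<bullet> i) *\<^sub>R i)"
    by (simp add: continuous_on_scaleR)
  then have "continuous_on UNIV (\<lambda>x. \<Sum>i\<in>Basis. (g x \<bullet> i) *\<^sub>R i)"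
    by (rule continuous_on_sum)
  then show ?thesis by (simp add: euclidean_representation)
qed

lemma GDERIV_eq_0_outside:
  assumes "closed K" "\<And>x. x \<notin> K \<Longrightarrow> \<phi> x = (0::real)" "GDERIV \<phi> x :> g" "x \<notin> K"
  shows "g = 0"
proof -
  have "((\<lambda>x. 0) has_derivative (\<lambda>h. h \<bullet> g)) (at x)"
    by (rule has_derivative_transform_within_open[of \<phi> _ x UNIV "- K"])
       (use assms in \<open>auto simp: gderiv_def\<close>)
  then have "(\<lambda>h. h \<bullet> g) = (\<lambda>h. 0)"
    by (rule has_derivative_unique) simp
  then have "g \<bullet> g = 0" by metis
  then show ?thesis by simp
qed

lemma integrable_lborel_compact_support:
  fixes f :: "'a::euclidean_space \<Rightarrow> 'b::{banach,second_countable_topology}"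
  assumes "continuous_on UNIV f" "compact K" "\<And>x. x \<notin> K \<Longrightarrow> f x = 0"
  shows "integrable lborel f"
proof -
  have "integrable lborel (\<lambda>x. indicator K x *\<^sub>R f x)"
    using assms by (intro borel_integrable_compact) (auto intro: continuous_on_subset)
  also have "(\<lambda>x. indicator K x *\<^sub>R f x) = f"
    using assms(3) by (auto simp: indicator_def)
  finally show ?thesis .
qed

lemma sq_int_compact_support:
  fixes f :: "'a::euclidean_space \<Rightarrow> 'b::euclidean_space"
  assumes "continuous_on UNIV f" "compact K" "\<And>x. x \<notin> K \<Longrightarrow> f x = 0"
  shows "sq_int f"
proof -
  have "f \<in> borel_measurable lborel"
    using borel_measurable_continuous_onI[OF assms(1)] by simp
  moreover have "integrable lborel (\<lambda>x. (norm (f x))\<^sup>2)"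
    by (rule integrable_lborel_compact_support[OF _ assms(2)])
       (use assms in \<open>auto intro!: continuous_on_power continuous_on_norm\<close>)
  ultimately show ?thesis
    unfolding sq_int_def
    by (subst integrable_completion) (auto intro: measurable_completion)
qed

text \<open>By translation invariance all difference quotients have integral zero.\<close>

lemma integral_directional_derivative_eq_0:
  fixes w h :: "'a::euclidean_space \<Rightarrow> real"
  assumes w: "continuous_on UNIV w" "\<And>x. x \<notin> K \<Longrightarrow> w x = 0" and K: "compact K"
    and h: "continuous_on UNIV h" "\<And>x. x \<notin> K \<Longrightarrow> h x = 0"
    and der: "\<And>x t. ((\<lambda>t. w (x + t *\<^sub>R i)) has_real_derivative h (x + t *\<^sub>R i)) (at t)"
  shows "(LINT x|lborel. h x) = 0"
proof -
  have iw: "integrable lborel w"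
    using w K by (intro integrable_lborel_compact_support)
  have "compact (h ` K)" using h(1) K by (intro compact_continuous_image) (auto intro: continuous_on_subset)
  then obtain M where M: "\<And>x. x \<in> K \<Longrightarrow> \<bar>h x\<bar> \<le> M"
    using compact_imp_bounded[of "h ` K"] unfolding bounded_iff by auto
  define M' where "M' = max M 0"
  have M': "\<bar>h x\<bar> \<le> M'" for x
    using M[of x] h(2)[of x] by (cases "x \<in> K") (auto simp: M'_def)
  obtain R where R: "\<And>x. x \<in> K \<Longrightarrow> norm x \<le> R"
    using compact_imp_bounded[OF K] by (auto simp: bounded_iff)
  define e where "e n = 1 / real (Suc n)" for n
  have e: "0 < e n" "e n \<le> 1" for n by (auto simp: e_def)
  have e0: "e \<longlonglongrightarrow> 0" unfolding e_def by (rule LIMSEQ_Suc[OF lim_1_over_n])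
  define q where "q n x = (w (x + e n *\<^sub>R i) - w x) / e n" for n x
  have mw: "w \<in> borel_measurable borel" "h \<in> borel_measurable borel"
    using w(1) h(1) by (auto intro: borel_measurable_continuous_onI)
  note [measurable] = mw
  have shift: "integrable lborel (\<lambda>x. w (x + c))" "(LINT x|lborel. w (x + c)) = (LINT x|lborel. w x)" for c
  proof -
    have "lborel = distr lborel borel (\<lambda>x. c + x)" by (rule lborel_distr_plus[symmetric])
    then have "integrable (distr lborel borel (\<lambda>x. c + x)) w" "(LINT x|distr lborel borel (\<lambda>x. c + x). w x) = (LINT x|lborel. w x)"
      using iw by auto
    then show "integrable lborel (\<lambda>x. w (x + c))" "(LINT x|lborel. w (x + c)) = (LINT x|lborel. w x)"
      by (simp_all add: integrable_distr_eq integral_distr add.commute)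
  qed
  have q0: "(LINT x|lborel. q n x) = 0" for n
    unfolding q_def using shift[of "e n *\<^sub>R i"] iw by simp
  have "(\<lambda>n. LINT x|lborel. q n x) \<longlonglongrightarrow> (LINT x|lborel. h x)"
  \<comment> \<open>By the mean value theorem q n x equals h at a point x + z i with 0 < z < e n
    \<le> 1. The value is nonzero only if that point lies in K, which forces norm x \<le> R + norm
    i.\<close>
  proof (rule integral_dominated_convergence[where w = "\<lambda>x. indicator (cball 0 (R + norm i)) x * M'"])
    show "integrable lborel (\<lambda>x. indicator (cball 0 (R + norm i)) x * M' :: real)"
      by (intro integrable_mult_left integrable_real_indicator)
         (use emeasure_bounded_finite[OF bounded_cball, of 0 "R + norm i"] in auto)
    show "AE x in lborel. (\<lambda>n. q n x) \<longlonglongrightarrow> h x"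
    proof (rule AE_I2)
      fix x
      have "((\<lambda>t. (w (x + t *\<^sub>R i) - w x) / t) \<longlongrightarrow> h x) (at 0)"
        using der[of x 0] by (simp add: has_field_derivative_iff)
      moreover have "filterlim e (at 0) sequentially"
        using e0 e(1) by (auto simp: filterlim_at less_imp_neq[symmetric] intro!: always_eventually)
      ultimately show "(\<lambda>n. q n x) \<longlonglongrightarrow> h x"
        unfolding q_def by (rule filterlim_compose)
    qed
    show "AE x in lborel. norm (q n x) \<le> indicator (cball 0 (R + norm i)) x * M'" for n
    proof (rule AE_I2)
      fix x
      obtain z where z: "0 < z" "z < e n" "w (x + e n *\<^sub>R i) - w (x + 0 *\<^sub>R i) = (e n - 0) * h (x + z *\<^sub>R i)"
        using MVT2[of 0 "e n" "\<lambda>t. w (x + t *\<^sub>R i)" "\<lambda>t. h (x + t *\<^sub>R i)"] der e(1) by blast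
      then have q: "q n x = h (x + z *\<^sub>R i)" using e(1)[of n] by (simp add: q_def)
      have "norm x \<le> R + norm i" if "x + z *\<^sub>R i \<in> K"
      proof -
        have "norm x \<le> norm (x + z *\<^sub>R i) + norm (z *\<^sub>R i)"
          using norm_triangle_ineq4[of "x + z *\<^sub>R i" "z *\<^sub>R i"] by simp
        also have "norm (z *\<^sub>R i) \<le> norm i"
          using z e(2)[of n] by (simp add: mult_left_le_one_le)
        finally show ?thesis using R[OF that] by simp
      qed
      then show "norm (q n x) \<le> indicator (cball 0 (R + norm i)) x * M'"
        using M'[of "x + z *\<^sub>R i"] h(2)[of "x + z *\<^sub>R i"] by (auto simp: q indicator_def)
    qed
  qed (auto simp: q_def)
  then show ?thesis using q0 by (simp add: LIMSEQ_const_iff)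
qed

text \<open>Integrate the derivative of \<open>(x \<bullet> i) * (\<phi> x)\<^sup>2\<close> in the direction \<open>i\<close>.\<close>

lemma poincare_test_function:
  fixes D :: "'a::euclidean_space set"
  assumes phi: "test_function D \<phi>" "\<And>x. GDERIV \<phi> x :> g x" and R: "\<And>x. x \<in> D \<Longrightarrow> norm x \<le> R"
  shows "(LINT x|lborel. (\<phi> x)\<^sup>2) \<le> 4 * R\<^sup>2 * (LINT x|lborel. (norm (g x))\<^sup>2)"
proof -
  obtain K where K: "compact K" "K \<subseteq> D" "\<And>x. x \<notin> K \<Longrightarrow> \<phi> x = 0"
    using test_functionD[OF phi(1)] by blast
  have g0: "x \<notin> K \<Longrightarrow> g x = 0" for x
    using GDERIV_eq_0_outside[OF compact_imp_closed[OF K(1)] K(3) phi(2)] by blast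
  note cont = test_function_continuous[OF phi(1)] test_function_gradient_continuous[OF phi]
  obtain i :: 'a where i: "i \<in> Basis" using nonempty_Basis by blast
  define w where "w x = (x \<bullet> i) * (\<phi> x)\<^sup>2" for x
  define h where "h x = (\<phi> x)\<^sup>2 + 2 * ((x \<bullet> i) * \<phi> x * (i \<bullet> g x))" for x
  have der: "((\<lambda>t. w (x + t *\<^sub>R i)) has_real_derivative h (x + t *\<^sub>R i)) (at t)" for x t
  proof -
    have "((\<lambda>t. x + t *\<^sub>R i) has_derivative (\<lambda>s. s *\<^sub>R i)) (at t)"
      by (auto intro!: derivative_eq_intros)
    then have "((\<lambda>t. \<phi> (x + t *\<^sub>R i)) has_derivative (\<lambda>s. (s *\<^sub>R i) \<bullet> g (x + t *\<^sub>R i))) (at t)"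
      by (rule has_derivative_compose) (use phi(2) in \<open>simp add: gderiv_def\<close>)
    then have d: "((\<lambda>t. \<phi> (x + t *\<^sub>R i)) has_real_derivative (i \<bullet> g (x + t *\<^sub>R i))) (at t)"
      by (simp add: has_field_derivative_def mult.commute[of _ "i \<bullet> _"])
    have "((\<lambda>t. (x \<bullet> i + t) * (\<phi> (x + t *\<^sub>R i))\<^sup>2) has_real_derivative h (x + t *\<^sub>R i)) (at t)"
      using i by (auto intro!: derivative_eq_intros d simp: h_def inner_add_left power2_eq_square algebra_simps)
    then show ?thesis using i by (simp add: w_def inner_add_left)
  qed
  have "(LINT x|lborel. h x) = 0"
    by (rule integral_directional_derivative_eq_0[OF _ _ K(1) _ _ der])
       (use K(3) g0 in \<open>auto simp: w_def h_def intro!: continuous_intros cont\<close>)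
  have ints: "integrable lborel (\<lambda>x. (\<phi> x)\<^sup>2)" "integrable lborel (\<lambda>x. (norm (g x))\<^sup>2)" "integrable lborel h"
    using K(3) g0 by (auto intro!: integrable_lborel_compact_support[OF _ K(1)] continuous_intros cont simp: h_def)
  \<comment> \<open>Put t = (x . i) (i . g x). Then h x - (\<phi> x)^2 / 2 + 2 t^2 = 2 (\<phi> x / 2
    + t)^2 is nonnegative, and t^2 \<le> R^2 |g x|^2.\<close>
  have "(\<phi> x)\<^sup>2 / 2 \<le> h x + 2 * R\<^sup>2 * (norm (g x))\<^sup>2" for x
  proof (cases "x \<in> K")
    case True
    then have "norm x \<le> R" using K(2) R by blast
    have "\<bar>(x \<bullet> i) * (i \<bullet> g x)\<bar> \<le> (norm x * norm i) * (norm i * norm (g x))"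
      unfolding abs_mult by (intro mult_mono Cauchy_Schwarz_ineq2) auto
    also have "\<dots> \<le> R * norm (g x)"
      using i \<open>norm x \<le> R\<close> by (simp add: mult_right_mono)
    finally have "\<bar>(x \<bullet> i) * (i \<bullet> g x)\<bar> \<le> R * norm (g x)" .
    then have "((x \<bullet> i) * (i \<bullet> g x))\<^sup>2 \<le> (R * norm (g x))\<^sup>2"
      unfolding abs_le_square_iff[symmetric] by linarith
    moreover have "0 \<le> (\<phi> x / 2 + (x \<bullet> i) * (i \<bullet> g x))\<^sup>2" by simp
    ultimately show ?thesis
      by (simp add: h_def power2_eq_square algebra_simps)
  qed (simp add: K(3) g0 h_def)
  then have "(LINT x|lborel. (\<phi> x)\<^sup>2 / 2) \<le> (LINT x|lborel. h x + 2 * R\<^sup>2 * (norm (g x))\<^sup>2)"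
    using ints by (intro integral_mono) auto
  also have "\<dots> = 2 * R\<^sup>2 * (LINT x|lborel. (norm (g x))\<^sup>2)"
    using ints \<open>(LINT x|lborel. h x) = 0\<close> by simp
  finally show ?thesis by simp
qed

section \<open>The space of gradients\<close>

definition test_pairs :: "'a::euclidean_space set \<Rightarrow> 'a H1 set" where
  "test_pairs D = {(abs_L2 \<phi>, abs_L2 g) |\<phi> g. test_function D \<phi> \<and> (\<forall>x. GDERIV \<phi> x :> g x)}"

lemma H10_eq: "H10 D = closure (test_pairs D)"
  by (simp add: H10_def test_pairs_def)

lemma continuously_differentiable_add:
  "continuously_differentiable k \<phi> \<Longrightarrow> continuously_differentiable k \<psi> \<Longrightarrow>
    continuously_differentiable k (\<lambda>x. \<phi> x + \<psi> x)"
proof (induction k arbitrary: \<phi> \<psi>)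
  case (Suc k)
  then have "frechet_derivative (\<lambda>x. \<phi> x + \<psi> x) (at x) =
      (\<lambda>i. frechet_derivative \<phi> (at x) i + frechet_derivative \<psi> (at x) i)" for x
    by (intro frechet_derivative_at[symmetric] has_derivative_add) (auto simp: frechet_derivative_works[symmetric])
  then show ?case using Suc by auto
qed (auto intro: continuous_on_add)

lemma continuously_differentiable_cmult:
  "continuously_differentiable k \<phi> \<Longrightarrow> continuously_differentiable k (\<lambda>x. c * \<phi> x)"
proof (induction k arbitrary: \<phi>)
  case (Suc k)
  then have "frechet_derivative (\<lambda>x. c * \<phi> x) (at x) = (\<lambda>i. c * frechet_derivative \<phi> (at x) i)" for x
    by (intro frechet_derivative_at[symmetric] has_derivative_mult_right) (auto simp: frechet_derivative_works[symmetric])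
  then show ?case using Suc by auto
qed (auto intro: continuous_on_mult)

lemma test_functionI:
  assumes "\<And>k. continuously_differentiable k \<phi>" "compact K" "K \<subseteq> D" "\<And>x. x \<notin> K \<Longrightarrow> \<phi> x = 0"
  shows "test_function D \<phi>"
proof -
  have "closure {x. \<phi> x \<noteq> 0} \<subseteq> K"
    using assms by (intro closure_minimal) (auto intro: compact_imp_closed)
  moreover from this have "compact (closure {x. \<phi> x \<noteq> 0})"
    using assms(2) compact_Int_closed[of K "closure {x. \<phi> x \<noteq> 0}"] by (simp add: Int_absorb1)
  ultimately show ?thesis using assms by (auto simp: test_function_def)
qed

lemma test_pair_sq_int:
  assumes "test_function D \<phi>" "\<And>x. GDERIV \<phi> x :> g x"
  shows "sq_int \<phi>" "sq_int g"
proof -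
  obtain K where K: "compact K" "K \<subseteq> D" "\<And>x. x \<notin> K \<Longrightarrow> \<phi> x = 0"
    using test_functionD[OF assms(1)] by blast
  show "sq_int \<phi>" "sq_int g"
    using sq_int_compact_support[OF test_function_continuous[OF assms(1)] K(1,3)]
      sq_int_compact_support[OF test_function_gradient_continuous[OF assms] K(1)]
      GDERIV_eq_0_outside[OF compact_imp_closed[OF K(1)] K(3) assms(2)] by blast+
qed

lemma continuously_differentiable_0: "continuously_differentiable k (\<lambda>x. 0)"
  by (induction k) auto

lemma subspace_test_pairs: "subspace (test_pairs D)"
proof (rule subspaceI)
  have "test_function D (\<lambda>x. 0)"
    by (rule test_functionI[where K = "{}"]) (auto simp: continuously_differentiable_0)
  then show "0 \<in> test_pairs D"
    unfolding test_pairs_def zero_prod_def zero_L2_def using GDERIV_const by blast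
next
  fix v w assume "v \<in> test_pairs D" "w \<in> test_pairs D"
  then obtain \<phi> g \<psi> h where v: "v = (abs_L2 \<phi>, abs_L2 g)" "test_function D \<phi>" "\<And>x. GDERIV \<phi> x :> g x"
    and w: "w = (abs_L2 \<psi>, abs_L2 h)" "test_function D \<psi>" "\<And>x. GDERIV \<psi> x :> h x"
    unfolding test_pairs_def by blast
  obtain K K' where "compact K" "K \<subseteq> D" "\<And>x. x \<notin> K \<Longrightarrow> \<phi> x = 0"
    "compact K'" "K' \<subseteq> D" "\<And>x. x \<notin> K' \<Longrightarrow> \<psi> x = 0"
    using test_functionD[OF v(2)] test_functionD[OF w(2)] by metis
  then have "test_function D (\<lambda>x. \<phi> x + \<psi> x)"
    using v(2) w(2) by (intro test_functionI[where K = "K \<union> K'"])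
      (auto simp: continuously_differentiable_add test_function_def)
  then show "v + w \<in> test_pairs D"
    using GDERIV_add[OF v(3) w(3)] test_pair_sq_int[OF v(2,3)] test_pair_sq_int[OF w(2,3)]
    unfolding test_pairs_def v(1) w(1) by (auto simp: abs_L2_add)
next
  fix v c assume "v \<in> test_pairs D"
  then obtain \<phi> g where v: "v = (abs_L2 \<phi>, abs_L2 g)" "test_function D \<phi>" "\<And>x. GDERIV \<phi> x :> g x"
    unfolding test_pairs_def by blast
  obtain K where "compact K" "K \<subseteq> D" "\<And>x. x \<notin> K \<Longrightarrow> \<phi> x = 0"
    using test_functionD[OF v(2)] by metis
  then have "test_function D (\<lambda>x. c * \<phi> x)"
    using v(2) by (intro test_functionI[where K = K])
      (auto simp: continuously_differentiable_cmult test_function_def)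
  moreover have "GDERIV (\<lambda>x. c * \<phi> x) x :> c *\<^sub>R g x" for x
    using has_derivative_mult_right[OF v(3)[unfolded gderiv_def]] by (simp add: gderiv_def)
  ultimately show "c *\<^sub>R v \<in> test_pairs D"
    using test_pair_sq_int[OF v(2,3)]
    unfolding test_pairs_def v(1) by (auto simp: abs_L2_scaleR)
qed

lemma subspace_H10: "subspace (H10 D)" and closed_H10: "closed (H10 D)"
  by (simp_all add: H10_eq subspace_closure subspace_test_pairs)

text \<open>The inequality is a closed condition in the H1 norm, so it passes from test functions to
  their closure. It makes the gradient injective on \<open>H10 D\<close>, with a bounded
  inverse.\<close>

lemma poincare_H10:
  assumes D: "bounded D"
  obtains C where "0 \<le> C" "\<And>v. v \<in> H10 D \<Longrightarrow> norm (fst v) \<le> C * norm (snd v)"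
proof -
  obtain R where R: "R > 0" "\<And>x. x \<in> D \<Longrightarrow> norm x \<le> R"
    using D bounded_pos by blast
  have "test_pairs D \<subseteq> {v. norm (fst v) \<le> 2 * R * norm (snd v)}"
  proof
    fix v assume "v \<in> test_pairs D"
    then obtain \<phi> g where v: "v = (abs_L2 \<phi>, abs_L2 g)" "test_function D \<phi>" "\<And>x. GDERIV \<phi> x :> g x"
      unfolding test_pairs_def by blast
    note cont = test_function_continuous[OF v(2)] test_function_gradient_continuous[OF v(2,3)]
    have "\<phi> \<in> borel_measurable borel" "g \<in> borel_measurable borel"
      using cont by (auto intro: borel_measurable_continuous_onI)
    then have "(norm (abs_L2 \<phi>))\<^sup>2 = (LINT x|lborel. (\<phi> x)\<^sup>2)" "(norm (abs_L2 g))\<^sup>2 = (LINT x|lborel. (norm (g x))\<^sup>2)"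
      using test_pair_sq_int[OF v(2,3)] by (auto simp: norm_L2_abs integral_completion)
    then have "(norm (abs_L2 \<phi>))\<^sup>2 \<le> (2 * R * norm (abs_L2 g))\<^sup>2"
      using poincare_test_function[OF v(2,3) R(2)] by (simp add: power_mult_distrib)
    then show "v \<in> {v. norm (fst v) \<le> 2 * R * norm (snd v)}"
      using R(1) by (simp add: v(1) power2_le_iff_abs_le)
  qed
  moreover have "closed {v :: 'a H1. norm (fst v) \<le> 2 * R * norm (snd v)}"
    by (intro closed_Collect_le continuous_intros)
  ultimately have "H10 D \<subseteq> {v. norm (fst v) \<le> 2 * R * norm (snd v)}"
    unfolding H10_eq by (rule closure_minimal)
  then show ?thesis using that[of "2 * R"] R(1) by auto
qed

text \<open>Vanishing outside D is written as invariance under multiplication by the indicator of D,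
  a closed condition that survives the closure of the test functions. It lets integrals over D be
  taken over the whole space.\<close>

lemma H10_gradient_vanishes_outside:
  assumes D: "open D" and v: "v \<in> H10 D"
  shows "AE x in lebesgue. x \<notin> D \<longrightarrow> rep_L2 (snd v) x = 0"
proof -
  have bd: "ess_bounded (indicator D :: 'a \<Rightarrow> real) 1"
    using D by (simp add: ess_bounded_def borel_measurable_indicator)
  have "test_pairs D \<subseteq> {v. mult_L2 (indicator D) (snd v) = snd v}"
  proof
    fix v assume "v \<in> test_pairs D"
    then obtain \<phi> g where v: "v = (abs_L2 \<phi>, abs_L2 g)" "test_function D \<phi>" "\<And>x. GDERIV \<phi> x :> g x"
      unfolding test_pairs_def by blast
    obtain K where K: "compact K" "K \<subseteq> D" "\<And>x. x \<notin> K \<Longrightarrow> \<phi> x = 0"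
      using test_functionD[OF v(2)] by metis
    have "g x = 0" if "x \<notin> D" for x
      using GDERIV_eq_0_outside[OF compact_imp_closed[OF K(1)] K(3) v(3)] K(2) that by blast
    then have "abs_L2 (\<lambda>x. indicator D x *\<^sub>R rep_L2 (abs_L2 g) x) = abs_L2 g"
      by (intro L2_eqI sq_int_mult[OF bd] sq_int_rep_L2 test_pair_sq_int[OF v(2,3)])
         (use rep_abs_L2[OF test_pair_sq_int(2)[OF v(2,3)]] in \<open>auto simp: indicator_def elim!: eventually_mono\<close>)
    then show "v \<in> {v. mult_L2 (indicator D) (snd v) = snd v}"
      by (simp add: v(1) mult_L2_apply[OF bd])
  qed
  moreover have "closed {v :: 'a H1. mult_L2 (indicator D) (snd v) = snd v}"
    by (intro closed_Collect_eq continuous_intros)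
  ultimately have "H10 D \<subseteq> {v. mult_L2 (indicator D) (snd v) = snd v}"
    unfolding H10_eq by (rule closure_minimal)
  then have "mult_L2 (indicator D) (snd v) = snd v" using v by blast
  then show ?thesis
    using rep_mult_L2[OF bd, of "snd v"] by (auto simp: indicator_def elim!: eventually_mono)
qed

definition grads :: "'a::euclidean_space set \<Rightarrow> ('a, 'a) L2 set" where
  "grads D = snd ` H10 D"

text \<open>By Poincare, convergent gradients have Cauchy potentials, so a limit of gradients is the
  gradient of a limit in \<open>H10 D\<close>.\<close>

lemma closed_subspace_grads:
  assumes D: "bounded D"
  shows "closed_subspace (grads D)"
proof
  show "subspace (grads D)"
    unfolding grads_def using linear_subspace_image[OF _ subspace_H10[of D], of snd] linear_snd by blast
  obtain C where C: "0 \<le> C" "\<And>v. v \<in> H10 D \<Longrightarrow> norm (fst v) \<le> C * norm (snd v)"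
    using poincare_H10[OF D] by blast
  show "closed (grads D)"
    unfolding closed_sequential_limits
  proof (intro allI impI, elim conjE)
    fix X l assume X: "\<forall>n. X n \<in> grads D" "X \<longlonglongrightarrow> l"
    then obtain v where v: "\<And>n. v n \<in> H10 D" "\<And>n. X n = snd (v n)"
      unfolding grads_def image_iff by metis
    have "dist (fst (v m)) (fst (v n)) \<le> C * dist (X m) (X n)" for m n
      using C(2)[OF subspace_diff[OF subspace_H10 v(1) v(1)], of m n] by (simp add: dist_norm v(2))
    moreover have "Cauchy X" using X(2) by (rule LIMSEQ_imp_Cauchy)
    ultimately have "Cauchy (\<lambda>n. fst (v n))"
    proof -
      assume le: "\<And>m n. dist (fst (v m)) (fst (v n)) \<le> C * dist (X m) (X n)" and "Cauchy X"
      show ?thesis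
      proof (rule metric_CauchyI)
        fix e :: real assume e: "0 < e"
        \<comment> \<open>C may be 0, hence the division by C + 1.\<close>
        obtain N where N: "\<And>m n. m \<ge> N \<Longrightarrow> n \<ge> N \<Longrightarrow> dist (X m) (X n) < e / (C + 1)"
          using metric_CauchyD[OF \<open>Cauchy X\<close>, of "e / (C + 1)"] e C(1) by auto
        have "dist (fst (v m)) (fst (v n)) < e" if "m \<ge> N" "n \<ge> N" for m n
        proof -
          have "C * dist (X m) (X n) \<le> (C + 1) * dist (X m) (X n)" by (simp add: mult_right_mono)
          also have "\<dots> < e" using N[OF that] C(1) by (simp add: field_simps)
          finally show ?thesis using le[of m n] by simp
        qed
        then show "\<exists>M. \<forall>m\<ge>M. \<forall>n\<ge>M. dist (fst (v m)) (fst (v n)) < e" by blast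
      qed
    qed
    then obtain k where "(\<lambda>n. fst (v n)) \<longlonglongrightarrow> k" using Cauchy_convergent convergent_def by blast
    then have "(\<lambda>n. (fst (v n), snd (v n))) \<longlonglongrightarrow> (k, l)"
      using X(2) by (intro tendsto_Pair) (simp_all add: v(2)[symmetric])
    then have "(k, l) \<in> H10 D"
      using closed_sequentially[OF closed_H10, of v D "(k, l)"] v(1) by simp
    then show "l \<in> grads D" unfolding grads_def by force
  qed
qed

text \<open>Inverse of the gradient map on \<open>H10 D\<close>. Poincare makes it well defined and
  Lipschitz, which transfers convergence of gradients to the H1 norm.\<close>

definition potential :: "'a::euclidean_space set \<Rightarrow> ('a, 'a) L2 \<Rightarrow> 'a H1" where
  "potential D g = (THE v. v \<in> H10 D \<and> snd v = g)"

lemma potential_eqI: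
  assumes D: "bounded D" and v: "v \<in> H10 D"
  shows "potential D (snd v) = v"
  unfolding potential_def
proof (rule the_equality)
  fix w assume w: "w \<in> H10 D \<and> snd w = snd v"
  obtain C where C: "0 \<le> C" "\<And>v. v \<in> H10 D \<Longrightarrow> norm (fst v) \<le> C * norm (snd v)"
    using poincare_H10[OF D] by blast
  have "w - v \<in> H10 D" using w v by (intro subspace_diff subspace_H10) auto
  from C(2)[OF this] w have "fst w = fst v" by simp
  with w show "w = v" by (simp add: prod_eq_iff)
qed (use v in simp)

lemma
  assumes D: "bounded D" and g: "g \<in> grads D"
  shows potential_in_H10: "potential D g \<in> H10 D" and snd_potential: "snd (potential D g) = g"
proof -
  obtain v where "v \<in> H10 D" "g = snd v" using g unfolding grads_def by blast
  then show "potential D g \<in> H10 D" "snd (potential D g) = g" using potential_eqI[OF D] by auto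
qed

lemma norm_potential_diff_le:
  assumes D: "bounded D"
  obtains C where "0 \<le> C"
    "\<And>g h. g \<in> grads D \<Longrightarrow> h \<in> grads D \<Longrightarrow> norm (potential D g - potential D h) \<le> C * norm (g - h)"
proof -
  obtain C where C: "0 \<le> C" "\<And>v. v \<in> H10 D \<Longrightarrow> norm (fst v) \<le> C * norm (snd v)"
    using poincare_H10[OF D] by blast
  have "norm (potential D g - potential D h) \<le> (C + 1) * norm (g - h)" if "g \<in> grads D" "h \<in> grads D" for g h
  proof -
    let ?v = "potential D g - potential D h"
    have "?v \<in> H10 D" using that D by (intro subspace_diff subspace_H10 potential_in_H10)
    moreover have v: "snd ?v = g - h" using that D by (simp add: snd_potential)
    moreover have "norm ?v \<le> norm (fst ?v) + norm (snd ?v)"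
      by (metis norm_Pair_le prod.collapse)
    ultimately have "norm ?v \<le> C * norm (g - h) + norm (g - h)" using C(2)[of ?v] unfolding v by linarith
    then show ?thesis by (simp add: algebra_simps)
  qed
  then show ?thesis using that[of "C + 1"] C(1) by auto
qed

text \<open>Riesz representation in the space of gradients: f composed with
  \<open>potential D\<close> is linear there and bounded in the L2 norm, because f is bounded by
  \<open>V_norm\<close>.\<close>

lemma H_minus1_representation:
  assumes D: "bounded D" and f: "f \<in> H_minus1 D"
  obtains F where "\<And>v. v \<in> H10 D \<Longrightarrow> f v = F \<bullet> snd v"
proof -
  interpret closed_subspace "grads D" by (rule closed_subspace_grads[OF D])
  obtain C where C: "\<And>v. v \<in> H10 D \<Longrightarrow> \<bar>f v\<bar> \<le> C * V_norm v"
    using f unfolding H_minus1_def by blast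
  have lin: "v \<in> H10 D \<Longrightarrow> w \<in> H10 D \<Longrightarrow> f (v + w) = f v + f w" "v \<in> H10 D \<Longrightarrow> f (c *\<^sub>R v) = c * f v" for v w c
    using f unfolding H_minus1_def by blast+
  have pot: "potential D (g + h) = potential D g + potential D h"
    "potential D (r *\<^sub>R g) = r *\<^sub>R potential D g" if "g \<in> grads D" and "h \<in> grads D" for g h r
    using potential_eqI[OF D subspace_add[OF subspace_H10 potential_in_H10[OF D that(1)] potential_in_H10[OF D that(2)]]]
      potential_eqI[OF D subspace_scale[OF subspace_H10 potential_in_H10[OF D that(1)]]] that
    by (simp_all add: snd_potential[OF D])
  have "\<exists>w\<in>grads D. \<forall>g\<in>grads D. w \<bullet> g = f (potential D g)"
  proof (rule symmetric_lax_milgram[OF subspace_G closed_G bounded_bilinear_inner, where c = 1 and C = C])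
    show "\<bar>f (potential D g)\<bar> \<le> C * norm g" if "g \<in> grads D" for g
      using C[OF potential_in_H10[OF D that]] snd_potential[OF D that] by (simp add: V_norm_def)
  qed (auto simp: inner_commute power2_norm_eq_inner pot lin potential_in_H10[OF D])
  then obtain w where w: "\<And>g. g \<in> grads D \<Longrightarrow> w \<bullet> g = f (potential D g)" by blast
  have "f v = w \<bullet> snd v" if "v \<in> H10 D" for v
    using w[of "snd v"] that potential_eqI[OF D that] by (simp add: grads_def)
  then show ?thesis using that by blast
qed

section \<open>Convergence of the series and measurability of the solution map\<close>

lemma AE_lebesgue_on_iff: "D \<in> sets lebesgue \<Longrightarrow> (AE x in lebesgue_on D. P x) \<longleftrightarrow> (AE x in lebesgue. x \<in> D \<longrightarrow> P x)"
  by (simp add: AE_restrict_space_iff)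

lemma Linf_norm_le_iff:
  assumes "D \<in> sets lebesgue" "g \<in> borel_measurable (lebesgue_on D)" "0 \<le> e"
  shows "Linf_norm D g \<le> ennreal e \<longleftrightarrow> (AE x in lebesgue. x \<in> D \<longrightarrow> \<bar>g x\<bar> \<le> e)"
proof
  assume "Linf_norm D g \<le> ennreal e"
  moreover have "AE x in lebesgue_on D. ennreal \<bar>g x\<bar> \<le> Linf_norm D g"
    unfolding Linf_norm_def by (rule esssup_AE)
  ultimately have "AE x in lebesgue_on D. \<bar>g x\<bar> \<le> e"
    using assms(3) by (elim eventually_mono) (meson ennreal_le_iff order_trans)
  then show "AE x in lebesgue. x \<in> D \<longrightarrow> \<bar>g x\<bar> \<le> e"
    by (simp add: AE_lebesgue_on_iff assms(1))
next
  assume "AE x in lebesgue. x \<in> D \<longrightarrow> \<bar>g x\<bar> \<le> e"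
  then have "AE x in lebesgue_on D. ennreal \<bar>g x\<bar> \<le> ennreal e"
    using assms(3) by (simp add: AE_lebesgue_on_iff[OF assms(1)])
  then show "Linf_norm D g \<le> ennreal e"
    unfolding Linf_norm_def using assms(2) by (intro esssup_I) auto
qed

section \<open>Essentially uniform convergence and operators with exponential coefficients\<close>

definition ess_uniform_limit :: "(nat \<Rightarrow> 'a::euclidean_space \<Rightarrow> real) \<Rightarrow> ('a \<Rightarrow> real) \<Rightarrow> bool" where
  "ess_uniform_limit S b \<longleftrightarrow> (\<forall>e>0. \<exists>N. \<forall>n\<ge>N. AE x in lebesgue. \<bar>S n x - b x\<bar> \<le> e)"

text \<open>Tolerances 1 / Suc k keep the condition countable, both for collecting null sets in x
  and for measurability in y.\<close>

definition ess_uniformly_Cauchy :: "(nat \<Rightarrow> 'a::euclidean_space \<Rightarrow> real) \<Rightarrow> bool" where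
  "ess_uniformly_Cauchy S \<longleftrightarrow> (\<forall>k. \<exists>N. \<forall>m\<ge>N. \<forall>n\<ge>N. AE x in lebesgue. \<bar>S m x - S n x\<bar> \<le> 1 / Suc k)"

lemma abs_diff_le_halves: "\<bar>s - b\<bar> \<le> e / 2 \<Longrightarrow> \<bar>t - b\<bar> \<le> e / 2 \<Longrightarrow> \<bar>s - t\<bar> \<le> e" for s t b e :: real
  by linarith

lemma ess_uniform_limit_imp_Cauchy:
  assumes "ess_uniform_limit S b" shows "ess_uniformly_Cauchy S"
  unfolding ess_uniformly_Cauchy_def
proof
  fix k
  obtain N where N: "\<And>n. n \<ge> N \<Longrightarrow> AE x in lebesgue. \<bar>S n x - b x\<bar> \<le> 1 / Suc k / 2"
    using assms unfolding ess_uniform_limit_def by (metis divide_pos_pos of_nat_0_less_iff zero_less_Suc zero_less_numeral zero_less_one)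
  have "AE x in lebesgue. \<bar>S m x - S n x\<bar> \<le> 1 / Suc k" if "m \<ge> N" "n \<ge> N" for m n
    using N[OF that(1)] N[OF that(2)] by eventually_elim (rule abs_diff_le_halves)
  then show "\<exists>N. \<forall>m\<ge>N. \<forall>n\<ge>N. AE x in lebesgue. \<bar>S m x - S n x\<bar> \<le> 1 / Suc k" by blast
qed

lemma ess_uniformly_Cauchy_limit:
  assumes S: "\<And>n. ess_bounded (S n) (c n)" and "ess_uniformly_Cauchy S"
  obtains b d where "ess_bounded b d" "ess_uniform_limit S b"
proof -
  have "\<forall>k. \<exists>N. \<forall>m\<ge>N. \<forall>n\<ge>N. AE x in lebesgue. \<bar>S m x - S n x\<bar> \<le> 1 / Suc k"
    using assms(2) unfolding ess_uniformly_Cauchy_def .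
  then obtain N where N: "\<And>k m n. m \<ge> N k \<Longrightarrow> n \<ge> N k \<Longrightarrow> AE x in lebesgue. \<bar>S m x - S n x\<bar> \<le> 1 / Suc k"
    by metis
  \<comment> \<open>Countably many exceptional sets are merged into one null set, off which the
    sequence is uniformly Cauchy.\<close>
  have all: "AE x in lebesgue. \<forall>k m n. m \<ge> N k \<longrightarrow> n \<ge> N k \<longrightarrow> \<bar>S m x - S n x\<bar> \<le> 1 / Suc k"
    unfolding AE_all_countable by (intro allI AE_impI N)
  define b where "b x = lim (\<lambda>n. S n x)" for x
  have lim: "AE x in lebesgue. (\<lambda>n. S n x) \<longlonglongrightarrow> b x"
    using all
  proof eventually_elim
    case (elim x)
    have "Cauchy (\<lambda>n. S n x)"
    proof (rule CauchyI)
      fix e :: real assume "e > 0"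
      then obtain k where k: "1 / Suc k < e" using nat_approx_posE by blast
      have "norm (S m x - S n x) < e" if "m \<ge> N k" "n \<ge> N k" for m n
        using elim that k by (smt (verit) real_norm_def)
      then show "\<exists>M. \<forall>m\<ge>M. \<forall>n\<ge>M. norm (S m x - S n x) < e" by blast
    qed
    then show ?case unfolding b_def by (simp add: Cauchy_convergent_iff convergent_LIMSEQ_iff)
  qed
  have close: "AE x in lebesgue. \<bar>S n x - b x\<bar> \<le> 1 / Suc k" if "n \<ge> N k" for n k
    using all lim
  proof eventually_elim
    case (elim x)
    have "(\<lambda>m. \<bar>S n x - S m x\<bar>) \<longlonglongrightarrow> \<bar>S n x - b x\<bar>"
      using elim(2) by (intro tendsto_intros)
    then show ?case
      by (rule LIMSEQ_le_const2) (use elim(1) that in \<open>auto intro!: exI[of _ "N k"]\<close>)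
  qed
  have "ess_uniform_limit S b"
    unfolding ess_uniform_limit_def
  proof (intro allI impI)
    fix e :: real assume "e > 0"
    then obtain k where k: "1 / Suc k < e" using nat_approx_posE by blast
    show "\<exists>N. \<forall>n\<ge>N. AE x in lebesgue. \<bar>S n x - b x\<bar> \<le> e"
    proof (intro exI allI impI)
      fix n assume "n \<ge> N k"
      from close[OF this] show "AE x in lebesgue. \<bar>S n x - b x\<bar> \<le> e"
        by eventually_elim (use k in linarith)
    qed
  qed
  moreover have "ess_bounded b (c (N 0) + 1)"
    unfolding ess_bounded_def
  proof (intro conjI)
    have [measurable]: "S n \<in> borel_measurable lebesgue" for n using S by (rule ess_boundedD)
    show "b \<in> borel_measurable lebesgue" unfolding b_def by measurable
    show "0 \<le> c (N 0) + 1" using ess_boundedD(1)[OF S[of "N 0"]] by simp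
    show "AE x in lebesgue. \<bar>b x\<bar> \<le> c (N 0) + 1"
      using ess_boundedD(3)[OF S[of "N 0"]] close[of 0 "N 0", OF order_refl] by eventually_elim auto
  qed
  ultimately show ?thesis using that by blast
qed

lemma exp_diff_le: "\<bar>exp s - exp t\<bar> \<le> exp (max s t) * \<bar>s - t\<bar>" for s t :: real
proof -
  have *: "exp s - exp t \<le> exp s * (s - t)" for s t :: real
  proof -
    have "exp s * (1 + (t - s)) \<le> exp s * exp (t - s)" by (intro mult_left_mono exp_ge_add_one_self) auto
    also have "\<dots> = exp t" by (simp add: exp_add[symmetric])
    finally show ?thesis by (simp add: algebra_simps)
  qed
  show ?thesis
    by (cases s t rule: linorder_le_cases) (use *[of s t] *[of t s] in \<open>auto simp: max_def abs_real_def not_le\<close>)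
qed

lemma mult_L2_exp_tendsto:
  fixes b :: "'a::euclidean_space \<Rightarrow> real"
  assumes S: "\<And>n::nat. ess_bounded (S n) (c n)" and b: "ess_bounded b d" and lim: "ess_uniform_limit S b"
  shows "(\<lambda>n. mult_L2 (\<lambda>x. exp (S n x)) :: ('a, 'b::euclidean_space) L2 \<Rightarrow>\<^sub>L ('a, 'b) L2)
      \<longlonglongrightarrow> mult_L2 (\<lambda>x. exp (b x))"
proof (rule LIMSEQ_I)
  fix e :: real assume e: "e > 0"
  \<comment> \<open>The bound 1 keeps S n and b below d + 1, where exp has Lipschitz constant exp (d
    + 1); the factor 2 leaves a strict inequality at the end.\<close>
  define e' where "e' = min 1 (e / (2 * exp (d + 1)))"
  have e': "e' > 0" "e' \<le> 1" "exp (d + 1) * e' < e" using e by (auto simp: e'_def min_def field_simps)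
  obtain N where N: "\<And>n. n \<ge> N \<Longrightarrow> AE x in lebesgue. \<bar>S n x - b x\<bar> \<le> e'"
    using lim e'(1) unfolding ess_uniform_limit_def by blast
  show "\<exists>no. \<forall>n\<ge>no. norm (mult_L2 (\<lambda>x. exp (S n x)) - mult_L2 (\<lambda>x. exp (b x)) :: ('a, 'b) L2 \<Rightarrow>\<^sub>L ('a, 'b) L2) < e"
  proof (intro exI allI impI)
    fix n assume "n \<ge> N"
    have "ess_bounded (\<lambda>x. exp (S n x) - exp (b x)) (exp (d + 1) * e')"
      unfolding ess_bounded_def
    proof (intro conjI)
      show "(\<lambda>x. exp (S n x) - exp (b x)) \<in> borel_measurable lebesgue"
        using ess_boundedD(2)[OF S] ess_boundedD(2)[OF b] by measurable
      show "AE x in lebesgue. \<bar>exp (S n x) - exp (b x)\<bar> \<le> exp (d + 1) * e'"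
        using N[OF \<open>n \<ge> N\<close>] ess_boundedD(3)[OF b]
      proof eventually_elim
        case (elim x)
        have "\<bar>exp (S n x) - exp (b x)\<bar> \<le> exp (max (S n x) (b x)) * \<bar>S n x - b x\<bar>" by (rule exp_diff_le)
        also have "\<dots> \<le> exp (d + 1) * e'" using elim e'(2) by (intro mult_mono) auto
        finally show ?case .
      qed
    qed (use e' in auto)
    from norm_mult_L2_le[OF this] show "norm (mult_L2 (\<lambda>x. exp (S n x)) - mult_L2 (\<lambda>x. exp (b x)) :: ('a, 'b) L2 \<Rightarrow>\<^sub>L ('a, 'b) L2) < e"
      unfolding mult_L2_diff[OF ess_bounded_exp(1)[OF S] ess_bounded_exp(1)[OF b], symmetric]
      using e'(3) by (rule order_le_less_trans)
  qed
qed

lemma coercive_on_mult_L2_exp: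
  "ess_bounded b c \<Longrightarrow> coercive_on G (exp (- c)) (mult_L2 (\<lambda>x. exp (b x)))"
  using ess_bounded_exp by (intro coercive_on_mult_L2) auto

text \<open>Each \<open>S n\<close> may come with its own bound. Close to the limit they share d +
  1, which supplies the common coercivity constant required by \<open>solve_tendsto\<close>.\<close>

lemma ess_uniform_limit_bounded:
  assumes b: "ess_bounded b d" and S: "\<And>n. S n \<in> borel_measurable lebesgue" and lim: "ess_uniform_limit S b"
  shows "\<forall>\<^sub>F n in sequentially. ess_bounded (S n) (d + 1)"
proof -
  obtain N where N: "\<And>n. n \<ge> N \<Longrightarrow> AE x in lebesgue. \<bar>S n x - b x\<bar> \<le> 1"
    using lim unfolding ess_uniform_limit_def by (metis zero_less_one)
  show ?thesis unfolding eventually_sequentially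
  proof (intro exI allI impI)
    fix n assume "n \<ge> N"
    show "ess_bounded (S n) (d + 1)" unfolding ess_bounded_def
    proof (intro conjI)
      show "AE x in lebesgue. \<bar>S n x\<bar> \<le> d + 1"
        using N[OF \<open>n \<ge> N\<close>] ess_boundedD(3)[OF b] by eventually_elim auto
    qed (use S ess_boundedD(1)[OF b] in auto)
  qed
qed

text \<open>\<open>\<Psi> j\<close> is \<open>\<psi> j\<close> corrected on a null set and extended
  by zero, so that multiplication operators act on L2 of the whole space. The vector F represents f
  on gradients.\<close>

locale diffusion_problem =
  fixes D :: "'a::euclidean_space set" and \<psi> \<Psi> :: "nat \<Rightarrow> 'a \<Rightarrow> real" and c :: "nat \<Rightarrow> real"
    and f :: "'a H1 \<Rightarrow> real" and F :: "('a, 'a) L2"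
  assumes open_D: "open D" and bounded_D: "bounded D"
    and psi_measurable: "\<And>j. \<psi> j \<in> borel_measurable (lebesgue_on D)"
    and Psi_bounded: "\<And>j. ess_bounded (\<Psi> j) (c j)"
    and Psi_eq: "\<And>j. AE x in lebesgue. x \<in> D \<longrightarrow> \<Psi> j x = \<psi> j x"
    and Psi_outside: "\<And>j x. x \<notin> D \<Longrightarrow> \<Psi> j x = 0"
    and f_eq: "\<And>v. v \<in> H10 D \<Longrightarrow> f v = F \<bullet> snd v"
begin

sublocale closed_subspace "grads D"
  by (rule closed_subspace_grads[OF bounded_D])

lemma D_measurable: "D \<in> sets lebesgue"
  using open_D by simp

definition partial :: "(nat \<Rightarrow> real) \<Rightarrow> nat \<Rightarrow> 'a \<Rightarrow> real" where
  "partial y n x = (\<Sum>j<n. y j * \<Psi> j x)"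

definition sol :: "('a \<Rightarrow> real) \<Rightarrow> ('a, 'a) L2" where
  "sol b = solve (grads D) (mult_L2 (\<lambda>x. exp (b x))) F"

lemma ess_bounded_sum: "finite J \<Longrightarrow> ess_bounded (\<lambda>x. \<Sum>j\<in>J. z j * \<Psi> j x) (\<Sum>j\<in>J. \<bar>z j\<bar> * c j)"
  by (induction J rule: finite_induct)
     (use ess_bounded_const[of 0] in \<open>simp_all add: ess_bounded_add[OF ess_bounded_cmult[OF Psi_bounded]]\<close>)

lemma partial_bounded: "ess_bounded (partial y n) (\<Sum>j<n. \<bar>y j\<bar> * c j)"
  unfolding partial_def[abs_def] by (rule ess_bounded_sum) simp

lemma sol_in_grads: "ess_bounded b d \<Longrightarrow> sol b \<in> grads D"
  unfolding sol_def by (rule solve_in_G[OF coercive_on_mult_L2_exp])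

lemma sol_tendsto:
  assumes S: "\<And>n::nat. ess_bounded (S n) (e n)" and b: "ess_bounded b d" and lim: "ess_uniform_limit S b"
  shows "(\<lambda>n. sol (S n)) \<longlonglongrightarrow> sol b"
  unfolding sol_def
proof (intro bounded_bilinear.tendsto[OF bounded_bilinear_blinfun_apply] tendsto_const solve_tendsto)
  show "\<forall>\<^sub>F n in sequentially. coercive_on (grads D) (exp (- (d + 1))) (mult_L2 (\<lambda>x. exp (S n x)))"
    using ess_uniform_limit_bounded[OF b ess_boundedD(2)[OF S] lim]
    by eventually_elim (rule coercive_on_mult_L2_exp)
  show "coercive_on (grads D) (exp (- d)) (mult_L2 (\<lambda>x. exp (b x)))"
    by (rule coercive_on_mult_L2_exp[OF b])
qed (rule mult_L2_exp_tendsto[OF S b lim])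

lemma potential_tendsto:
  assumes "\<And>n. g n \<in> grads D" "h \<in> grads D" "(g \<longlongrightarrow> h) T"
  shows "((\<lambda>n. potential D (g n)) \<longlongrightarrow> potential D h) T"
proof -
  obtain C where C: "0 \<le> C"
    "\<And>g h. g \<in> grads D \<Longrightarrow> h \<in> grads D \<Longrightarrow> norm (potential D g - potential D h) \<le> C * norm (g - h)"
    using norm_potential_diff_le[OF bounded_D] by blast
  show ?thesis
  proof (rule LIM_zero_cancel, rule tendsto_0_le[where K = C])
    show "((\<lambda>n. norm (g n - h)) \<longlongrightarrow> 0) T" using assms(3) by (simp add: LIM_zero tendsto_norm_zero)
    show "\<forall>\<^sub>F n in T. norm (potential D (g n) - potential D h) \<le> norm (norm (g n - h)) * C"
      using C(2)[OF assms(1,2)] by (simp add: mult.commute)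
  qed
qed

text \<open>Gradients from \<open>H10 D\<close> vanish outside D, so the values of B there do not
  affect the integrals, and the weak problem on D becomes the operator equation on
  \<open>grads D\<close>.\<close>

lemma weak_solution_iff:
  assumes B: "ess_bounded B d" "AE x in lebesgue. x \<in> D \<longrightarrow> B x = b x"
    and b: "b \<in> borel_measurable (lebesgue_on D)"
  shows "weak_solution D (\<lambda>x. exp (b x)) f w \<longleftrightarrow> w = potential D (sol B)"
proof -
  note eB = ess_bounded_exp(1)[OF B(1)]
  have eq: "(LINT x:D|lebesgue. exp (b x) * (rep_L2 (snd w) x \<bullet> rep_L2 (snd v) x)) = mult_L2 (\<lambda>x. exp (B x)) (snd w) \<bullet> snd v"
    if w: "w \<in> H10 D" for v w
  proof -
    have m: "(\<lambda>x. rep_L2 (snd w) x \<bullet> rep_L2 (snd v) x) \<in> borel_measurable lebesgue"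
      by (intro borel_measurable_inner sq_intD sq_int_rep_L2)
    then have "(\<lambda>x. exp (b x) * (rep_L2 (snd w) x \<bullet> rep_L2 (snd v) x)) \<in> borel_measurable (lebesgue_on D)"
      using b measurable_restrict_space1[OF m, of D] by measurable
    then have mb: "(\<lambda>x. indicator D x *\<^sub>R (exp (b x) * (rep_L2 (snd w) x \<bullet> rep_L2 (snd v) x))) \<in> borel_measurable lebesgue"
      using D_measurable by (subst borel_measurable_restrict_space_iff[symmetric]) auto
    have "AE x in lebesgue. indicator D x *\<^sub>R (exp (b x) * (rep_L2 (snd w) x \<bullet> rep_L2 (snd v) x))
        = exp (B x) * (rep_L2 (snd w) x \<bullet> rep_L2 (snd v) x)"
      using B(2) H10_gradient_vanishes_outside[OF open_D w]
      by eventually_elim (auto simp: indicator_def)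
    then show ?thesis
      unfolding inner_mult_L2[OF eB] set_lebesgue_integral_def
      by (intro integral_cong_AE mb borel_measurable_times ess_boundedD(2)[OF eB] m)
  qed
  have A: "coercive_on (grads D) (exp (- d)) (mult_L2 (\<lambda>x. exp (B x)))"
    by (rule coercive_on_mult_L2_exp[OF B(1)])
  have "weak_solution D (\<lambda>x. exp (b x)) f w \<longleftrightarrow>
      w \<in> H10 D \<and> (\<forall>v\<in>H10 D. mult_L2 (\<lambda>x. exp (B x)) (snd w) \<bullet> snd v = F \<bullet> snd v)"
    unfolding weak_solution_def by (intro conj_cong refl ball_cong) (simp add: eq f_eq)
  also have "\<dots> \<longleftrightarrow> w \<in> H10 D \<and> solves (grads D) (mult_L2 (\<lambda>x. exp (B x))) F (snd w)"
    unfolding solves_def grads_def by blast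
  also have "\<dots> \<longleftrightarrow> w \<in> H10 D \<and> snd w = sol B"
    unfolding sol_def using solves_solve[OF A, of F] solve_eqI[OF A, of F "snd w"] by auto
  also have "\<dots> \<longleftrightarrow> w = potential D (sol B)"
    using potential_eqI[OF bounded_D] potential_in_H10[OF bounded_D sol_in_grads[OF B(1)]]
      snd_potential[OF bounded_D sol_in_grads[OF B(1)]] by metis
  finally show ?thesis .
qed

lemma partial_eq: "AE x in lebesgue. x \<in> D \<longrightarrow> (\<forall>n. (\<Sum>j<n. y j * \<psi> j x) = partial y n x)"
proof -
  have "AE x in lebesgue. \<forall>j. x \<in> D \<longrightarrow> \<Psi> j x = \<psi> j x"
    unfolding AE_all_countable using Psi_eq by blast
  then show ?thesis by eventually_elim (auto simp: partial_def)
qed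

lemma measurable_lebesgue_on: "g \<in> borel_measurable lebesgue \<Longrightarrow> g \<in> borel_measurable (lebesgue_on D)"
  by (rule measurable_restrict_space1)

lemma Linf_sums_iff:
  "Linf_sums D (\<lambda>j x. y j * \<psi> j x) b \<longleftrightarrow>
     b \<in> Linf D \<and> ess_uniform_limit (partial y) (\<lambda>x. indicator D x * b x)"
proof -
  have "(\<lambda>n. Linf_norm D (\<lambda>x. (\<Sum>j<n. y j * \<psi> j x) - b x)) \<longlonglongrightarrow> 0
      \<longleftrightarrow> ess_uniform_limit (partial y) (\<lambda>x. indicator D x * b x)" if b: "b \<in> borel_measurable (lebesgue_on D)"
  proof -
    have le: "Linf_norm D (\<lambda>x. (\<Sum>j<n. y j * \<psi> j x) - b x) \<le> ennreal e
        \<longleftrightarrow> (AE x in lebesgue. \<bar>partial y n x - indicator D x * b x\<bar> \<le> e)" if "0 \<le> e" for n e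
    proof -
      have "(\<lambda>x. (\<Sum>j<n. y j * \<psi> j x) - b x) \<in> borel_measurable (lebesgue_on D)"
        using b psi_measurable by measurable
      then have "Linf_norm D (\<lambda>x. (\<Sum>j<n. y j * \<psi> j x) - b x) \<le> ennreal e
          \<longleftrightarrow> (AE x in lebesgue. x \<in> D \<longrightarrow> \<bar>(\<Sum>j<n. y j * \<psi> j x) - b x\<bar> \<le> e)"
        by (rule Linf_norm_le_iff[OF D_measurable _ that])
      also have "\<dots> \<longleftrightarrow> (AE x in lebesgue. \<bar>partial y n x - indicator D x * b x\<bar> \<le> e)"
      proof
        assume "AE x in lebesgue. x \<in> D \<longrightarrow> \<bar>(\<Sum>j<n. y j * \<psi> j x) - b x\<bar> \<le> e"
        then show "AE x in lebesgue. \<bar>partial y n x - indicator D x * b x\<bar> \<le> e"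
          using partial_eq[of y]
        proof eventually_elim
          case (elim x)
          then show ?case using \<open>0 \<le> e\<close> by (cases "x \<in> D") (auto simp: partial_def Psi_outside)
        qed
      next
        assume "AE x in lebesgue. \<bar>partial y n x - indicator D x * b x\<bar> \<le> e"
        then show "AE x in lebesgue. x \<in> D \<longrightarrow> \<bar>(\<Sum>j<n. y j * \<psi> j x) - b x\<bar> \<le> e"
          using partial_eq[of y] by eventually_elim auto
      qed
      finally show ?thesis .
    qed
    show ?thesis
    proof
      assume lim: "(\<lambda>n. Linf_norm D (\<lambda>x. (\<Sum>j<n. y j * \<psi> j x) - b x)) \<longlonglongrightarrow> 0"
      show "ess_uniform_limit (partial y) (\<lambda>x. indicator D x * b x)"
        unfolding ess_uniform_limit_def
      proof (intro allI impI)
        fix e :: real assume e: "e > 0"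
        then obtain N where "\<And>n. n \<ge> N \<Longrightarrow> Linf_norm D (\<lambda>x. (\<Sum>j<n. y j * \<psi> j x) - b x) < ennreal e"
          using order_tendstoD(2)[OF lim, of "ennreal e"] by (auto simp: eventually_sequentially)
        then show "\<exists>N. \<forall>n\<ge>N. AE x in lebesgue. \<bar>partial y n x - indicator D x * b x\<bar> \<le> e"
          using le[of e] e by (intro exI[of _ N]) (auto intro: less_imp_le)
      qed
    next
      assume lim: "ess_uniform_limit (partial y) (\<lambda>x. indicator D x * b x)"
      show "(\<lambda>n. Linf_norm D (\<lambda>x. (\<Sum>j<n. y j * \<psi> j x) - b x)) \<longlonglongrightarrow> 0"
      proof (rule order_tendstoI)
        fix a :: ennreal assume "0 < a"
        then obtain z where z: "0 < z" "z < a" using dense by blast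
        then have "z \<noteq> top" by (metis not_top_less)
        then obtain r where r: "z = ennreal r" "0 < r"
          using z(1) by (cases z) auto
        then obtain N where "\<And>n. n \<ge> N \<Longrightarrow> AE x in lebesgue. \<bar>partial y n x - indicator D x * b x\<bar> \<le> r"
          using lim unfolding ess_uniform_limit_def by blast
        then have "\<And>n. n \<ge> N \<Longrightarrow> Linf_norm D (\<lambda>x. (\<Sum>j<n. y j * \<psi> j x) - b x) \<le> z"
          using le[of r] r by auto
        then show "\<forall>\<^sub>F n in sequentially. Linf_norm D (\<lambda>x. (\<Sum>j<n. y j * \<psi> j x) - b x) < a"
          using z(2) unfolding eventually_sequentially by (meson order_le_less_trans)
      qed simp
    qed
  qed
  then show ?thesis unfolding Linf_sums_def Linf_def by blast
qed

lemma Linf_bounded: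
  assumes "b \<in> Linf D"
  obtains d where "ess_bounded (\<lambda>x. indicator D x * b x) d"
proof -
  have m: "b \<in> borel_measurable (lebesgue_on D)" "Linf_norm D b < \<infinity>" using assms by (auto simp: Linf_def)
  then obtain d where d: "Linf_norm D b = ennreal d" "0 \<le> d"
    by (cases "Linf_norm D b") auto
  have "AE x in lebesgue. x \<in> D \<longrightarrow> \<bar>b x\<bar> \<le> d"
    using Linf_norm_le_iff[OF D_measurable m(1) d(2)] d(1) by simp
  moreover have "(\<lambda>x. indicator D x * b x) \<in> borel_measurable lebesgue"
    using m(1) D_measurable borel_measurable_restrict_space_iff[of D lebesgue b] by simp
  ultimately have "ess_bounded (\<lambda>x. indicator D x * b x) d"
    using d(2) by (auto simp: ess_bounded_def indicator_def elim!: eventually_mono)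
  then show ?thesis by (rule that)
qed

lemma ess_uniform_limit_unique:
  assumes "ess_uniform_limit S b" "ess_uniform_limit S b'"
  shows "AE x in lebesgue. b x = b' x"
proof -
  have "AE x in lebesgue. \<forall>k. \<bar>b x - b' x\<bar> \<le> 1 / Suc k"
    unfolding AE_all_countable
  proof
    fix k
    have pos: "0 < 1 / real (Suc k) / 2" by simp
    obtain N N' where "\<And>n. n \<ge> N \<Longrightarrow> AE x in lebesgue. \<bar>S n x - b x\<bar> \<le> 1 / Suc k / 2"
      "\<And>n. n \<ge> N' \<Longrightarrow> AE x in lebesgue. \<bar>S n x - b' x\<bar> \<le> 1 / Suc k / 2"
      using assms pos unfolding ess_uniform_limit_def by meson
    from this(1)[of "max N N'"] this(2)[of "max N N'"]
    have "AE x in lebesgue. \<bar>S (max N N') x - b x\<bar> \<le> 1 / Suc k / 2" "AE x in lebesgue. \<bar>S (max N N') x - b' x\<bar> \<le> 1 / Suc k / 2"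
      by auto
    then show "AE x in lebesgue. \<bar>b x - b' x\<bar> \<le> 1 / Suc k"
      unfolding abs_minus_commute[of "S _ _"] by eventually_elim (rule abs_diff_le_halves)
  qed
  then show ?thesis
  proof eventually_elim
    case (elim x)
    show ?case
    proof (rule ccontr)
      assume "b x \<noteq> b' x"
      then obtain k where "1 / Suc k < \<bar>b x - b' x\<bar>" using nat_approx_posE[of "\<bar>b x - b' x\<bar>"] by auto
      with elim show False by (meson not_le)
    qed
  qed
qed

text \<open>\<open>log_field\<close> selects some limit of the series. Limits are unique almost
  everywhere on D, so the selected one defines the same weak problem as b.\<close>

lemma
  assumes b: "ess_bounded b d" and lim: "ess_uniform_limit (partial y) b"
  shows log_field_convergesI: "log_field_converges D \<psi> y"
    and unique_weak_solution: "\<exists>!w. weak_solution D (diffusion D \<psi> y) f w"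
    and solution_eq: "solution D \<psi> f y = potential D (sol b)"
proof -
  have "AE x in lebesgue. x \<in> D \<longrightarrow> \<bar>b x\<bar> \<le> d"
    using ess_boundedD(3)[OF b] by (auto elim: eventually_mono)
  then have "Linf_norm D b \<le> ennreal d"
    using Linf_norm_le_iff[OF D_measurable measurable_lebesgue_on[OF ess_boundedD(2)[OF b]] ess_boundedD(1)[OF b]] by blast
  then have bL: "b \<in> Linf D"
    using measurable_lebesgue_on[OF ess_boundedD(2)[OF b]] by (auto simp: Linf_def ennreal_less_top intro: order_le_less_trans)
  have "ess_uniform_limit (partial y) (\<lambda>x. indicator D x * b x)"
    unfolding ess_uniform_limit_def
  proof (intro allI impI)
    fix e :: real assume "e > 0"
    then obtain N where N: "\<And>n. n \<ge> N \<Longrightarrow> AE x in lebesgue. \<bar>partial y n x - b x\<bar> \<le> e"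
      using lim unfolding ess_uniform_limit_def by blast
    have "AE x in lebesgue. \<bar>partial y n x - indicator D x * b x\<bar> \<le> e" if "n \<ge> N" for n
      using N[OF that]
    proof eventually_elim
      case (elim x)
      then show ?case using \<open>e > 0\<close> by (cases "x \<in> D") (auto simp: partial_def Psi_outside)
    qed
    then show "\<exists>N. \<forall>n\<ge>N. AE x in lebesgue. \<bar>partial y n x - indicator D x * b x\<bar> \<le> e" by blast
  qed
  then have ex: "Linf_sums D (\<lambda>j x. y j * \<psi> j x) b" using bL by (simp add: Linf_sums_iff)
  then show conv: "log_field_converges D \<psi> y" unfolding log_field_converges_def by blast
  have l: "Linf_sums D (\<lambda>j x. y j * \<psi> j x) (log_field D \<psi> y)"
    unfolding log_field_def by (rule someI[of _ b]) (rule ex)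
  then have "AE x in lebesgue. b x = indicator D x * log_field D \<psi> y x"
    using ess_uniform_limit_unique[OF lim] by (simp add: Linf_sums_iff)
  then have eq: "AE x in lebesgue. x \<in> D \<longrightarrow> b x = log_field D \<psi> y x"
    by (auto elim: eventually_mono)
  have lm: "log_field D \<psi> y \<in> borel_measurable (lebesgue_on D)"
    using l by (simp add: Linf_sums_def Linf_def)
  have iff: "weak_solution D (diffusion D \<psi> y) f w \<longleftrightarrow> w = potential D (sol b)" for w
    using weak_solution_iff[OF b eq lm, of w] by (simp add: diffusion_def[abs_def])
  then show "\<exists>!w. weak_solution D (diffusion D \<psi> y) f w" by simp
  show "solution D \<psi> f y = potential D (sol b)"
    unfolding solution_def if_P[OF conv] by (rule the_equality) (simp_all add: iff)
qed

lemma log_field_converges_limit: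
  assumes "log_field_converges D \<psi> y"
  obtains b d where "ess_bounded b d" "ess_uniform_limit (partial y) b"
proof -
  obtain l where l: "l \<in> Linf D" "ess_uniform_limit (partial y) (\<lambda>x. indicator D x * l x)"
    using assms unfolding log_field_converges_def Linf_sums_iff by blast
  from Linf_bounded[OF l(1)] l(2) show ?thesis using that by blast
qed

text \<open>Completeness removes the unknown limit from the convergence condition, which makes its
  measurability in y accessible.\<close>

lemma log_field_converges_iff: "log_field_converges D \<psi> y \<longleftrightarrow> ess_uniformly_Cauchy (partial y)"
proof
  assume "log_field_converges D \<psi> y"
  then obtain b d where "ess_bounded b d" "ess_uniform_limit (partial y) b"
    by (rule log_field_converges_limit)
  then show "ess_uniformly_Cauchy (partial y)" by (intro ess_uniform_limit_imp_Cauchy)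
next
  assume "ess_uniformly_Cauchy (partial y)"
  then obtain b d where "ess_bounded b d" "ess_uniform_limit (partial y) b"
    by (rule ess_uniformly_Cauchy_limit[OF partial_bounded])
  then show "log_field_converges D \<psi> y" by (rule log_field_convergesI)
qed

lemma tendsto_coordinate:
  fixes Y :: "nat \<Rightarrow> 'k \<Rightarrow> real"
  assumes "Y \<longlonglongrightarrow> y" shows "(\<lambda>n. Y n j) \<longlonglongrightarrow> y j"
  using continuous_on_tendsto_compose[OF continuous_on_product_coordinates assms] by simp

text \<open>At fixed x only finitely many coordinates of y enter, and continuously; along a
  convergent sequence of y the exceptional sets in x are countably many.\<close>

lemma closed_partial_close: "closed {y. AE x in lebesgue. \<bar>partial y m x - partial y n x\<bar> \<le> e}"
  unfolding closed_sequential_limits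
proof (intro allI impI, elim conjE)
  fix Y y assume Y: "\<forall>k. Y k \<in> {y. AE x in lebesgue. \<bar>partial y m x - partial y n x\<bar> \<le> e}" "Y \<longlonglongrightarrow> y"
  have "AE x in lebesgue. \<forall>k. \<bar>partial (Y k) m x - partial (Y k) n x\<bar> \<le> e"
    using Y(1) by (simp add: AE_all_countable)
  then have "AE x in lebesgue. \<bar>partial y m x - partial y n x\<bar> \<le> e"
  proof eventually_elim
    case (elim x)
    have "(\<lambda>k. \<bar>partial (Y k) m x - partial (Y k) n x\<bar>) \<longlonglongrightarrow> \<bar>partial y m x - partial y n x\<bar>"
      unfolding partial_def by (intro tendsto_intros tendsto_coordinate Y(2))
    then show ?case by (rule LIMSEQ_le_const2) (use elim in auto)
  qed
  then show "y \<in> {y. AE x in lebesgue. \<bar>partial y m x - partial y n x\<bar> \<le> e}" by simp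
qed

lemma converges_measurable: "{y. log_field_converges D \<psi> y} \<in> sets borel"
proof -
  have "{y. log_field_converges D \<psi> y} =
      (\<Inter>k. \<Union>N. \<Inter>m\<in>{N..}. \<Inter>n\<in>{N..}. {y. AE x in lebesgue. \<bar>partial y m x - partial y n x\<bar> \<le> 1 / Suc k})"
    unfolding log_field_converges_iff ess_uniformly_Cauchy_def set_eq_iff
    by (simp only: mem_Collect_eq INT_iff UN_iff Ball_def Bex_def atLeast_iff UNIV_I simp_thms)
  also have "\<dots> \<in> sets borel"
    by (intro sets.countable_INT'' sets.countable_UN'' sets.countable_INT' borel_closed closed_partial_close) auto
  finally show ?thesis .
qed

lemma continuous_sol_partial: "continuous_on UNIV (\<lambda>y. potential D (sol (partial y n)))"
proof (rule continuous_on_sequentiallyI)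
  fix Y :: "nat \<Rightarrow> nat \<Rightarrow> real" and y assume Y: "Y \<longlonglongrightarrow> y"
  have "ess_uniform_limit (\<lambda>k. partial (Y k) n) (partial y n)"
    unfolding ess_uniform_limit_def
  proof (intro allI impI)
    fix e :: real assume "e > 0"
    have "(\<lambda>k. \<Sum>j<n. \<bar>Y k j - y j\<bar> * c j) \<longlonglongrightarrow> (\<Sum>j<n. \<bar>y j - y j\<bar> * c j)"
      by (intro tendsto_intros tendsto_coordinate Y)
    then have "\<forall>\<^sub>F k in sequentially. (\<Sum>j<n. \<bar>Y k j - y j\<bar> * c j) < e"
      using \<open>e > 0\<close> by (intro order_tendstoD) auto
    then obtain N where N: "\<And>k. k \<ge> N \<Longrightarrow> (\<Sum>j<n. \<bar>Y k j - y j\<bar> * c j) < e"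
      unfolding eventually_sequentially by blast
    have close: "AE x in lebesgue. \<bar>partial (Y k) n x - partial y n x\<bar> \<le> (\<Sum>j<n. \<bar>Y k j - y j\<bar> * c j)" for k
      using ess_boundedD(3)[OF ess_bounded_sum[of "{..<n}" "\<lambda>j. Y k j - y j"]]
      by (simp add: partial_def sum_subtractf left_diff_distrib)
    have "AE x in lebesgue. \<bar>partial (Y k) n x - partial y n x\<bar> \<le> e" if "k \<ge> N" for k
      using close[of k] by eventually_elim (use N[OF that] in linarith)
    then show "\<exists>N. \<forall>k\<ge>N. AE x in lebesgue. \<bar>partial (Y k) n x - partial y n x\<bar> \<le> e" by blast
  qed
  then show "(\<lambda>k. potential D (sol (partial (Y k) n))) \<longlonglongrightarrow> potential D (sol (partial y n))"
  proof -
    assume lim: "ess_uniform_limit (\<lambda>k. partial (Y k) n) (partial y n)"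
    show ?thesis
      using sol_in_grads[OF partial_bounded] sol_in_grads[OF partial_bounded]
        sol_tendsto[OF partial_bounded partial_bounded lim]
      by (rule potential_tendsto)
  qed
qed

text \<open>On the Borel set where the series converges, the solution is the pointwise limit of the
  continuous maps built from the partial sums; elsewhere it has the constant dummy value.\<close>

lemma solution_measurable: "solution D \<psi> f \<in> borel_measurable borel"
proof (rule borel_measurable_LIMSEQ_metric)
  let ?g = "\<lambda>n y. if log_field_converges D \<psi> y then potential D (sol (partial y n)) else 0"
  show "?g n \<in> borel_measurable borel" for n
  proof (rule measurable_If)
    show "(\<lambda>y. potential D (sol (partial y n))) \<in> borel_measurable borel"
      by (rule borel_measurable_continuous_onI[OF continuous_sol_partial])
  qed (use converges_measurable in auto)
  fix y
  show "(\<lambda>n. ?g n y) \<longlonglongrightarrow> solution D \<psi> f y"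
  proof (cases "log_field_converges D \<psi> y")
    case True
    then obtain b d where b: "ess_bounded b d" "ess_uniform_limit (partial y) b"
      by (rule log_field_converges_limit)
    have "(\<lambda>n. potential D (sol (partial y n))) \<longlonglongrightarrow> potential D (sol b)"
      using sol_in_grads[OF partial_bounded] sol_in_grads[OF b(1)] sol_tendsto[OF partial_bounded b]
      by (rule potential_tendsto)
    then show ?thesis using True by (simp add: solution_eq[OF b])
  qed (simp add: solution_def)
qed

end

section \<open>The standard Gaussian measure on the line and Hermite polynomials\<close>

abbreviation gaussian :: "real measure" where
  "gaussian \<equiv> density lborel (\<lambda>x. ennreal (std_normal_density x))"

lemma prob_space_gaussian: "prob_space gaussian"
  by (rule prob_space_normal_density) simp

text \<open>Completing the square: an exponential tilt of the standard Gaussian is a multiple of the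
  Gaussian shifted by k.\<close>

lemma std_normal_density_exp: "std_normal_density t * exp (k * t) = exp (k\<^sup>2 / 2) * normal_density k 1 t"
proof -
  have "- (t\<^sup>2 / 2) + k * t = k\<^sup>2 / 2 + - ((t - k)\<^sup>2 / 2)"
    by (simp add: power2_eq_square field_simps)
  then show ?thesis
    by (simp add: normal_density_def exp_add[symmetric])
qed

lemma integrable_std_normal_density_exp_abs:
  "integrable lborel (\<lambda>t. std_normal_density t * exp (k * \<bar>t\<bar>))"
proof (rule Bochner_Integration.integrable_bound)
  show "integrable lborel (\<lambda>t. std_normal_density t * exp (k * t) + std_normal_density t * exp ((- k) * t))"
    unfolding std_normal_density_exp by simp
  show "AE t in lborel. norm (std_normal_density t * exp (k * \<bar>t\<bar>))
      \<le> norm (std_normal_density t * exp (k * t) + std_normal_density t * exp ((- k) * t))"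
  proof (rule AE_I2)
    fix t
    have "exp (k * \<bar>t\<bar>) \<le> exp (k * t) + exp ((- k) * t)"
      by (cases "0 \<le> t") (auto simp: abs_if)
    then have "std_normal_density t * exp (k * \<bar>t\<bar>) \<le> std_normal_density t * (exp (k * t) + exp ((- k) * t))"
      by (rule mult_left_mono) simp
    then show "norm (std_normal_density t * exp (k * \<bar>t\<bar>))
      \<le> norm (std_normal_density t * exp (k * t) + std_normal_density t * exp ((- k) * t))"
      unfolding distrib_left real_norm_def by (subst abs_of_nonneg) auto
  qed
qed simp

lemma integrable_gaussian_exp_abs: "integrable gaussian (\<lambda>t. exp (k * \<bar>t\<bar>))"
  using integrable_std_normal_density_exp_abs[of k]
  by (subst integrable_real_density) auto

lemma integral_gaussian: "f \<in> borel_measurable borel \<Longrightarrow>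
    (LINT t|gaussian. f t) = (LINT t|lborel. std_normal_density t * f t :: real)"
  by (subst integral_real_density) auto

lemma gaussian_tail_vanishes:
  fixes k :: real
  shows "((\<lambda>t. exp (k * \<bar>t\<bar>) * std_normal_density t) \<longlongrightarrow> 0) at_top"
    and "((\<lambda>t. exp (k * \<bar>t\<bar>) * std_normal_density t) \<longlongrightarrow> 0) at_bot"
proof -
  have "((\<lambda>t. exp (k\<^sup>2 / 2) * normal_density k 1 t) \<longlongrightarrow> 0) at_top"
    unfolding normal_density_def by real_asymp
  then show t: "((\<lambda>t. exp (k * \<bar>t\<bar>) * std_normal_density t) \<longlongrightarrow> 0) at_top"
    by (rule Lim_transform_eventually)
       (use eventually_ge_at_top[of 0] in eventually_elim, simp add: std_normal_density_exp[symmetric])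
  show "((\<lambda>t. exp (k * \<bar>t\<bar>) * std_normal_density t) \<longlongrightarrow> 0) at_bot"
    using t unfolding filterlim_at_bot_mirror by (simp add: normal_density_def)
qed

lemma std_normal_density_has_real_derivative:
  "(std_normal_density has_real_derivative - t * std_normal_density t) (at t)"
  unfolding normal_density_def by (auto intro!: derivative_eq_intros simp: field_simps)

lemma gaussian_integration_by_parts:
  fixes g g' :: "real \<Rightarrow> real"
  assumes der: "\<And>t. (g has_real_derivative g' t) (at t)" and cont: "continuous_on UNIV g'"
    and bound: "\<And>t. \<bar>g t\<bar> \<le> C * exp (k * \<bar>t\<bar>)" "\<And>t. \<bar>g' t\<bar> \<le> C * exp (k * \<bar>t\<bar>)"
  shows "(LINT t|gaussian. g' t - t * g t) = 0"
proof -
  let ?\<phi> = std_normal_density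
  let ?F = "\<lambda>t. g t * ?\<phi> t" and ?f = "\<lambda>t. ?\<phi> t * (g' t - t * g t)"
  have g: "continuous_on UNIV g"
    using der by (intro continuous_at_imp_continuous_on) (auto intro: DERIV_isCont)
  have [measurable]: "g \<in> borel_measurable borel" "g' \<in> borel_measurable borel"
    using g cont by (auto intro: borel_measurable_continuous_onI)
  have C: "0 \<le> C" using bound(1)[of 0] by simp
  \<comment> \<open>The integrand is the derivative of g times the density, and both boundary values
    vanish by the exponential bound on g.\<close>
  have "(LBINT t=-\<infinity>..\<infinity>. ?f t) = 0 - 0"
  proof (rule interval_integral_FTC_integrable[where F = ?F])
    show "(?F has_vector_derivative ?f t) (at t)" for t
      unfolding has_real_derivative_iff_has_vector_derivative[symmetric]
      by (auto intro!: derivative_eq_intros der std_normal_density_has_real_derivative simp: algebra_simps)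
    show "isCont ?f t" for t
    proof -
      have "continuous_on UNIV ?f"
        unfolding normal_density_def by (intro continuous_intros g cont) auto
      then show ?thesis by (simp add: continuous_on_eq_continuous_at)
    qed
    have "integrable lborel ?f"
    proof (rule Bochner_Integration.integrable_bound)
      \<comment> \<open>The rate grows from k to k + 1 because |t| \<le> exp |t| absorbs the factor
        t.\<close>
      show "integrable lborel (\<lambda>t. C * (?\<phi> t * exp ((k + 1) * \<bar>t\<bar>)) + C * (?\<phi> t * exp ((k + 1) * \<bar>t\<bar>)))"
        by (intro Bochner_Integration.integrable_add integrable_mult_right integrable_std_normal_density_exp_abs)
      show "AE t in lborel. norm (?f t)
          \<le> norm (C * (?\<phi> t * exp ((k + 1) * \<bar>t\<bar>)) + C * (?\<phi> t * exp ((k + 1) * \<bar>t\<bar>)))"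
      proof (rule AE_I2)
        fix t
        have e: "exp (k * \<bar>t\<bar>) \<le> exp ((k + 1) * \<bar>t\<bar>)" by (simp add: algebra_simps)
        have "\<bar>t\<bar> \<le> exp \<bar>t\<bar>" using exp_ge_add_one_self[of "\<bar>t\<bar>"] by linarith
        then have e': "\<bar>t\<bar> * exp (k * \<bar>t\<bar>) \<le> exp ((k + 1) * \<bar>t\<bar>)"
          by (simp add: exp_add distrib_right mult.commute[of _ "exp (k * _)"])
        have "\<bar>g' t\<bar> \<le> C * exp ((k + 1) * \<bar>t\<bar>)"
          using bound(2)[of t] mult_left_mono[OF e C] by linarith
        moreover have "\<bar>t\<bar> * \<bar>g t\<bar> \<le> \<bar>t\<bar> * (C * exp (k * \<bar>t\<bar>))"
          by (intro mult_left_mono bound) simp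
        moreover have "\<bar>t\<bar> * (C * exp (k * \<bar>t\<bar>)) \<le> C * exp ((k + 1) * \<bar>t\<bar>)"
          using mult_left_mono[OF e' C] by (simp add: mult_ac)
        ultimately have "\<bar>g' t - t * g t\<bar> \<le> C * exp ((k + 1) * \<bar>t\<bar>) + C * exp ((k + 1) * \<bar>t\<bar>)"
          using abs_triangle_ineq4[of "g' t" "t * g t"] unfolding abs_mult by linarith
        then have "?\<phi> t * \<bar>g' t - t * g t\<bar> \<le> ?\<phi> t * (C * exp ((k + 1) * \<bar>t\<bar>) + C * exp ((k + 1) * \<bar>t\<bar>))"
          by (rule mult_left_mono) simp
        then show "norm (?f t) \<le> norm (C * (?\<phi> t * exp ((k + 1) * \<bar>t\<bar>)) + C * (?\<phi> t * exp ((k + 1) * \<bar>t\<bar>)))"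
          using C by (simp only: real_norm_def abs_mult) (simp add: algebra_simps)
      qed
    qed simp
    then show "set_integrable lborel (einterval (- \<infinity>) \<infinity>) ?f"
      by (simp add: set_integrable_def)
    have lim: "(?F \<longlongrightarrow> 0) T" if "((\<lambda>t. exp (k * \<bar>t\<bar>) * ?\<phi> t) \<longlongrightarrow> 0) T" for T
    proof (rule tendsto_0_le[OF that, where K = C], rule always_eventually, rule allI)
      fix t
      have "\<bar>g t\<bar> * ?\<phi> t \<le> C * exp (k * \<bar>t\<bar>) * ?\<phi> t" by (intro mult_right_mono bound) simp
      then show "norm (?F t) \<le> norm (exp (k * \<bar>t\<bar>) * ?\<phi> t) * C" by (simp add: abs_mult mult_ac)
    qed
    show "((?F \<circ> real_of_ereal) \<longlongrightarrow> 0) (at_right (- \<infinity>))"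
      using lim[OF gaussian_tail_vanishes(2)] by (simp add: ereal_tendsto_simps1)
    show "((?F \<circ> real_of_ereal) \<longlongrightarrow> 0) (at_left \<infinity>)"
      using lim[OF gaussian_tail_vanishes(1)] by (simp add: ereal_tendsto_simps1)
  qed simp
  then show ?thesis
    by (subst integral_gaussian) (auto simp: interval_lebesgue_integral_def set_lebesgue_integral_def)
qed

text \<open>The monic Hermite polynomials. Up to sign, t He_k - He_k' is what differentiating He_k
  times the Gaussian density produces; \<open>pCons 0\<close> multiplies by t.\<close>

fun hermite_poly :: "nat \<Rightarrow> real poly" where
  "hermite_poly 0 = 1"
| "hermite_poly (Suc k) = pCons 0 (hermite_poly k) - pderiv (hermite_poly k)"

lemma higher_deriv_std_normal_density:
  "(deriv ^^ k) std_normal_density = (\<lambda>t. (-1) ^ k * poly (hermite_poly k) t * std_normal_density t)"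
proof (induction k)
  case (Suc k)
  have "((\<lambda>t. (-1) ^ k * poly (hermite_poly k) t * std_normal_density t) has_real_derivative
      (-1) ^ Suc k * poly (hermite_poly (Suc k)) t * std_normal_density t) (at t)" for t
    by (auto intro!: derivative_eq_intros poly_DERIV std_normal_density_has_real_derivative simp: algebra_simps)
  then show ?case by (simp add: Suc fun_eq_iff DERIV_imp_deriv)
qed simp

lemma hermite_eq: "hermite k t = poly (hermite_poly k) t / sqrt (fact k)"
proof -
  have "(-1) ^ k * ((-1) ^ k) = (1::real)" by (simp add: power_mult_distrib[symmetric])
  moreover have "std_normal_density t \<noteq> 0" using normal_density_pos[of 1 0 t] by simp
  ultimately show ?thesis
    by (simp add: hermite_def higher_deriv_std_normal_density)
qed

lemma pderiv_hermite_poly: "pderiv (hermite_poly (Suc k)) = smult (of_nat (Suc k)) (hermite_poly k)"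
proof (induction k)
  case 0
  show ?case by (simp add: pderiv_pCons pderiv_1)
next
  case (Suc k)
  have "pderiv (hermite_poly (Suc (Suc k))) =
      hermite_poly (Suc k) + pCons 0 (pderiv (hermite_poly (Suc k))) - pderiv (pderiv (hermite_poly (Suc k)))"
    by (simp only: hermite_poly.simps(2)[of "Suc k"] pderiv_diff pderiv_pCons)
  also have "\<dots> = hermite_poly (Suc k)
      + smult (of_nat (Suc k)) (pCons 0 (hermite_poly k) - pderiv (hermite_poly k))"
    unfolding Suc.IH pderiv_smult
    by (simp add: smult_diff_right del: of_nat_Suc hermite_poly.simps)
  also have "\<dots> = smult (of_nat (Suc (Suc k))) (hermite_poly (Suc k))"
    by (simp only: of_nat_Suc[of "Suc k"] smult_add_left smult_1_left hermite_poly.simps(2)[of k])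
  finally show ?case .
qed

lemma hermite_0 [simp]: "hermite 0 t = 1"
  by (simp add: hermite_eq)

text \<open>At k = 0 the truncated index k - 1 = 0 is harmless because sqrt 0 kills the term. The
  recurrence and the lowering of multi-indices below rely on the same convention.\<close>

lemma hermite_has_real_derivative:
  "(hermite k has_real_derivative sqrt k * hermite (k - 1) t) (at t)"
proof (cases k)
  case 0
  then show ?thesis by (simp add: hermite_0[abs_def] fun_eq_iff[symmetric])
next
  case (Suc m)
  have "((\<lambda>t. poly (hermite_poly k) t / sqrt (fact k)) has_real_derivative poly (pderiv (hermite_poly k)) t / sqrt (fact k)) (at t)"
    by (intro DERIV_cdivide poly_DERIV)
  moreover have "poly (pderiv (hermite_poly k)) t / sqrt (fact k) = sqrt k * hermite (k - 1) t"
    unfolding Suc pderiv_hermite_poly hermite_eq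
    by (simp add: real_sqrt_mult field_simps del: of_nat_Suc hermite_poly.simps)
  ultimately show ?thesis by (simp add: hermite_eq[abs_def])
qed

lemma hermite_recurrence:
  "t * hermite k t = sqrt (Suc k) * hermite (Suc k) t + sqrt k * hermite (k - 1) t"
proof -
  have "sqrt k * hermite (k - 1) t = poly (pderiv (hermite_poly k)) t / sqrt (fact k)"
  proof (rule DERIV_unique[OF hermite_has_real_derivative])
    show "(hermite k has_real_derivative poly (pderiv (hermite_poly k)) t / sqrt (fact k)) (at t)"
      unfolding hermite_eq[abs_def] by (intro DERIV_cdivide poly_DERIV)
  qed
  moreover have "sqrt (Suc k) * hermite (Suc k) t = poly (hermite_poly (Suc k)) t / sqrt (fact k)"
    unfolding hermite_eq by (simp add: real_sqrt_mult del: of_nat_Suc hermite_poly.simps)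
  ultimately show ?thesis by (simp add: hermite_eq diff_divide_distrib)
qed

text \<open>Exponential growth is coarser than polynomial growth, but it is the form that the
  integration by parts and the growth class of functions of y work with.\<close>

lemma poly_exp_bound: "\<exists>C k. 0 \<le> C \<and> 0 \<le> k \<and> (\<forall>t. \<bar>poly p t\<bar> \<le> C * exp (k * \<bar>t :: real\<bar>))"
proof (induction p)
  case 0
  show ?case by (intro exI[of _ 0]) auto
next
  case (pCons a p)
  then obtain C k where C: "0 \<le> C" "0 \<le> k" "\<And>t. \<bar>poly p t\<bar> \<le> C * exp (k * \<bar>t\<bar>)" by blast
  have "\<bar>poly (pCons a p) t\<bar> \<le> (\<bar>a\<bar> + C) * exp ((k + 1) * \<bar>t\<bar>)" for t
  proof -
    have "\<bar>t\<bar> \<le> exp \<bar>t\<bar>" using exp_ge_add_one_self[of "\<bar>t\<bar>"] by linarith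
    then have "\<bar>t\<bar> * \<bar>poly p t\<bar> \<le> exp \<bar>t\<bar> * (C * exp (k * \<bar>t\<bar>))"
      by (intro mult_mono C) auto
    also have "\<dots> = C * exp ((k + 1) * \<bar>t\<bar>)" by (simp add: exp_add algebra_simps)
    finally have "\<bar>t\<bar> * \<bar>poly p t\<bar> \<le> C * exp ((k + 1) * \<bar>t\<bar>)" .
    moreover have "\<bar>a\<bar> * 1 \<le> \<bar>a\<bar> * exp ((k + 1) * \<bar>t\<bar>)" using C(2) by (intro mult_left_mono) auto
    ultimately show ?thesis
      using abs_triangle_ineq[of a "t * poly p t"] by (simp add: abs_mult distrib_right)
  qed
  then show ?case using C by (intro exI[of _ "\<bar>a\<bar> + C"] exI[of _ "k + 1"]) auto
qed

lemma hermite_exp_bound: "\<exists>C k. 0 \<le> C \<and> 0 \<le> k \<and> (\<forall>t. \<bar>hermite n t\<bar> \<le> C * exp (k * \<bar>t\<bar>))"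
proof -
  obtain C k where C: "0 \<le> C" "0 \<le> k" "\<And>t. \<bar>poly (hermite_poly n) t\<bar> \<le> C * exp (k * \<bar>t\<bar>)"
    using poly_exp_bound by blast
  have "1 \<le> sqrt (fact n)" by simp
  then have "\<bar>hermite n t\<bar> \<le> \<bar>poly (hermite_poly n) t\<bar>" for t
    unfolding hermite_eq by (simp add: divide_le_eq mult_le_cancel_left1)
  then show ?thesis using C order_trans by meson
qed

lemma continuous_on_hermite: "continuous_on UNIV (hermite n)"
  unfolding hermite_eq[abs_def] by (intro continuous_intros) auto

lemma hermite_measurable [measurable]: "hermite n \<in> borel_measurable borel"
  by (rule borel_measurable_continuous_onI[OF continuous_on_hermite])

section \<open>The Gaussian measure on sequences\<close>

lemma sets_gaussian_seq [measurable_cong]: "sets gaussian_seq = sets borel"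
  unfolding gaussian_seq_def sets_PiM_equal_borel[symmetric] by (rule sets_PiM_cong) auto

lemma sets_gaussian_seq_PiM: "sets gaussian_seq = sets (PiM UNIV (\<lambda>_. gaussian))"
  by (simp add: gaussian_seq_def)

lemma space_gaussian_seq [simp]: "space gaussian_seq = UNIV"
  by (simp add: gaussian_seq_def space_PiM)

interpretation gaussian_seq: prob_space gaussian_seq
  unfolding gaussian_seq_def by (intro prob_space_PiM prob_space_gaussian)

lemma coordinate_measurable [measurable]: "(\<lambda>y. y j) \<in> borel_measurable gaussian_seq"
  by (simp add: measurable_cong_sets[OF sets_gaussian_seq refl])

lemma distr_coordinate: "distr gaussian_seq borel (\<lambda>y. y j) = gaussian"
proof -
  have "distr (PiM UNIV (\<lambda>_. gaussian)) gaussian (\<lambda>y. y j) = gaussian"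
    using distr_PiM_component[of UNIV "\<lambda>_. gaussian" j] prob_space_gaussian by simp
  then show ?thesis
    by (simp add: gaussian_seq_def cong: distr_cong)
qed

lemma nn_integral_coordinate:
  "g \<in> borel_measurable borel \<Longrightarrow> (\<integral>\<^sup>+y. g (y j) \<partial>gaussian_seq) = (\<integral>\<^sup>+t. g t \<partial>gaussian)"
  by (subst distr_coordinate[of j, symmetric]) (simp add: nn_integral_distr)

lemma update_measurable_pair [measurable]:
  "(\<lambda>(t, y). y(j := t)) \<in> gaussian \<Otimes>\<^sub>M gaussian_seq \<rightarrow>\<^sub>M gaussian_seq"
  unfolding gaussian_seq_def
proof (rule measurable_PiM_single')
  show "(\<lambda>x. (case x of (t, y) \<Rightarrow> y(j := t)) i) \<in> gaussian \<Otimes>\<^sub>M (\<Pi>\<^sub>M i\<in>UNIV. gaussian) \<rightarrow>\<^sub>M gaussian" for i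
    by (cases "i = j") (simp_all add: split_beta)
qed simp

text \<open>Replacing coordinate j by an independent Gaussian leaves the measure unchanged. With
  this, Fubini isolates one coordinate without splitting the product space.\<close>

lemma distr_update: "distr (gaussian \<Otimes>\<^sub>M gaussian_seq) gaussian_seq (\<lambda>(t, y). y(j := t)) = gaussian_seq"
  using distr_pair_PiM_eq_PiM[of UNIV "\<lambda>_. gaussian" j] prob_space_gaussian
  by (simp add: gaussian_seq_def)

lemma update_measurable [measurable]: "(\<lambda>y. y(j := g y)) \<in> gaussian_seq \<rightarrow>\<^sub>M gaussian_seq"
  if "g \<in> borel_measurable gaussian_seq"
proof -
  have "(\<lambda>y. (g y, y)) \<in> gaussian_seq \<rightarrow>\<^sub>M gaussian \<Otimes>\<^sub>M gaussian_seq"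
    using that by (intro measurable_Pair) auto
  from measurable_compose[OF this update_measurable_pair[of j]] show ?thesis by simp
qed

lemma ennreal_le_suminf: "f j \<le> (\<Sum>j. f j)" for f :: "nat \<Rightarrow> ennreal"
  using sum_le_suminf[of f "{j}"] by simp

lemma tendsto_0_powr_cancel:
  fixes x :: "nat \<Rightarrow> real"
  assumes "(\<lambda>j. x j powr q) \<longlonglongrightarrow> 0" "0 < q" "\<And>j. 0 \<le> x j"
  shows "x \<longlonglongrightarrow> 0"
proof -
  have "(\<lambda>j. (x j powr q) powr (1 / q)) \<longlonglongrightarrow> 0"
    by (rule tendsto_zero_powrI[OF assms(1) tendsto_const]) (use assms in auto)
  then show ?thesis using assms by (simp add: powr_powr)
qed

section \<open>Weighted suprema: a full-measure set and exponential moments\<close>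

locale gaussian_weights =
  fixes \<rho> :: "nat \<Rightarrow> real" and q :: real
  assumes rho_pos: "\<And>j. 0 < \<rho> j" and q_pos: "0 < q"
    and rho_summable: "summable (\<lambda>j. inverse (\<rho> j) powr q)"
begin

text \<open>The condition y_j = o(\<rho>_j), rather than mere boundedness of the ratios, gives
  uniform convergence of the series for the exponent. It is insensitive to changing one coordinate,
  so partial derivatives can be taken inside the set.\<close>

definition good :: "(nat \<Rightarrow> real) set" where
  "good = {y. (\<lambda>j. \<bar>y j\<bar> / \<rho> j) \<longlonglongrightarrow> 0}"

definition size :: "(nat \<Rightarrow> real) \<Rightarrow> real" where
  "size y = (SUP j. \<bar>y j\<bar> / \<rho> j)"

lemma bdd_above_good: "y \<in> good \<Longrightarrow> bdd_above (range (\<lambda>j. \<bar>y j\<bar> / \<rho> j))"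
  unfolding good_def mem_Collect_eq by (rule Bseq_bdd_above[OF convergent_imp_Bseq[OF convergentI]])

lemma le_size: "y \<in> good \<Longrightarrow> \<bar>y j\<bar> / \<rho> j \<le> size y"
  unfolding size_def by (rule cSUP_upper[OF UNIV_I bdd_above_good])

lemma abs_le_size: "y \<in> good \<Longrightarrow> \<bar>y j\<bar> \<le> \<rho> j * size y"
  using le_size[of y j] rho_pos[of j] by (simp add: field_simps)

lemma size_nonneg: "y \<in> good \<Longrightarrow> 0 \<le> size y"
  using le_size[of y 0] rho_pos[of 0] by (meson abs_ge_zero divide_nonneg_pos order_trans)

lemma size_le: "(\<And>j. \<bar>y j\<bar> / \<rho> j \<le> c) \<Longrightarrow> size y \<le> c"
  unfolding size_def by (rule cSUP_least) auto

lemma good_update: "y(j := t) \<in> good \<longleftrightarrow> y \<in> good"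
proof -
  have "\<forall>\<^sub>F i in sequentially. \<bar>(y(j := t)) i\<bar> / \<rho> i = \<bar>y i\<bar> / \<rho> i"
    using eventually_gt_at_top[of j] by eventually_elim auto
  then show ?thesis unfolding good_def by (simp add: tendsto_cong)
qed

lemma size_update: "y \<in> good \<Longrightarrow> size (y(j := t)) \<le> size y + \<bar>t\<bar> / \<rho> j"
proof (rule size_le)
  fix i assume y: "y \<in> good"
  show "\<bar>(y(j := t)) i\<bar> / \<rho> i \<le> size y + \<bar>t\<bar> / \<rho> j"
    using le_size[OF y, of i] size_nonneg[OF y] rho_pos[of j] by (cases "i = j") (auto intro: add_increasing2)
qed

lemma good_measurable [measurable]: "good \<in> sets gaussian_seq"
proof -
  have "good = {y. \<forall>k. \<exists>N. \<forall>n\<ge>N. \<bar>y n\<bar> / \<rho> n < 1 / Suc k}"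
  proof (intro equalityI subsetI CollectI allI)
    fix y k assume "y \<in> good"
    then have "\<forall>\<^sub>F n in sequentially. \<bar>y n\<bar> / \<rho> n < 1 / Suc k"
      unfolding good_def by (intro order_tendstoD) auto
    then show "\<exists>N. \<forall>n\<ge>N. \<bar>y n\<bar> / \<rho> n < 1 / Suc k" by (simp add: eventually_sequentially)
  next
    fix y assume y: "y \<in> {y. \<forall>k. \<exists>N. \<forall>n\<ge>N. \<bar>y n\<bar> / \<rho> n < 1 / Suc k}"
    have "(\<lambda>j. \<bar>y j\<bar> / \<rho> j) \<longlonglongrightarrow> 0"
    proof (rule LIMSEQ_I)
      fix e :: real assume "e > 0"
      then obtain k where "1 / Suc k < e" using nat_approx_posE by blast
      moreover obtain N where "\<And>n. n \<ge> N \<Longrightarrow> \<bar>y n\<bar> / \<rho> n < 1 / Suc k" using y by blast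
      ultimately have "norm (\<bar>y n\<bar> / \<rho> n - 0) < e" if "n \<ge> N" for n
        using that rho_pos[of n] by (simp add: abs_mult) (meson less_trans)
      then show "\<exists>N. \<forall>n\<ge>N. norm (\<bar>y n\<bar> / \<rho> n - 0) < e" by blast
    qed
    then show "y \<in> good" by (simp add: good_def)
  qed
  moreover have "{y \<in> space gaussian_seq. \<forall>k. \<exists>N. \<forall>n\<ge>N. \<bar>y n\<bar> / \<rho> n < 1 / Suc k} \<in> sets gaussian_seq"
    by measurable
  ultimately show ?thesis by simp
qed

text \<open>A sum in place of the supremum, so that expectations can be taken term by term. The
  factor with power q is at least 1 where the ratio is, and yields the summable \<rho>_j^(-q) after
  integration; the constant exp k covers the case \<open>size y \<le> 1\<close>.\<close>

definition majorant :: "real \<Rightarrow> (nat \<Rightarrow> real) \<Rightarrow> ennreal" where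
  "majorant k y = ennreal (exp k) + (\<Sum>j. ennreal ((\<bar>y j\<bar> / \<rho> j) powr q * exp (k * (\<bar>y j\<bar> / \<rho> j))))"

lemma majorant_measurable [measurable]: "majorant k \<in> borel_measurable gaussian_seq"
  unfolding majorant_def[abs_def] by measurable

lemma rho_bounded_below: "\<exists>R>0. \<forall>j. 1 / \<rho> j \<le> R"
proof -
  have "(\<lambda>j. inverse (\<rho> j)) \<longlonglongrightarrow> 0"
    using rho_pos by (intro tendsto_0_powr_cancel[OF summable_LIMSEQ_zero[OF rho_summable] q_pos]) (simp add: less_imp_le)
  then have "Bseq (\<lambda>j. inverse (\<rho> j))" by (rule convergent_imp_Bseq[OF convergentI])
  then obtain R where R: "0 < R" "\<And>j. norm (inverse (\<rho> j)) \<le> R" by (auto elim: BseqE)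
  have "1 / \<rho> j \<le> R" for j using R(2)[of j] rho_pos[of j] by (simp add: divide_inverse)
  with R(1) show ?thesis by blast
qed

lemma majorant_finite:
  assumes k: "0 \<le> k"
  shows "(\<integral>\<^sup>+y. majorant k y \<partial>gaussian_seq) < \<infinity>"
proof -
  obtain R where R: "0 < R" "\<And>j. 1 / \<rho> j \<le> R" using rho_bounded_below by blast
  \<comment> \<open>In the exponent, q comes from |t|^q \<le> exp (q |t|) and k R from 1 / \<rho>_j
    \<le> R, so that I does not depend on j.\<close>
  define I where "I = (LINT t|gaussian. exp ((q + k * R) * \<bar>t\<bar>))"
  have I: "(\<integral>\<^sup>+t. ennreal (exp ((q + k * R) * \<bar>t\<bar>)) \<partial>gaussian) = ennreal I"
    unfolding I_def by (rule nn_integral_eq_integral[OF integrable_gaussian_exp_abs]) simp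
  have I0: "0 \<le> I" unfolding I_def by simp
  have bound: "(\<integral>\<^sup>+y. ennreal ((\<bar>y j\<bar> / \<rho> j) powr q * exp (k * (\<bar>y j\<bar> / \<rho> j))) \<partial>gaussian_seq)
      \<le> ennreal (inverse (\<rho> j) powr q * I)" for j
  proof -
    have le: "(\<bar>t\<bar> / \<rho> j) powr q * exp (k * (\<bar>t\<bar> / \<rho> j)) \<le> inverse (\<rho> j) powr q * exp ((q + k * R) * \<bar>t\<bar>)" for t
    proof -
      have "(\<bar>t\<bar> / \<rho> j) powr q = inverse (\<rho> j) powr q * \<bar>t\<bar> powr q"
        using rho_pos[of j] by (simp add: divide_inverse powr_mult less_imp_le mult.commute)
      moreover have "\<bar>t\<bar> powr q \<le> exp (q * \<bar>t\<bar>)"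
      proof -
        have "\<bar>t\<bar> \<le> exp \<bar>t\<bar>" using exp_ge_add_one_self[of "\<bar>t\<bar>"] by linarith
        then have "\<bar>t\<bar> powr q \<le> exp \<bar>t\<bar> powr q" using q_pos by (intro powr_mono2) auto
        then show ?thesis by (simp add: powr_def)
      qed
      moreover have "exp (k * (\<bar>t\<bar> / \<rho> j)) \<le> exp (k * R * \<bar>t\<bar>)"
      proof -
        have "\<bar>t\<bar> * (1 / \<rho> j) \<le> \<bar>t\<bar> * R" by (intro mult_left_mono R) simp
        then have "k * (\<bar>t\<bar> / \<rho> j) \<le> k * (\<bar>t\<bar> * R)" using k by (intro mult_left_mono) auto
        then show ?thesis by (simp add: mult_ac)
      qed
      ultimately have "(\<bar>t\<bar> / \<rho> j) powr q * exp (k * (\<bar>t\<bar> / \<rho> j))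
          \<le> (inverse (\<rho> j) powr q * exp (q * \<bar>t\<bar>)) * exp (k * R * \<bar>t\<bar>)"
        by (auto intro!: mult_mono mult_left_mono)
      then show ?thesis by (simp add: exp_add distrib_right mult.assoc)
    qed
    have "(\<integral>\<^sup>+y. ennreal ((\<bar>y j\<bar> / \<rho> j) powr q * exp (k * (\<bar>y j\<bar> / \<rho> j))) \<partial>gaussian_seq)
        = (\<integral>\<^sup>+t. ennreal ((\<bar>t\<bar> / \<rho> j) powr q * exp (k * (\<bar>t\<bar> / \<rho> j))) \<partial>gaussian)"
      by (rule nn_integral_coordinate) measurable
    also have "\<dots> \<le> (\<integral>\<^sup>+t. ennreal (inverse (\<rho> j) powr q) * ennreal (exp ((q + k * R) * \<bar>t\<bar>)) \<partial>gaussian)"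
      using le by (intro nn_integral_mono) (simp add: ennreal_mult[symmetric])
    also have "\<dots> = ennreal (inverse (\<rho> j) powr q * I)"
      using I0 by (subst nn_integral_cmult) (auto simp: I ennreal_mult)
    finally show ?thesis .
  qed
  have "(\<integral>\<^sup>+y. majorant k y \<partial>gaussian_seq) = ennreal (exp k)
      + (\<Sum>j. \<integral>\<^sup>+y. ennreal ((\<bar>y j\<bar> / \<rho> j) powr q * exp (k * (\<bar>y j\<bar> / \<rho> j))) \<partial>gaussian_seq)"
    unfolding majorant_def
    by (subst nn_integral_add, measurable, subst nn_integral_suminf, measurable)
       (simp add: gaussian_seq.emeasure_space_1[simplified])
  also have "\<dots> \<le> ennreal (exp k) + (\<Sum>j. ennreal (inverse (\<rho> j) powr q * I))"
    by (intro add_left_mono suminf_le bound) auto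
  also have "\<dots> < \<infinity>"
  proof -
    have "(\<Sum>j. ennreal (inverse (\<rho> j) powr q * I)) = ennreal (\<Sum>j. inverse (\<rho> j) powr q * I)"
      using I0 by (intro suminf_ennreal2 summable_mult2[OF rho_summable]) auto
    then show ?thesis by (simp only:) (simp add: less_top[symmetric])
  qed
  finally show ?thesis .
qed

lemma exp_size_le_majorant:
  assumes y: "y \<in> good" and k: "0 \<le> k"
  shows "ennreal (exp (k * size y)) \<le> majorant k y"
proof (cases "size y \<le> 1")
  case True
  then have "exp (k * size y) \<le> exp k" using k by (simp add: mult_left_le)
  then have "ennreal (exp (k * size y)) \<le> ennreal (exp k)" by (rule ennreal_leI)
  then show ?thesis unfolding majorant_def by (rule order_trans) simp
next
  case False
  have "exp (k * size y) \<le> C" if C: "majorant k y \<le> ennreal C" "0 \<le> C" for C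
  proof -
    \<comment> \<open>Every s strictly between 1 and the supremum is exceeded by some ratio, whose
      term alone dominates exp (k s); afterwards s tends to the supremum from the left.\<close>
    have "exp (k * s) \<le> C" if s: "1 < s" "s < size y" for s
    proof -
      obtain j where j: "s < \<bar>y j\<bar> / \<rho> j"
        using s(2) less_cSUP_iff[OF _ bdd_above_good[OF y]] unfolding size_def by auto
      let ?t = "\<bar>y j\<bar> / \<rho> j"
      have "exp (k * s) \<le> 1 * exp (k * ?t)" using mult_left_mono[OF less_imp_le[OF j] k] by simp
      also have "\<dots> \<le> ?t powr q * exp (k * ?t)"
        using j s q_pos by (intro mult_right_mono ge_one_powr_ge_zero) auto
      finally have "ennreal (exp (k * s)) \<le> ennreal (?t powr q * exp (k * ?t))" by (rule ennreal_leI)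
      also have "\<dots> \<le> (\<Sum>j. ennreal ((\<bar>y j\<bar> / \<rho> j) powr q * exp (k * (\<bar>y j\<bar> / \<rho> j))))"
        by (rule ennreal_le_suminf)
      also have "\<dots> \<le> majorant k y" unfolding majorant_def by simp
      also have "\<dots> \<le> ennreal C" by (rule C)
      finally show ?thesis using C(2) by simp
    qed
    moreover have "((\<lambda>s. exp (k * s)) \<longlongrightarrow> exp (k * size y)) (at_left (size y))"
      by (intro tendsto_intros)
    moreover have "\<forall>\<^sub>F s in at_left (size y). 1 < s \<and> s < size y"
      using False by (auto simp: eventually_at_left[of 1 "size y"] not_le)
    ultimately show ?thesis
      by (intro tendsto_upperbound[where F = "at_left (size y)" and f = "\<lambda>s. exp (k * s)"])
         (auto elim: eventually_mono)
  qed
  then show ?thesis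
    by (cases "majorant k y") (auto simp: ennreal_leI)
qed

text \<open>Finiteness of \<open>majorant 0\<close> makes the q-th powers of the ratios summable
  almost surely, so the ratios tend to 0.\<close>

lemma AE_good: "AE y in gaussian_seq. y \<in> good"
proof -
  have "AE y in gaussian_seq. majorant 0 y \<noteq> \<infinity>"
    using majorant_finite[of 0] by (intro nn_integral_PInf_AE) auto
  then show ?thesis
  proof eventually_elim
    case (elim y)
    then have "(\<Sum>j. ennreal ((\<bar>y j\<bar> / \<rho> j) powr q)) \<noteq> \<infinity>" by (auto simp: majorant_def)
    then have "summable (\<lambda>j. (\<bar>y j\<bar> / \<rho> j) powr q)"
      by (intro summable_suminf_not_top) auto
    then show ?case
      unfolding good_def mem_Collect_eq using rho_pos q_pos
      by (intro tendsto_0_powr_cancel[OF summable_LIMSEQ_zero]) (auto simp: less_imp_le)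
  qed
qed

end

section \<open>Functions of exponential growth in the weighted supremum\<close>

context gaussian_weights
begin

text \<open>A class closed under sums and products in which all moments are finite: growth rates k
  add up under products, and exp (k * \<open>size y\<close>) has a finite integral for every k.
  Growth is prescribed only on \<open>good\<close>, whose complement is a null set.\<close>

definition tame :: "((nat \<Rightarrow> real) \<Rightarrow> 'v::real_normed_vector) \<Rightarrow> bool" where
  "tame F \<longleftrightarrow> F \<in> borel_measurable gaussian_seq \<and>
     (\<exists>C k. 0 \<le> C \<and> 0 \<le> k \<and> (\<forall>y\<in>good. norm (F y) \<le> C * exp (k * size y)))"

lemma tameI:
  "F \<in> borel_measurable gaussian_seq \<Longrightarrow> 0 \<le> C \<Longrightarrow> 0 \<le> k \<Longrightarrow>
    (\<And>y. y \<in> good \<Longrightarrow> norm (F y) \<le> C * exp (k * size y)) \<Longrightarrow> tame F"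
  unfolding tame_def by blast

lemma tameE:
  assumes "tame F"
  obtains C k where "0 \<le> C" "0 \<le> k" "\<And>y. y \<in> good \<Longrightarrow> norm (F y) \<le> C * exp (k * size y)"
  using assms unfolding tame_def by blast

lemma tame_measurable [measurable_dest]: "tame F \<Longrightarrow> F \<in> borel_measurable gaussian_seq"
  by (simp add: tame_def)

lemma tame_nn_integral:
  assumes "\<And>y. y \<in> good \<Longrightarrow> F y \<le> ennreal (C * exp (k * size y))" "0 \<le> C" "0 \<le> k"
  shows "(\<integral>\<^sup>+y. F y \<partial>gaussian_seq) < \<infinity>"
proof -
  have "(\<integral>\<^sup>+y. F y \<partial>gaussian_seq) \<le> (\<integral>\<^sup>+y. ennreal C * majorant k y \<partial>gaussian_seq)"
  proof (rule nn_integral_mono_AE)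
    show "AE y in gaussian_seq. F y \<le> ennreal C * majorant k y"
      using AE_good
    proof eventually_elim
      case (elim y)
      have "F y \<le> ennreal C * ennreal (exp (k * size y))"
        using assms(1)[OF elim] assms(2) by (simp add: ennreal_mult)
      also have "\<dots> \<le> ennreal C * majorant k y"
        by (intro mult_left_mono exp_size_le_majorant[OF elim assms(3)]) simp
      finally show ?case .
    qed
  qed
  also have "\<dots> = ennreal C * (\<integral>\<^sup>+y. majorant k y \<partial>gaussian_seq)"
    by (rule nn_integral_cmult) measurable
  also have "\<dots> < \<infinity>"
    using majorant_finite[OF assms(3)] by (simp add: ennreal_mult_less_top)
  finally show ?thesis .
qed

lemma tame_integrable:
  fixes F :: "(nat \<Rightarrow> real) \<Rightarrow> 'v::{banach,second_countable_topology}"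
  assumes F: "tame F" shows "integrable gaussian_seq F"
proof (rule integrableI_bounded)
  obtain C k where C: "0 \<le> C" "0 \<le> k" "\<And>y. y \<in> good \<Longrightarrow> norm (F y) \<le> C * exp (k * size y)"
    using tameE[OF F] by blast
  show "(\<integral>\<^sup>+y. norm (F y) \<partial>gaussian_seq) < \<infinity>"
    by (rule tame_nn_integral[of _ C k]) (use C in \<open>auto intro: ennreal_leI\<close>)
qed (use F in measurable)

lemma tame_const: "tame (\<lambda>y. c)"
  by (rule tameI[where C = "norm c" and k = 0]) auto

lemma tame_add:
  fixes F G :: "(nat \<Rightarrow> real) \<Rightarrow> 'v::{real_normed_vector,second_countable_topology}"
  assumes F: "tame F" and G: "tame G" shows "tame (\<lambda>y. F y + G y)"
proof -
  obtain C k C' k' where C: "0 \<le> C" "0 \<le> k" "\<And>y. y \<in> good \<Longrightarrow> norm (F y) \<le> C * exp (k * size y)"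
    "0 \<le> C'" "0 \<le> k'" "\<And>y. y \<in> good \<Longrightarrow> norm (G y) \<le> C' * exp (k' * size y)"
    using tameE[OF F] tameE[OF G] by metis
  show ?thesis
  proof (rule tameI[where C = "C + C'" and k = "k + k'"])
    show "(\<lambda>y. F y + G y) \<in> borel_measurable gaussian_seq" using F G by measurable
    fix y assume y: "y \<in> good"
    note s = size_nonneg[OF y]
    have "norm (F y + G y) \<le> C * exp (k * size y) + C' * exp (k' * size y)"
      by (rule norm_triangle_mono) (use C y in auto)
    also have "\<dots> \<le> C * exp ((k + k') * size y) + C' * exp ((k + k') * size y)"
      using C s by (intro add_mono mult_left_mono) (auto simp: distrib_right)
    finally show "norm (F y + G y) \<le> (C + C') * exp ((k + k') * size y)"
      by (simp add: distrib_right)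
  qed (use C in auto)
qed

lemma tame_scaleR:
  fixes F :: "(nat \<Rightarrow> real) \<Rightarrow> 'v::{real_normed_vector,second_countable_topology}"
  assumes g: "tame g" and F: "tame F" shows "tame (\<lambda>y. g y *\<^sub>R F y)"
proof -
  obtain C k C' k' where C: "0 \<le> C" "0 \<le> k" "\<And>y. y \<in> good \<Longrightarrow> norm (F y) \<le> C * exp (k * size y)"
    "0 \<le> C'" "0 \<le> k'" "\<And>y. y \<in> good \<Longrightarrow> norm (g y) \<le> C' * exp (k' * size y)"
    using tameE[OF F] tameE[OF g] by metis
  show ?thesis
  proof (rule tameI[where C = "C' * C" and k = "k' + k"])
    show "(\<lambda>y. g y *\<^sub>R F y) \<in> borel_measurable gaussian_seq" using F g by measurable
    fix y assume y: "y \<in> good"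
    have "norm (g y *\<^sub>R F y) \<le> (C' * exp (k' * size y)) * (C * exp (k * size y))"
      using C(3,6)[OF y] C by (auto intro!: mult_mono)
    then show "norm (g y *\<^sub>R F y) \<le> C' * C * exp ((k' + k) * size y)"
      by (simp add: distrib_right exp_add mult_ac)
  qed (use C in auto)
qed

lemma tame_mult: "tame f \<Longrightarrow> tame g \<Longrightarrow> tame (\<lambda>y. f y * g y :: real)"
  using tame_scaleR[of f g] by simp

lemma tame_bounded_linear:
  fixes L :: "'v::{real_normed_vector,second_countable_topology} \<Rightarrow> 'w::real_normed_vector"
  assumes L: "bounded_linear L" and F: "tame F" shows "tame (\<lambda>y. L (F y))"
proof -
  obtain K where K: "0 \<le> K" "\<And>x. norm (L x) \<le> norm x * K"
    using bounded_linear.nonneg_bounded[OF L] by blast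
  obtain C k where C: "0 \<le> C" "0 \<le> k" "\<And>y. y \<in> good \<Longrightarrow> norm (F y) \<le> C * exp (k * size y)"
    using tameE[OF F] by blast
  show ?thesis
  proof (rule tameI[where C = "K * C" and k = k])
    show "(\<lambda>y. L (F y)) \<in> borel_measurable gaussian_seq"
      using tame_measurable[OF F] borel_measurable_continuous_onI[OF linear_continuous_on[OF L]]
      by (rule measurable_compose)
    fix y assume y: "y \<in> good"
    show "norm (L (F y)) \<le> K * C * exp (k * size y)"
      using order_trans[OF K(2) mult_right_mono[OF C(3)[OF y] K(1)]] by (simp add: mult_ac)
  qed (use C K in auto)
qed

lemma tame_inner_const: "tame F \<Longrightarrow> tame (\<lambda>y. F y \<bullet> v)"
  for F :: "(nat \<Rightarrow> real) \<Rightarrow> 'v::{real_inner,second_countable_topology}"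
  by (rule tame_bounded_linear[OF bounded_linear_inner_left])

lemma tame_norm_squared:
  fixes F :: "(nat \<Rightarrow> real) \<Rightarrow> 'v::{real_normed_vector,second_countable_topology}"
  assumes F: "tame F" shows "tame (\<lambda>y. (norm (F y))\<^sup>2)"
proof -
  obtain C k where C: "0 \<le> C" "0 \<le> k" "\<And>y. y \<in> good \<Longrightarrow> norm (F y) \<le> C * exp (k * size y)"
    using tameE[OF F] by blast
  have "tame (\<lambda>y. norm (F y))"
    by (rule tameI[OF _ C(1,2)]) (use C F in auto)
  from tame_mult[OF this this] show ?thesis by (simp add: power2_eq_square)
qed

lemma tame_coordinate:
  assumes g: "g \<in> borel_measurable borel" "0 \<le> C" "0 \<le> k" "\<And>t. \<bar>g t\<bar> \<le> C * exp (k * \<bar>t :: real\<bar>)"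
  shows "tame (\<lambda>y. g (y j) :: real)"
proof (rule tameI[where C = C and k = "k * \<rho> j"])
  show "(\<lambda>y. g (y j)) \<in> borel_measurable gaussian_seq" using g(1) by measurable
  fix y assume y: "y \<in> good"
  have "k * \<bar>y j\<bar> \<le> k * (\<rho> j * size y)" using g abs_le_size[OF y] by (intro mult_left_mono) auto
  then have "C * exp (k * \<bar>y j\<bar>) \<le> C * exp (k * \<rho> j * size y)"
    using g by (intro mult_left_mono) (auto simp: mult_ac)
  then show "norm (g (y j)) \<le> C * exp (k * \<rho> j * size y)"
    using g(4)[of "y j"] by simp
qed (use g rho_pos[of j] in auto)

lemma tame_id_coordinate: "tame (\<lambda>y. y j)"
proof (rule tame_coordinate[where C = 1 and k = 1 and g = "\<lambda>t. t"])
  show "\<bar>t\<bar> \<le> 1 * exp (1 * \<bar>t\<bar>)" for t :: real 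
    using exp_ge_add_one_self[of "\<bar>t\<bar>"] unfolding mult_1_left by linarith
qed auto

lemma tame_hermite: "tame (\<lambda>y. hermite n (y j))"
  using hermite_exp_bound[of n] tame_coordinate[of "hermite n"] by auto

lemma tame_prod: "finite J \<Longrightarrow> (\<And>j. j \<in> J \<Longrightarrow> tame (f j)) \<Longrightarrow> tame (\<lambda>y. \<Prod>j\<in>J. f j y :: real)"
  by (induction J rule: finite_induct) (auto intro: tame_const tame_mult)

lemma tame_hermite_prod: "\<nu> \<in> multi_idx \<Longrightarrow> tame (hermite_prod \<nu>)"
  unfolding hermite_prod_def[abs_def] multi_idx_def by (auto intro: tame_prod tame_hermite)

end

lemma multi_idx_update: "\<nu> \<in> multi_idx \<Longrightarrow> \<nu>(j := n) \<in> multi_idx"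
  unfolding multi_idx_def by (auto intro: finite_subset[of _ "insert j {j. \<nu> j \<noteq> 0}"])

lemma hermite_prod_zero [simp]: "hermite_prod (\<lambda>_. 0) y = 1"
  by (simp add: hermite_prod_def)

lemma hermite_prod_split:
  assumes "\<nu> \<in> multi_idx"
  shows "hermite_prod \<nu> y = hermite (\<nu> j) (y j) * hermite_prod (\<nu>(j := 0)) y"
proof -
  have fin: "finite {i. \<nu> i \<noteq> 0}" using assms by (simp add: multi_idx_def)
  have "{i. (\<nu>(j := 0)) i \<noteq> 0} = {i. \<nu> i \<noteq> 0} - {j}" by auto
  moreover have "(\<Prod>i\<in>{i. \<nu> i \<noteq> 0} - {j}. hermite ((\<nu>(j := 0)) i) (y i)) = (\<Prod>i\<in>{i. \<nu> i \<noteq> 0} - {j}. hermite (\<nu> i) (y i))"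
    by (rule prod.cong) auto
  ultimately show ?thesis
    using prod.remove[OF fin, of j "\<lambda>i. hermite (\<nu> i) (y i)"]
    by (cases "\<nu> j = 0") (auto simp: hermite_prod_def)
qed

lemma hermite_prod_update:
  "\<nu> \<in> multi_idx \<Longrightarrow> hermite_prod (\<nu>(j := n)) y = hermite n (y j) * hermite_prod (\<nu>(j := 0)) y"
  using hermite_prod_split[OF multi_idx_update, of \<nu> j n y j] by simp

lemma hermite_prod_update_arg: "hermite_prod (\<nu>(j := 0)) (y(j := t)) = hermite_prod (\<nu>(j := 0)) y"
  unfolding hermite_prod_def by (rule prod.cong) auto

section \<open>The Hermite ladder, orthonormality and Bessel's inequality\<close>

context gaussian_weights
begin

text \<open>Integrate by parts in the coordinate \<open>j\<close>, all other coordinates being fixed.\<close>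

lemma gaussian_seq_integration_by_parts:
  fixes F F' :: "(nat \<Rightarrow> real) \<Rightarrow> real"
  assumes F: "tame F" "tame F'"
    and der: "\<And>y t. y \<in> good \<Longrightarrow> ((\<lambda>t. F (y(j := t))) has_real_derivative F' (y(j := t))) (at t)"
    and cont: "\<And>y. y \<in> good \<Longrightarrow> continuous_on UNIV (\<lambda>t. F' (y(j := t)))"
  shows "(LINT y|gaussian_seq. F' y) = (LINT y|gaussian_seq. y j * F y)"
proof -
  obtain C k C' k' where C: "0 \<le> C" "0 \<le> k" "\<And>y. y \<in> good \<Longrightarrow> norm (F y) \<le> C * exp (k * size y)"
    "0 \<le> C'" "0 \<le> k'" "\<And>y. y \<in> good \<Longrightarrow> norm (F' y) \<le> C' * exp (k' * size y)"
    using tameE[OF F(1)] tameE[OF F(2)] by metis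
  define H where "H y = F' y - y j * F y" for y
  have "tame (\<lambda>y. F' y + (-1) * (y j * F y))"
    by (intro tame_add tame_mult tame_const tame_id_coordinate F)
  then have tH: "tame H" by (simp add: H_def[abs_def])
  note [measurable] = tame_measurable[OF tH]
  have inner: "(LINT t|gaussian. H (y(j := t))) = 0" if y: "y \<in> good" for y
  proof -
    \<comment> \<open>One pair of constants must serve both F and F', hence C + C' and k + k'.
      Changing coordinate j raises \<open>size y\<close> by at most |t| / \<rho>_j, which fixes the
      growth rate in t.\<close>
    have bound: "C0 * exp (k0 * size (y(j := t))) \<le> (C + C') * exp ((k + k') * size y) * exp ((k + k') / \<rho> j * \<bar>t\<bar>)"
      if "(C0 = C \<and> k0 = k) \<or> (C0 = C' \<and> k0 = k')" for C0 k0 t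
    proof -
      have yt: "y(j := t) \<in> good" using y by (simp add: good_update)
      have "k0 * size (y(j := t)) \<le> (k + k') * (size y + \<bar>t\<bar> / \<rho> j)"
        using that C size_update[OF y] size_nonneg[OF yt] by (intro mult_mono) auto
      then have "C0 * exp (k0 * size (y(j := t))) \<le> (C + C') * exp ((k + k') * (size y + \<bar>t\<bar> / \<rho> j))"
        using that C by (intro mult_mono) auto
      then show ?thesis by (simp add: distrib_left exp_add mult_ac)
    qed
    have "(LINT t|gaussian. F' (y(j := t)) - t * F (y(j := t))) = 0"
    proof (rule gaussian_integration_by_parts[OF der[OF y] cont[OF y]])
      fix t
      have yt: "y(j := t) \<in> good" using y by (simp add: good_update)
      show "\<bar>F (y(j := t))\<bar> \<le> (C + C') * exp ((k + k') * size y) * exp ((k + k') / \<rho> j * \<bar>t\<bar>)"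
        using C(3)[OF yt] bound[of C k t] by simp
      show "\<bar>F' (y(j := t))\<bar> \<le> (C + C') * exp ((k + k') * size y) * exp ((k + k') / \<rho> j * \<bar>t\<bar>)"
        using C(6)[OF yt] bound[of C' k' t] by simp
    qed
    then show ?thesis by (simp add: H_def)
  qed
  interpret P: pair_sigma_finite gaussian gaussian_seq
    by (intro pair_sigma_finite.intro prob_space_imp_sigma_finite prob_space_gaussian gaussian_seq.prob_space_axioms)
  have "(LINT y|gaussian_seq. H y) = integral\<^sup>L (distr (gaussian \<Otimes>\<^sub>M gaussian_seq) gaussian_seq (\<lambda>(t, y). y(j := t))) H"
    by (simp add: distr_update)
  also have "\<dots> = (LINT p|(gaussian \<Otimes>\<^sub>M gaussian_seq). (case p of (t, y) \<Rightarrow> H (y(j := t))))"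
    by (subst integral_distr) (auto simp: split_beta')
  also have "\<dots> = (LINT y|gaussian_seq. (LINT t|gaussian. H (y(j := t))))"
  proof (rule P.integral_snd[symmetric])
    have "integrable (distr (gaussian \<Otimes>\<^sub>M gaussian_seq) gaussian_seq (\<lambda>(t, y). y(j := t))) H"
      using tame_integrable[OF tH] by (simp add: distr_update)
    from integrable_distr[OF update_measurable_pair this]
    show "integrable (gaussian \<Otimes>\<^sub>M gaussian_seq) (\<lambda>(t, y). H (y(j := t)))"
      by (simp add: split_beta')
  qed
  also have "\<dots> = (LINT y|gaussian_seq. 0)"
  proof (rule integral_cong_AE)
    show "AE y in gaussian_seq. (LINT t|gaussian. H (y(j := t))) = 0"
      using AE_good by eventually_elim (rule inner)
    have "(\<lambda>y. LINT t|gaussian. (case (y, t) of (y, t) \<Rightarrow> H (y(j := t)))) \<in> borel_measurable gaussian_seq"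
    proof (rule P.M1.borel_measurable_lebesgue_integral)
      have "(\<lambda>p. (snd p, fst p)) \<in> gaussian_seq \<Otimes>\<^sub>M gaussian \<rightarrow>\<^sub>M gaussian \<Otimes>\<^sub>M gaussian_seq" by measurable
      from measurable_compose[OF measurable_compose[OF this update_measurable_pair[of j]] tame_measurable[OF tH]]
      show "(\<lambda>(x, y). case (x, y) of (y, t) \<Rightarrow> H (y(j := t))) \<in> borel_measurable (gaussian_seq \<Otimes>\<^sub>M gaussian)"
        by (simp add: split_beta')
    qed
    then show "(\<lambda>y. LINT t|gaussian. H (y(j := t))) \<in> borel_measurable gaussian_seq" by simp
  qed simp
  finally have "(LINT y|gaussian_seq. F' y - y j * F y) = 0" by (simp add: H_def)
  moreover have "integrable gaussian_seq F'" "integrable gaussian_seq (\<lambda>y. y j * F y)"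
    by (intro tame_integrable tame_mult tame_id_coordinate F)+
  ultimately show ?thesis by simp
qed

lemma inner_integral_scaleR:
  fixes F :: "(nat \<Rightarrow> real) \<Rightarrow> 'v::{real_inner,banach,second_countable_topology}"
  assumes "integrable M (\<lambda>y. g y *\<^sub>R F y)"
  shows "(LINT y|M. g y *\<^sub>R F y) \<bullet> v = (LINT y|M. g y * (F y \<bullet> v))"
  by (subst integral_inner_left[symmetric]) (use assms in auto)

text \<open>Integrate by parts with G = H_\<nu> (F . v). The derivative of H_\<nu> produces a term
  with the lowered index; the recurrence for y_j H_\<nu> contains the same term, so the two cancel
  and only the raised index remains. Pairing with all v recovers the vector identity.\<close>

lemma hermite_ladder:
  fixes F F' :: "(nat \<Rightarrow> real) \<Rightarrow> 'v::{real_inner,banach,second_countable_topology}"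
  assumes F: "tame F" "tame F'" and \<nu>: "\<nu> \<in> multi_idx"
    and der: "\<And>y t. y \<in> good \<Longrightarrow> ((\<lambda>t. F (y(j := t))) has_vector_derivative F' (y(j := t))) (at t)"
    and cont: "\<And>y. y \<in> good \<Longrightarrow> continuous_on UNIV (\<lambda>t. F' (y(j := t)))"
  shows "(LINT y|gaussian_seq. hermite_prod \<nu> y *\<^sub>R F' y) =
    sqrt (Suc (\<nu> j)) *\<^sub>R (LINT y|gaussian_seq. hermite_prod (\<nu>(j := Suc (\<nu> j))) y *\<^sub>R F y)"
proof -
  let ?n = "\<nu> j" and ?\<nu>z = "\<nu>(j := 0)" and ?up = "\<nu>(j := Suc (\<nu> j))" and ?down = "\<nu>(j := \<nu> j - 1)"
  have up: "?up \<in> multi_idx" "?down \<in> multi_idx" "?\<nu>z \<in> multi_idx" using \<nu> by (auto intro: multi_idx_update)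
  note tH = tame_hermite_prod[OF \<nu>] tame_hermite_prod[OF up(1)] tame_hermite_prod[OF up(2)] tame_hermite_prod[OF up(3)]
  have main: "(LINT y|gaussian_seq. hermite_prod \<nu> y * (F' y \<bullet> v)) =
    sqrt (Suc ?n) * (LINT y|gaussian_seq. hermite_prod ?up y * (F y \<bullet> v))" for v
  proof -
    define G where "G y = hermite_prod \<nu> y * (F y \<bullet> v)" for y
    define G' where "G' y = hermite_prod \<nu> y * (F' y \<bullet> v) + sqrt ?n * (hermite_prod ?down y * (F y \<bullet> v))" for y
    have tame: "tame (\<lambda>y. hermite_prod \<nu> y * (F' y \<bullet> v))" "tame (\<lambda>y. hermite_prod ?down y * (F y \<bullet> v))"
      "tame (\<lambda>y. hermite_prod ?up y * (F y \<bullet> v))" "tame G"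
      unfolding G_def[abs_def] by (intro tame_mult tH tame_inner_const F)+
    have tG': "tame G'" unfolding G'_def[abs_def] by (intro tame_add tame_mult[OF tame_const] tame)
    have eq: "y j * G y = sqrt (Suc ?n) * (hermite_prod ?up y * (F y \<bullet> v)) + sqrt ?n * (hermite_prod ?down y * (F y \<bullet> v))" for y
    proof -
      have "y j * G y = (y j * hermite ?n (y j)) * hermite_prod ?\<nu>z y * (F y \<bullet> v)"
        using hermite_prod_split[OF \<nu>, of y j] by (simp add: G_def)
      also have "\<dots> = sqrt (Suc ?n) * (hermite_prod ?up y * (F y \<bullet> v)) + sqrt ?n * (hermite_prod ?down y * (F y \<bullet> v))"
        unfolding hermite_recurrence hermite_prod_update[OF \<nu>, of j "Suc ?n"] hermite_prod_update[OF \<nu>, of j "?n - 1"]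
        by (simp only: distrib_right mult.assoc)
      finally show ?thesis .
    qed
    have split: "hermite_prod \<nu> (y(j := t)) = hermite ?n t * hermite_prod ?\<nu>z y"
      "hermite_prod ?down (y(j := t)) = hermite (?n - 1) t * hermite_prod ?\<nu>z y" for y t
      using hermite_prod_split[OF \<nu>, of "y(j := t)" j] hermite_prod_update[OF \<nu>, of j "?n - 1" "y(j := t)"]
      by (simp_all add: hermite_prod_update_arg)
    have derv: "((\<lambda>t. F (y(j := t)) \<bullet> v) has_real_derivative F' (y(j := t)) \<bullet> v) (at t)" if "y \<in> good" for y t
      using bounded_linear.has_vector_derivative[OF bounded_linear_inner_left der[OF that]]
      by (simp add: has_real_derivative_iff_has_vector_derivative)
    have cF: "continuous_on UNIV (\<lambda>t. F (y(j := t)))" if "y \<in> good" for y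
      using der[OF that] by (intro continuous_at_imp_continuous_on) (auto dest: has_vector_derivative_continuous)
    have "(LINT y|gaussian_seq. G' y) = (LINT y|gaussian_seq. y j * G y)"
    proof (rule gaussian_seq_integration_by_parts[OF tame(4) tG'])
      show "((\<lambda>t. G (y(j := t))) has_real_derivative G' (y(j := t))) (at t)" if y: "y \<in> good" for y t
        unfolding G_def G'_def split
        by (auto intro!: derivative_eq_intros hermite_has_real_derivative derv[OF y] simp: algebra_simps)
      show "continuous_on UNIV (\<lambda>t. G' (y(j := t)))" if y: "y \<in> good" for y
        unfolding G'_def split
        by (intro continuous_intros continuous_on_hermite cont[OF y] cF[OF y])
    qed
    then show ?thesis
      unfolding eq unfolding G'_def using tame(1-3)[THEN tame_integrable]
      by simp
  qed
  have "(LINT y|gaussian_seq. hermite_prod \<nu> y *\<^sub>R F' y) \<bullet> v =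
    (sqrt (Suc ?n) *\<^sub>R (LINT y|gaussian_seq. hermite_prod ?up y *\<^sub>R F y)) \<bullet> v" for v
    using main[of v] inner_integral_scaleR[OF tame_integrable[OF tame_scaleR[OF tH(1) F(2)]], of v]
      inner_integral_scaleR[OF tame_integrable[OF tame_scaleR[OF tH(2) F(1)]], of v]
    by simp
  then show ?thesis by (metis vector_eq_rdot)
qed

text \<open>The formula of \<open>hermite_coeff\<close> for general Hilbert space values: it is
  applied to gradients, to the polynomials \<open>hermite_prod\<close> themselves and to the
  solution.\<close>

definition coeff :: "((nat \<Rightarrow> real) \<Rightarrow> 'v::{real_inner,banach,second_countable_topology}) \<Rightarrow> (nat \<Rightarrow> nat) \<Rightarrow> 'v" where
  "coeff F \<nu> = (LINT y|gaussian_seq. hermite_prod \<nu> y *\<^sub>R F y)"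

text \<open>Induction on the total degree of \<nu>: the ladder lowers \<nu> and \<mu> together in
  one coordinate. At degree 0 the ladder with F = 1 and F' = 0 shows that
  \<open>hermite_prod \<mu>\<close> has mean zero unless \<mu> = 0.\<close>

lemma hermite_orthonormal:
  assumes "\<nu> \<in> multi_idx" "\<mu> \<in> multi_idx"
  shows "coeff (hermite_prod \<mu>) \<nu> = (if \<mu> = \<nu> then 1 else 0)"
  using assms
proof (induction "\<Sum>j | \<nu> j \<noteq> 0. \<nu> j" arbitrary: \<nu> \<mu>)
  case 0
  then have \<nu>: "\<nu> = (\<lambda>_. 0)" by (auto simp: multi_idx_def)
  show ?case
  proof (cases "\<mu> = (\<lambda>_. 0)")
    case True
    then show ?thesis using gaussian_seq.prob_space by (simp add: \<nu> coeff_def hermite_prod_zero[abs_def])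
  next
    case False
    then obtain j where j: "\<mu> j \<noteq> 0" by auto
    let ?\<mu> = "\<mu>(j := \<mu> j - 1)"
    have "(LINT y|gaussian_seq. hermite_prod ?\<mu> y *\<^sub>R 0) =
        sqrt (Suc (?\<mu> j)) *\<^sub>R (LINT y|gaussian_seq. hermite_prod (?\<mu>(j := Suc (?\<mu> j))) y *\<^sub>R (1::real))"
      by (rule hermite_ladder) (auto intro: tame_const multi_idx_update 0)
    moreover have "?\<mu>(j := Suc (?\<mu> j)) = \<mu>" using j by auto
    ultimately show ?thesis using False by (simp add: coeff_def \<nu> hermite_prod_zero[abs_def])
  qed
next
  case (Suc n)
  have fin: "finite {j. \<nu> j \<noteq> 0}" using Suc.prems by (simp add: multi_idx_def)
  obtain j where j: "\<nu> j \<noteq> 0" using Suc.hyps(2) by (metis (mono_tags, lifting) mem_Collect_eq nat.simps(3) sum.neutral)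
  let ?\<nu> = "\<nu>(j := \<nu> j - 1)" and ?\<mu> = "\<mu>(j := \<mu> j - 1)"
  have mi: "?\<nu> \<in> multi_idx" "?\<mu> \<in> multi_idx" using Suc.prems by (auto intro: multi_idx_update)
  have "(\<Sum>i | ?\<nu> i \<noteq> 0. ?\<nu> i) = (\<Sum>i | \<nu> i \<noteq> 0. ?\<nu> i)"
    using fin by (intro sum.mono_neutral_left) auto
  moreover have "(\<Sum>i | \<nu> i \<noteq> 0. \<nu> i) = \<nu> j + (\<Sum>i\<in>{i. \<nu> i \<noteq> 0} - {j}. \<nu> i)"
    using j by (intro sum.remove fin) auto
  moreover have "(\<Sum>i | \<nu> i \<noteq> 0. ?\<nu> i) = ?\<nu> j + (\<Sum>i\<in>{i. \<nu> i \<noteq> 0} - {j}. ?\<nu> i)"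
    using j by (intro sum.remove fin) auto
  moreover have "(\<Sum>i\<in>{i. \<nu> i \<noteq> 0} - {j}. ?\<nu> i) = (\<Sum>i\<in>{i. \<nu> i \<noteq> 0} - {j}. \<nu> i)"
    by (rule sum.cong) auto
  ultimately have size: "n = (\<Sum>i | ?\<nu> i \<noteq> 0. ?\<nu> i)" using Suc.hyps(2) j by simp
  have up: "?\<nu>(j := Suc (?\<nu> j)) = \<nu>" "Suc (?\<nu> j) = \<nu> j" using j by auto
  have split: "hermite_prod \<mu> (y(j := t)) = hermite (\<mu> j) t * hermite_prod (\<mu>(j := 0)) y"
      "hermite_prod ?\<mu> (y(j := t)) = hermite (\<mu> j - 1) t * hermite_prod (\<mu>(j := 0)) y" for y t
    using hermite_prod_split[OF Suc.prems(2), of "y(j := t)" j] hermite_prod_update[OF Suc.prems(2), of j "\<mu> j - 1" "y(j := t)"]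
    by (simp_all add: hermite_prod_update_arg)
  have "(LINT y|gaussian_seq. hermite_prod ?\<nu> y *\<^sub>R (sqrt (\<mu> j) * hermite_prod ?\<mu> y)) =
      sqrt (Suc (?\<nu> j)) *\<^sub>R (LINT y|gaussian_seq. hermite_prod (?\<nu>(j := Suc (?\<nu> j))) y *\<^sub>R hermite_prod \<mu> y)"
  proof (rule hermite_ladder)
    show "((\<lambda>t. hermite_prod \<mu> (y(j := t))) has_vector_derivative sqrt (\<mu> j) * hermite_prod ?\<mu> (y(j := t))) (at t)" for y t
      unfolding split has_real_derivative_iff_has_vector_derivative[symmetric]
      by (auto intro!: derivative_eq_intros hermite_has_real_derivative)
    show "continuous_on UNIV (\<lambda>t. sqrt (\<mu> j) * hermite_prod ?\<mu> (y(j := t)))" for y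
      unfolding split by (intro continuous_intros continuous_on_hermite)
  qed (intro tame_mult tame_const tame_hermite_prod Suc.prems mi)+
  then have "sqrt (\<mu> j) * coeff (hermite_prod ?\<mu>) ?\<nu> = sqrt (\<nu> j) * coeff (hermite_prod \<mu>) \<nu>"
    unfolding up coeff_def by (simp add: mult.left_commute)
  moreover have "coeff (hermite_prod ?\<mu>) ?\<nu> = (if ?\<mu> = ?\<nu> then 1 else 0)"
    by (rule Suc.hyps(1)[OF size mi])
  moreover have "?\<mu> = ?\<nu> \<longleftrightarrow> \<mu> = \<nu>" if "\<mu> j \<noteq> 0"
  proof
    assume eq: "?\<mu> = ?\<nu>"
    show "\<mu> = \<nu>"
    proof
      fix i show "\<mu> i = \<nu> i" using fun_cong[OF eq, of i] that j by (cases "i = j") auto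
    qed
  qed simp
  ultimately show ?case using j by (cases "\<mu> j = 0") auto
qed

text \<open>Induction on N. Subtracting one more term leaves the other coefficients alone by
  orthonormality. The cross term in the expanded square is governed by the coefficient being
  removed, so the squared norm drops by exactly its square.\<close>

lemma hermite_partial_sum_error:
  fixes F :: "(nat \<Rightarrow> real) \<Rightarrow> 'v::{real_inner,banach,second_countable_topology}"
  assumes F: "tame F" and N: "finite N" "N \<subseteq> multi_idx"
  shows "tame (\<lambda>y. F y - (\<Sum>\<nu>\<in>N. hermite_prod \<nu> y *\<^sub>R coeff F \<nu>))"
    and "\<mu> \<in> multi_idx \<Longrightarrow> coeff (\<lambda>y. F y - (\<Sum>\<nu>\<in>N. hermite_prod \<nu> y *\<^sub>R coeff F \<nu>)) \<mu>
        = (if \<mu> \<in> N then 0 else coeff F \<mu>)"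
    and "(LINT y|gaussian_seq. (norm (F y - (\<Sum>\<nu>\<in>N. hermite_prod \<nu> y *\<^sub>R coeff F \<nu>)))\<^sup>2)
      = (LINT y|gaussian_seq. (norm (F y))\<^sup>2) - (\<Sum>\<nu>\<in>N. (norm (coeff F \<nu>))\<^sup>2)"
proof -
  let ?R = "\<lambda>N y. F y - (\<Sum>\<nu>\<in>N. hermite_prod \<nu> y *\<^sub>R coeff F \<nu>)"
  have "tame (?R N) \<and> (\<forall>\<mu>\<in>multi_idx. coeff (?R N) \<mu> = (if \<mu> \<in> N then 0 else coeff F \<mu>)) \<and>
    (LINT y|gaussian_seq. (norm (?R N y))\<^sup>2)
      = (LINT y|gaussian_seq. (norm (F y))\<^sup>2) - (\<Sum>\<nu>\<in>N. (norm (coeff F \<nu>))\<^sup>2)"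
    using N
  proof (induction N rule: finite_induct)
    case (insert \<nu> N)
    let ?c = "coeff F \<nu>"
    have IH: "tame (?R N)" "\<And>\<mu>. \<mu> \<in> multi_idx \<Longrightarrow> coeff (?R N) \<mu> = (if \<mu> \<in> N then 0 else coeff F \<mu>)"
      "(LINT y|gaussian_seq. (norm (?R N y))\<^sup>2)
        = (LINT y|gaussian_seq. (norm (F y))\<^sup>2) - (\<Sum>\<nu>\<in>N. (norm (coeff F \<nu>))\<^sup>2)"
      using insert by auto
    have \<nu>: "\<nu> \<in> multi_idx" using insert by simp
    note tH = tame_hermite_prod[OF \<nu>]
    have R: "?R (insert \<nu> N) = (\<lambda>y. ?R N y + hermite_prod \<nu> y *\<^sub>R (- ?c))"
      using insert by (simp add: fun_eq_iff algebra_simps)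
    have tame: "tame (?R (insert \<nu> N))"
      unfolding R by (intro tame_add IH tame_scaleR tH tame_const)
    have co: "coeff (?R (insert \<nu> N)) \<mu> = coeff (?R N) \<mu> - coeff (hermite_prod \<nu>) \<mu> *\<^sub>R ?c" if "\<mu> \<in> multi_idx" for \<mu>
    proof -
      note tM = tame_hermite_prod[OF that]
      have "integrable gaussian_seq (\<lambda>y. hermite_prod \<mu> y *\<^sub>R ?R N y)"
        "integrable gaussian_seq (\<lambda>y. hermite_prod \<mu> y * hermite_prod \<nu> y)"
        by (intro tame_integrable tame_scaleR tame_mult tM tH IH)+
      then have "(LINT y|gaussian_seq. hermite_prod \<mu> y *\<^sub>R (?R N y + hermite_prod \<nu> y *\<^sub>R (- ?c)))
        = (LINT y|gaussian_seq. hermite_prod \<mu> y *\<^sub>R ?R N y)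
          - (LINT y|gaussian_seq. hermite_prod \<mu> y * hermite_prod \<nu> y) *\<^sub>R ?c"
        unfolding scaleR_add_right scaleR_scaleR by simp
      then show ?thesis
        unfolding R coeff_def[of "?R N"] coeff_def[of "hermite_prod \<nu>"] real_scaleR_def coeff_def[of "\<lambda>y. ?R N y + hermite_prod \<nu> y *\<^sub>R (- ?c)"] .
    qed
    have "(norm (?R (insert \<nu> N) y))\<^sup>2 = (norm (?R N y))\<^sup>2 - 2 * (hermite_prod \<nu> y * (?R N y \<bullet> ?c))
        + (norm ?c)\<^sup>2 * (hermite_prod \<nu> y * hermite_prod \<nu> y)" for y
      unfolding fun_cong[OF R] power2_norm_eq_inner
      by (simp add: inner_add_left inner_add_right inner_commute algebra_simps)
    moreover have "integrable gaussian_seq (\<lambda>y. (norm (?R N y))\<^sup>2)"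
        "integrable gaussian_seq (\<lambda>y. hermite_prod \<nu> y * (?R N y \<bullet> ?c))"
        "integrable gaussian_seq (\<lambda>y. hermite_prod \<nu> y * hermite_prod \<nu> y)"
      by (intro tame_integrable tame_norm_squared tame_inner_const tame_mult tH IH)+
    ultimately have "(LINT y|gaussian_seq. (norm (?R (insert \<nu> N) y))\<^sup>2) = (LINT y|gaussian_seq. (norm (?R N y))\<^sup>2)
        - 2 * (LINT y|gaussian_seq. hermite_prod \<nu> y * (?R N y \<bullet> ?c))
        + (norm ?c)\<^sup>2 * (LINT y|gaussian_seq. hermite_prod \<nu> y * hermite_prod \<nu> y)"
      by simp
    also have "(LINT y|gaussian_seq. hermite_prod \<nu> y * (?R N y \<bullet> ?c)) = coeff (?R N) \<nu> \<bullet> ?c"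
      unfolding coeff_def[of "?R N"]
      by (rule inner_integral_scaleR[symmetric]) (intro tame_integrable tame_scaleR tH IH)
    also have "coeff (?R N) \<nu> = ?c" using IH(2)[OF \<nu>] insert by simp
    also have "(LINT y|gaussian_seq. hermite_prod \<nu> y * hermite_prod \<nu> y) = 1"
      using hermite_orthonormal[OF \<nu> \<nu>] by (simp add: coeff_def)
    finally have "(LINT y|gaussian_seq. (norm (?R (insert \<nu> N) y))\<^sup>2)
        = (LINT y|gaussian_seq. (norm (F y))\<^sup>2) - (\<Sum>\<nu>\<in>insert \<nu> N. (norm (coeff F \<nu>))\<^sup>2)"
      using insert by (simp add: IH(3) power2_norm_eq_inner)
    then show ?case
      using tame co IH(2) hermite_orthonormal[OF _ \<nu>] insert.hyps(2) by auto
  qed (use F in simp)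
  then show "tame (?R N)" "\<mu> \<in> multi_idx \<Longrightarrow> coeff (?R N) \<mu> = (if \<mu> \<in> N then 0 else coeff F \<mu>)"
    "(LINT y|gaussian_seq. (norm (?R N y))\<^sup>2)
      = (LINT y|gaussian_seq. (norm (F y))\<^sup>2) - (\<Sum>\<nu>\<in>N. (norm (coeff F \<nu>))\<^sup>2)"
    by blast+
qed

lemma bessel_inequality:
  fixes F :: "(nat \<Rightarrow> real) \<Rightarrow> 'v::{real_inner,banach,second_countable_topology}"
  assumes "tame F" "finite N" "N \<subseteq> multi_idx"
  shows "(\<Sum>\<nu>\<in>N. (norm (coeff F \<nu>))\<^sup>2) \<le> (LINT y|gaussian_seq. (norm (F y))\<^sup>2)"
proof -
  have "0 \<le> (LINT y|gaussian_seq. (norm (F y - (\<Sum>\<nu>\<in>N. hermite_prod \<nu> y *\<^sub>R coeff F \<nu>)))\<^sup>2)" by simp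
  then show ?thesis unfolding hermite_partial_sum_error(3)[OF assms] by simp
qed

end

section \<open>Completeness of the Hermite polynomials\<close>

text \<open>A determinate moment problem. Vanishing against all Hermite polynomials gives vanishing
  moments of the signed law of Y weighted by g; exponential integrability then kills its Fourier
  transform, and Levy's uniqueness theorem identifies its positive and negative parts.\<close>

lemma expectation_indicator_eq_0:
  fixes g Y :: "'p \<Rightarrow> real"
  assumes [measurable]: "Y \<in> borel_measurable M"
    and g: "\<And>c. integrable M (\<lambda>x. g x * exp (c * \<bar>Y x\<bar>))"
    and zero: "\<And>k. (LINT x|M. g x * hermite k (Y x)) = 0"
    and A: "A \<in> sets borel"
  shows "(LINT x|M. g x * indicator A (Y x)) = 0"
proof -
  have gi: "integrable M g" using g[of 0] by simp
  note [measurable] = borel_measurable_integrable[OF gi]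
  have poly_int: "integrable M (\<lambda>x. g x * poly p (Y x))" for p
  proof -
    obtain C k where C: "0 \<le> C" "\<And>t. \<bar>poly p t\<bar> \<le> C * exp (k * \<bar>t\<bar>)" using poly_exp_bound by blast
    have "(\<lambda>x. poly p (Y x)) \<in> borel_measurable M"
      by (rule measurable_compose[OF assms(1) borel_measurable_continuous_onI]) (intro continuous_intros)
    then show ?thesis
      using C by (intro Bochner_Integration.integrable_bound[OF integrable_mult_right[OF g, of C k]])
        (auto simp: abs_mult mult.left_commute[of C] intro!: AE_I2 mult_left_mono)
  qed
  \<comment> \<open>The recurrence trades a power of Y for neighbouring Hermite indices, so the
    claim is proved for all k at once.\<close>
  have "(LINT x|M. g x * (Y x ^ m * hermite k (Y x))) = 0" for m k
  proof (induction m arbitrary: k)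
    case (Suc m)
    have int: "integrable M (\<lambda>x. g x * (Y x ^ m * hermite k (Y x)))" for k
      using integrable_divide[OF poly_int[of "monom 1 m * hermite_poly k"], of "sqrt (fact k)"]
      by (simp add: hermite_eq poly_monom mult.assoc)
    have "g x * (Y x ^ Suc m * hermite k (Y x)) = sqrt (Suc k) * (g x * (Y x ^ m * hermite (Suc k) (Y x)))
        + sqrt k * (g x * (Y x ^ m * hermite (k - 1) (Y x)))" for x
    proof -
      have "g x * (Y x ^ Suc m * hermite k (Y x)) = g x * Y x ^ m * (Y x * hermite k (Y x))" by (simp add: mult_ac)
      then show ?thesis unfolding hermite_recurrence by (simp add: algebra_simps)
    qed
    then show ?case using int Suc.IH by simp
  qed (use zero in simp)
  from this[of _ 0] have moments: "(LINT x|M. g x * Y x ^ m) = 0" for m by simp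
  have pow_int: "integrable M (\<lambda>x. g x * Y x ^ m)" for m
    using poly_int[of "monom 1 m"] by (simp add: poly_monom)
  have fourier: "(CLINT x|M. of_real (g x) * iexp (t * Y x)) = 0" for t
  proof -
    define S :: "nat \<Rightarrow> 'p \<Rightarrow> complex" where
      "S n x = (\<Sum>k<n. ((\<i> * t) ^ k / fact k) * complex_of_real (g x * Y x ^ k))" for n x
    have eq: "S n x = of_real (g x) * (\<Sum>k<n. (\<i> * (t * Y x)) ^ k / fact k)" for n x
      unfolding S_def sum_distrib_left by (intro sum.cong refl) (simp add: power_mult_distrib mult_ac)
    have "(\<lambda>n. CLINT x|M. S n x) \<longlonglongrightarrow> (CLINT x|M. of_real (g x) * iexp (t * Y x))"
    proof (rule integral_dominated_convergence[where w = "\<lambda>x. \<bar>g x * exp (\<bar>t\<bar> * \<bar>Y x\<bar>)\<bar>"])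
      show "integrable M (\<lambda>x. \<bar>g x * exp (\<bar>t\<bar> * \<bar>Y x\<bar>)\<bar>)" by (rule integrable_abs[OF g])
      show "AE x in M. (\<lambda>n. S n x) \<longlonglongrightarrow> of_real (g x) * iexp (t * Y x)"
      proof (rule AE_I2)
        fix x
        have "(\<lambda>k. (\<i> * (t * Y x)) ^ k /\<^sub>R fact k) sums exp (\<i> * (t * Y x))" by (rule exp_converges)
        then have "(\<lambda>n. \<Sum>k<n. (\<i> * (t * Y x)) ^ k / fact k) \<longlonglongrightarrow> exp (\<i> * (t * Y x))"
          by (simp add: sums_def scaleR_conv_of_real divide_inverse mult.commute)
        then show "(\<lambda>n. S n x) \<longlonglongrightarrow> of_real (g x) * iexp (t * Y x)"
          unfolding eq by (intro tendsto_mult tendsto_const) simp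
      qed
      show "AE x in M. norm (S n x) \<le> \<bar>g x * exp (\<bar>t\<bar> * \<bar>Y x\<bar>)\<bar>" for n
      proof (rule AE_I2)
        fix x
        have "norm (\<Sum>k<n. (\<i> * (t * Y x)) ^ k / fact k) \<le> (\<Sum>k<n. norm ((\<i> * (t * Y x)) ^ k / fact k))"
          by (rule norm_sum)
        also have "\<dots> = (\<Sum>k<n. (\<bar>t\<bar> * \<bar>Y x\<bar>) ^ k /\<^sub>R fact k)"
          by (intro sum.cong refl) (simp add: norm_divide norm_power norm_mult abs_mult norm_inverse norm_fact divide_inverse mult.commute)
        also have "\<dots> \<le> (\<Sum>k. (\<bar>t\<bar> * \<bar>Y x\<bar>) ^ k /\<^sub>R fact k)"
          by (intro sum_le_suminf sums_summable[OF exp_converges]) auto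
        also have "\<dots> = exp (\<bar>t\<bar> * \<bar>Y x\<bar>)" by (rule sums_unique[symmetric, OF exp_converges])
        finally show "norm (S n x) \<le> \<bar>g x * exp (\<bar>t\<bar> * \<bar>Y x\<bar>)\<bar>"
          unfolding eq norm_mult abs_mult by (intro mult_mono) auto
      qed
      show "S n \<in> borel_measurable M" for n unfolding S_def[abs_def] by measurable
    qed measurable
    moreover have "(CLINT x|M. S n x) = 0" for n
    proof -
      have "(CLINT x|M. S n x) = (\<Sum>k<n. CLINT x|M. ((\<i> * t) ^ k / fact k) * complex_of_real (g x * Y x ^ k))"
        unfolding S_def by (intro Bochner_Integration.integral_sum integrable_mult_right integrable_of_real pow_int)
      also have "\<dots> = (\<Sum>k<n. ((\<i> * t) ^ k / fact k) * of_real (LINT x|M. g x * Y x ^ k))"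
        by (intro sum.cong refl) (simp only: integral_mult_right_zero integral_complex_of_real)
      finally show ?thesis by (simp add: moments)
    qed
    ultimately show ?thesis by (simp add: LIMSEQ_const_iff)
  qed
  \<comment> \<open>Levy's theorem concerns probability measures. The positive and negative parts of
    g have the same mass m, by the zeroth moment, and are divided by it; if m = 0 then g vanishes
    almost everywhere.\<close>
  define m where "m = (LINT x|M. max (g x) 0)"
  have int_pm: "integrable M (\<lambda>x. max (g x) 0)" "integrable M (\<lambda>x. max (- g x) 0)" using gi by auto
  have split: "g x = max (g x) 0 - max (- g x) 0" for x by auto
  have "(LINT x|M. g x) = m - (LINT x|M. max (- g x) 0)"
    unfolding m_def by (subst split) (rule Bochner_Integration.integral_diff[OF int_pm])
  then have m': "m = (LINT x|M. max (- g x) 0)" using moments[of 0] by simp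
  have m0: "0 \<le> m" unfolding m_def by simp
  show ?thesis
  proof (cases "m = 0")
    case True
    have "AE x in M. max (g x) 0 = 0" "AE x in M. max (- g x) 0 = 0"
      using integral_nonneg_eq_0_iff_AE[OF int_pm(1)] integral_nonneg_eq_0_iff_AE[OF int_pm(2)] True m' by (auto simp: m_def)
    then have "AE x in M. g x * indicator A (Y x) = 0" by eventually_elim (auto simp: max_def split: if_splits)
    then show ?thesis by (subst integral_cong_AE[of _ _ "\<lambda>_. 0"]) (use A in auto)
  next
    case False
    then have m: "m > 0" using m0 by simp
    define \<mu> where "\<mu> h = distr (density M (\<lambda>x. ennreal (h x / m))) borel Y" for h
    have prob: "prob_space (density M (\<lambda>x. ennreal (h x / m)))"
      if "integrable M h" "\<And>x. 0 \<le> h x" "(LINT x|M. h x) = m" for h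
    proof
      have [measurable]: "h \<in> borel_measurable M" using that(1) by auto
      have "(\<integral>\<^sup>+x. ennreal (h x / m) \<partial>M) = ennreal (LINT x|M. h x / m)"
        using that m by (intro nn_integral_eq_integral) auto
      then show "emeasure (density M (\<lambda>x. ennreal (h x / m))) (space (density M (\<lambda>x. ennreal (h x / m)))) = 1"
        using that m by (simp add: emeasure_density cong: nn_integral_cong)
    qed
    have dist: "real_distribution (\<mu> h)"
      if "integrable M h" "\<And>x. 0 \<le> h x" "(LINT x|M. h x) = m" for h
      unfolding \<mu>_def using prob_space.real_distribution_distr[OF prob[OF that]] by simp
    have char: "char (\<mu> h) t = (CLINT x|M. of_real (h x) * iexp (t * Y x)) / m"
      if "integrable M h" "\<And>x. 0 \<le> h x" for h t
    proof -
      have [measurable]: "h \<in> borel_measurable M" using that(1) by auto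
      have "char (\<mu> h) t = (CLINT x|M. (h x / m) *\<^sub>R iexp (t * Y x))"
        unfolding char_def \<mu>_def using that m
        by (subst integral_distr, measurable, subst integral_density) auto
      then show ?thesis by (simp add: scaleR_conv_of_real)
    qed
    have "char (\<mu> (\<lambda>x. max (g x) 0)) = char (\<mu> (\<lambda>x. max (- g x) 0))"
    proof
      fix t
      have int: "integrable M (\<lambda>x. of_real (h x) * iexp (t * Y x))" if "integrable M h" for h
        using that by (intro Bochner_Integration.integrable_bound[OF that]) (auto simp: norm_mult)
      have "(CLINT x|M. of_real (max (g x) 0) * iexp (t * Y x)) - (CLINT x|M. of_real (max (- g x) 0) * iexp (t * Y x))
          = (CLINT x|M. of_real (max (g x) 0) * iexp (t * Y x) - of_real (max (- g x) 0) * iexp (t * Y x))"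
        by (rule Bochner_Integration.integral_diff[symmetric]) (intro int int_pm)+
      also have "\<dots> = (CLINT x|M. of_real (g x) * iexp (t * Y x))"
        by (intro Bochner_Integration.integral_cong refl) (auto simp: max_def)
      finally show "char (\<mu> (\<lambda>x. max (g x) 0)) t = char (\<mu> (\<lambda>x. max (- g x) 0)) t"
        unfolding char[OF int_pm(1) max.cobounded2] char[OF int_pm(2) max.cobounded2] fourier by simp
    qed
    then have eq: "\<mu> (\<lambda>x. max (g x) 0) = \<mu> (\<lambda>x. max (- g x) 0)"
      using int_pm m' by (intro Levy_uniqueness dist) (auto simp: m_def)
    have val: "ennreal (LINT x|M. h x / m * indicator A (Y x)) = emeasure (\<mu> h) A"
      if "integrable M h" "\<And>x. 0 \<le> h x" for h
    proof -
      have [measurable]: "h \<in> borel_measurable M" using that(1) by auto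
      have "integrable M (\<lambda>x. h x / m * indicator A (Y x))"
        by (rule Bochner_Integration.integrable_bound[OF integrable_divide[OF that(1), of m]])
           (use A m in \<open>auto simp: abs_mult indicator_def\<close>)
      then have "ennreal (LINT x|M. h x / m * indicator A (Y x)) = (\<integral>\<^sup>+x. ennreal (h x / m * indicator A (Y x)) \<partial>M)"
        using that m by (intro nn_integral_eq_integral[symmetric]) auto
      also have "\<dots> = (\<integral>\<^sup>+x. ennreal (h x / m) * indicator (Y -` A \<inter> space M) x \<partial>M)"
        by (intro nn_integral_cong) (auto simp: indicator_def)
      also have "\<dots> = emeasure (\<mu> h) A"
        unfolding \<mu>_def using A by (subst emeasure_distr, simp, simp, subst emeasure_density) auto
      finally show ?thesis .
    qed
    have "ennreal (LINT x|M. max (g x) 0 / m * indicator A (Y x)) = ennreal (LINT x|M. max (- g x) 0 / m * indicator A (Y x))"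
      using val[OF int_pm(1) max.cobounded2] val[OF int_pm(2) max.cobounded2] eq by simp
    then have e: "(LINT x|M. max (g x) 0 / m * indicator A (Y x)) = (LINT x|M. max (- g x) 0 / m * indicator A (Y x))"
      using m by (subst (asm) ennreal_inj) auto
    have int: "integrable M (\<lambda>x. h x / m * indicator A (Y x))" if "integrable M h" for h
      by (rule Bochner_Integration.integrable_bound[OF integrable_divide[OF that(1), of m]])
         (use A m that in \<open>auto simp: abs_mult indicator_def\<close>)
    have "(LINT x|M. g x * indicator A (Y x)) =
        (LINT x|M. m * (max (g x) 0 / m * indicator A (Y x) - max (- g x) 0 / m * indicator A (Y x)))"
      using m by (intro Bochner_Integration.integral_cong refl) (auto simp: max_def indicator_def)
    also have "\<dots> = m * ((LINT x|M. max (g x) 0 / m * indicator A (Y x)) - (LINT x|M. max (- g x) 0 / m * indicator A (Y x)))"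
      by (simp only: integral_mult_right_zero Bochner_Integration.integral_diff[OF int int, OF int_pm])
    finally show ?thesis using e by simp
  qed
qed

context gaussian_weights
begin

lemma integrable_mult_tame:
  assumes h: "h \<in> borel_measurable gaussian_seq" "integrable gaussian_seq (\<lambda>y. (h y)\<^sup>2)" and T: "tame T"
  shows "integrable gaussian_seq (\<lambda>y. h y * T y :: real)"
proof (rule Bochner_Integration.integrable_bound)
  show "integrable gaussian_seq (\<lambda>y. (h y)\<^sup>2 + T y * T y)"
    by (intro Bochner_Integration.integrable_add h tame_integrable tame_mult T)
  show "AE y in gaussian_seq. norm (h y * T y) \<le> norm ((h y)\<^sup>2 + T y * T y)"
  proof (rule AE_I2)
    fix y
    have "2 * (\<bar>h y\<bar> * \<bar>T y\<bar>) \<le> (h y)\<^sup>2 + T y * T y"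
      using sum_squares_bound[of "\<bar>h y\<bar>" "\<bar>T y\<bar>"] by (simp add: power2_eq_square mult.assoc)
    moreover have "0 \<le> \<bar>h y\<bar> * \<bar>T y\<bar>" by simp
    ultimately have "\<bar>h y\<bar> * \<bar>T y\<bar> \<le> (h y)\<^sup>2 + T y * T y" by linarith
    then show "norm (h y * T y) \<le> norm ((h y)\<^sup>2 + T y * T y)"
      unfolding real_norm_def abs_mult by (rule order_trans[OF _ abs_ge_self])
  qed
qed (use h(1) tame_measurable[OF T] in measurable)

lemma tame_indicator: "A \<in> sets borel \<Longrightarrow> tame (\<lambda>y. indicator A (y j) :: real)"
  by (rule tame_coordinate[where C = 1 and k = 0]) (auto simp: indicator_def)

lemma tame_exp_coordinate: "tame (\<lambda>y. exp (c * \<bar>y j\<bar>))"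
proof (rule tame_coordinate[where C = 1 and k = "\<bar>c\<bar>" and g = "\<lambda>t. exp (c * \<bar>t\<bar>)"])
  show "\<bar>exp (c * \<bar>t\<bar>)\<bar> \<le> 1 * exp (\<bar>c\<bar> * \<bar>t\<bar>)" for t :: real by (simp add: mult_right_mono)
qed auto

text \<open>Hermite factors are replaced by indicator functions one coordinate at a time.\<close>

lemma hermite_complete_rectangle:
  assumes h: "h \<in> borel_measurable gaussian_seq" "integrable gaussian_seq (\<lambda>y. (h y)\<^sup>2)"
    and zero: "\<And>\<nu>. \<nu> \<in> multi_idx \<Longrightarrow> (LINT y|gaussian_seq. h y * hermite_prod \<nu> y) = 0"
    and A: "\<And>i. A i \<in> sets borel"
    and \<nu>: "\<nu> \<in> multi_idx" "\<And>i. i < n \<Longrightarrow> \<nu> i = 0"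
  shows "(LINT y|gaussian_seq. h y * ((\<Prod>i<n. indicator (A i) (y i)) * hermite_prod \<nu> y)) = 0"
  using \<nu>
proof (induction n arbitrary: \<nu>)
  case (Suc n)
  define T where "T y = (\<Prod>i<n. indicator (A i) (y i)) * hermite_prod \<nu> y" for y
  have tT: "tame T"
    unfolding T_def[abs_def] by (intro tame_mult tame_prod tame_indicator A tame_hermite_prod Suc.prems) auto
  have "(LINT y|gaussian_seq. (h y * T y) * indicator (A n) (y n)) = 0"
  proof (rule expectation_indicator_eq_0[OF coordinate_measurable _ _ A])
    show "integrable gaussian_seq (\<lambda>y. h y * T y * exp (c * \<bar>y n\<bar>))" for c
      unfolding mult.assoc by (rule integrable_mult_tame[OF h]) (intro tame_mult tT tame_exp_coordinate)
    fix k
    have "\<nu>(n := 0) = \<nu>" using Suc.prems(2)[of n] by auto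
    then have "hermite_prod (\<nu>(n := k)) y = hermite k (y n) * hermite_prod \<nu> y" for y
      using hermite_prod_update[OF Suc.prems(1), of n k y] by simp
    then have eq: "h y * T y * hermite k (y n) = h y * ((\<Prod>i<n. indicator (A i) (y i)) * hermite_prod (\<nu>(n := k)) y)" for y
      by (simp add: T_def mult_ac)
    show "(LINT y|gaussian_seq. h y * T y * hermite k (y n)) = 0"
      unfolding eq by (rule Suc.IH[OF multi_idx_update[OF Suc.prems(1)]]) (use Suc.prems(2) in auto)
  qed
  then show ?case by (simp add: T_def mult_ac)
qed (use zero in simp)

text \<open>The measures whose densities p and n are the positive and negative parts of h agree on
  finite-dimensional rectangles, hence everywhere. So p = n almost surely, and as one of them is
  always 0, h = 0.\<close>

lemma hermite_complete_real:
  assumes h: "h \<in> borel_measurable gaussian_seq" "integrable gaussian_seq (\<lambda>y. (h y)\<^sup>2)"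
    and zero: "\<And>\<nu>. \<nu> \<in> multi_idx \<Longrightarrow> (LINT y|gaussian_seq. h y * hermite_prod \<nu> y) = 0"
  shows "AE y in gaussian_seq. h y = 0"
proof -
  note [measurable] = h(1)
  have hi: "integrable gaussian_seq h"
    using integrable_mult_tame[OF h tame_const[of 1]] by simp
  define p where "p y = max (h y) 0" for y
  define n where "n y = max (- h y) 0" for y
  have [measurable]: "p \<in> borel_measurable gaussian_seq" "n \<in> borel_measurable gaussian_seq"
    unfolding p_def[abs_def] n_def[abs_def] by measurable
  have int: "integrable gaussian_seq p" "integrable gaussian_seq n"
    unfolding p_def[abs_def] n_def[abs_def] using hi by auto
  have "density gaussian_seq (\<lambda>y. ennreal (p y)) = density gaussian_seq (\<lambda>y. ennreal (n y))"
  proof (rule measure_eqI_PiM_infinite)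
    show "finite_measure (density gaussian_seq (\<lambda>y. ennreal (p y)))"
    proof (rule finite_measureI)
      have "(\<integral>\<^sup>+y. ennreal (p y) \<partial>gaussian_seq) = ennreal (LINT y|gaussian_seq. p y)"
        by (rule nn_integral_eq_integral[OF int(1)]) (simp add: p_def)
      then show "emeasure (density gaussian_seq (\<lambda>y. ennreal (p y))) (space (density gaussian_seq (\<lambda>y. ennreal (p y)))) \<noteq> \<infinity>"
        by (subst emeasure_density) simp_all
    qed
    fix A :: "nat \<Rightarrow> real set" and J :: "nat set"
    assume J: "finite J" and A: "\<And>i. i \<in> J \<Longrightarrow> A i \<in> sets gaussian"
    obtain N where N: "\<And>i. i \<in> J \<Longrightarrow> i < N" using J unfolding finite_nat_set_iff_bounded by blast
    \<comment> \<open>The rectangle over J is padded with UNIV to one over an initial segment of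
      coordinates.\<close>
    define B where "B i = (if i \<in> J then A i else UNIV)" for i
    have B: "B i \<in> sets borel" for i using A by (auto simp: B_def)
    define E where "E = prod_emb UNIV (\<lambda>_. gaussian) J (Pi\<^sub>E J A)"
    have E_sets: "E \<in> sets gaussian_seq"
      unfolding E_def sets_gaussian_seq_PiM using J A by (intro sets_PiM_I) auto
    have ind: "indicator E y = (\<Prod>i<N. indicator (B i) (y i) :: real)" for y
    proof -
      have "y \<in> E \<longleftrightarrow> (\<forall>i<N. y i \<in> B i)"
        unfolding E_def B_def prod_emb_def using N by (auto simp: PiE_iff)
      moreover have "(\<Prod>i<N. indicator (B i) (y i) :: real) = (if \<forall>i<N. y i \<in> B i then 1 else 0)"
        by (auto simp: indicator_def)
      ultimately show ?thesis by (simp add: indicator_def)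
    qed
    have zi: "(\<lambda>_. 0) \<in> multi_idx" by (simp add: multi_idx_def)
    have "(LINT y|gaussian_seq. h y * indicator E y) = 0"
      using hermite_complete_rectangle[OF h zero B zi, of N] by (simp add: ind)
    moreover have "(LINT y|gaussian_seq. h y * indicator E y)
        = (LINT y|gaussian_seq. p y * indicator E y - n y * indicator E y)"
      by (intro Bochner_Integration.integral_cong refl) (auto simp: p_def n_def max_def)
    moreover have intE: "integrable gaussian_seq (\<lambda>y. p y * indicator E y)" "integrable gaussian_seq (\<lambda>y. n y * indicator E y)"
      using E_sets int by (auto intro: integrable_real_mult_indicator)
    ultimately have eq: "(LINT y|gaussian_seq. p y * indicator E y) = (LINT y|gaussian_seq. n y * indicator E y)" by simp
    have val: "emeasure (density gaussian_seq (\<lambda>y. ennreal (g y))) E = ennreal (LINT y|gaussian_seq. g y * indicator E y)"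
      if "integrable gaussian_seq (\<lambda>y. g y * indicator E y)" "\<And>y. 0 \<le> g y" "g \<in> borel_measurable gaussian_seq" for g
    proof -
      have val: "emeasure (density gaussian_seq (\<lambda>y. ennreal (g y))) E = (\<integral>\<^sup>+y. ennreal (g y * indicator E y) \<partial>gaussian_seq)"
        using that E_sets by (subst emeasure_density) (auto intro!: nn_integral_cong simp: indicator_def)
      also have "\<dots> = ennreal (LINT y|gaussian_seq. g y * indicator E y)"
        using that by (intro nn_integral_eq_integral) auto
      finally show ?thesis .
    qed
    have pos: "\<And>y. 0 \<le> p y" "\<And>y. 0 \<le> n y" by (simp_all add: p_def n_def)
    show "emeasure (density gaussian_seq (\<lambda>y. ennreal (p y))) (prod_emb UNIV (\<lambda>_. gaussian) J (Pi\<^sub>E J A))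
        = emeasure (density gaussian_seq (\<lambda>y. ennreal (n y))) (prod_emb UNIV (\<lambda>_. gaussian) J (Pi\<^sub>E J A))"
      unfolding E_def[symmetric] using val[OF intE(1) pos(1)] val[OF intE(2) pos(2)] eq by simp
  qed (simp_all add: sets_gaussian_seq_PiM)
  then have "AE y in gaussian_seq. ennreal (p y) = ennreal (n y)"
    by (subst (asm) gaussian_seq.density_unique_iff) auto
  then show ?thesis
    by eventually_elim (auto simp: p_def n_def max_def split: if_splits)
qed

text \<open>Scalar completeness is applied to r . v for v in a countable dense set. If r y \<noteq>
  0, the open half space of all v with r y . v > 0 would meet that set.\<close>

lemma hermite_complete:
  fixes r :: "(nat \<Rightarrow> real) \<Rightarrow> 'v::{real_inner,banach,second_countable_topology}"
  assumes r: "r \<in> borel_measurable gaussian_seq" "integrable gaussian_seq (\<lambda>y. (norm (r y))\<^sup>2)"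
    and int: "\<And>\<nu>. \<nu> \<in> multi_idx \<Longrightarrow> integrable gaussian_seq (\<lambda>y. hermite_prod \<nu> y *\<^sub>R r y)"
    and zero: "\<And>\<nu>. \<nu> \<in> multi_idx \<Longrightarrow> coeff r \<nu> = 0"
  shows "AE y in gaussian_seq. r y = 0"
proof -
  note [measurable] = r(1)
  have *: "AE y in gaussian_seq. r y \<bullet> v = 0" for v
  proof (rule hermite_complete_real)
    show "integrable gaussian_seq (\<lambda>y. (r y \<bullet> v)\<^sup>2)"
    proof (rule Bochner_Integration.integrable_bound[OF integrable_mult_right[OF r(2), of "(norm v)\<^sup>2"]])
      have "(r y \<bullet> v)\<^sup>2 \<le> (norm v)\<^sup>2 * (norm (r y))\<^sup>2" for y
        using power_mono[OF Cauchy_Schwarz_ineq2[of "r y" v], of 2] by (simp add: power_mult_distrib mult.commute)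
      then show "AE y in gaussian_seq. norm ((r y \<bullet> v)\<^sup>2) \<le> norm ((norm v)\<^sup>2 * (norm (r y))\<^sup>2)" by simp
    qed measurable
    show "(LINT y|gaussian_seq. (r y \<bullet> v) * hermite_prod \<nu> y) = 0" if "\<nu> \<in> multi_idx" for \<nu>
      using inner_integral_scaleR[OF int[OF that], of v] zero[OF that] by (simp add: coeff_def mult.commute)
  qed measurable
  obtain S :: "'v set" where S: "countable S" "\<And>X. open X \<Longrightarrow> X \<noteq> {} \<Longrightarrow> \<exists>d\<in>S. d \<in> X"
    using countable_dense_exists by blast
  have "AE y in gaussian_seq. \<forall>v\<in>S. r y \<bullet> v = 0"
    using S(1) * by (simp add: AE_ball_countable)
  then show ?thesis
  proof eventually_elim
    case (elim y)
    show ?case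
    proof (rule ccontr)
      assume "r y \<noteq> 0"
      then have "open {v. r y \<bullet> v > 0}" "r y \<in> {v. r y \<bullet> v > 0}"
        by (auto intro!: open_Collect_less continuous_intros)
      then obtain d where "d \<in> S" "r y \<bullet> d > 0" using S(2) by blast
      with elim show False by auto
    qed
  qed
qed

end

text \<open>Riesz-Fischer for Banach space values: a fast subsequence converges almost everywhere,
  and Fatou's lemma carries the L2 estimates to its limit.\<close>

lemma (in prob_space) L2_Cauchy_limit:
  fixes X :: "nat \<Rightarrow> 'a \<Rightarrow> 'v::{banach,second_countable_topology}"
  assumes [measurable]: "\<And>n. X n \<in> borel_measurable M"
    and cauchy: "\<And>e. e > 0 \<Longrightarrow> \<exists>N. \<forall>m\<ge>N. \<forall>n\<ge>N. (\<integral>\<^sup>+x. ennreal ((norm (X m x - X n x))\<^sup>2) \<partial>M) \<le> ennreal e"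
  obtains w where "w \<in> borel_measurable M"
    "\<And>e. e > 0 \<Longrightarrow> \<exists>N. \<forall>n\<ge>N. (\<integral>\<^sup>+x. ennreal ((norm (w x - X n x))\<^sup>2) \<partial>M) \<le> ennreal e"
proof -
  have "\<exists>r. \<forall>k. (\<forall>m\<ge>r k. \<forall>n\<ge>r k. (\<integral>\<^sup>+x. ennreal ((norm (X m x - X n x))\<^sup>2) \<partial>M) \<le> ennreal ((1/4) ^ k)) \<and> r k < r (Suc k)"
  proof (rule dependent_nat_choice)
    show "\<exists>x. \<forall>m\<ge>x. \<forall>n\<ge>x. (\<integral>\<^sup>+y. ennreal ((norm (X m y - X n y))\<^sup>2) \<partial>M) \<le> ennreal ((1/4) ^ 0)"
      using cauchy[of 1] by simp
    fix r k
    obtain N where "\<forall>m\<ge>N. \<forall>n\<ge>N. (\<integral>\<^sup>+x. ennreal ((norm (X m x - X n x))\<^sup>2) \<partial>M) \<le> ennreal ((1/4) ^ Suc k)"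
      using cauchy[of "(1/4) ^ Suc k"] by auto
    then show "\<exists>r'. (\<forall>m\<ge>r'. \<forall>n\<ge>r'. (\<integral>\<^sup>+x. ennreal ((norm (X m x - X n x))\<^sup>2) \<partial>M) \<le> ennreal ((1/4) ^ Suc k)) \<and> r < r'"
      by (intro exI[of _ "max N (Suc r)"]) auto
  qed
  then obtain r where r: "\<And>k m n. m \<ge> r k \<Longrightarrow> n \<ge> r k \<Longrightarrow> (\<integral>\<^sup>+x. ennreal ((norm (X m x - X n x))\<^sup>2) \<partial>M) \<le> ennreal ((1/4) ^ k)"
    and r': "\<And>k. r k < r (Suc k)" by blast
  have r_mono: "strict_mono r" using r' by (rule strict_monoI_Suc)
  define g where "g k x = X (r (Suc k)) x - X (r k) x" for k x
  have [measurable]: "g k \<in> borel_measurable M" for k unfolding g_def[abs_def] by measurable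
  have g_int: "(\<integral>\<^sup>+x. ennreal (norm (g k x)) \<partial>M) \<le> ennreal (2 * (1/2) ^ k)" for k
  proof -
    \<comment> \<open>Young's inequality with weight 2^k turns the bound 4^(-k) on the squared L2
      norm into the summable L1 bound 2 * 2^(-k).\<close>
    have "norm (g k x) \<le> (1/2) ^ k + 2 ^ k * (norm (g k x))\<^sup>2" for x
    proof -
      have "(1/2) ^ k * (2 * (2 ^ k * norm (g k x)) * 1) \<le> (1/2) ^ k * ((2 ^ k * norm (g k x))\<^sup>2 + 1\<^sup>2)"
        by (intro mult_left_mono sum_squares_bound) simp
      then have "2 * norm (g k x) \<le> 2 ^ k * (norm (g k x))\<^sup>2 + (1/2) ^ k"
        by (simp add: power2_eq_square power_one_over field_simps)
      then show ?thesis using norm_ge_zero[of "g k x"] by linarith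
    qed
    then have "(\<integral>\<^sup>+x. ennreal (norm (g k x)) \<partial>M) \<le> (\<integral>\<^sup>+x. ennreal ((1/2) ^ k) + ennreal (2 ^ k) * ennreal ((norm (g k x))\<^sup>2) \<partial>M)"
      by (intro nn_integral_mono) (simp add: ennreal_mult[symmetric] ennreal_plus[symmetric] ennreal_leI del: ennreal_plus)
    also have "\<dots> = ennreal ((1/2) ^ k) + ennreal (2 ^ k) * (\<integral>\<^sup>+x. ennreal ((norm (g k x))\<^sup>2) \<partial>M)"
      by (subst nn_integral_add) (auto simp: nn_integral_cmult emeasure_space_1)
    also have "\<dots> \<le> ennreal ((1/2) ^ k) + ennreal (2 ^ k) * ennreal ((1/4) ^ k)"
      unfolding g_def using r'[of k] by (intro add_left_mono mult_left_mono r) auto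
    also have "\<dots> = ennreal ((1/2) ^ k + 2 ^ k * (1/4) ^ k)"
      by (simp add: ennreal_mult[symmetric] ennreal_plus[symmetric] del: ennreal_plus)
    also have "(1/2) ^ k + 2 ^ k * (1/4) ^ k = 2 * (1/2 :: real) ^ k"
      by (simp add: power_mult_distrib[symmetric])
    finally show ?thesis .
  qed
  have "(\<integral>\<^sup>+x. (\<Sum>k. ennreal (norm (g k x))) \<partial>M) = (\<Sum>k. \<integral>\<^sup>+x. ennreal (norm (g k x)) \<partial>M)"
    by (rule nn_integral_suminf) measurable
  also have "\<dots> \<le> (\<Sum>k. ennreal (2 * (1/2) ^ k))"
    by (intro suminf_le g_int) auto
  also have "\<dots> = ennreal (\<Sum>k. 2 * (1/2) ^ k)"
    by (rule suminf_ennreal2) (auto intro: summable_mult summable_geometric)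
  finally have "(\<integral>\<^sup>+x. (\<Sum>k. ennreal (norm (g k x))) \<partial>M) \<noteq> \<infinity>" by (auto simp: top_unique)
  then have "AE x in M. (\<Sum>k. ennreal (norm (g k x))) \<noteq> \<infinity>"
    by (intro nn_integral_PInf_AE) auto
  then have conv: "AE x in M. convergent (\<lambda>k. X (r k) x)"
  proof eventually_elim
    case (elim x)
    have "summable (\<lambda>k. norm (g k x))" by (rule summable_suminf_not_top) (use elim in auto)
    then have "convergent (\<lambda>n. \<Sum>k<n. g k x)"
      unfolding summable_iff_convergent[symmetric] by (rule summable_norm_cancel)
    moreover have "(\<Sum>k<n. g k x) = X (r n) x - X (r 0) x" for n
      unfolding g_def by (rule sum_lessThan_telescope)
    ultimately have "convergent (\<lambda>n. (X (r n) x - X (r 0) x) + X (r 0) x)"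
      by (intro convergent_add convergent_const) simp
    then show ?case by simp
  qed
  define w where "w x = lim (\<lambda>k. X (r k) x)" for x
  have [measurable]: "w \<in> borel_measurable M" unfolding w_def[abs_def] by measurable
  have lim: "AE x in M. (\<lambda>k. X (r k) x) \<longlonglongrightarrow> w x"
    using conv by eventually_elim (simp add: w_def convergent_LIMSEQ_iff)
  show ?thesis
  proof (rule that)
    fix e :: real assume "e > 0"
    then obtain N where N: "\<And>m n. m \<ge> N \<Longrightarrow> n \<ge> N \<Longrightarrow> (\<integral>\<^sup>+x. ennreal ((norm (X m x - X n x))\<^sup>2) \<partial>M) \<le> ennreal e"
      using cauchy by blast
    have "(\<integral>\<^sup>+x. ennreal ((norm (w x - X n x))\<^sup>2) \<partial>M) \<le> ennreal e" if "n \<ge> N" for n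
    proof -
      have "(\<integral>\<^sup>+x. ennreal ((norm (w x - X n x))\<^sup>2) \<partial>M)
          = (\<integral>\<^sup>+x. liminf (\<lambda>k. ennreal ((norm (X (r k) x - X n x))\<^sup>2)) \<partial>M)"
      proof (rule nn_integral_cong_AE)
        show "AE x in M. ennreal ((norm (w x - X n x))\<^sup>2) = liminf (\<lambda>k. ennreal ((norm (X (r k) x - X n x))\<^sup>2))"
          using lim
        proof eventually_elim
          case (elim x)
          have "(\<lambda>k. ennreal ((norm (X (r k) x - X n x))\<^sup>2)) \<longlonglongrightarrow> ennreal ((norm (w x - X n x))\<^sup>2)"
            by (intro tendsto_ennrealI tendsto_power tendsto_norm tendsto_diff elim tendsto_const)
          from lim_imp_Liminf[OF _ this] show ?case by simp
        qed
      qed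
      also have "\<dots> \<le> liminf (\<lambda>k. \<integral>\<^sup>+x. ennreal ((norm (X (r k) x - X n x))\<^sup>2) \<partial>M)"
        by (rule nn_integral_liminf) measurable
      also have "\<dots> \<le> liminf (\<lambda>k::nat. ennreal e)"
      proof (rule Liminf_mono, unfold eventually_sequentially, intro exI allI impI)
        fix k assume "k \<ge> N"
        then have "r k \<ge> N" using seq_suble[OF r_mono, of k] by linarith
        then show "(\<integral>\<^sup>+x. ennreal ((norm (X (r k) x - X n x))\<^sup>2) \<partial>M) \<le> ennreal e" using that by (rule N)
      qed
      also have "\<dots> = ennreal e" by (simp add: Liminf_const)
      finally show ?thesis .
    qed
    then show "\<exists>N. \<forall>n\<ge>N. (\<integral>\<^sup>+x. ennreal ((norm (w x - X n x))\<^sup>2) \<partial>M) \<le> ennreal e" by blast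
  qed measurable
qed

lemma countable_multi_idx: "countable multi_idx"
proof -
  have "multi_idx \<subseteq> (\<lambda>xs i. if i < length xs then xs ! i else 0) ` (UNIV :: nat list set)"
  proof
    fix \<nu> assume "\<nu> \<in> multi_idx"
    then obtain n where n: "\<And>i. \<nu> i \<noteq> 0 \<Longrightarrow> i < n"
      unfolding multi_idx_def using finite_nat_set_iff_bounded by auto
    have "\<nu> = (\<lambda>i. if i < length (map \<nu> [0..<n]) then map \<nu> [0..<n] ! i else 0)"
      using n by (auto simp: fun_eq_iff)
    then show "\<nu> \<in> (\<lambda>xs i. if i < length xs then xs ! i else 0) ` (UNIV :: nat list set)" by (rule image_eqI) simp
  qed
  then show ?thesis by (rule countable_subset) auto
qed

lemma infinite_multi_idx: "infinite multi_idx"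
proof -
  have "inj (\<lambda>j i :: nat. if i = j then Suc 0 else 0)"
    by (rule injI) (metis nat.simps(3))
  then have "infinite (range (\<lambda>j i :: nat. if i = j then Suc 0 else 0))"
    using finite_imageD by blast
  moreover have "range (\<lambda>j i :: nat. if i = j then Suc 0 else 0) \<subseteq> multi_idx"
    by (auto simp: multi_idx_def)
  ultimately show ?thesis using finite_subset by blast
qed

section \<open>Parseval's identity\<close>

context gaussian_weights
begin

lemma coeff_diff:
  fixes F G :: "(nat \<Rightarrow> real) \<Rightarrow> 'v::{real_inner,banach,second_countable_topology}"
  assumes "integrable gaussian_seq (\<lambda>y. hermite_prod \<nu> y *\<^sub>R F y)" "integrable gaussian_seq (\<lambda>y. hermite_prod \<nu> y *\<^sub>R G y)"
  shows "coeff (\<lambda>y. F y - G y) \<nu> = coeff F \<nu> - coeff G \<nu>"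
  unfolding coeff_def using assms by (simp add: scaleR_diff_right)

text \<open>The error formula is applied to the sum itself: its coefficients on N are those of F, so
  the remainder is zero and the squared norm equals the sum of squares.\<close>

lemma
  fixes F :: "(nat \<Rightarrow> real) \<Rightarrow> 'v::{real_inner,banach,second_countable_topology}"
  assumes F: "tame F" and N: "finite N" "N \<subseteq> multi_idx"
  shows tame_hermite_sum: "tame (\<lambda>y. \<Sum>\<nu>\<in>N. hermite_prod \<nu> y *\<^sub>R coeff F \<nu>)" (is "tame ?G")
    and norm_hermite_sum: "(LINT y|gaussian_seq. (norm (\<Sum>\<nu>\<in>N. hermite_prod \<nu> y *\<^sub>R coeff F \<nu>))\<^sup>2)
      = (\<Sum>\<nu>\<in>N. (norm (coeff F \<nu>))\<^sup>2)"
proof -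
  show G: "tame ?G"
    using N by (induction N rule: finite_induct) (auto intro!: tame_const tame_add tame_scaleR tame_hermite_prod)
  have c: "coeff ?G \<mu> = coeff F \<mu>" if "\<mu> \<in> N" for \<mu>
  proof -
    have mu: "\<mu> \<in> multi_idx" using that N by blast
    have "coeff (\<lambda>y. F y - ?G y) \<mu> = coeff F \<mu> - coeff ?G \<mu>"
      by (intro coeff_diff tame_integrable tame_scaleR tame_hermite_prod mu F G)
    then show ?thesis using hermite_partial_sum_error(2)[OF F N mu] that by simp
  qed
  have "?G y - (\<Sum>\<nu>\<in>N. hermite_prod \<nu> y *\<^sub>R coeff ?G \<nu>) = 0" for y
  proof -
    have "(\<Sum>\<nu>\<in>N. hermite_prod \<nu> y *\<^sub>R coeff ?G \<nu>) = ?G y"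
      by (intro sum.cong refl arg_cong2[where f = "(*\<^sub>R)"] c)
    then show ?thesis by simp
  qed
  then have "(LINT y|gaussian_seq. (norm (?G y - (\<Sum>\<nu>\<in>N. hermite_prod \<nu> y *\<^sub>R coeff ?G \<nu>)))\<^sup>2) = 0"
    by (simp only: norm_zero) simp
  then show "(LINT y|gaussian_seq. (norm (?G y))\<^sup>2) = (\<Sum>\<nu>\<in>N. (norm (coeff F \<nu>))\<^sup>2)"
    unfolding hermite_partial_sum_error(3)[OF G N]
    using sum.cong[OF refl, of N "\<lambda>\<nu>. (norm (coeff ?G \<nu>))\<^sup>2" "\<lambda>\<nu>. (norm (coeff F \<nu>))\<^sup>2"] c by simp
qed

lemma nn_integral_norm_squared_tame:
  fixes F :: "(nat \<Rightarrow> real) \<Rightarrow> 'v::{real_normed_vector,second_countable_topology}"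
  assumes "tame F"
  shows "(\<integral>\<^sup>+y. ennreal ((norm (F y))\<^sup>2) \<partial>gaussian_seq) = ennreal (LINT y|gaussian_seq. (norm (F y))\<^sup>2)"
  by (rule nn_integral_eq_integral[OF tame_integrable[OF tame_norm_squared[OF assms]]]) simp

text \<open>Coefficients depend continuously on the function in L2. The crude splitting a b \<le> e
  a^2 + b^2 / e gives 2 e in place of e, which suffices for letting e tend to 0.\<close>

lemma norm_coeff_le:
  fixes D :: "(nat \<Rightarrow> real) \<Rightarrow> 'v::{real_inner,banach,second_countable_topology}"
  assumes D [measurable]: "D \<in> borel_measurable gaussian_seq" and e: "e > 0" "integrable gaussian_seq (\<lambda>y. (norm (D y))\<^sup>2)"
      "(LINT y|gaussian_seq. (norm (D y))\<^sup>2) \<le> e\<^sup>2" and \<nu>: "\<nu> \<in> multi_idx"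
  shows "integrable gaussian_seq (\<lambda>y. hermite_prod \<nu> y *\<^sub>R D y)" "norm (coeff D \<nu>) \<le> 2 * e"
proof -
  note tH = tame_hermite_prod[OF \<nu>]
  note [measurable] = tame_measurable[OF tH]
  have H1: "integrable gaussian_seq (\<lambda>y. hermite_prod \<nu> y * hermite_prod \<nu> y)"
    by (intro tame_integrable tame_mult tH)
  have H2: "(LINT y|gaussian_seq. hermite_prod \<nu> y * hermite_prod \<nu> y) = 1"
    using hermite_orthonormal[OF \<nu> \<nu>] by (simp add: coeff_def)
  have le: "norm (hermite_prod \<nu> y *\<^sub>R D y) \<le> e * (hermite_prod \<nu> y * hermite_prod \<nu> y) + (norm (D y))\<^sup>2 / e" for y
  proof -
    have "2 * (e * \<bar>hermite_prod \<nu> y\<bar>) * norm (D y) \<le> (e * \<bar>hermite_prod \<nu> y\<bar>)\<^sup>2 + (norm (D y))\<^sup>2"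
      by (rule sum_squares_bound)
    moreover have "0 \<le> (e * \<bar>hermite_prod \<nu> y\<bar>) * norm (D y)" using e by simp
    ultimately have "(e * \<bar>hermite_prod \<nu> y\<bar>) * norm (D y) \<le> (e * \<bar>hermite_prod \<nu> y\<bar>)\<^sup>2 + (norm (D y))\<^sup>2" by linarith
    then show ?thesis using e(1) by (simp add: power_mult_distrib power2_eq_square field_simps)
  qed
  have int: "integrable gaussian_seq (\<lambda>y. e * (hermite_prod \<nu> y * hermite_prod \<nu> y) + (norm (D y))\<^sup>2 / e)"
    using H1 e by simp
  show i: "integrable gaussian_seq (\<lambda>y. hermite_prod \<nu> y *\<^sub>R D y)"
  proof (rule Bochner_Integration.integrable_bound[OF int])
    show "AE y in gaussian_seq. norm (hermite_prod \<nu> y *\<^sub>R D y) \<le> norm (e * (hermite_prod \<nu> y * hermite_prod \<nu> y) + (norm (D y))\<^sup>2 / e)"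
      using order_trans[OF le abs_ge_self] by (intro AE_I2) simp
  qed measurable
  have "norm (coeff D \<nu>) \<le> (LINT y|gaussian_seq. norm (hermite_prod \<nu> y *\<^sub>R D y))"
    unfolding coeff_def by (rule integral_norm_bound)
  also have "\<dots> \<le> (LINT y|gaussian_seq. e * (hermite_prod \<nu> y * hermite_prod \<nu> y) + (norm (D y))\<^sup>2 / e)"
    by (intro integral_mono integrable_norm i int le)
  also have "\<dots> = e + (LINT y|gaussian_seq. (norm (D y))\<^sup>2) / e"
    using H1 H2 e by simp
  also have "\<dots> \<le> e + e\<^sup>2 / e" using e by (intro add_left_mono divide_right_mono) auto
  finally show "norm (coeff D \<nu>) \<le> 2 * e" using e by (simp add: power2_eq_square)
qed

text \<open>The partial sums X n are Cauchy in L2 with some limit w. All coefficients of F - w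
  vanish, so F = w almost surely by completeness; the squared error of X n, which is the part of the
  squared norm of F not yet summed, therefore tends to 0.\<close>

lemma parseval:
  fixes F :: "(nat \<Rightarrow> real) \<Rightarrow> 'v::{real_inner,banach,second_countable_topology}"
  assumes F: "tame F"
  shows "((\<lambda>\<nu>. (norm (coeff F \<nu>))\<^sup>2) has_sum (LINT y|gaussian_seq. (norm (F y))\<^sup>2)) multi_idx"
proof -
  define e where "e = from_nat_into multi_idx"
  have e: "bij_betw e UNIV multi_idx"
    unfolding e_def by (rule bij_betw_from_nat_into[OF countable_multi_idx infinite_multi_idx])
  have inj: "inj e" and e_mem: "e i \<in> multi_idx" for i using e by (auto simp: bij_betw_def)
  define c where "c i = (norm (coeff F (e i)))\<^sup>2" for i
  define X where "X n y = (\<Sum>i<n. hermite_prod (e i) y *\<^sub>R coeff F (e i))" for n y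
  have sub: "finite (e ` A)" "e ` A \<subseteq> multi_idx" if "finite A" for A using that e_mem by auto
  have X: "X n = (\<lambda>y. \<Sum>\<nu>\<in>e ` {..<n}. hermite_prod \<nu> y *\<^sub>R coeff F \<nu>)" for n
    by (simp add: X_def sum.reindex inj_on_subset[OF inj] fun_eq_iff)
  have c_sum: "(\<Sum>\<nu>\<in>e ` A. (norm (coeff F \<nu>))\<^sup>2) = sum c A" for A
    by (simp add: c_def sum.reindex inj_on_subset[OF inj])
  have tX: "tame (X n)" for n
    unfolding X by (intro tame_hermite_sum F sub) simp_all
  have err: "(LINT y|gaussian_seq. (norm (F y - X n y))\<^sup>2) = (LINT y|gaussian_seq. (norm (F y))\<^sup>2) - (\<Sum>i<n. c i)" for n
    unfolding X c_sum[symmetric] by (rule hermite_partial_sum_error(3)[OF F sub]) simp_all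
  have tR: "tame (\<lambda>y. F y - X n y)" for n
    unfolding X by (rule hermite_partial_sum_error(1)[OF F sub]) simp_all
  have "0 \<le> (LINT y|gaussian_seq. (norm (F y - X n y))\<^sup>2)" for n by simp
  then have "(\<Sum>i<n. c i) \<le> (LINT y|gaussian_seq. (norm (F y))\<^sup>2)" for n unfolding err by simp
  then have c_summable: "summable c"
    by (intro summableI_nonneg_bounded) (auto simp: c_def)
  have diff: "(\<integral>\<^sup>+y. ennreal ((norm (X m y - X n y))\<^sup>2) \<partial>gaussian_seq) = ennreal (sum c {n..<m})" if "n \<le> m" for m n
  proof -
    have "X m y - X n y = (\<Sum>i=n..<m. hermite_prod (e i) y *\<^sub>R coeff F (e i))" for y
      unfolding X_def using that by (simp add: sum_diff_nat_ivl lessThan_atLeast0)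
    then have eq: "(\<lambda>y. X m y - X n y) = (\<lambda>y. \<Sum>\<nu>\<in>e ` {n..<m}. hermite_prod \<nu> y *\<^sub>R coeff F \<nu>)"
      by (simp add: sum.reindex inj_on_subset[OF inj] fun_eq_iff)
    have "tame (\<lambda>y. \<Sum>\<nu>\<in>e ` {n..<m}. hermite_prod \<nu> y *\<^sub>R coeff F \<nu>)"
      by (rule tame_hermite_sum[OF F sub]) simp_all
    from nn_integral_norm_squared_tame[OF this] norm_hermite_sum[OF F sub, of "{n..<m}"] show ?thesis
      by (simp add: fun_cong[OF eq] c_sum)
  qed
  have cauchy: "\<exists>N. \<forall>m\<ge>N. \<forall>n\<ge>N. (\<integral>\<^sup>+y. ennreal ((norm (X m y - X n y))\<^sup>2) \<partial>gaussian_seq) \<le> ennreal \<epsilon>" if "\<epsilon> > 0" for \<epsilon>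
  proof -
    obtain N where N: "\<And>m n. n \<ge> N \<Longrightarrow> norm (sum c {n..<m}) < \<epsilon>"
      using c_summable \<open>\<epsilon> > 0\<close> unfolding summable_Cauchy by blast
    have "(\<integral>\<^sup>+y. ennreal ((norm (X m y - X n y))\<^sup>2) \<partial>gaussian_seq) \<le> ennreal \<epsilon>" if "m \<ge> N" "n \<ge> N" for m n
    proof (cases "n \<le> m")
      case True
      then show ?thesis using N[OF that(2), of m] by (auto simp: diff intro!: ennreal_leI)
    next
      case False
      then show ?thesis using N[OF that(1), of n] diff[of m n]
        by (auto simp: norm_minus_commute[of "X m _"] intro!: ennreal_leI)
    qed
    then show ?thesis by blast
  qed
  obtain w where w: "w \<in> borel_measurable gaussian_seq"
    "\<And>\<epsilon>. \<epsilon> > 0 \<Longrightarrow> \<exists>N. \<forall>n\<ge>N. (\<integral>\<^sup>+y. ennreal ((norm (w y - X n y))\<^sup>2) \<partial>gaussian_seq) \<le> ennreal \<epsilon>"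
    using gaussian_seq.L2_Cauchy_limit[of X, OF tame_measurable[OF tX] cauchy] by blast
  note [measurable] = w(1) tame_measurable[OF tX] tame_measurable[OF F]
  have close: "\<exists>N. \<forall>n\<ge>N. integrable gaussian_seq (\<lambda>y. (norm (w y - X n y))\<^sup>2) \<and>
      (LINT y|gaussian_seq. (norm (w y - X n y))\<^sup>2) \<le> \<epsilon>" if "\<epsilon> > 0" for \<epsilon>
  proof -
    obtain N where N: "\<And>n. n \<ge> N \<Longrightarrow> (\<integral>\<^sup>+y. ennreal ((norm (w y - X n y))\<^sup>2) \<partial>gaussian_seq) \<le> ennreal \<epsilon>"
      using w(2)[OF \<open>\<epsilon> > 0\<close>] by blast
    have "integrable gaussian_seq (\<lambda>y. (norm (w y - X n y))\<^sup>2) \<and>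
      (LINT y|gaussian_seq. (norm (w y - X n y))\<^sup>2) \<le> \<epsilon>" if "n \<ge> N" for n
    proof
      show i: "integrable gaussian_seq (\<lambda>y. (norm (w y - X n y))\<^sup>2)"
        using N[OF that] by (intro integrableI_bounded) (auto simp: less_top[symmetric] top_unique)
      have "ennreal (LINT y|gaussian_seq. (norm (w y - X n y))\<^sup>2) \<le> ennreal \<epsilon>"
        using N[OF that] by (subst nn_integral_eq_integral[OF i, symmetric]) auto
      then show "(LINT y|gaussian_seq. (norm (w y - X n y))\<^sup>2) \<le> \<epsilon>" using \<open>\<epsilon> > 0\<close> by simp
    qed
    then show ?thesis by blast
  qed
  have "AE y in gaussian_seq. F y - w y = 0"
  proof (rule hermite_complete)
    obtain N where N: "integrable gaussian_seq (\<lambda>y. (norm (w y - X N y))\<^sup>2)"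
      using close[of 1] by auto
    have "(norm (F y - w y))\<^sup>2 \<le> 2 * (norm (F y - X N y))\<^sup>2 + 2 * (norm (w y - X N y))\<^sup>2" for y
      using norm_add_sq_le[of "F y - X N y" "X N y - w y"] by (simp add: norm_minus_commute)
    then have le: "norm ((norm (F y - w y))\<^sup>2) \<le> norm (2 * (norm (F y - X N y))\<^sup>2 + 2 * (norm (w y - X N y))\<^sup>2)" for y
      unfolding real_norm_def abs_power2 by (rule order_trans[OF _ abs_ge_self])
    show i: "integrable gaussian_seq (\<lambda>y. (norm (F y - w y))\<^sup>2)"
    proof (rule Bochner_Integration.integrable_bound[OF _ _ AE_I2[OF le]])
      show "integrable gaussian_seq (\<lambda>y. 2 * (norm (F y - X N y))\<^sup>2 + 2 * (norm (w y - X N y))\<^sup>2)"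
        by (intro Bochner_Integration.integrable_add integrable_mult_right N tame_integrable[OF tame_norm_squared[OF tR[of N]]])
    qed measurable
    fix \<nu> assume \<nu>: "\<nu> \<in> multi_idx"
    \<comment> \<open>A \<ge> 1 ensures A \<le> A^2, the form of bound that
      \<open>norm_coeff_le\<close> takes.\<close>
    define A where "A = 1 + (LINT y|gaussian_seq. (norm (F y - w y))\<^sup>2)"
    have "1 \<le> A" unfolding A_def by simp
    then have "(LINT y|gaussian_seq. (norm (F y - w y))\<^sup>2) \<le> A\<^sup>2"
      using self_le_power[of A 2] by (simp add: A_def)
    then show int: "integrable gaussian_seq (\<lambda>y. hermite_prod \<nu> y *\<^sub>R (F y - w y))"
      using \<open>1 \<le> A\<close> by (intro norm_coeff_le(1)[OF _ _ i _ \<nu>, of A]) auto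
    have small: "norm (coeff (\<lambda>y. F y - w y) \<nu>) \<le> 2 * \<epsilon>" if \<epsilon>: "\<epsilon> > 0" for \<epsilon>
    proof -
      obtain N where N: "\<And>n. n \<ge> N \<Longrightarrow> integrable gaussian_seq (\<lambda>y. (norm (w y - X n y))\<^sup>2) \<and>
          (LINT y|gaussian_seq. (norm (w y - X n y))\<^sup>2) \<le> \<epsilon>\<^sup>2"
        using close[of "\<epsilon>\<^sup>2"] \<epsilon> by auto
      obtain i where i: "\<nu> = e i" using e \<nu> by (metis bij_betw_imp_surj_on imageE)
      \<comment> \<open>n > i puts \<nu> among the first n indices, so F - X n has zero coefficient
        there.\<close>
      define n where "n = max N (Suc i)"
      have n: "n \<ge> N" "i < n" by (auto simp: n_def)
      have R0: "coeff (\<lambda>y. F y - X n y) \<nu> = 0"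
        unfolding X using n(2) i by (subst hermite_partial_sum_error(2)[OF F sub \<nu>]) auto
      have "norm (coeff (\<lambda>y. w y - X n y) \<nu>) \<le> 2 * \<epsilon>"
        using N[OF n(1)] \<epsilon> by (intro norm_coeff_le(2)[OF _ _ _ _ \<nu>]) auto
      moreover have "coeff (\<lambda>y. (F y - X n y) - (w y - X n y)) \<nu> = coeff (\<lambda>y. F y - X n y) \<nu> - coeff (\<lambda>y. w y - X n y) \<nu>"
      proof (rule coeff_diff)
        show "integrable gaussian_seq (\<lambda>y. hermite_prod \<nu> y *\<^sub>R (F y - X n y))"
          by (intro tame_integrable tame_scaleR tame_hermite_prod[OF \<nu>] tR)
        show "integrable gaussian_seq (\<lambda>y. hermite_prod \<nu> y *\<^sub>R (w y - X n y))"
          using N[OF n(1)] \<epsilon> by (intro norm_coeff_le(1)[OF _ \<epsilon> _ _ \<nu>]) auto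
      qed
      ultimately show ?thesis using R0 by simp
    qed
    show "coeff (\<lambda>y. F y - w y) \<nu> = 0"
    proof (rule ccontr)
      assume "coeff (\<lambda>y. F y - w y) \<nu> \<noteq> 0"
      then show False using small[of "norm (coeff (\<lambda>y. F y - w y) \<nu>) / 4"] by simp
    qed
  qed measurable
  then have Fw: "(LINT y|gaussian_seq. (norm (F y - X n y))\<^sup>2) = (LINT y|gaussian_seq. (norm (w y - X n y))\<^sup>2)" for n
    by (intro integral_cong_AE) auto
  have "c sums (LINT y|gaussian_seq. (norm (F y))\<^sup>2)"
    unfolding sums_def
  proof (rule LIMSEQ_I)
    fix \<epsilon> :: real assume "\<epsilon> > 0"
    then obtain N where N: "\<And>n. n \<ge> N \<Longrightarrow> (LINT y|gaussian_seq. (norm (w y - X n y))\<^sup>2) \<le> \<epsilon> / 2"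
      using close[of "\<epsilon> / 2"] by auto
    have "norm ((\<Sum>i<n. c i) - (LINT y|gaussian_seq. (norm (F y))\<^sup>2)) < \<epsilon>" if "n \<ge> N" for n
    proof -
      have "(LINT y|gaussian_seq. (norm (F y))\<^sup>2) - (\<Sum>i<n. c i) \<le> \<epsilon> / 2"
        using N[OF that] unfolding Fw[symmetric] err .
      moreover have "0 \<le> (LINT y|gaussian_seq. (norm (F y - X n y))\<^sup>2)" by simp
      ultimately show ?thesis unfolding err real_norm_def using \<open>\<epsilon> > 0\<close> by linarith
    qed
    then show "\<exists>no. \<forall>n\<ge>no. norm ((\<Sum>i<n. c i) - (LINT y|gaussian_seq. (norm (F y))\<^sup>2)) < \<epsilon>" by blast
  qed
  moreover have "summable (\<lambda>i. norm (c i))" using c_summable by (simp add: c_def[abs_def])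
  ultimately have "(c has_sum (LINT y|gaussian_seq. (norm (F y))\<^sup>2)) UNIV"
    by (intro norm_summable_imp_has_sum)
  then show ?thesis
    unfolding c_def by (subst (asm) has_sum_reindex_bij_betw[OF e])
qed

end

section \<open>Parametric derivatives of the solution\<close>

text \<open>The bound K holds at every point, not only almost everywhere, so that all series in x
  converge pointwise without exceptional sets depending on y.\<close>

locale parametric_problem = gaussian_weights \<rho> q + diffusion_problem D \<psi> \<Psi> c f F
  for \<rho> q and D :: "'a::euclidean_space set" and \<psi> \<Psi> c f F +
  fixes K :: real
  assumes Psi_sum: "\<And>x n. (\<Sum>j<n. \<rho> j * \<bar>\<Psi> j x\<bar>) \<le> K"
begin

lemma K_nonneg: "0 \<le> K"
  using Psi_sum[of _ 0] by simp

lemma Psi_le: "\<bar>\<Psi> j x\<bar> \<le> K / \<rho> j"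
proof -
  have "\<rho> j * \<bar>\<Psi> j x\<bar> \<le> (\<Sum>i<Suc j. \<rho> i * \<bar>\<Psi> i x\<bar>)"
    using rho_pos by (intro member_le_sum) (auto simp: less_imp_le)
  with Psi_sum[of x "Suc j"] show ?thesis using rho_pos[of j] by (simp add: field_simps)
qed

lemma Psi_measurable [measurable]: "\<Psi> j \<in> borel_measurable lebesgue"
  by (rule ess_boundedD(2)[OF Psi_bounded])

lemma Psi_weighted_summable: "summable (\<lambda>j. \<rho> j * \<bar>\<Psi> j x\<bar>)"
  using Psi_sum rho_pos by (intro summableI_nonneg_bounded) (auto simp: less_imp_le)

lemma Psi_weighted_suminf: "(\<Sum>j. \<rho> j * \<bar>\<Psi> j x\<bar>) \<le> K"
  by (intro suminf_le_const Psi_weighted_summable Psi_sum)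

definition field :: "(nat \<Rightarrow> real) \<Rightarrow> 'a \<Rightarrow> real" where
  "field y x = (\<Sum>j. y j * \<Psi> j x)"

lemma field_measurable [measurable]: "field y \<in> borel_measurable lebesgue"
  unfolding field_def[abs_def] by measurable

lemma abs_term_le:
  assumes "\<bar>y j\<bar> / \<rho> j \<le> e" shows "\<bar>y j * \<Psi> j x\<bar> \<le> e * (\<rho> j * \<bar>\<Psi> j x\<bar>)"
proof -
  have "\<bar>y j\<bar> \<le> e * \<rho> j" using assms rho_pos[of j] by (simp add: field_simps)
  then have "\<bar>y j\<bar> * \<bar>\<Psi> j x\<bar> \<le> (e * \<rho> j) * \<bar>\<Psi> j x\<bar>" by (rule mult_right_mono) simp
  then show ?thesis by (simp add: abs_mult mult_ac)
qed

lemma abs_summable_field: "y \<in> good \<Longrightarrow> summable (\<lambda>j. \<bar>y j * \<Psi> j x\<bar>)"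
  by (rule summable_comparison_test'[OF summable_mult[OF Psi_weighted_summable[of x], of "size y"], of 0])
     (simp add: abs_term_le[OF le_size])

lemma summable_field: "y \<in> good \<Longrightarrow> summable (\<lambda>j. y j * \<Psi> j x)"
  by (rule summable_rabs_cancel[OF abs_summable_field])

lemma field_bounded:
  assumes y: "y \<in> good" shows "ess_bounded (field y) (K * size y)"
  unfolding ess_bounded_def
proof (intro conjI AE_I2)
  fix x
  have "\<bar>field y x\<bar> \<le> (\<Sum>j. \<bar>y j * \<Psi> j x\<bar>)"
    unfolding field_def by (rule summable_rabs[OF abs_summable_field[OF y]])
  also have "\<dots> \<le> (\<Sum>j. size y * (\<rho> j * \<bar>\<Psi> j x\<bar>))"
    by (intro suminf_le abs_term_le le_size y abs_summable_field summable_mult Psi_weighted_summable)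
  also have "\<dots> = size y * (\<Sum>j. \<rho> j * \<bar>\<Psi> j x\<bar>)"
    by (rule suminf_mult[OF Psi_weighted_summable])
  also have "\<dots> \<le> size y * K"
    by (intro mult_left_mono Psi_weighted_suminf size_nonneg y)
  finally show "\<bar>field y x\<bar> \<le> K * size y" by (simp add: mult.commute)
qed (use K_nonneg size_nonneg[OF y] in auto)

text \<open>Beyond index n the ratios |y_j| / \<rho>_j are at most e', so the tail of the series is
  at most e' K, uniformly in x.\<close>

lemma field_limit:
  assumes y: "y \<in> good" shows "ess_uniform_limit (partial y) (field y)"
  unfolding ess_uniform_limit_def
proof (intro allI impI)
  fix e :: real assume e: "e > 0"
  define e' where "e' = e / (K + 1)"
  have e': "e' > 0" "e' * K \<le> e" using e K_nonneg by (auto simp: e'_def field_simps)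
  have "\<forall>\<^sub>F j in sequentially. \<bar>y j\<bar> / \<rho> j < e'"
    using y e'(1) unfolding good_def by (intro order_tendstoD) auto
  then obtain N where N: "\<And>j. j \<ge> N \<Longrightarrow> \<bar>y j\<bar> / \<rho> j \<le> e'"
    unfolding eventually_sequentially by (meson less_imp_le)
  have "\<bar>partial y n x - field y x\<bar> \<le> e" if "n \<ge> N" for n x
  proof -
    have "field y x = (\<Sum>j. y (j + n) * \<Psi> (j + n) x) + partial y n x"
      unfolding field_def partial_def by (rule suminf_split_initial_segment[OF summable_field[OF y]])
    then have "\<bar>partial y n x - field y x\<bar> = \<bar>\<Sum>j. y (j + n) * \<Psi> (j + n) x\<bar>" by simp
    also have "\<dots> \<le> (\<Sum>j. \<bar>y (j + n) * \<Psi> (j + n) x\<bar>)"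
      using abs_summable_field[OF y, of x] by (intro summable_rabs) (subst summable_iff_shift)
    also have "\<dots> \<le> (\<Sum>j. e' * (\<rho> (j + n) * \<bar>\<Psi> (j + n) x\<bar>))"
    proof (rule suminf_le)
      show "summable (\<lambda>j. \<bar>y (j + n) * \<Psi> (j + n) x\<bar>)"
        using abs_summable_field[OF y, of x] by (subst summable_iff_shift)
      have "summable (\<lambda>j. \<rho> (j + n) * \<bar>\<Psi> (j + n) x\<bar>)"
        using Psi_weighted_summable[of x] by (subst summable_iff_shift)
      then show "summable (\<lambda>j. e' * (\<rho> (j + n) * \<bar>\<Psi> (j + n) x\<bar>))" by (rule summable_mult)
    qed (use N that in \<open>intro abs_term_le; simp\<close>)
    also have "\<dots> = e' * (\<Sum>j. \<rho> (j + n) * \<bar>\<Psi> (j + n) x\<bar>)"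
      using Psi_weighted_summable[of x] by (intro suminf_mult) (subst summable_iff_shift)
    also have "\<dots> \<le> e' * (\<Sum>j. \<rho> j * \<bar>\<Psi> j x\<bar>)"
    proof (rule mult_left_mono)
      have "0 \<le> (\<Sum>j<n. \<rho> j * \<bar>\<Psi> j x\<bar>)" using rho_pos by (intro sum_nonneg) (simp add: less_imp_le)
      then show "(\<Sum>j. \<rho> (j + n) * \<bar>\<Psi> (j + n) x\<bar>) \<le> (\<Sum>j. \<rho> j * \<bar>\<Psi> j x\<bar>)"
        using suminf_split_initial_segment[OF Psi_weighted_summable[of x], of n] by simp
    qed (use e'(1) in simp)
    also have "\<dots> \<le> e' * K" using e'(1) by (intro mult_left_mono Psi_weighted_suminf) simp
    finally show ?thesis using e'(2) by simp
  qed
  then show "\<exists>N. \<forall>n\<ge>N. AE x in lebesgue. \<bar>partial y n x - field y x\<bar> \<le> e"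
    by (intro exI[of _ N]) simp
qed

lemma field_update:
  assumes y: "y \<in> good" shows "field (y(j := y j + h)) x = field y x + h * \<Psi> j x"
proof -
  have "(\<lambda>i. if i = j then h * \<Psi> j x else 0) sums (h * \<Psi> j x)" by (rule sums_single)
  then have "(\<lambda>i. y i * \<Psi> i x + (if i = j then h * \<Psi> j x else 0)) sums (field y x + h * \<Psi> j x)"
    unfolding field_def by (intro sums_add summable_sums summable_field y)
  moreover have "y i * \<Psi> i x + (if i = j then h * \<Psi> j x else 0) = (y(j := y j + h)) i * \<Psi> i x" for i
    by (simp add: distrib_right)
  ultimately show ?thesis unfolding field_def by (simp add: sums_iff)
qed

text \<open>A label \<open>(j, i)\<close> stands for one differentiation with respect to \<open>y\<^sub>j\<close>.  Distinct labels
  of the same direction turn the multi-index Leibniz rule into a sum over subsets, without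
  binomial coefficients.\<close>

definition A :: "(nat \<Rightarrow> real) \<Rightarrow> (nat \<times> nat) set \<Rightarrow> ('a, 'a) L2 \<Rightarrow>\<^sub>L ('a, 'a) L2" where
  "A y U = mult_L2 (\<lambda>x. exp (field y x) * (\<Prod>l\<in>U. \<Psi> (fst l) x))"

text \<open>The Leibniz rule for differentiating the equation in the directions of S, solved for the
  term T = S, whose operator is \<open>A y {}\<close>. The source does not depend on y and survives
  only for S = {}. Infinite S get the default 0, so that cardinality is a termination
  measure.\<close>

function Du :: "(nat \<Rightarrow> real) \<Rightarrow> (nat \<times> nat) set \<Rightarrow> ('a, 'a) L2" where
  "Du y S = (if finite S then solve (grads D) (A y {})
     ((if S = {} then F else 0) - (\<Sum>T\<in>Pow S - {S}. A y (S - T) (Du y T))) else 0)"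
  by auto
termination
proof (relation "inv_image less_than (\<lambda>(y, S). card S)")
  fix S T :: "(nat \<times> nat) set" and y :: "nat \<Rightarrow> real"
  assume "finite S" "T \<in> Pow S - {S}"
  then show "((y, T), y, S) \<in> inv_image less_than (\<lambda>(y, S). card S)"
    by (auto intro!: psubset_card_mono)
qed simp

declare Du.simps [simp del]

lemma prod_Psi_bounded: "finite U \<Longrightarrow> ess_bounded (\<lambda>x. \<Prod>l\<in>U. \<Psi> (fst l) x) (\<Prod>l\<in>U. c (fst l))"
  by (induction U rule: finite_induct)
     (use ess_bounded_const[of 1] in \<open>simp_all add: ess_bounded_mult[OF Psi_bounded]\<close>)

lemma A_bounded:
  assumes "y \<in> good" "finite U"
  shows "ess_bounded (\<lambda>x. exp (field y x) * (\<Prod>l\<in>U. \<Psi> (fst l) x)) (exp (K * size y) * (\<Prod>l\<in>U. c (fst l)))"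
  by (intro ess_bounded_mult ess_bounded_exp(1) field_bounded prod_Psi_bounded assms)

lemma A_coercive: "y \<in> good \<Longrightarrow> coercive_on (grads D) (exp (- (K * size y))) (A y {})"
  using coercive_on_mult_L2_exp[OF field_bounded] by (simp add: A_def)

lemma Du_in_grads: "y \<in> good \<Longrightarrow> finite S \<Longrightarrow> Du y S \<in> grads D"
  by (subst Du.simps) (simp add: solve_in_G[OF A_coercive])

lemma Du_empty: "Du y {} = sol (field y)"
  by (subst Du.simps) (simp add: sol_def A_def)

lemma Du_equation:
  assumes y: "y \<in> good" and S: "finite S" and v: "v \<in> grads D"
  shows "A y {} (Du y S) \<bullet> v = (if S = {} then F \<bullet> v else 0) - (\<Sum>T\<in>Pow S - {S}. A y (S - T) (Du y T) \<bullet> v)"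
  by (subst Du.simps) (simp add: S inner_solve[OF A_coercive[OF y] v] inner_diff_left inner_sum_left)

lemma A_update:
  assumes y: "y \<in> good" and U: "finite U" "l \<notin> U"
  shows "((\<lambda>h. A (y(fst l := y (fst l) + h)) U) has_vector_derivative A y (insert l U)) (at 0)"
proof -
  have "A (y(fst l := y (fst l) + h)) U = mult_L2 (\<lambda>x. exp (field y x) * (\<Prod>l\<in>U. \<Psi> (fst l) x) * exp (h * \<Psi> (fst l) x))" for h
    by (simp add: A_def field_update[OF y] exp_add mult_ac)
  moreover have "A y (insert l U) = mult_L2 (\<lambda>x. exp (field y x) * (\<Prod>l\<in>U. \<Psi> (fst l) x) * \<Psi> (fst l) x)"
    using U by (simp add: A_def mult_ac)
  ultimately show ?thesis
    using mult_L2_exp_has_vector_derivative[OF A_bounded[OF y U(1)] Psi_bounded[of "fst l"]] by simp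
qed

lemma good_shift: "y \<in> good \<Longrightarrow> y(j := y j + h) \<in> good"
  by (simp add: good_update)

lemma solve_A_update:
  assumes y: "y \<in> good"
  shows "((\<lambda>h. solve (grads D) (A (y(fst l := y (fst l) + h)) {})) has_vector_derivative
    - (solve (grads D) (A y {}) o\<^sub>L A y {l} o\<^sub>L solve (grads D) (A y {}))) (at 0)"
proof -
  let ?j = "fst l"
  have "((\<lambda>h. solve (grads D) (A (y(?j := y ?j + h)) {})) has_vector_derivative
    - (solve (grads D) (A (y(?j := y ?j + 0)) {}) o\<^sub>L A y {l} o\<^sub>L solve (grads D) (A (y(?j := y ?j + 0)) {}))) (at 0)"
  proof (rule solve_has_vector_derivative)
    show "coercive_on (grads D) (exp (- (K * size (y(?j := y ?j + h))))) (A (y(?j := y ?j + h)) {})" for h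
      by (intro A_coercive good_shift y)
    show "exp (- (K * (size y + (\<bar>y ?j\<bar> + 1) / \<rho> ?j))) \<le> exp (- (K * size (y(?j := y ?j + h))))"
      if "\<bar>h\<bar> \<le> 1" for h
    proof -
      have "\<bar>y ?j + h\<bar> / \<rho> ?j \<le> (\<bar>y ?j\<bar> + 1) / \<rho> ?j"
        using that rho_pos[of ?j] by (intro divide_right_mono) auto
      then have "size (y(?j := y ?j + h)) \<le> size y + (\<bar>y ?j\<bar> + 1) / \<rho> ?j"
        using size_update[OF y, of ?j "y ?j + h"] by linarith
      then show ?thesis using K_nonneg by (simp add: mult_left_mono)
    qed
    show "((\<lambda>h. A (y(?j := y ?j + h)) {}) has_vector_derivative A y {l}) (at 0)"
      using A_update[OF y, of "{}" l] by simp
  qed (rule exp_gt_zero)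
  then show ?thesis by simp
qed

text \<open>A proper subset of insert l S either avoids l, and is then any subset of S, or is insert
  l T with T a proper subset of S. The two families match the two halves of the product
  rule.\<close>

lemma sum_Pow_insert:
  fixes g :: "'l set \<Rightarrow> 'v::comm_monoid_add"
  assumes "finite S" "l \<notin> S"
  shows "(\<Sum>T\<in>Pow (insert l S) - {insert l S}. g T) = (\<Sum>T\<in>Pow S. g T) + (\<Sum>T\<in>Pow S - {S}. g (insert l T))"
proof -
  have eq: "Pow (insert l S) - {insert l S} = Pow S \<union> insert l ` (Pow S - {S})"
  proof (intro equalityI subsetI)
    fix T assume T: "T \<in> Pow (insert l S) - {insert l S}"
    show "T \<in> Pow S \<union> insert l ` (Pow S - {S})"
    proof (cases "l \<in> T")
      case True
      then have "T = insert l (T - {l})" "T - {l} \<subseteq> S" "T - {l} \<noteq> S" using T by auto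
      then show ?thesis by blast
    qed (use T in auto)
  qed (use assms(2) in auto)
  have "inj_on (insert l) (Pow S - {S})"
    using assms(2) by (auto simp: inj_on_def)
  then have "(\<Sum>T\<in>insert l ` (Pow S - {S}). g T) = (\<Sum>T\<in>Pow S - {S}. g (insert l T))"
    by (simp add: sum.reindex)
  moreover have "Pow S \<inter> insert l ` (Pow S - {S}) = {}" using assms(2) by auto
  ultimately show ?thesis unfolding eq using assms(1) by (subst sum.union_disjoint) auto
qed

text \<open>The product rule on the right-hand side R yields every term of the recursion for insert
  l S except T = S. That one, with operator \<open>A y {l}\<close>, comes from the derivative of the
  solution operator.\<close>

lemma Du_has_vector_derivative_0:
  assumes y: "y \<in> good" and S: "finite S" "l \<notin> S"
  shows "((\<lambda>h. Du (y(fst l := y (fst l) + h)) S) has_vector_derivative Du y (insert l S)) (at 0)"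
  using S
proof (induction S rule: finite_psubset_induct)
  case (psubset S)
  let ?y = "\<lambda>h. y(fst l := y (fst l) + h)" and ?L = "solve (grads D) (A y {})"
  define R where "R h = (if S = {} then F else 0) - (\<Sum>T\<in>Pow S - {S}. A (?y h) (S - T) (Du (?y h) T))" for h
  define R' where "R' = - (\<Sum>T\<in>Pow S - {S}. A y (S - T) (Du y (insert l T)) + A y (insert l (S - T)) (Du y T))"
  have y0: "?y 0 = y" by simp
  have Du_R: "Du (?y h) S = solve (grads D) (A (?y h) {}) (R h)" for h
    unfolding R_def using psubset.hyps by (subst Du.simps) simp
  have term_der: "((\<lambda>h. A (?y h) (S - T) (Du (?y h) T)) has_vector_derivative
      A y (S - T) (Du y (insert l T)) + A y (insert l (S - T)) (Du y T)) (at 0)" if T: "T \<in> Pow S - {S}" for T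
  proof -
    have *: "finite (S - T)" "l \<notin> S - T" "T \<subset> S" "l \<notin> T" using T psubset by auto
    show ?thesis
      using bounded_bilinear.has_vector_derivative[OF bounded_bilinear_blinfun_apply
          A_update[OF y *(1,2)] psubset.IH[OF *(3,4)]] unfolding y0 .
  qed
  have "(R has_vector_derivative R') (at 0)"
    unfolding R_def[abs_def] R'_def
    by (rule has_vector_derivative_eq_rhs[OF has_vector_derivative_diff[OF has_vector_derivative_const
        has_vector_derivative_sum[OF term_der]]]) (assumption, rule diff_0)
  from bounded_bilinear.has_vector_derivative[OF bounded_bilinear_blinfun_apply solve_A_update[OF y, of l] this]
  have "((\<lambda>h. Du (?y h) S) has_vector_derivative ?L R' - ?L (A y {l} (Du y S))) (at 0)"
    using Du_R[of 0] unfolding y0 Du_R by (simp add: blinfun.minus_left)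
  moreover have "?L R' - ?L (A y {l} (Du y S)) = Du y (insert l S)"
  proof -
    have sub: "insert l S - T = insert l (S - T)" "insert l S - insert l T = S - T" if "T \<subseteq> S" for T
      using psubset.prems that by auto
    have "(\<Sum>T\<in>Pow (insert l S) - {insert l S}. A y (insert l S - T) (Du y T))
        = (\<Sum>T\<in>Pow S. A y (insert l (S - T)) (Du y T)) + (\<Sum>T\<in>Pow S - {S}. A y (S - T) (Du y (insert l T)))"
      unfolding sum_Pow_insert[OF psubset.hyps psubset.prems]
      by (intro arg_cong2[where f = "(+)"] sum.cong refl) (simp_all only: sub Pow_iff Diff_iff)
    also have "(\<Sum>T\<in>Pow S. A y (insert l (S - T)) (Du y T))
        = A y {l} (Du y S) + (\<Sum>T\<in>Pow S - {S}. A y (insert l (S - T)) (Du y T))"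
      using psubset.hyps by (subst sum.remove[of _ S]) auto
    finally have "(\<Sum>T\<in>Pow (insert l S) - {insert l S}. A y (insert l S - T) (Du y T)) = A y {l} (Du y S) - R'"
      by (simp add: R'_def sum.distrib algebra_simps)
    then show ?thesis
      using psubset.hyps by (subst (2) Du.simps) (simp add: blinfun.diff_right)
  qed
  ultimately show ?case by (simp only:)
qed

lemma Du_has_vector_derivative:
  assumes y: "y \<in> good" and S: "finite S" "l \<notin> S"
  shows "((\<lambda>t. Du (y(fst l := t)) S) has_vector_derivative Du (y(fst l := t)) (insert l S)) (at t)"
proof -
  let ?y = "y(fst l := t)"
  have "?y \<in> good" using y by (simp add: good_update)
  from Du_has_vector_derivative_0[OF this S]
  have "((\<lambda>h. Du (y(fst l := t + h)) S) has_vector_derivative Du ?y (insert l S)) (at (t - t))" by simp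
  moreover have "((\<lambda>s. s - t) has_vector_derivative 1) (at t)"
    by (auto intro!: derivative_eq_intros)
  ultimately show ?thesis
    using vector_diff_chain_at[of "\<lambda>s. s - t" 1 t "\<lambda>h. Du (y(fst l := t + h)) S"] by (simp add: o_def)
qed

text \<open>A label (j, i) outside the finite set S always exists, and differentiability along it
  gives continuity.\<close>

lemma Du_continuous:
  assumes y: "y \<in> good" and S: "finite S"
  shows "continuous_on UNIV (\<lambda>t. Du (y(j := t)) S)"
proof -
  have "infinite (range (\<lambda>i :: nat. (j, i)))"
    by (rule range_inj_infinite) (auto simp: inj_on_def)
  then obtain i where "(j, i) \<notin> S" using S by (metis finite_subset image_subsetI)
  then show ?thesis
    using Du_has_vector_derivative[OF y S, of "(j, i)"]
    by (intro continuous_at_imp_continuous_on) (auto dest: has_vector_derivative_continuous)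
qed

end

section \<open>Subset sums, the weighted energy estimate, and derivatives as random
  variables\<close>

lemma prod_one_plus_eq_sum_Pow:
  fixes v :: "'l \<Rightarrow> 'r::comm_semiring_1"
  assumes "finite L"
  shows "(\<Prod>l\<in>L. 1 + v l) = (\<Sum>U\<in>Pow L. \<Prod>l\<in>U. v l)"
  using prod_add[OF assms, of v "\<lambda>_. 1"] by (simp add: add.commute)

lemma prod_one_plus_le_exp: "(\<And>l. l \<in> L \<Longrightarrow> 0 \<le> v l) \<Longrightarrow> (\<Prod>l\<in>L. 1 + v l) \<le> exp (\<Sum>l\<in>L. v l :: real)"
proof (induction L rule: infinite_finite_induct)
  case (insert l L)
  have "(1 + v l) * (\<Prod>l\<in>L. 1 + v l) \<le> exp (v l) * exp (\<Sum>l\<in>L. v l)"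
    using insert by (intro mult_mono prod_nonneg) (auto intro: add_nonneg_nonneg)
  then show ?case using insert by (simp add: exp_add)
qed auto

text \<open>The products of v over nonempty subsets of L sum to at most 3/2 - 1 = 1/2. For fixed S,
  and likewise for fixed T, the differences S - T are distinct nonempty sets, so each half of the
  double sum gains a factor 1/2; T = {} accounts for the extra term.\<close>

lemma subset_convolution_le:
  fixes v :: "'l \<Rightarrow> real" and n :: "'l set \<Rightarrow> real"
  assumes L: "finite L" and v: "\<And>l. l \<in> L \<Longrightarrow> 0 \<le> v l" and small: "(\<Prod>l\<in>L. 1 + v l) \<le> 3 / 2"
    and n: "\<And>S. S \<subseteq> L \<Longrightarrow> 0 \<le> n S"
  shows "(\<Sum>S\<in>Pow L - {{}}. \<Sum>T\<in>Pow S - {S}. (\<Prod>l\<in>S - T. v l) * (n T + n S))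
    \<le> (\<Sum>S\<in>Pow L - {{}}. n S) + n {} / 2"
proof -
  define g where "g U = (\<Prod>l\<in>U. v l)" for U
  have g: "0 \<le> g U" if "U \<subseteq> L" for U unfolding g_def using that v by (intro prod_nonneg) auto
  have gsum: "(\<Sum>U\<in>Pow L - {{}}. g U) \<le> 1 / 2"
    using small L unfolding prod_one_plus_eq_sum_Pow[OF L] g_def by (subst (asm) sum.remove[of _ "{}"]) auto
  have half: "(\<Sum>U\<in>C. g (h U)) \<le> 1 / 2" if "inj_on h C" "h ` C \<subseteq> Pow L - {{}}" for C and h :: "'l set \<Rightarrow> 'l set"
  proof -
    have "(\<Sum>U\<in>C. g (h U)) = (\<Sum>U\<in>h ` C. g U)" by (rule sum.reindex_cong[OF that(1) refl refl, symmetric])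
    also have "\<dots> \<le> (\<Sum>U\<in>Pow L - {{}}. g U)" using that(2) L g by (intro sum_mono2) auto
    finally show ?thesis using gsum by simp
  qed
  have "(\<Sum>S\<in>Pow L - {{}}. \<Sum>T\<in>Pow S - {S}. g (S - T) * n S) \<le> (\<Sum>S\<in>Pow L - {{}}. 1 / 2 * n S)"
    unfolding sum_distrib_right[symmetric]
  proof (rule sum_mono)
    fix S assume S: "S \<in> Pow L - {{}}"
    have "(\<Sum>T\<in>Pow S - {S}. g (S - T)) \<le> 1 / 2"
      using S by (intro half[of "\<lambda>T. S - T"]) (auto simp: inj_on_def)
    then show "(\<Sum>T\<in>Pow S - {S}. g (S - T)) * n S \<le> 1 / 2 * n S"
      using S n by (intro mult_right_mono) auto
  qed
  moreover have "(\<Sum>S\<in>Pow L - {{}}. \<Sum>T\<in>Pow S - {S}. g (S - T) * n T) \<le> (\<Sum>T\<in>Pow L. 1 / 2 * n T)"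
  proof -
    have "(\<Sum>S\<in>Pow L - {{}}. \<Sum>T\<in>Pow S - {S}. g (S - T) * n T)
        = (\<Sum>S\<in>Pow L - {{}}. \<Sum>T\<in>Pow L. if T \<subset> S then g (S - T) * n T else 0)"
    proof (rule sum.cong[OF refl])
      fix S assume "S \<in> Pow L - {{}}"
      then show "(\<Sum>T\<in>Pow S - {S}. g (S - T) * n T) = (\<Sum>T\<in>Pow L. if T \<subset> S then g (S - T) * n T else 0)"
        using L by (intro sum.mono_neutral_cong_left) auto
    qed
    also have "\<dots> = (\<Sum>T\<in>Pow L. \<Sum>S\<in>Pow L - {{}}. if T \<subset> S then g (S - T) * n T else 0)"
      by (rule sum.swap)
    also have "\<dots> = (\<Sum>T\<in>Pow L. (\<Sum>S\<in>{S \<in> Pow L - {{}}. T \<subset> S}. g (S - T)) * n T)"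
      using L by (intro sum.cong refl, unfold sum_distrib_right, subst sum.inter_filter) auto
    also have "\<dots> \<le> (\<Sum>T\<in>Pow L. 1 / 2 * n T)"
      using n by (intro sum_mono mult_right_mono half) (auto simp: inj_on_def)
    finally show ?thesis .
  qed
  moreover have "(\<Sum>T\<in>Pow L. n T) = n {} + (\<Sum>S\<in>Pow L - {{}}. n S)"
    using L by (intro sum.remove) auto
  ultimately show ?thesis
    unfolding g_def[symmetric] by (simp add: distrib_left sum.distrib sum_divide_distrib[symmetric])
qed

lemma ess_bounded_abs: "ess_bounded g c \<Longrightarrow> ess_bounded (\<lambda>x. \<bar>g x\<bar>) c"
  by (auto simp: ess_bounded_def)

context parametric_problem
begin

lemma A_weighted_bounded:
  assumes y: "y \<in> good" and U: "finite U"
  shows "ess_bounded (\<lambda>x. exp (field y x) * (\<Prod>l\<in>U. w l * \<bar>\<Psi> (fst l) x\<bar>))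
    (exp (K * size y) * (\<Prod>l\<in>U. \<bar>w l\<bar> * c (fst l)))"
proof (rule ess_bounded_mult[OF ess_bounded_exp(1)[OF field_bounded[OF y]]])
  show "ess_bounded (\<lambda>x. \<Prod>l\<in>U. w l * \<bar>\<Psi> (fst l) x\<bar>) (\<Prod>l\<in>U. \<bar>w l\<bar> * c (fst l))"
    using U by (induction U rule: finite_induct)
      (use ess_bounded_const[of 1] in \<open>simp_all add: ess_bounded_mult[OF ess_bounded_cmult[OF ess_bounded_abs[OF Psi_bounded]]]\<close>)
qed

text \<open>Testing the equation for \<open>Du y S\<close> with \<open>Du y S\<close> itself, weighting and summing over \<open>S\<close>,
  the mixed terms are absorbed because the weights \<open>w\<close> are small against the \<open>\<Psi> j\<close>.\<close>

lemma Du_energy: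
  assumes y: "y \<in> good" and L: "finite L" and w: "\<And>l. l \<in> L \<Longrightarrow> 0 \<le> w l"
    and small: "\<And>x. (\<Prod>l\<in>L. 1 + w l * \<bar>\<Psi> (fst l) x\<bar>) \<le> 3 / 2"
  shows "(\<Sum>S\<in>Pow L. (\<Prod>l\<in>S. w l)\<^sup>2 * (norm (Du y S))\<^sup>2) \<le> 3 / 2 * exp (2 * K * size y) * (norm F)\<^sup>2"
proof -
  define a where "a x = exp (field y x)" for x
  define d where "d S x = rep_L2 (Du y S) x" for S x
  define om where "om S = (\<Prod>l\<in>S. w l)" for S
  define n where "n S x = (om S)\<^sup>2 * (norm (d S x))\<^sup>2" for S x
  define g where "g U x = (\<Prod>l\<in>U. w l * \<bar>\<Psi> (fst l) x\<bar>)" for U x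
  define e where "e S = (LINT x|lebesgue. a x * n S x)" for S
  have fin: "finite S" if "S \<subseteq> L" for S using that L finite_subset by blast
  have om: "0 \<le> om S" if "S \<subseteq> L" for S unfolding om_def using that w by (intro prod_nonneg) auto
  have g_nonneg: "0 \<le> g U x" if "U \<subseteq> L" for U x unfolding g_def using that w by (intro prod_nonneg) auto
  have ea: "ess_bounded a (exp (K * size y))"
    unfolding a_def[abs_def] by (rule ess_bounded_exp(1)[OF field_bounded[OF y]])
  have int_n: "integrable lebesgue (\<lambda>x. a x * n S x)" for S
    using integrable_mult_right[OF integrable_mult_L2[OF ea, of "Du y S" "Du y S"], of "(om S)\<^sup>2"]
    by (simp add: n_def d_def power2_norm_eq_inner mult_ac)
  have int_g: "integrable lebesgue (\<lambda>x. a x * (g U x * n S x))" if "U \<subseteq> L" for U S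
    using integrable_mult_right[OF integrable_mult_L2[OF A_weighted_bounded[OF y fin[OF that], of w], of "Du y S" "Du y S"], of "(om S)\<^sup>2"]
    by (simp add: n_def d_def a_def g_def power2_norm_eq_inner mult_ac)
  have e_eq: "e S = (om S)\<^sup>2 * (A y {} (Du y S) \<bullet> Du y S)" for S
  proof -
    have "A y {} (Du y S) \<bullet> Du y S = (LINT x|lebesgue. a x * (d S x \<bullet> d S x))"
      unfolding A_def a_def d_def using inner_mult_L2[OF A_bounded[OF y, of "{}"], of "Du y S" "Du y S"] by simp
    moreover have "a x * n S x = (om S)\<^sup>2 * (a x * (d S x \<bullet> d S x))" for x
      by (simp add: n_def power2_norm_eq_inner mult.left_commute)
    ultimately show ?thesis by (simp only: e_def integral_mult_right_zero)
  qed
  have e_step: "e S \<le> (\<Sum>T\<in>Pow S - {S}. LINT x|lebesgue. a x * (g (S - T) x * (n T x + n S x)) / 2)"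
    if S: "S \<in> Pow L - {{}}" for S
  proof -
    have "e S = (\<Sum>T\<in>Pow S - {S}. - ((om S)\<^sup>2 * (A y (S - T) (Du y T) \<bullet> Du y S)))"
      unfolding e_eq using S Du_equation[OF y fin Du_in_grads[OF y fin], of S S]
      by (simp add: sum_distrib_left sum_negf)
    also have "\<dots> \<le> (\<Sum>T\<in>Pow S - {S}. LINT x|lebesgue. a x * (g (S - T) x * (n T x + n S x)) / 2)"
    proof (rule sum_mono)
      fix T assume T: "T \<in> Pow S - {S}"
      then have sub: "S - T \<subseteq> L" "T \<subseteq> L" "S \<subseteq> L" "finite (S - T)" using S fin by auto
      \<comment> \<open>Of the two factors om S, one is split: its part over S - T joins the \<Psi>
        factors in g, its part over T goes with \<open>d T\<close>, and the other om S goes with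
        \<open>d S\<close>. Young's inequality then separates T from S.\<close>
      have "om S = om (S - T) * om T"
        unfolding om_def using T fin[OF sub(3)] by (intro prod.subset_diff) auto
      then have om_S: "(om S)\<^sup>2 = om (S - T) * (om T * om S)" by (simp add: power2_eq_square)
      define P where "P x = (\<Prod>l\<in>S - T. \<Psi> (fst l) x)" for x
      have gP: "g (S - T) x = om (S - T) * \<bar>P x\<bar>" for x
        by (simp add: g_def om_def P_def prod.distrib abs_prod)
      have A: "A y (S - T) (Du y T) \<bullet> Du y S = (LINT x|lebesgue. a x * P x * (d T x \<bullet> d S x))"
        unfolding A_def a_def P_def d_def by (rule inner_mult_L2[OF A_bounded[OF y sub(4)]])
      have intA: "integrable lebesgue (\<lambda>x. a x * P x * (d T x \<bullet> d S x))"
        unfolding a_def P_def d_def by (rule integrable_mult_L2[OF A_bounded[OF y sub(4)]])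
      have "- ((om S)\<^sup>2 * (A y (S - T) (Du y T) \<bullet> Du y S)) = (LINT x|lebesgue. - ((om S)\<^sup>2) * (a x * P x * (d T x \<bullet> d S x)))"
        unfolding A by simp
      also have "\<dots> \<le> (LINT x|lebesgue. a x * (g (S - T) x * (n T x + n S x)) / 2)"
      proof (rule integral_mono)
        show "integrable lebesgue (\<lambda>x. - ((om S)\<^sup>2) * (a x * P x * (d T x \<bullet> d S x)))"
          by (rule integrable_mult_right[OF intA])
        show "integrable lebesgue (\<lambda>x. a x * (g (S - T) x * (n T x + n S x)) / 2)"
          using Bochner_Integration.integrable_add[OF int_g[OF sub(1), of T] int_g[OF sub(1), of S]]
          by (intro integrable_divide) (simp add: distrib_left)
        fix x
        have "- ((om S)\<^sup>2) * (a x * P x * (d T x \<bullet> d S x)) \<le> \<bar>(om S)\<^sup>2 * (a x * P x * (d T x \<bullet> d S x))\<bar>"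
          by (simp only: mult_minus_left abs_ge_minus_self)
        also have "\<dots> = om (S - T) * (om T * om S) * (a x * \<bar>P x\<bar> * \<bar>d T x \<bullet> d S x\<bar>)"
          unfolding om_S using om sub by (simp add: abs_mult a_def)
        also have "\<dots> \<le> om (S - T) * (om T * om S) * (a x * \<bar>P x\<bar> * (norm (d T x) * norm (d S x)))"
          using om sub by (intro mult_left_mono Cauchy_Schwarz_ineq2) (auto simp: a_def)
        also have "\<dots> = a x * g (S - T) x * ((om T * norm (d T x)) * (om S * norm (d S x)))"
          by (simp add: gP mult_ac)
        also have "\<dots> \<le> a x * g (S - T) x * ((n T x + n S x) / 2)"
        proof (rule mult_left_mono)
          show "(om T * norm (d T x)) * (om S * norm (d S x)) \<le> (n T x + n S x) / 2"
            using sum_squares_bound[of "om T * norm (d T x)" "om S * norm (d S x)"]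
            by (simp add: n_def power_mult_distrib)
        qed (use g_nonneg[OF sub(1)] in \<open>simp add: a_def\<close>)
        finally show "- ((om S)\<^sup>2) * (a x * P x * (d T x \<bullet> d S x)) \<le> a x * (g (S - T) x * (n T x + n S x)) / 2"
          by simp
      qed
      finally show "- ((om S)\<^sup>2 * (A y (S - T) (Du y T) \<bullet> Du y S))
          \<le> (LINT x|lebesgue. a x * (g (S - T) x * (n T x + n S x)) / 2)" .
    qed
    finally show ?thesis .
  qed
  define X where "X = (\<Sum>S\<in>Pow L - {{}}. e S)"
  have int_gg: "integrable lebesgue (\<lambda>x. a x * (g (S - T) x * (n T x + n S x)) / 2)" if "S \<in> Pow L - {{}}" for S T
  proof -
    have "S - T \<subseteq> L" using that by auto
    from Bochner_Integration.integrable_add[OF int_g[OF this, of T] int_g[OF this, of S]] show ?thesis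
      by (intro integrable_divide) (simp add: distrib_left)
  qed
  have "X \<le> (\<Sum>S\<in>Pow L - {{}}. \<Sum>T\<in>Pow S - {S}. LINT x|lebesgue. a x * (g (S - T) x * (n T x + n S x)) / 2)"
    unfolding X_def by (intro sum_mono e_step)
  also have "\<dots> = (LINT x|lebesgue. (\<Sum>S\<in>Pow L - {{}}. \<Sum>T\<in>Pow S - {S}. a x * (g (S - T) x * (n T x + n S x)) / 2))"
    using int_gg by (simp add: Bochner_Integration.integral_sum Bochner_Integration.integrable_sum del: integral_divide_zero)
  also have "\<dots> \<le> (LINT x|lebesgue. (\<Sum>S\<in>Pow L - {{}}. a x * n S x) / 2 + (a x * n {} x) / 4)"
  proof (rule integral_mono)
    show "integrable lebesgue (\<lambda>x. \<Sum>S\<in>Pow L - {{}}. \<Sum>T\<in>Pow S - {S}. a x * (g (S - T) x * (n T x + n S x)) / 2)"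
      by (intro Bochner_Integration.integrable_sum int_gg)
    show "integrable lebesgue (\<lambda>x. (\<Sum>S\<in>Pow L - {{}}. a x * n S x) / 2 + (a x * n {} x) / 4)"
      by (intro Bochner_Integration.integrable_add Bochner_Integration.integrable_sum integrable_divide int_n)
    fix x
    have "(\<Sum>S\<in>Pow L - {{}}. \<Sum>T\<in>Pow S - {S}. g (S - T) x * (n T x + n S x)) \<le> (\<Sum>S\<in>Pow L - {{}}. n S x) + n {} x / 2"
      unfolding g_def by (rule subset_convolution_le[OF L]) (use w small in \<open>auto simp: n_def\<close>)
    then have "a x / 2 * (\<Sum>S\<in>Pow L - {{}}. \<Sum>T\<in>Pow S - {S}. g (S - T) x * (n T x + n S x))
        \<le> a x / 2 * ((\<Sum>S\<in>Pow L - {{}}. n S x) + n {} x / 2)"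
      by (rule mult_left_mono) (simp add: a_def)
    then show "(\<Sum>S\<in>Pow L - {{}}. \<Sum>T\<in>Pow S - {S}. a x * (g (S - T) x * (n T x + n S x)) / 2)
        \<le> (\<Sum>S\<in>Pow L - {{}}. a x * n S x) / 2 + (a x * n {} x) / 4"
      by (simp add: sum_distrib_left sum_divide_distrib distrib_left add_divide_distrib)
  qed
  also have "\<dots> = X / 2 + e {} / 4"
    using int_n by (simp add: X_def e_def)
  \<comment> \<open>The estimate X \<le> X / 2 + e {} / 4 is absorbed into the left side. The total
    e {} + X is then at most 3/2 times e {}.\<close>
  finally have X: "X \<le> e {} / 2" by simp
  have "e {} = F \<bullet> Du y {}"
    using Du_equation[OF y _ Du_in_grads[OF y], of "{}" "{}"] by (simp add: e_eq om_def)
  also have "\<dots> \<le> norm F * norm (Du y {})" by (rule norm_cauchy_schwarz)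
  also have "\<dots> \<le> norm F * (exp (K * size y) * norm F)"
  proof (rule mult_left_mono)
    have "norm (Du y {}) \<le> norm F / exp (- (K * size y))"
      using solves_norm_le[OF A_coercive[OF y] solves_solve[OF A_coercive[OF y]], of F]
      by (simp add: Du.simps[of y "{}"])
    then show "norm (Du y {}) \<le> exp (K * size y) * norm F" by (simp add: exp_minus field_simps)
  qed simp
  finally have e0: "e {} \<le> exp (K * size y) * (norm F)\<^sup>2" by (simp add: power2_eq_square mult_ac)
  have low: "exp (- (K * size y)) * ((om S)\<^sup>2 * (norm (Du y S))\<^sup>2) \<le> e S" if "S \<in> Pow L" for S
  proof -
    have "Du y S \<in> grads D" using that fin by (intro Du_in_grads y) auto
    from coercive_onD(3)[OF A_coercive[OF y] this]
    have "(om S)\<^sup>2 * (exp (- (K * size y)) * (norm (Du y S))\<^sup>2) \<le> e S"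
      unfolding e_eq by (rule mult_left_mono) simp
    then show ?thesis by (simp add: mult_ac)
  qed
  \<comment> \<open>Coercivity converts energies into norms at the cost of exp (K *
    \<open>size y\<close>). The bound on e {} has already cost the same factor, hence 2 K in the
    result.\<close>
  have "exp (- (K * size y)) * (\<Sum>S\<in>Pow L. (om S)\<^sup>2 * (norm (Du y S))\<^sup>2) \<le> (\<Sum>S\<in>Pow L. e S)"
    unfolding sum_distrib_left by (intro sum_mono low)
  also have "\<dots> = e {} + X" unfolding X_def using L by (intro sum.remove) auto
  also have "\<dots> \<le> 3 / 2 * (exp (K * size y) * (norm F)\<^sup>2)" using X e0 by simp
  finally have "exp (K * size y) * (exp (- (K * size y)) * (\<Sum>S\<in>Pow L. (om S)\<^sup>2 * (norm (Du y S))\<^sup>2))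
      \<le> exp (K * size y) * (3 / 2 * (exp (K * size y) * (norm F)\<^sup>2))"
    by (rule mult_left_mono) simp
  moreover have "exp (2 * K * size y) = exp (K * size y) * exp (K * size y)"
    by (simp add: exp_add[symmetric])
  ultimately show ?thesis by (simp add: om_def exp_minus field_simps)
qed

text \<open>Cut off outside \<open>good\<close>, so that a globally measurable function of y
  results.\<close>

definition Dg :: "(nat \<times> nat) set \<Rightarrow> (nat \<Rightarrow> real) \<Rightarrow> ('a, 'a) L2" where
  "Dg S y = (if y \<in> good then Du y S else 0)"

lemma solution_good: "y \<in> good \<Longrightarrow> solution D \<psi> f y = potential D (Dg {} y)"
  by (simp add: solution_eq[OF field_bounded field_limit] Dg_def Du_empty)

lemma Dg_in_grads: "finite S \<Longrightarrow> Dg S y \<in> grads D"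
  using Du_in_grads subspace_0[OF subspace_G] by (simp add: Dg_def)

text \<open>The base case is the measurable solution map. Each further derivative is a pointwise
  limit of difference quotients; off \<open>good\<close> these are identically 0, because shifting a
  coordinate does not lead back into it.\<close>

lemma Dg_measurable: "finite S \<Longrightarrow> Dg S \<in> borel_measurable gaussian_seq"
proof (induction S rule: finite_induct)
  case empty
  have "Dg {} = (\<lambda>y. if y \<in> good then snd (solution D \<psi> f y) else 0)"
    by (auto simp: fun_eq_iff solution_good snd_potential[OF bounded_D Du_in_grads] Dg_def)
  moreover have "(\<lambda>y. snd (solution D \<psi> f y)) \<in> borel_measurable gaussian_seq"
    using measurable_compose[OF solution_measurable borel_measurable_continuous_onI[OF continuous_on_snd[OF continuous_on_id]]]
    by (simp add: measurable_cong_sets[OF sets_gaussian_seq refl])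
  ultimately show ?case by simp
next
  case (insert l S)
  note [measurable] = insert.IH
  let ?j = "fst l" and ?h = "\<lambda>n. 1 / real (Suc n)"
  show ?case
  proof (rule borel_measurable_LIMSEQ_metric)
    fix n
    show "(\<lambda>y. (1 / ?h n) *\<^sub>R (Dg S (y(?j := y ?j + ?h n)) - Dg S y)) \<in> borel_measurable gaussian_seq"
      by measurable
  next
    fix y
    show "(\<lambda>n. (1 / ?h n) *\<^sub>R (Dg S (y(?j := y ?j + ?h n)) - Dg S y)) \<longlonglongrightarrow> Dg (insert l S) y"
    proof (cases "y \<in> good")
      case True
      have "((\<lambda>h. (1 / h) *\<^sub>R (Du (y(?j := y ?j + h)) S - Du (y(?j := y ?j + 0)) S)) \<longlongrightarrow> Du y (insert l S)) (at 0)"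
        using Du_has_vector_derivative_0[OF True insert.hyps] unfolding has_vector_derivative_at_0_iff .
      moreover have "filterlim ?h (at 0) sequentially"
        using LIMSEQ_Suc[OF lim_1_over_n] by (auto simp: filterlim_at simp del: of_nat_Suc intro!: always_eventually)
      ultimately have "(\<lambda>n. (1 / ?h n) *\<^sub>R (Du (y(?j := y ?j + ?h n)) S - Du (y(?j := y ?j + 0)) S)) \<longlonglongrightarrow> Du y (insert l S)"
        by (rule filterlim_compose)
      then show ?thesis using True by (simp add: Dg_def good_update)
    qed (simp add: Dg_def good_update)
  qed
qed

lemma tame_Dg: assumes S: "finite S" shows "tame (Dg S)"
proof -
  \<comment> \<open>The weights are adapted to this S: each term w l |\<Psi>| is at most t, so the
    product over S is at most exp (card S * t) \<le> 3/2 with no smallness of K. The resulting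
    constant depends on S, which is enough for growth in y.\<close>
  define t where "t = ln (3 / 2) / (card S + 1)"
  define w where "w l = t * \<rho> (fst l) / (K + 1)" for l :: "nat \<times> nat"
  have t: "0 < t" by (simp add: t_def)
  have w_pos: "0 < w l" for l using t rho_pos K_nonneg by (simp add: w_def)
  have "(\<Prod>l\<in>S. 1 + w l * \<bar>\<Psi> (fst l) x\<bar>) \<le> 3 / 2" for x
  proof -
    have le: "w l * \<bar>\<Psi> (fst l) x\<bar> \<le> t" for l
    proof -
      have "w l * \<bar>\<Psi> (fst l) x\<bar> \<le> w l * (K / \<rho> (fst l))"
        using w_pos[of l] by (intro mult_left_mono Psi_le) simp
      also have "\<dots> = t * (K / (K + 1))" using rho_pos[of "fst l"] by (simp add: w_def)
      also have "\<dots> \<le> t" using t K_nonneg by (intro mult_left_le) auto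
      finally show ?thesis .
    qed
    have "(\<Prod>l\<in>S. 1 + w l * \<bar>\<Psi> (fst l) x\<bar>) \<le> exp (\<Sum>l\<in>S. w l * \<bar>\<Psi> (fst l) x\<bar>)"
      using w_pos by (intro prod_one_plus_le_exp) (simp add: less_imp_le)
    also have "(\<Sum>l\<in>S. w l * \<bar>\<Psi> (fst l) x\<bar>) \<le> card S * t"
      using sum_bounded_above[of S "\<lambda>l. w l * \<bar>\<Psi> (fst l) x\<bar>" t] le by simp
    also have "\<dots> \<le> ln (3 / 2)" by (simp add: t_def field_simps)
    finally show ?thesis by simp
  qed
  then have energy: "(\<Sum>T\<in>Pow S. (\<Prod>l\<in>T. w l)\<^sup>2 * (norm (Du y T))\<^sup>2) \<le> 3 / 2 * exp (2 * K * size y) * (norm F)\<^sup>2"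
    if "y \<in> good" for y
    using w_pos by (intro Du_energy that S) (auto simp: less_imp_le)
  define W where "W = (\<Prod>l\<in>S. w l)"
  have W: "0 < W" unfolding W_def using w_pos by (simp add: prod_pos)
  show ?thesis
  proof (rule tameI[where C = "2 * norm F / W" and k = K])
    fix y assume y: "y \<in> good"
    have "W\<^sup>2 * (norm (Du y S))\<^sup>2 \<le> (\<Sum>T\<in>Pow S. (\<Prod>l\<in>T. w l)\<^sup>2 * (norm (Du y T))\<^sup>2)"
      unfolding W_def using S by (intro member_le_sum) auto
    also have "\<dots> \<le> 3 / 2 * exp (2 * K * size y) * (norm F)\<^sup>2" by (rule energy[OF y])
    also have "\<dots> \<le> (2 * norm F * exp (K * size y))\<^sup>2"
    proof -
      have "exp (2 * K * size y) = (exp (K * size y))\<^sup>2"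
        by (simp add: power2_eq_square exp_add[symmetric])
      then show ?thesis by (simp add: power_mult_distrib)
    qed
    finally have "(W * norm (Du y S))\<^sup>2 \<le> (2 * norm F * exp (K * size y))\<^sup>2" by (simp add: power_mult_distrib)
    then have "W * norm (Du y S) \<le> 2 * norm F * exp (K * size y)"
      by (rule power2_le_imp_le) simp
    then show "norm (Dg S y) \<le> 2 * norm F / W * exp (K * size y)"
      using W y by (simp add: Dg_def field_simps)
  qed (use Dg_measurable[OF S] K_nonneg W in auto)
qed

lemma coeff_Dg_insert:
  assumes S: "finite S" "l \<notin> S" and \<nu>: "\<nu> \<in> multi_idx"
  shows "coeff (Dg (insert l S)) \<nu> = sqrt (Suc (\<nu> (fst l))) *\<^sub>R coeff (Dg S) (\<nu>(fst l := Suc (\<nu> (fst l))))"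
  unfolding coeff_def
proof (rule hermite_ladder[OF tame_Dg tame_Dg \<nu>])
  fix y assume y: "y \<in> good"
  show "((\<lambda>t. Dg S (y(fst l := t))) has_vector_derivative Dg (insert l S) (y(fst l := t))) (at t)" for t
    using Du_has_vector_derivative[OF y S] y by (simp add: Dg_def good_update)
  show "continuous_on UNIV (\<lambda>t. Dg (insert l S) (y(fst l := t)))"
    using Du_continuous[OF y, of "insert l S"] S y by (simp add: Dg_def good_update)
qed (use S in auto)

end

section \<open>Weighted summability of the Hermite coefficients\<close>

text \<open>A number l < m codes the label (l div r, l mod r). The counter m runs through blocks of
  length r, one per variable, and a label is kept if its position in the block is below \<nu>_j.
  Derivatives can thus be taken one at a time by induction on m.\<close>

definition labels :: "nat \<Rightarrow> (nat \<Rightarrow> nat) \<Rightarrow> nat \<Rightarrow> (nat \<times> nat) set" where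
  "labels r \<nu> m = (\<lambda>l. (l div r, l mod r)) ` {l. l < m \<and> l mod r < \<nu> (l div r)}"

text \<open>The index left after the first m steps. Truncated subtraction takes care of blocks not
  yet begun, where m \<le> r j, and of variables with \<nu>_j < r.\<close>

definition lowered :: "nat \<Rightarrow> (nat \<Rightarrow> nat) \<Rightarrow> nat \<Rightarrow> nat \<Rightarrow> nat" where
  "lowered r \<nu> m j = \<nu> j - min r (m - r * j)"

lemma finite_labels: "finite (labels r \<nu> m)"
  unfolding labels_def by (rule finite_imageI) simp

lemma labels_complete:
  assumes "0 < r"
  shows "labels r \<nu> (r * J) = Sigma {..<J} (\<lambda>j. {..<min (\<nu> j) r})"
proof (intro equalityI subsetI)
  fix x assume "x \<in> labels r \<nu> (r * J)"
  then show "x \<in> Sigma {..<J} (\<lambda>j. {..<min (\<nu> j) r})"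
    unfolding labels_def using assms by (auto simp: less_mult_imp_div_less mult.commute)
next
  fix x assume "x \<in> Sigma {..<J} (\<lambda>j. {..<min (\<nu> j) r})"
  then obtain j i where x: "x = (j, i)" "j < J" "i < \<nu> j" "i < r" by auto
  have "r * j + i < r * Suc j" using x by simp
  also have "\<dots> \<le> r * J" using x by (intro mult_le_mono2) simp
  finally have "r * j + i < r * J" .
  then show "x \<in> labels r \<nu> (r * J)"
    unfolding labels_def using x by (intro image_eqI[of _ _ "r * j + i"]) auto
qed

lemma lowered_multi_idx: "\<nu> \<in> multi_idx \<Longrightarrow> lowered r \<nu> m \<in> multi_idx"
  unfolding multi_idx_def lowered_def by (auto intro: finite_subset[of _ "{j. \<nu> j \<noteq> 0}"])

lemma lowered_complete:
  assumes "j < J" shows "lowered r \<nu> (r * J) j = \<nu> j - r"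
proof -
  have "r * 1 \<le> r * (J - j)" using assms by (intro mult_le_mono2) auto
  then show ?thesis by (simp add: lowered_def right_diff_distrib')
qed

text \<open>min (\<nu> j) r and \<nu> j - r together determine \<nu> j. This injectivity is what
  lets Bessel's inequality be used for each label set separately.\<close>

lemma labels_lowered_inj:
  assumes r: "0 < r" and zero: "\<And>j. J \<le> j \<Longrightarrow> \<nu> j = 0" "\<And>j. J \<le> j \<Longrightarrow> \<mu> j = 0"
    and eq: "labels r \<nu> (r * J) = labels r \<mu> (r * J)" "lowered r \<nu> (r * J) = lowered r \<mu> (r * J)"
  shows "\<nu> = \<mu>"
proof
  fix j
  show "\<nu> j = \<mu> j"
  proof (cases "j < J")
    case True
    have "{..<min (\<nu> j) r} = {..<min (\<mu> j) r}"
      using eq(1) True unfolding labels_complete[OF r] by (auto simp: set_eq_iff)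
    then have "min (\<nu> j) r = min (\<mu> j) r" by (metis card_lessThan)
    moreover have "\<nu> j - r = \<mu> j - r"
      using fun_cong[OF eq(2), of j] by (simp add: lowered_complete[OF True])
    ultimately show ?thesis by linarith
  qed (use zero in simp)
qed

context parametric_problem
begin

text \<open>Each label (j, i) is one rung of the ladder, from degree \<nu>_j - i down to \<nu>_j - i
  - 1, with factor sqrt (\<nu>_j - i).\<close>

lemma coeff_Dg_labels:
  assumes r: "0 < r" and \<nu>: "\<nu> \<in> multi_idx"
  shows "coeff (Dg (labels r \<nu> m)) (lowered r \<nu> m) =
    (\<Prod>l\<in>labels r \<nu> m. sqrt (real (\<nu> (fst l) - snd l))) *\<^sub>R coeff (Dg {}) \<nu>"
proof (induction m)
  case 0
  have "lowered r \<nu> 0 = \<nu>" by (auto simp: lowered_def)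
  then show ?case by (simp add: labels_def)
next
  case (Suc m)
  define j where "j = m div r"
  define i where "i = m mod r"
  have m: "m = r * j + i" "i < r" using r by (simp_all add: j_def i_def)
  have at_j: "lowered r \<nu> m j = \<nu> j - i" "lowered r \<nu> (Suc m) j = \<nu> j - Suc i"
    using m(2) by (simp_all add: lowered_def m(1))
  have off_j: "lowered r \<nu> (Suc m) k = lowered r \<nu> m k" if "k \<noteq> j" for k
  proof (cases "k < j")
    case True
    have "r * Suc k \<le> r * j" using True by (intro mult_le_mono2) simp
    then have "r \<le> m - r * k" unfolding m(1) by simp
    then show ?thesis by (simp add: lowered_def)
  next
    case False
    then have "r * Suc j \<le> r * k" using that by (intro mult_le_mono2) simp
    then have "Suc m \<le> r * k" unfolding m(1) using m(2) by simp
    then show ?thesis by (simp add: lowered_def)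
  qed
  have set: "{l. l < Suc m \<and> l mod r < \<nu> (l div r)} =
      (if i < \<nu> j then insert m {l. l < m \<and> l mod r < \<nu> (l div r)} else {l. l < m \<and> l mod r < \<nu> (l div r)})"
    by (auto simp: less_Suc_eq i_def j_def)
  show ?case
  proof (cases "i < \<nu> j")
    case True
    then have lab: "labels r \<nu> (Suc m) = insert (j, i) (labels r \<nu> m)"
      unfolding labels_def set by (simp add: i_def j_def)
    have new: "(j, i) \<notin> labels r \<nu> m"
    proof
      assume "(j, i) \<in> labels r \<nu> m"
      then obtain l where "l < m" "j = l div r" "i = l mod r" unfolding labels_def by auto
      then show False unfolding m(1) by simp
    qed
    have low: "(lowered r \<nu> (Suc m))(j := Suc (lowered r \<nu> (Suc m) j)) = lowered r \<nu> m"
      using True at_j off_j by (auto simp: fun_eq_iff)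
    have up: "Suc (lowered r \<nu> (Suc m) j) = \<nu> j - i" using True at_j by simp
    have "coeff (Dg (labels r \<nu> (Suc m))) (lowered r \<nu> (Suc m)) = sqrt (real (\<nu> j - i)) *\<^sub>R coeff (Dg (labels r \<nu> m)) (lowered r \<nu> m)"
      unfolding lab using coeff_Dg_insert[OF finite_labels new lowered_multi_idx[OF \<nu>], of r "Suc m"]
      unfolding fst_conv low unfolding up .
    then show ?thesis
      unfolding Suc.IH lab using new finite_labels by simp
  next
    case False
    then have "labels r \<nu> (Suc m) = labels r \<nu> m" unfolding labels_def set by simp
    moreover have "lowered r \<nu> (Suc m) = lowered r \<nu> m"
    proof
      fix k show "lowered r \<nu> (Suc m) k = lowered r \<nu> m k"
        using False at_j off_j by (cases "k = j") auto
    qed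
    ultimately show ?thesis using Suc.IH by simp
  qed
qed

text \<open>One constant for all finite label sets, which makes the coefficient bounds
  uniform.\<close>

definition energy_bound :: real where
  "energy_bound = enn2real (\<integral>\<^sup>+y. ennreal (3 / 2 * (norm F)\<^sup>2) * majorant (2 * K) y \<partial>gaussian_seq)"

lemma expected_energy:
  assumes L: "finite L" and w: "\<And>l. l \<in> L \<Longrightarrow> 0 \<le> w l"
    and small: "\<And>x. (\<Prod>l\<in>L. 1 + w l * \<bar>\<Psi> (fst l) x\<bar>) \<le> 3 / 2"
  shows "(\<Sum>S\<in>Pow L. (\<Prod>l\<in>S. w l)\<^sup>2 * (LINT y|gaussian_seq. (norm (Dg S y))\<^sup>2)) \<le> energy_bound"
proof -
  let ?h = "\<lambda>y. \<Sum>S\<in>Pow L. (\<Prod>l\<in>S. w l)\<^sup>2 * (norm (Dg S y))\<^sup>2"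
  have fin: "finite S" if "S \<in> Pow L" for S using that L finite_subset by auto
  have int: "integrable gaussian_seq (\<lambda>y. (\<Prod>l\<in>S. w l)\<^sup>2 * (norm (Dg S y))\<^sup>2)" if "S \<in> Pow L" for S
    by (intro integrable_mult_right tame_integrable tame_norm_squared tame_Dg fin that)
  have eq: "(\<Sum>S\<in>Pow L. (\<Prod>l\<in>S. w l)\<^sup>2 * (LINT y|gaussian_seq. (norm (Dg S y))\<^sup>2)) = (LINT y|gaussian_seq. ?h y)"
    using int by (simp add: Bochner_Integration.integral_sum)
  have "ennreal (LINT y|gaussian_seq. ?h y) = (\<integral>\<^sup>+y. ennreal (?h y) \<partial>gaussian_seq)"
    by (rule nn_integral_eq_integral[symmetric, OF Bochner_Integration.integrable_sum[OF int]])
       (assumption, intro AE_I2 sum_nonneg mult_nonneg_nonneg, auto)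
  also have "\<dots> \<le> (\<integral>\<^sup>+y. ennreal (3 / 2 * (norm F)\<^sup>2) * majorant (2 * K) y \<partial>gaussian_seq)"
  proof (rule nn_integral_mono_AE)
    show "AE y in gaussian_seq. ennreal (?h y) \<le> ennreal (3 / 2 * (norm F)\<^sup>2) * majorant (2 * K) y"
      using AE_good
    proof eventually_elim
      case (elim y)
      have "?h y \<le> 3 / 2 * (norm F)\<^sup>2 * exp (2 * K * size y)"
        using Du_energy[OF elim L w small] elim by (simp add: Dg_def mult_ac)
      then have "ennreal (?h y) \<le> ennreal (3 / 2 * (norm F)\<^sup>2) * ennreal (exp (2 * K * size y))"
        by (subst ennreal_mult[symmetric]) (auto intro: ennreal_leI)
      also have "\<dots> \<le> ennreal (3 / 2 * (norm F)\<^sup>2) * majorant (2 * K) y"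
        using K_nonneg by (intro mult_left_mono exp_size_le_majorant elim) auto
      finally show ?case .
    qed
  qed
  finally have "ennreal (LINT y|gaussian_seq. ?h y) \<le> (\<integral>\<^sup>+y. ennreal (3 / 2 * (norm F)\<^sup>2) * majorant (2 * K) y \<partial>gaussian_seq)" .
  moreover have "(\<integral>\<^sup>+y. ennreal (3 / 2 * (norm F)\<^sup>2) * majorant (2 * K) y \<partial>gaussian_seq) < top"
    using majorant_finite[of "2 * K"] K_nonneg by (subst nn_integral_cmult) (auto simp: ennreal_mult_less_top)
  ultimately have "enn2real (ennreal (LINT y|gaussian_seq. ?h y)) \<le> energy_bound"
    unfolding energy_bound_def by (rule enn2real_mono)
  moreover have "0 \<le> (LINT y|gaussian_seq. ?h y)" by (intro Bochner_Integration.integral_nonneg sum_nonneg) auto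
  ultimately show ?thesis unfolding eq by simp
qed

text \<open>Group the indices by their label set S. Within a group \<open>lowered\<close> is
  injective, so Bessel's inequality applies to \<open>Dg S\<close>, and the energy estimate with
  weights \<rho>_j sums the groups. Each variable carries r labels, hence the condition on r
  K.\<close>

lemma weighted_coeff_sum_le:
  assumes r: "0 < r" and small: "r * K \<le> ln (3 / 2)" and N: "finite N" "N \<subseteq> multi_idx"
    and J: "\<And>\<nu> j. \<nu> \<in> N \<Longrightarrow> J \<le> j \<Longrightarrow> \<nu> j = 0"
  shows "(\<Sum>\<nu>\<in>N. (\<Prod>l\<in>labels r \<nu> (r * J). (\<rho> (fst l))\<^sup>2 * real (\<nu> (fst l) - snd l)) * (norm (coeff (Dg {}) \<nu>))\<^sup>2)
    \<le> energy_bound"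
proof -
  define L where "L = {..<J} \<times> {..<r}"
  define om where "om S = (\<Prod>l\<in>S. \<rho> (fst l))\<^sup>2" for S :: "(nat \<times> nat) set"
  let ?lab = "\<lambda>\<nu>. labels r \<nu> (r * J)" and ?low = "\<lambda>\<nu>. lowered r \<nu> (r * J)"
  have L: "finite L" by (simp add: L_def)
  have fin: "finite S" if "S \<in> Pow L" for S using that L finite_subset by auto
  have lab: "?lab \<nu> \<in> Pow L" for \<nu> unfolding labels_complete[OF r] L_def by auto
  have term_eq: "(\<Prod>l\<in>?lab \<nu>. (\<rho> (fst l))\<^sup>2 * real (\<nu> (fst l) - snd l)) * (norm (coeff (Dg {}) \<nu>))\<^sup>2
      = om (?lab \<nu>) * (norm (coeff (Dg (?lab \<nu>)) (?low \<nu>)))\<^sup>2" if "\<nu> \<in> N" for \<nu>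
  proof -
    have "\<nu> \<in> multi_idx" using that N by blast
    have "(norm (coeff (Dg (?lab \<nu>)) (?low \<nu>)))\<^sup>2 = (\<Prod>l\<in>?lab \<nu>. sqrt (real (\<nu> (fst l) - snd l)))\<^sup>2 * (norm (coeff (Dg {}) \<nu>))\<^sup>2"
      unfolding coeff_Dg_labels[OF r \<open>\<nu> \<in> multi_idx\<close>] by (simp add: power_mult_distrib)
    also have "(\<Prod>l\<in>?lab \<nu>. sqrt (real (\<nu> (fst l) - snd l)))\<^sup>2 = (\<Prod>l\<in>?lab \<nu>. real (\<nu> (fst l) - snd l))"
      by (simp add: prod_power_distrib)
    finally show ?thesis by (simp add: om_def prod_power_distrib prod.distrib)
  qed
  have "(\<Sum>\<nu>\<in>N. (\<Prod>l\<in>?lab \<nu>. (\<rho> (fst l))\<^sup>2 * real (\<nu> (fst l) - snd l)) * (norm (coeff (Dg {}) \<nu>))\<^sup>2)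
      = (\<Sum>\<nu>\<in>N. om (?lab \<nu>) * (norm (coeff (Dg (?lab \<nu>)) (?low \<nu>)))\<^sup>2)"
    by (intro sum.cong refl term_eq)
  also have "\<dots> = (\<Sum>S\<in>Pow L. \<Sum>\<nu>\<in>{\<nu>. \<nu> \<in> N \<and> ?lab \<nu> = S}. om (?lab \<nu>) * (norm (coeff (Dg (?lab \<nu>)) (?low \<nu>)))\<^sup>2)"
    using L lab by (intro sum.group[symmetric] N) auto
  also have "\<dots> = (\<Sum>S\<in>Pow L. om S * (\<Sum>\<nu>\<in>{\<nu>. \<nu> \<in> N \<and> ?lab \<nu> = S}. (norm (coeff (Dg S) (?low \<nu>)))\<^sup>2))"
    unfolding sum_distrib_left by (intro sum.cong refl) auto
  also have "\<dots> \<le> (\<Sum>S\<in>Pow L. om S * (LINT y|gaussian_seq. (norm (Dg S y))\<^sup>2))"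
  proof (rule sum_mono, rule mult_left_mono)
    fix S assume S: "S \<in> Pow L"
    let ?N = "{\<nu>. \<nu> \<in> N \<and> ?lab \<nu> = S}"
    have inj: "inj_on ?low ?N"
    proof (rule inj_onI)
      fix \<nu> \<mu> assume mem: "\<nu> \<in> ?N" "\<mu> \<in> ?N" and low: "?low \<nu> = ?low \<mu>"
      have "?lab \<nu> = ?lab \<mu>" using mem by simp
      with low show "\<nu> = \<mu>" using mem by (intro labels_lowered_inj[where \<nu> = \<nu> and \<mu> = \<mu> and J = J, OF r]) (simp_all add: J)
    qed
    have "(\<Sum>\<nu>\<in>?N. (norm (coeff (Dg S) (?low \<nu>)))\<^sup>2) = (\<Sum>\<mu>\<in>?low ` ?N. (norm (coeff (Dg S) \<mu>))\<^sup>2)"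
      by (rule sum.reindex_cong[OF inj refl refl, symmetric])
    also have "\<dots> \<le> (LINT y|gaussian_seq. (norm (Dg S y))\<^sup>2)"
    proof (rule bessel_inequality[OF tame_Dg[OF fin[OF S]]])
      show "finite (?low ` ?N)" using N(1) by simp
      show "?low ` ?N \<subseteq> multi_idx" using N(2) lowered_multi_idx by blast
    qed
    finally show "(\<Sum>\<nu>\<in>?N. (norm (coeff (Dg S) (?low \<nu>)))\<^sup>2) \<le> (LINT y|gaussian_seq. (norm (Dg S y))\<^sup>2)" .
  qed (simp add: om_def)
  also have "\<dots> \<le> energy_bound"
    unfolding om_def
  proof (rule expected_energy[OF L])
    fix x
    have "(\<Prod>l\<in>L. 1 + \<rho> (fst l) * \<bar>\<Psi> (fst l) x\<bar>) \<le> exp (\<Sum>l\<in>L. \<rho> (fst l) * \<bar>\<Psi> (fst l) x\<bar>)"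
      using rho_pos by (intro prod_one_plus_le_exp) (simp add: less_imp_le)
    also have "(\<Sum>l\<in>L. \<rho> (fst l) * \<bar>\<Psi> (fst l) x\<bar>) = (\<Sum>j<J. \<Sum>i<r. \<rho> j * \<bar>\<Psi> j x\<bar>)"
      unfolding L_def by (subst sum.cartesian_product) (simp add: split_beta)
    also have "\<dots> = r * (\<Sum>j<J. \<rho> j * \<bar>\<Psi> j x\<bar>)" by (simp add: sum_distrib_left)
    also have "\<dots> \<le> ln (3 / 2)"
      using mult_left_mono[OF Psi_sum[where x = x and n = J], of "real r"] small by linarith
    finally show "(\<Prod>l\<in>L. 1 + \<rho> (fst l) * \<bar>\<Psi> (fst l) x\<bar>) \<le> 3 / 2" by simp
  qed (simp add: rho_pos less_imp_le)
  finally show ?thesis .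
qed

end

text \<open>The factor contributed to the weight by one variable of degree n with x = \<rho>_j: it
  equals x^(2m) n! / (n - m)! with m = min n r.\<close>

definition beta :: "nat \<Rightarrow> real \<Rightarrow> nat \<Rightarrow> real" where
  "beta r x n = (\<Prod>i<min n r. x\<^sup>2 * real (n - i))"

lemma beta_0 [simp]: "beta r x 0 = 1"
  by (simp add: beta_def)

lemma prod_labels_eq:
  assumes "0 < r"
  shows "(\<Prod>l\<in>labels r \<nu> (r * J). (\<rho> (fst l))\<^sup>2 * real (\<nu> (fst l) - snd l)) = (\<Prod>j<J. beta r (\<rho> j) (\<nu> j))"
  unfolding labels_complete[OF assms] beta_def by (subst prod.Sigma) (auto simp: split_beta)

text \<open>Only one factor x^2 is kept, because x^2 raised to -q/2 is the summable x^(-q); the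
  remaining powers of x are bounded below by powers of \<delta>. The growth n^r comes from n - i
  \<ge> n / r for i < r < n, and for n \<le> r it is absorbed by (n / r)^r \<le> 1.\<close>

lemma beta_lower_bound:
  assumes r: "0 < r" and \<delta>: "0 < \<delta>" "\<delta> \<le> 1" "\<delta> \<le> x\<^sup>2" and n: "1 \<le> n"
  shows "(\<delta> / r) ^ r * x\<^sup>2 * real n ^ r \<le> beta r x n"
proof (cases "n \<le> r")
  case True
  have "(\<delta> / r) ^ r * x\<^sup>2 * real n ^ r = \<delta> ^ r * x\<^sup>2 * (n / r) ^ r" by (simp add: power_divide)
  also have "\<dots> \<le> \<delta> ^ r * x\<^sup>2 * 1"
    using True r \<delta> by (intro mult_left_mono power_le_one) auto
  also have "\<dots> \<le> \<delta> ^ (n - 1) * x\<^sup>2"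
    using True \<delta> by (simp add: mult_right_mono power_decreasing)
  also have "\<dots> \<le> (x\<^sup>2) ^ (n - 1) * x\<^sup>2" using \<delta> by (intro mult_right_mono power_mono) auto
  also have "\<dots> = (\<Prod>i<n. x\<^sup>2 * 1)" using n by (cases n) (auto simp: mult.commute)
  also have "\<dots> \<le> (\<Prod>i<n. x\<^sup>2 * real (n - i))" by (intro prod_mono conjI mult_left_mono) auto
  also have "\<dots> = beta r x n" using True by (simp add: beta_def min_def)
  finally show ?thesis .
next
  case False
  have "(\<delta> / r) ^ r * x\<^sup>2 * real n ^ r = \<delta> ^ r * x\<^sup>2 * (n / r) ^ r" by (simp add: power_divide)
  also have "\<dots> \<le> \<delta> ^ (r - 1) * x\<^sup>2 * (n / r) ^ r"
    using \<delta> by (intro mult_right_mono power_decreasing) auto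
  also have "\<dots> \<le> (x\<^sup>2) ^ (r - 1) * x\<^sup>2 * (n / r) ^ r" using \<delta> by (intro mult_right_mono power_mono) auto
  also have "\<dots> = (x\<^sup>2 * (n / r)) ^ r"
    unfolding power_mult_distrib[of "x\<^sup>2"] using r by (cases r) (auto simp: mult.commute)
  also have "\<dots> = (\<Prod>i<r. x\<^sup>2 * (n / r))" by simp
  also have "\<dots> \<le> (\<Prod>i<r. x\<^sup>2 * real (n - i))"
  proof (intro prod_mono conjI mult_left_mono)
    fix i assume i: "i \<in> {..<r}"
    obtain r' where r': "r = Suc r'" using r by (cases r) auto
    have "real r * real i \<le> real r * real r'" using i r' by simp
    also have "\<dots> \<le> real n * real r'" using False by (intro mult_right_mono) auto
    finally have "real n \<le> real r * (real n - real i)" unfolding r' by (simp add: algebra_simps)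
    then show "n / r \<le> real (n - i)" using i False r by (simp add: divide_le_eq mult.commute of_nat_diff)
  qed auto
  also have "\<dots> = beta r x n" using False by (simp add: beta_def min_def)
  finally show ?thesis .
qed

text \<open>On a box a sum of products factorizes into one-variable sums, and every finite set of
  multi-indices fits into some box.\<close>

definition idx_box :: "nat \<Rightarrow> nat \<Rightarrow> (nat \<Rightarrow> nat) set" where
  "idx_box J M = {\<nu>. (\<forall>j. \<nu> j \<le> M) \<and> (\<forall>j\<ge>J. \<nu> j = 0)}"

lemma sum_idx_box:
  fixes g :: "nat \<Rightarrow> nat \<Rightarrow> real"
  shows "finite (idx_box J M) \<and> (\<Sum>\<nu>\<in>idx_box J M. \<Prod>j<J. g j (\<nu> j)) = (\<Prod>j<J. \<Sum>n\<le>M. g j n)"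
proof (induction J)
  case 0
  have "idx_box 0 M = {\<lambda>_. 0}" by (auto simp: idx_box_def)
  then show ?case by simp
next
  case (Suc J)
  let ?f = "\<lambda>(\<nu> :: nat \<Rightarrow> nat, n). \<nu>(J := n)"
  have img: "idx_box (Suc J) M = ?f ` (idx_box J M \<times> {..M})"
  proof (intro equalityI subsetI)
    fix \<nu> assume \<nu>: "\<nu> \<in> idx_box (Suc J) M"
    have "\<nu>(J := 0) \<in> idx_box J M"
      unfolding idx_box_def
    proof (intro CollectI conjI allI impI)
      fix j show "(\<nu>(J := 0)) j \<le> M" using \<nu> by (auto simp: idx_box_def)
      assume "J \<le> j"
      then show "(\<nu>(J := 0)) j = 0" using \<nu> by (cases "j = J") (auto simp: idx_box_def)
    qed
    moreover have "\<nu> J \<le> M" "\<nu> = ?f (\<nu>(J := 0), \<nu> J)" using \<nu> by (auto simp: idx_box_def)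
    ultimately show "\<nu> \<in> ?f ` (idx_box J M \<times> {..M})" by blast
  qed (auto simp: idx_box_def)
  have inj: "inj_on ?f (idx_box J M \<times> {..M})"
  proof (rule inj_onI, clarify)
    fix \<nu> n \<mu> m assume a: "\<nu> \<in> idx_box J M" "\<mu> \<in> idx_box J M" "\<nu>(J := n) = \<mu>(J := m)"
    have "\<nu> j = \<mu> j" for j using fun_cong[OF a(3), of j] a(1,2) by (cases "j = J") (auto simp: idx_box_def)
    then show "\<nu> = \<mu> \<and> n = m" using fun_cong[OF a(3), of J] by auto
  qed
  have "(\<Sum>\<nu>\<in>idx_box (Suc J) M. \<Prod>j<Suc J. g j (\<nu> j)) = (\<Sum>(\<nu>, n)\<in>idx_box J M \<times> {..M}. (\<Prod>j<J. g j (\<nu> j)) * g J n)"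
    unfolding img by (subst sum.reindex[OF inj]) (auto intro!: sum.cong prod.cong)
  also have "\<dots> = (\<Sum>\<nu>\<in>idx_box J M. \<Prod>j<J. g j (\<nu> j)) * (\<Sum>n\<le>M. g J n)"
    unfolding sum_product by (subst sum.cartesian_product) simp
  finally show ?case using Suc.IH unfolding img by simp
qed

lemma subset_idx_box:
  assumes "finite N" "N \<subseteq> multi_idx"
  obtains J M where "N \<subseteq> idx_box J M"
proof -
  have "\<exists>J M. N \<subseteq> idx_box J M"
    using assms
  proof (induction N rule: finite_induct)
    case (insert \<nu> N)
    then obtain J M where IH: "N \<subseteq> idx_box J M" by auto
    have "finite {j. \<nu> j \<noteq> 0}" using insert by (simp add: multi_idx_def)
    then obtain J' where J': "\<And>j. \<nu> j \<noteq> 0 \<Longrightarrow> j < J'" unfolding finite_nat_set_iff_bounded by auto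
    have J'': "\<nu> j = 0" if "J' \<le> j" for j using J'[of j] that by (cases "\<nu> j = 0") auto
    define M' where "M' = (\<Sum>j<J'. \<nu> j)"
    have "\<nu> j \<le> M'" for j
      using J'[of j] member_le_sum[of j "{..<J'}" \<nu>] by (cases "\<nu> j = 0") (auto simp: M'_def)
    then have "\<nu> \<in> idx_box (max J J') (max M M')"
      using J'' by (auto simp: idx_box_def le_max_iff_disj)
    moreover have "N \<subseteq> idx_box (max J J') (max M M')"
      using IH by (auto simp: idx_box_def le_max_iff_disj)
    ultimately show ?case by blast
  qed (auto simp: idx_box_def)
  then show ?thesis using that by blast
qed

text \<open>The sum over a box factorizes into factors at most 1 + C1 \<rho>_j^(-q), the 1 being
  degree 0, and their product is at most the exponential of C1 times the l^q sum.\<close>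

lemma (in gaussian_weights) beta_powr_sum_bounded:
  assumes r: "0 < r" "4 \<le> r * q"
  obtains C where "\<And>J M. (\<Sum>\<nu>\<in>idx_box J M. (\<Prod>j<J. beta r (\<rho> j) (\<nu> j)) powr (- q / 2)) \<le> C"
proof -
  obtain R where R: "0 < R" "\<And>j. 1 / \<rho> j \<le> R" using rho_bounded_below by blast
  define \<delta> where "\<delta> = min 1 ((1 / R)\<^sup>2)"
  have \<delta>: "0 < \<delta>" "\<delta> \<le> 1" "\<delta> \<le> (\<rho> j)\<^sup>2" for j
  proof -
    have "1 / R \<le> \<rho> j" using R(2)[of j] R(1) rho_pos[of j] by (simp add: field_simps)
    then have "(1 / R)\<^sup>2 \<le> (\<rho> j)\<^sup>2" using R(1) by (intro power_mono) auto
    then show "\<delta> \<le> (\<rho> j)\<^sup>2" by (simp add: \<delta>_def)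
  qed (use R(1) in \<open>auto simp: \<delta>_def\<close>)
  define \<kappa> where "\<kappa> = (\<delta> / r) ^ r"
  have \<kappa>: "0 < \<kappa>" using \<delta> r by (simp add: \<kappa>_def)
  \<comment> \<open>Since 4 \<le> r q, raising n^r to -q/2 gives at most n^(-2), so this series
    controls the positive degrees.\<close>
  define Z where "Z = (\<Sum>n. 1 / real (Suc n) ^ 2)"
  have Zs: "summable (\<lambda>n. 1 / real (Suc n) ^ 2)"
    using inverse_power_summable[of 2, where 'a = real] by (subst summable_Suc_iff) (simp add: inverse_eq_divide)
  define C1 where "C1 = \<kappa> powr (- q / 2) * Z"
  have Z0: "0 \<le> Z" unfolding Z_def by (intro suminf_nonneg Zs) simp
  have C1: "0 \<le> C1" using Z0 by (simp add: C1_def)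
  have beta_pos: "0 < beta r (\<rho> j) n" for j n
    unfolding beta_def using rho_pos[of j] by (intro prod_pos) auto
  have beta_le: "beta r (\<rho> j) (Suc n) powr (- q / 2) \<le> \<kappa> powr (- q / 2) * inverse (\<rho> j) powr q * (1 / real (Suc n) ^ 2)" for j n
  proof -
    let ?n = "real (Suc n)"
    have pos: "0 < \<kappa> * (\<rho> j)\<^sup>2 * ?n ^ r" using \<kappa> rho_pos[of j] by simp
    have "beta r (\<rho> j) (Suc n) powr (- q / 2) \<le> (\<kappa> * (\<rho> j)\<^sup>2 * ?n ^ r) powr (- q / 2)"
      unfolding \<kappa>_def using pos q_pos
      by (intro powr_mono2' beta_lower_bound r \<delta>) (auto simp: \<kappa>_def)
    also have "\<dots> = \<kappa> powr (- q / 2) * ((\<rho> j)\<^sup>2 powr (- q / 2)) * ((?n ^ r) powr (- q / 2))"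
      using \<kappa> rho_pos[of j] by (simp add: powr_mult)
    also have "(\<rho> j)\<^sup>2 powr (- q / 2) = inverse (\<rho> j) powr q"
    proof -
      have "(\<rho> j)\<^sup>2 powr (- q / 2) = \<rho> j powr (- q)"
        using powr_powr[of "\<rho> j" 2 "- q / 2"] rho_pos[of j] by (simp add: powr_numeral)
      then show ?thesis using rho_pos[of j] by (simp add: powr_minus inverse_powr)
    qed
    also have "(?n ^ r) powr (- q / 2) \<le> 1 / ?n ^ 2"
    proof -
      have "(?n ^ r) powr (- q / 2) = ?n powr (- (r * q / 2))"
        by (simp add: powr_realpow[symmetric] powr_powr del: of_nat_Suc)
      also have "\<dots> \<le> ?n powr (- 2)" using r(2) by (intro powr_mono) auto
      also have "\<dots> = 1 / ?n ^ 2" by (simp add: powr_minus powr_numeral divide_inverse del: of_nat_Suc)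
      finally show ?thesis .
    qed
    finally show ?thesis by (simp add: mult_left_mono)
  qed
  have col: "(\<Sum>n\<le>M. beta r (\<rho> j) n powr (- q / 2)) \<le> 1 + C1 * inverse (\<rho> j) powr q" for j M
  proof -
    have "(\<Sum>n\<le>M. beta r (\<rho> j) n powr (- q / 2)) = 1 + (\<Sum>n<M. beta r (\<rho> j) (Suc n) powr (- q / 2))"
      by (simp add: sum.atMost_shift)
    also have "(\<Sum>n<M. beta r (\<rho> j) (Suc n) powr (- q / 2))
        \<le> (\<Sum>n<M. \<kappa> powr (- q / 2) * inverse (\<rho> j) powr q * (1 / real (Suc n) ^ 2))"
      by (intro sum_mono beta_le)
    also have "\<dots> \<le> \<kappa> powr (- q / 2) * inverse (\<rho> j) powr q * Z"
      unfolding sum_distrib_left[symmetric] Z_def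
      by (intro mult_left_mono sum_le_suminf Zs) auto
    finally show ?thesis by (simp add: C1_def mult_ac)
  qed
  have "(\<Sum>\<nu>\<in>idx_box J M. (\<Prod>j<J. beta r (\<rho> j) (\<nu> j)) powr (- q / 2)) \<le> exp (C1 * (\<Sum>j. inverse (\<rho> j) powr q))" for J M
  proof -
    have "(\<Sum>\<nu>\<in>idx_box J M. (\<Prod>j<J. beta r (\<rho> j) (\<nu> j)) powr (- q / 2))
        = (\<Sum>\<nu>\<in>idx_box J M. \<Prod>j<J. beta r (\<rho> j) (\<nu> j) powr (- q / 2))"
      by (intro sum.cong refl prod_powr_distrib)
    also have "\<dots> = (\<Prod>j<J. \<Sum>n\<le>M. beta r (\<rho> j) n powr (- q / 2))"
      using sum_idx_box[of J M "\<lambda>j n. beta r (\<rho> j) n powr (- q / 2)"] by blast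
    also have "\<dots> \<le> (\<Prod>j<J. 1 + C1 * inverse (\<rho> j) powr q)"
      by (intro prod_mono conjI col sum_nonneg) auto
    also have "\<dots> \<le> exp (\<Sum>j<J. C1 * inverse (\<rho> j) powr q)"
      using C1 by (intro prod_one_plus_le_exp) simp
    also have "\<dots> \<le> exp (C1 * (\<Sum>j. inverse (\<rho> j) powr q))"
      unfolding sum_distrib_left[symmetric] using C1
      by (simp add: mult_left_mono sum_le_suminf[OF rho_summable])
    finally show ?thesis .
  qed
  then show ?thesis using that by blast
qed

section \<open>Best n-term approximation\<close>

text \<open>k indices with c \<ge> t force the sum of c^p to be at least k t^p, which exceeds the
  total once k is large.\<close>

lemma finite_superlevel_set:
  fixes c :: "'i \<Rightarrow> real"
  assumes c: "\<And>i. i \<in> X \<Longrightarrow> 0 \<le> c i" and p: "0 < p" and sm: "(\<lambda>i. c i powr p) summable_on X" and t: "0 < t"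
  shows "finite {i \<in> X. t \<le> c i}"
proof (rule ccontr)
  assume inf: "infinite {i \<in> X. t \<le> c i}"
  obtain k :: nat where k: "(\<Sum>\<^sub>\<infinity>i\<in>X. c i powr p) < real k * t powr p"
    using reals_Archimedean3[of "t powr p"] t by auto
  obtain B where B: "B \<subseteq> {i \<in> X. t \<le> c i}" "finite B" "card B = k"
    using infinite_arbitrarily_large[OF inf] by blast
  have "real k * t powr p = (\<Sum>i\<in>B. t powr p)" using B by simp
  also have "\<dots> \<le> (\<Sum>i\<in>B. c i powr p)"
    using B(1) t p by (intro sum_mono powr_mono2) auto
  also have "\<dots> \<le> (\<Sum>\<^sub>\<infinity>i\<in>X. c i powr p)"
    using B by (intro finite_sum_le_infsum sm) auto
  finally show False using k by simp
qed

text \<open>Greedy choice of a maximizer on the complement. If some value there is positive, only a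
  finite superlevel set has to be searched; otherwise any index will do.\<close>

lemma n_largest_exists:
  assumes c: "\<And>\<nu>. \<nu> \<in> multi_idx \<Longrightarrow> 0 \<le> c \<nu>" and p: "0 < p"
    and sm: "(\<lambda>\<nu>. c \<nu> powr p) summable_on multi_idx"
  shows "\<exists>\<Lambda>. n_largest c n \<Lambda>"
proof (induction n)
  case 0
  show ?case by (rule exI[of _ "{}"]) (simp add: n_largest_def)
next
  case (Suc n)
  then obtain \<Lambda> where \<Lambda>: "\<Lambda> \<subseteq> multi_idx" "finite \<Lambda>" "card \<Lambda> = n" "\<And>\<nu> \<mu>. \<nu> \<in> \<Lambda> \<Longrightarrow> \<mu> \<in> multi_idx - \<Lambda> \<Longrightarrow> c \<mu> \<le> c \<nu>"
    unfolding n_largest_def by blast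
  have "infinite (multi_idx - \<Lambda>)" using infinite_multi_idx \<Lambda>(2) by (simp add: Diff_infinite_finite)
  then obtain \<mu>0 where \<mu>0: "\<mu>0 \<in> multi_idx - \<Lambda>" by (metis finite.emptyI ex_in_conv)
  have "\<exists>\<nu>\<in>multi_idx - \<Lambda>. \<forall>\<mu>\<in>multi_idx - \<Lambda>. c \<mu> \<le> c \<nu>"
  proof (cases "\<exists>\<mu>\<in>multi_idx - \<Lambda>. 0 < c \<mu>")
    case True
    then obtain \<mu>1 where \<mu>1: "\<mu>1 \<in> multi_idx - \<Lambda>" "0 < c \<mu>1" by blast
    define B where "B = {\<mu> \<in> multi_idx - \<Lambda>. c \<mu>1 \<le> c \<mu>}"
    have fin: "finite B"
      by (rule finite_subset[OF _ finite_superlevel_set[OF c p sm \<mu>1(2)]]) (auto simp: B_def)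
    have "B \<noteq> {}" using \<mu>1 by (auto simp: B_def)
    then have "Max (c ` B) \<in> c ` B" using fin by (intro Max_in) auto
    then obtain \<nu> where \<nu>: "\<nu> \<in> B" "Max (c ` B) = c \<nu>" by (rule imageE)
    have le: "c \<mu> \<le> c \<nu>" if "\<mu> \<in> B" for \<mu>
      using Max_ge[of "c ` B" "c \<mu>"] fin that \<nu>(2) by simp
    have "c \<mu> \<le> c \<nu>" if "\<mu> \<in> multi_idx - \<Lambda>" for \<mu>
      using \<nu>(1) le[of \<mu>] that by (cases "c \<mu>1 \<le> c \<mu>") (auto simp: B_def)
    then show ?thesis using \<nu>(1) by (auto simp: B_def)
  next
    case False
    then have "c \<mu> \<le> c \<mu>0" if "\<mu> \<in> multi_idx - \<Lambda>" for \<mu>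
      using that c[of \<mu>0] \<mu>0 by (meson DiffD1 not_less order_trans)
    then show ?thesis using \<mu>0 by blast
  qed
  then obtain \<nu> where \<nu>: "\<nu> \<in> multi_idx - \<Lambda>" "\<And>\<mu>. \<mu> \<in> multi_idx - \<Lambda> \<Longrightarrow> c \<mu> \<le> c \<nu>" by blast
  have "n_largest c (Suc n) (insert \<nu> \<Lambda>)"
    unfolding n_largest_def using \<Lambda> \<nu> by auto
  then show ?case by blast
qed

text \<open>For j outside \<Lambda>, n c_j^p \<le> S because n entries are at least as large.
  Writing c_j^2 = c_j^(2-p) c_j^p and bounding the first factor by (S / n)^((2-p)/p) leaves the l^p
  sum.\<close>

lemma stechkin:
  fixes c :: "'i \<Rightarrow> real"
  assumes c: "\<And>i. i \<in> X \<Longrightarrow> 0 \<le> c i" and p: "0 < p" "p < 2"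
    and sm: "(\<lambda>i. c i powr p) summable_on X" and T: "((\<lambda>i. (c i)\<^sup>2) has_sum T) X"
    and \<Lambda>: "\<Lambda> \<subseteq> X" "finite \<Lambda>" "card \<Lambda> = n" "1 \<le> n" "\<And>i j. i \<in> \<Lambda> \<Longrightarrow> j \<in> X - \<Lambda> \<Longrightarrow> c j \<le> c i"
  shows "T - (\<Sum>i\<in>\<Lambda>. (c i)\<^sup>2) \<le> (\<Sum>\<^sub>\<infinity>i\<in>X. c i powr p) powr (2 / p) * real n powr (- 2 * (1 / p - 1 / 2))"
proof -
  define S where "S = (\<Sum>\<^sub>\<infinity>i\<in>X. c i powr p)"
  define M where "M = (S / n) powr ((2 - p) / p)"
  have S0: "0 \<le> S" unfolding S_def by (intro infsum_nonneg) simp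
  have tail: "(c j)\<^sup>2 \<le> M * c j powr p" if j: "j \<in> X - \<Lambda>" for j
  proof -
    have "real n * c j powr p = (\<Sum>i\<in>\<Lambda>. c j powr p)" using \<Lambda>(3) by simp
    also have "\<dots> \<le> (\<Sum>i\<in>\<Lambda>. c i powr p)"
      using \<Lambda>(5) j c p by (intro sum_mono powr_mono2) auto
    also have "\<dots> \<le> S" unfolding S_def by (intro finite_sum_le_infsum sm \<Lambda>) auto
    finally have "c j powr p \<le> S / n" using \<Lambda>(4) by (simp add: field_simps)
    then have "(c j powr p) powr ((2 - p) / p) \<le> M"
      unfolding M_def using p by (intro powr_mono2) auto
    then have "c j powr (2 - p) \<le> M" using p by (simp add: powr_powr)
    then have "c j powr (2 - p) * c j powr p \<le> M * c j powr p" by (intro mult_right_mono) auto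
    moreover have "c j powr (2 - p) * c j powr p = (c j)\<^sup>2"
      using c[of j] j by (cases "c j = 0") (auto simp: powr_add[symmetric] powr_numeral)
    ultimately show ?thesis by simp
  qed
  have sub: "(\<lambda>i. c i powr p) summable_on (X - \<Lambda>)" by (rule summable_on_subset_banach[OF sm]) auto
  have "T - (\<Sum>i\<in>\<Lambda>. (c i)\<^sup>2) \<le> M * (\<Sum>\<^sub>\<infinity>i\<in>X - \<Lambda>. c i powr p)"
  proof (rule has_sum_mono)
    show "((\<lambda>i. (c i)\<^sup>2) has_sum (T - (\<Sum>i\<in>\<Lambda>. (c i)\<^sup>2))) (X - \<Lambda>)"
      by (rule has_sum_Diff[OF T has_sum_finite[OF \<Lambda>(2)] \<Lambda>(1)])
    show "((\<lambda>i. M * c i powr p) has_sum (M * (\<Sum>\<^sub>\<infinity>i\<in>X - \<Lambda>. c i powr p))) (X - \<Lambda>)"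
      by (intro has_sum_cmult_right has_sum_infsum sub)
  qed (rule tail)
  also have "\<dots> \<le> M * S"
    unfolding S_def by (intro mult_left_mono infsum_mono2 sub sm) (auto simp: M_def)
  also have "M * S = S powr (2 / p) * real n powr (- 2 * (1 / p - 1 / 2))"
  proof (cases "S = 0")
    case False
    define t where "t = (2 - p) / p"
    have e: "t + 1 = 2 / p" "- t = - 2 * (1 / p - 1 / 2)" using p by (auto simp: t_def field_simps)
    have "M * S = (S powr t * S powr 1) * real n powr (- t)"
      using S0 by (simp add: M_def t_def[symmetric] powr_divide powr_minus_divide)
    also have "S powr t * S powr 1 = S powr (2 / p)"
      by (simp only: powr_add[symmetric] e)
    finally show ?thesis unfolding e .
  qed simp
  finally show ?thesis unfolding S_def .
qed

context parametric_problem
begin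

lemma coeff_powr_summable:
  fixes r :: nat
  assumes p: "0 < p" "p < 2" and q_eq: "q = 2 * p / (2 - p)" and r: "0 < r" "4 \<le> r * q" "r * K \<le> ln (3 / 2)"
  shows "(\<lambda>\<nu>. norm (coeff (Dg {}) \<nu>) powr p) summable_on multi_idx"
proof (rule nonneg_bdd_above_summable_on)
  obtain C where C: "\<And>J M. (\<Sum>\<nu>\<in>idx_box J M. (\<Prod>j<J. beta r (\<rho> j) (\<nu> j)) powr (- q / 2)) \<le> C"
    using beta_powr_sum_bounded[OF r(1,2)] by blast
  have "(\<Sum>\<nu>\<in>N. norm (coeff (Dg {}) \<nu>) powr p) \<le> energy_bound + C" if N: "finite N" "N \<subseteq> multi_idx" for N
  proof -
    obtain J M where JM: "N \<subseteq> idx_box J M" using subset_idx_box[OF N] by blast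
    define b where "b \<nu> = (\<Prod>j<J. beta r (\<rho> j) (\<nu> j))" for \<nu>
    have b: "0 < b \<nu>" for \<nu>
      unfolding b_def beta_def using rho_pos by (intro prod_pos) (auto simp: less_imp_neq[symmetric])
    define x where "x \<nu> = norm (coeff (Dg {}) \<nu>)" for \<nu>
    have "x \<nu> powr p \<le> b \<nu> * (x \<nu>)\<^sup>2 + b \<nu> powr (- q / 2)" for \<nu>
    proof (cases "x \<nu> = 0")
      case False
      then have x: "0 < x \<nu>" by (simp add: x_def)
      define m where "m = max (b \<nu> * (x \<nu>)\<^sup>2) (b \<nu> powr (- q / 2))"
      have m: "0 < m" using b[of \<nu>] by (auto simp: m_def less_max_iff_disj)
      \<comment> \<open>This relation makes x^p the geometric mean of b x^2 and b^(-q/2) with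
        exponents p/2 and 1 - p/2. Such a mean is at most the maximum, hence at most the sum, which
        replaces Hoelder's inequality by a termwise bound.\<close>
      have e: "(- q / 2) * (1 - p / 2) = - (p / 2)" using p by (simp add: q_eq field_simps)
      have "x \<nu> powr p = ((x \<nu>)\<^sup>2) powr (p / 2)"
        using powr_powr[of "x \<nu>" 2 "p / 2"] x by (simp add: powr_numeral)
      also have "\<dots> = (b \<nu> powr (p / 2) * ((x \<nu>)\<^sup>2) powr (p / 2)) * b \<nu> powr (- (p / 2))"
        using b[of \<nu>] by (simp add: powr_minus field_simps)
      also have "b \<nu> powr (p / 2) * ((x \<nu>)\<^sup>2) powr (p / 2) = (b \<nu> * (x \<nu>)\<^sup>2) powr (p / 2)"
        using b[of \<nu>] x by (simp add: powr_mult)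
      also have "b \<nu> powr (- (p / 2)) = (b \<nu> powr (- q / 2)) powr (1 - p / 2)"
        by (simp only: powr_powr e)
      also have "(b \<nu> * (x \<nu>)\<^sup>2) powr (p / 2) * (b \<nu> powr (- q / 2)) powr (1 - p / 2) \<le> m powr (p / 2) * m powr (1 - p / 2)"
        using p b[of \<nu>] by (intro mult_mono powr_mono2) (auto simp: m_def)
      also have "\<dots> = m" using m by (simp add: powr_add[symmetric])
      also have "m \<le> b \<nu> * (x \<nu>)\<^sup>2 + b \<nu> powr (- q / 2)" using b[of \<nu>] by (auto simp: m_def max_def)
      finally show ?thesis .
    qed (use b[of \<nu>] in simp)
    then have "(\<Sum>\<nu>\<in>N. x \<nu> powr p) \<le> (\<Sum>\<nu>\<in>N. b \<nu> * (x \<nu>)\<^sup>2) + (\<Sum>\<nu>\<in>N. b \<nu> powr (- q / 2))"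
      unfolding sum.distrib[symmetric] by (intro sum_mono)
    moreover have "(\<Sum>\<nu>\<in>N. b \<nu> * (x \<nu>)\<^sup>2) \<le> energy_bound"
      using weighted_coeff_sum_le[OF r(1,3) N, of J] JM unfolding b_def x_def prod_labels_eq[OF r(1)]
      by (auto simp: idx_box_def subset_iff)
    moreover have "(\<Sum>\<nu>\<in>N. b \<nu> powr (- q / 2)) \<le> (\<Sum>\<nu>\<in>idx_box J M. b \<nu> powr (- q / 2))"
      using sum_idx_box[of J M] JM by (intro sum_mono2) auto
    ultimately show ?thesis using C[of J M] unfolding b_def x_def by linarith
  qed
  then show "bdd_above (sum (\<lambda>\<nu>. norm (coeff (Dg {}) \<nu>) powr p) ` {N. N \<subseteq> multi_idx \<and> finite N})"
    by (intro bdd_aboveI[of _ "energy_bound + C"]) auto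
qed simp

text \<open>Almost surely equal to the solution, but in \<open>H10 D\<close> for every y and with
  gradient exactly \<open>Dg {}\<close>.\<close>

definition sol_good :: "(nat \<Rightarrow> real) \<Rightarrow> 'a H1" where
  "sol_good y = (if y \<in> good then solution D \<psi> f y else 0)"

lemma snd_sol_good: "snd (sol_good y) = Dg {} y"
  by (simp add: sol_good_def solution_good snd_potential[OF bounded_D Dg_in_grads]) (simp add: Dg_def)

lemma sol_good_in_H10: "sol_good y \<in> H10 D"
  using subspace_0[OF subspace_H10[of D]]
  by (simp add: sol_good_def solution_good potential_in_H10[OF bounded_D Dg_in_grads])

lemma solution_borel_measurable [measurable]: "solution D \<psi> f \<in> borel_measurable gaussian_seq"
  using solution_measurable by (simp add: measurable_cong_sets[OF sets_gaussian_seq refl])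

lemma tame_sol_good: "tame sol_good"
proof -
  obtain C0 where C0: "0 \<le> C0" "\<And>v. v \<in> H10 D \<Longrightarrow> norm (fst v) \<le> C0 * norm (snd v)"
    using poincare_H10[OF bounded_D] by blast
  obtain C k where C: "0 \<le> C" "0 \<le> k" "\<And>y. y \<in> good \<Longrightarrow> norm (Dg {} y) \<le> C * exp (k * size y)"
    using tameE[OF tame_Dg[of "{}"]] by auto
  show ?thesis
  proof (rule tameI[where C = "(C0 + 1) * C" and k = k])
    show "sol_good \<in> borel_measurable gaussian_seq" unfolding sol_good_def[abs_def] by measurable
    fix y assume y: "y \<in> good"
    have "norm (sol_good y) \<le> norm (fst (sol_good y)) + norm (snd (sol_good y))"
      by (metis norm_Pair_le prod.collapse)
    also have "\<dots> \<le> (C0 + 1) * norm (Dg {} y)"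
      using C0(2)[OF sol_good_in_H10[of y]] by (simp add: snd_sol_good algebra_simps)
    also have "\<dots> \<le> (C0 + 1) * (C * exp (k * size y))"
      using C0(1) by (intro mult_left_mono C y) auto
    finally show "norm (sol_good y) \<le> (C0 + 1) * C * exp (k * size y)" by (simp add: mult.assoc)
  qed (use C C0 in auto)
qed

lemma AE_sol_good: "AE y in gaussian_seq. solution D \<psi> f y = sol_good y"
  using AE_good by eventually_elim (simp add: sol_good_def)

text \<open>Integration commutes with the bounded projection \<open>snd\<close>, so the gradient of
  the coefficient is the coefficient of the gradient.\<close>

lemma hermite_coeff_solution:
  assumes \<nu>: "\<nu> \<in> multi_idx"
  shows "hermite_coeff (solution D \<psi> f) \<nu> = coeff sol_good \<nu>"
    and "snd (hermite_coeff (solution D \<psi> f) \<nu>) = coeff (Dg {}) \<nu>"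
    and "hermite_coeff (solution D \<psi> f) \<nu> \<in> H10 D"
proof -
  note tH = tame_hermite_prod[OF \<nu>]
  note [measurable] = tame_measurable[OF tH] tame_measurable[OF tame_sol_good]
  have int: "integrable gaussian_seq (\<lambda>y. hermite_prod \<nu> y *\<^sub>R sol_good y)"
    by (intro tame_integrable tame_scaleR tH tame_sol_good)
  show eq: "hermite_coeff (solution D \<psi> f) \<nu> = coeff sol_good \<nu>"
    unfolding hermite_coeff_def coeff_def
  proof (rule integral_cong_AE)
    show "AE y in gaussian_seq. hermite_prod \<nu> y *\<^sub>R solution D \<psi> f y = hermite_prod \<nu> y *\<^sub>R sol_good y"
      using AE_sol_good by eventually_elim simp
  qed measurable
  show "snd (hermite_coeff (solution D \<psi> f) \<nu>) = coeff (Dg {}) \<nu>"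
    unfolding eq unfolding coeff_def
    using integral_bounded_linear[OF bounded_linear_snd int] by (simp add: snd_sol_good)
  show "hermite_coeff (solution D \<psi> f) \<nu> \<in> H10 D"
    unfolding eq coeff_def
    by (intro integral_in_closed_subspace subspace_H10 closed_H10 int AE_I2 subspace_scale[OF subspace_H10] sol_good_in_H10)
qed

lemma V_norm_hermite_coeff: "\<nu> \<in> multi_idx \<Longrightarrow> V_norm (hermite_coeff (solution D \<psi> f) \<nu>) = norm (coeff (Dg {}) \<nu>)"
  by (simp add: V_norm_def hermite_coeff_solution(2))

text \<open>A bound on the gradient by C exp (k' * \<open>size y\<close>) keeps this shape under
  powers, so one growth bound yields every moment.\<close>

lemma in_LkI:
  assumes w: "w \<in> borel_measurable gaussian_seq" "AE y in gaussian_seq. w y \<in> H10 D"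
    and T: "tame T" "\<And>y. y \<in> good \<Longrightarrow> snd (w y) = T y" and k: "0 \<le> k"
  shows "w \<in> Lk D k"
proof -
  obtain C k' where C: "0 \<le> C" "0 \<le> k'" "\<And>y. y \<in> good \<Longrightarrow> norm (T y) \<le> C * exp (k' * size y)"
    using tameE[OF T(1)] by blast
  have "(\<integral>\<^sup>+y. ennreal (V_norm (w y) powr k) \<partial>gaussian_seq) < \<infinity>"
  proof (rule tame_nn_integral[of _ "C powr k" "k * k'"])
    fix y assume y: "y \<in> good"
    have "V_norm (w y) powr k \<le> (C * exp (k' * size y)) powr k"
      using C(3)[OF y] T(2)[OF y] k by (intro powr_mono2) (auto simp: V_norm_def)
    also have "\<dots> = C powr k * exp (k * k' * size y)"
      using C(1) by (simp add: powr_mult exp_powr_real mult_ac)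
    finally show "ennreal (V_norm (w y) powr k) \<le> ennreal (C powr k * exp (k * k' * size y))"
      by (rule ennreal_leI)
  qed (use C k in auto)
  then show ?thesis using w by (simp add: Lk_def)
qed

lemma solution_in_Lk: "0 \<le> k \<Longrightarrow> solution D \<psi> f \<in> Lk D k"
proof (rule in_LkI[OF solution_borel_measurable _ tame_Dg[of "{}"]])
  show "AE y in gaussian_seq. solution D \<psi> f y \<in> H10 D"
    using AE_sol_good by eventually_elim (simp add: sol_good_in_H10)
  show "snd (solution D \<psi> f y) = Dg {} y" if "y \<in> good" for y
    using snd_sol_good[of y] that by (simp add: sol_good_def)
qed simp

text \<open>In the V norm only gradients count, and at that level the error is the Hermite remainder
  of \<open>Dg {}\<close>, whose squared norm is known exactly.\<close>

lemma hermite_error: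
  assumes \<Lambda>: "finite \<Lambda>" "\<Lambda> \<subseteq> multi_idx"
  defines "e \<equiv> \<lambda>y. solution D \<psi> f y - hermite_sum (solution D \<psi> f) \<Lambda> y"
  shows "e \<in> Lk D 2"
    and "(gauss_L2_norm e)\<^sup>2 = (LINT y|gaussian_seq. (norm (Dg {} y))\<^sup>2) - (\<Sum>\<nu>\<in>\<Lambda>. (norm (coeff (Dg {}) \<nu>))\<^sup>2)"
proof -
  let ?T = "\<lambda>y. Dg {} y - (\<Sum>\<nu>\<in>\<Lambda>. hermite_prod \<nu> y *\<^sub>R coeff (Dg {}) \<nu>)"
  have mi: "\<nu> \<in> multi_idx" if "\<nu> \<in> \<Lambda>" for \<nu> using that \<Lambda>(2) by blast
  have tT: "tame ?T" using \<Lambda> by (intro hermite_partial_sum_error(1) tame_Dg) auto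
  have m: "e \<in> borel_measurable gaussian_seq"
    unfolding e_def hermite_sum_def[abs_def]
    by (intro borel_measurable_diff solution_borel_measurable borel_measurable_sum borel_measurable_scaleR
        tame_measurable tame_hermite_prod mi borel_measurable_const)
  have H10: "AE y in gaussian_seq. e y \<in> H10 D"
    using AE_sol_good
  proof eventually_elim
    case (elim y)
    show ?case
      unfolding e_def hermite_sum_def elim
      by (intro subspace_diff subspace_H10 sol_good_in_H10 subspace_sum subspace_scale[OF subspace_H10] hermite_coeff_solution(3) mi)
  qed
  have snd_sum: "snd (hermite_sum (solution D \<psi> f) \<Lambda> y) = (\<Sum>\<nu>\<in>\<Lambda>. hermite_prod \<nu> y *\<^sub>R coeff (Dg {}) \<nu>)" for y
    unfolding hermite_sum_def linear_sum[OF linear_snd]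
    by (intro sum.cong refl) (simp add: hermite_coeff_solution(2) mi)
  have snd_e: "snd (e y) = ?T y" if "y \<in> good" for y
    using snd_sol_good[of y] that by (simp add: e_def snd_sum sol_good_def)
  show "e \<in> Lk D 2" by (rule in_LkI[OF m H10 tT snd_e]) simp_all
  have "(LINT y|gaussian_seq. (V_norm (e y))\<^sup>2) = (LINT y|gaussian_seq. (norm (?T y))\<^sup>2)"
  proof (rule integral_cong_AE)
    have "(\<lambda>y. norm (snd (e y))) \<in> borel_measurable gaussian_seq"
      using measurable_compose[OF m borel_measurable_continuous_onI[OF continuous_on_snd[OF continuous_on_id]]] by simp
    then show "(\<lambda>y. (V_norm (e y))\<^sup>2) \<in> borel_measurable gaussian_seq" by (simp add: V_norm_def)
    show "AE y in gaussian_seq. (V_norm (e y))\<^sup>2 = (norm (?T y))\<^sup>2"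
      using AE_good by eventually_elim (simp add: V_norm_def snd_e)
  qed (use tame_measurable[OF tame_norm_squared[OF tT]] in simp)
  moreover have "0 \<le> (LINT y|gaussian_seq. (V_norm (e y))\<^sup>2)" by simp
  ultimately show "(gauss_L2_norm e)\<^sup>2 = (LINT y|gaussian_seq. (norm (Dg {} y))\<^sup>2) - (\<Sum>\<nu>\<in>\<Lambda>. (norm (coeff (Dg {}) \<nu>))\<^sup>2)"
    using hermite_partial_sum_error(3)[OF tame_Dg \<Lambda>, of "{}"] unfolding gauss_L2_norm_def
    by (simp only: real_sqrt_pow2 finite.emptyI)
qed

lemma solution_Lk_hermite_lp_rate:
  fixes r :: nat
  assumes p: "0 < p" "p < 2" and q_eq: "q = 2 * p / (2 - p)" and r: "0 < r" "4 \<le> r * q" "r * K \<le> ln (3 / 2)"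
    and s: "s = 1 / p - 1 / 2"
  defines "u \<equiv> solution D \<psi> f"
  shows "(AE y in gaussian_seq. log_field_converges D \<psi> y \<and>
            (\<exists>!w. weak_solution D (diffusion D \<psi> y) f w)) \<and>
         (\<forall>k\<ge>0. u \<in> Lk D k) \<and>
         (\<lambda>\<nu>. V_norm (hermite_coeff u \<nu>) powr p) summable_on multi_idx \<and>
         s = 1 / q \<and>
         (\<forall>n\<ge>1. \<exists>\<Lambda>. n_largest (\<lambda>\<nu>. V_norm (hermite_coeff u \<nu>)) n \<Lambda>) \<and>
         (\<exists>C. \<forall>n\<ge>1. \<forall>\<Lambda>. n_largest (\<lambda>\<nu>. V_norm (hermite_coeff u \<nu>)) n \<Lambda> \<longrightarrow>
            (\<lambda>y. u y - hermite_sum u \<Lambda> y) \<in> Lk D 2 \<and>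
            gauss_L2_norm (\<lambda>y. u y - hermite_sum u \<Lambda> y) \<le> C * real n powr (- s))"
proof (intro conjI)
  show "AE y in gaussian_seq. log_field_converges D \<psi> y \<and> (\<exists>!w. weak_solution D (diffusion D \<psi> y) f w)"
    using AE_good
    by eventually_elim (use log_field_convergesI[OF field_bounded field_limit] unique_weak_solution[OF field_bounded field_limit] in blast)
  show "\<forall>k\<ge>0. u \<in> Lk D k" unfolding u_def using solution_in_Lk by blast
  let ?c = "\<lambda>\<nu>. V_norm (hermite_coeff u \<nu>)"
  show sm: "(\<lambda>\<nu>. ?c \<nu> powr p) summable_on multi_idx"
    using coeff_powr_summable[OF p q_eq r] unfolding u_def
    by (subst summable_on_cong[where g = "\<lambda>\<nu>. norm (coeff (Dg {}) \<nu>) powr p"]) (simp_all add: V_norm_hermite_coeff)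
  show "s = 1 / q" using p by (simp add: s q_eq field_simps)
  have c0: "0 \<le> ?c \<nu>" for \<nu> by (simp add: V_norm_def)
  show "\<forall>n\<ge>1. \<exists>\<Lambda>. n_largest ?c n \<Lambda>" using n_largest_exists[OF _ p(1) sm] c0 by blast
  define A where "A = (\<Sum>\<^sub>\<infinity>\<nu>\<in>multi_idx. ?c \<nu> powr p) powr (2 / p)"
  show "\<exists>C. \<forall>n\<ge>1. \<forall>\<Lambda>. n_largest ?c n \<Lambda> \<longrightarrow> (\<lambda>y. u y - hermite_sum u \<Lambda> y) \<in> Lk D 2 \<and>
            gauss_L2_norm (\<lambda>y. u y - hermite_sum u \<Lambda> y) \<le> C * real n powr (- s)"
  proof (intro exI allI impI conjI)
    fix n \<Lambda> assume n: "1 \<le> n" and "n_largest ?c n \<Lambda>"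
    then have \<Lambda>: "\<Lambda> \<subseteq> multi_idx" "finite \<Lambda>" "card \<Lambda> = n" "\<And>\<nu> \<mu>. \<nu> \<in> \<Lambda> \<Longrightarrow> \<mu> \<in> multi_idx - \<Lambda> \<Longrightarrow> ?c \<mu> \<le> ?c \<nu>"
      unfolding n_largest_def by blast+
    show "(\<lambda>y. u y - hermite_sum u \<Lambda> y) \<in> Lk D 2"
      unfolding u_def by (rule hermite_error(1)[OF \<Lambda>(2,1)])
    let ?T = "LINT y|gaussian_seq. (norm (Dg {} y))\<^sup>2"
    have T: "((\<lambda>\<nu>. (?c \<nu>)\<^sup>2) has_sum ?T) multi_idx"
      using parseval[OF tame_Dg[of "{}"]] unfolding u_def
      by (subst has_sum_cong[where g = "\<lambda>\<nu>. (norm (coeff (Dg {}) \<nu>))\<^sup>2"]) (simp_all add: V_norm_hermite_coeff)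
    have "(gauss_L2_norm (\<lambda>y. u y - hermite_sum u \<Lambda> y))\<^sup>2 = ?T - (\<Sum>\<nu>\<in>\<Lambda>. (norm (coeff (Dg {}) \<nu>))\<^sup>2)"
      unfolding u_def by (rule hermite_error(2)[OF \<Lambda>(2,1)])
    also have "(\<Sum>\<nu>\<in>\<Lambda>. (norm (coeff (Dg {}) \<nu>))\<^sup>2) = (\<Sum>\<nu>\<in>\<Lambda>. (?c \<nu>)\<^sup>2)"
      using \<Lambda>(1) by (intro sum.cong refl) (auto simp: u_def V_norm_hermite_coeff)
    also have "?T - (\<Sum>\<nu>\<in>\<Lambda>. (?c \<nu>)\<^sup>2) \<le> A * real n powr (- 2 * s)"
      unfolding A_def s by (rule stechkin[OF c0 p sm T \<Lambda>(1,2,3) n \<Lambda>(4)])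
    also have "\<dots> = (sqrt A * real n powr (- s))\<^sup>2"
    proof -
      have "(real n powr (- s))\<^sup>2 = real n powr (- 2 * s)"
        by (simp add: power2_eq_square powr_add[symmetric])
      then show ?thesis by (simp add: power_mult_distrib A_def)
    qed
    finally show "gauss_L2_norm (\<lambda>y. u y - hermite_sum u \<Lambda> y) \<le> sqrt A * real n powr (- s)"
      by (rule power2_le_imp_le) (simp add: A_def)
  qed
qed

end

theorem theorem1p2:
  fixes D :: "'a::euclidean_space set"
    and f :: "'a H1 \<Rightarrow> real"
    and \<psi> :: "nat \<Rightarrow> 'a \<Rightarrow> real"
    and u :: "(nat \<Rightarrow> real) \<Rightarrow> 'a H1"
    and p q s :: real
  assumes "bounded_lipschitz_domain D"
    and "f \<in> H_minus1 D"
    and "\<And>j. \<psi> j \<in> Linf D"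
    and "0 < p" and "p < 2"
    and "q = 2 * p / (2 - p)"
    and "s = 1 / p - 1 / 2"
    and "\<exists>\<rho> :: nat \<Rightarrow> real. (\<forall>j. 0 < \<rho> j) \<and>
           esssup (lebesgue_on D) (\<lambda>x. \<Sum>j. ennreal (\<rho> j * \<bar>\<psi> j x\<bar>)) < \<infinity> \<and>
           summable (\<lambda>j. inverse (\<rho> j) powr q)"
    and "u = solution D \<psi> f"
  shows "(AE y in gaussian_seq. log_field_converges D \<psi> y \<and>
            (\<exists>!w. weak_solution D (diffusion D \<psi> y) f w)) \<and>
         (\<forall>k\<ge>0. u \<in> Lk D k) \<and>
         (\<lambda>\<nu>. V_norm (hermite_coeff u \<nu>) powr p) summable_on multi_idx \<and>
         s = 1 / q \<and>
         (\<forall>n\<ge>1. \<exists>\<Lambda>. n_largest (\<lambda>\<nu>. V_norm (hermite_coeff u \<nu>)) n \<Lambda>) \<and>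
         (\<exists>C. \<forall>n\<ge>1. \<forall>\<Lambda>. n_largest (\<lambda>\<nu>. V_norm (hermite_coeff u \<nu>)) n \<Lambda> \<longrightarrow>
            (\<lambda>y. u y - hermite_sum u \<Lambda> y) \<in> Lk D 2 \<and>
            gauss_L2_norm (\<lambda>y. u y - hermite_sum u \<Lambda> y) \<le> C * real n powr (- s))"
proof -
  have D: "open D" "bounded D" using assms(1) by (auto simp: bounded_lipschitz_domain_def)
  then have D_sets: "D \<in> sets lebesgue" by simp
  have psi_m [measurable]: "\<psi> j \<in> borel_measurable (lebesgue_on D)" for j
    using assms(3)[of j] by (simp add: Linf_def)
  have q: "0 < q" using assms(4,5,6) by simp
  obtain \<rho>0 :: "nat \<Rightarrow> real" where \<rho>0: "\<And>j. 0 < \<rho>0 j"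
    "esssup (lebesgue_on D) (\<lambda>x. \<Sum>j. ennreal (\<rho>0 j * \<bar>\<psi> j x\<bar>)) < \<infinity>"
    "summable (\<lambda>j. inverse (\<rho>0 j) powr q)"
    using assms(8) by blast
  define W where "W x = (\<Sum>j. ennreal (\<rho>0 j * \<bar>\<psi> j x\<bar>))" for x
  obtain K0 where K0: "esssup (lebesgue_on D) W = ennreal K0" "0 \<le> K0"
    using \<rho>0(2) unfolding W_def[abs_def] by (cases "esssup (lebesgue_on D) (\<lambda>x. \<Sum>j. ennreal (\<rho>0 j * \<bar>\<psi> j x\<bar>))") auto
  have W_AE: "AE x in lebesgue. x \<in> D \<longrightarrow> W x \<le> ennreal K0"
    using esssup_AE[of W "lebesgue_on D"] K0(1) by (simp add: AE_lebesgue_on_iff[OF D_sets])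
  have W_m [measurable]: "W \<in> borel_measurable (lebesgue_on D)" unfolding W_def[abs_def] by measurable
  \<comment> \<open>r depends on q alone; it must be fixed before the weights are rescaled in terms
    of it.\<close>
  obtain r :: nat where r: "0 < r" "4 \<le> r * q"
  proof -
    obtain n :: nat where "4 / q < n" using reals_Archimedean2 by blast
    then have "4 \<le> Suc n * q" using q by (simp add: field_simps)
    then show ?thesis using that[of "Suc n"] by simp
  qed
  \<comment> \<open>Chosen to make r \<kappa> K0 \<le> ln (3/2); adding 1 to K0 avoids division by
    0.\<close>
  define \<kappa> where "\<kappa> = ln (3 / 2) / (r * (K0 + 1))"
  have \<kappa>: "0 < \<kappa>" using r K0(2) by (simp add: \<kappa>_def)
  define \<rho> where "\<rho> j = \<kappa> * \<rho>0 j" for j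
  \<comment> \<open>Set to 0 on the null set where W exceeds its essential supremum, so that the sum
    bound holds at every point.\<close>
  define \<Psi> where "\<Psi> j x = (if x \<in> D \<and> W x \<le> ennreal K0 then \<psi> j x else 0)" for j x
  have sum_le: "(\<Sum>j<n. \<rho>0 j * \<bar>\<Psi> j x\<bar>) \<le> K0" for n x
  proof (cases "x \<in> D \<and> W x \<le> ennreal K0")
    case True
    have "ennreal (\<Sum>j<n. \<rho>0 j * \<bar>\<psi> j x\<bar>) = (\<Sum>j<n. ennreal (\<rho>0 j * \<bar>\<psi> j x\<bar>))"
      using \<rho>0(1) by (intro sum_ennreal[symmetric]) (simp add: less_imp_le)
    also have "\<dots> \<le> W x" unfolding W_def by (intro sum_le_suminf) auto
    finally have "ennreal (\<Sum>j<n. \<rho>0 j * \<bar>\<psi> j x\<bar>) \<le> ennreal K0" using True by (meson order_trans)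
    then show ?thesis using K0(2) True by (simp add: \<Psi>_def)
  qed (use K0(2) in \<open>auto simp: \<Psi>_def\<close>)
  obtain F where F: "\<And>v. v \<in> H10 D \<Longrightarrow> f v = F \<bullet> snd v"
    using H_minus1_representation[OF D(2) assms(2)] by blast
  interpret parametric_problem \<rho> q D \<psi> \<Psi> "\<lambda>j. K0 / \<rho>0 j" f F "\<kappa> * K0"
  proof unfold_locales
    show "0 < \<rho> j" for j using \<kappa> \<rho>0(1) by (simp add: \<rho>_def)
    have "inverse (\<rho> j) powr q = inverse \<kappa> powr q * inverse (\<rho>0 j) powr q" for j
      using \<kappa> \<rho>0(1)[of j] by (simp add: \<rho>_def powr_mult)
    then show "summable (\<lambda>j. inverse (\<rho> j) powr q)" using \<rho>0(3) by (simp add: summable_mult)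
    show "ess_bounded (\<Psi> j) (K0 / \<rho>0 j)" for j
      unfolding ess_bounded_def
    proof (intro conjI AE_I2)
      have "(\<lambda>x. if W x \<le> ennreal K0 then \<psi> j x else 0) \<in> borel_measurable (lebesgue_on D)" by measurable
      then have "(\<lambda>x. indicator D x *\<^sub>R (if W x \<le> ennreal K0 then \<psi> j x else 0)) \<in> borel_measurable lebesgue"
        using D_sets by (subst (asm) borel_measurable_restrict_space_iff) auto
      moreover have "(\<lambda>x. indicator D x *\<^sub>R (if W x \<le> ennreal K0 then \<psi> j x else 0)) = \<Psi> j"
        by (auto simp: \<Psi>_def fun_eq_iff indicator_def)
      ultimately show "\<Psi> j \<in> borel_measurable lebesgue" by simp
      show "0 \<le> K0 / \<rho>0 j" using K0(2) \<rho>0(1)[of j] by simp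
      fix x
      have "\<rho>0 j * \<bar>\<Psi> j x\<bar> \<le> (\<Sum>i<Suc j. \<rho>0 i * \<bar>\<Psi> i x\<bar>)"
        using \<rho>0(1) by (intro member_le_sum) (auto simp: less_imp_le)
      then show "\<bar>\<Psi> j x\<bar> \<le> K0 / \<rho>0 j"
        using sum_le[of x "Suc j"] \<rho>0(1)[of j] by (simp add: field_simps)
    qed
    show "AE x in lebesgue. x \<in> D \<longrightarrow> \<Psi> j x = \<psi> j x" for j
      using W_AE by eventually_elim (auto simp: \<Psi>_def)
    show "(\<Sum>j<n. \<rho> j * \<bar>\<Psi> j x\<bar>) \<le> \<kappa> * K0" for x n
      using mult_left_mono[OF sum_le[of x n], of \<kappa>] \<kappa> by (simp add: \<rho>_def sum_distrib_left mult.assoc)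
  qed (use D q F psi_m in \<open>auto simp: \<Psi>_def\<close>)
  have "r * (\<kappa> * K0) = ln (3 / 2) * (K0 / (K0 + 1))" using r by (simp add: \<kappa>_def)
  also have "\<dots> \<le> ln (3 / 2)" using K0(2) by (intro mult_left_le) auto
  finally show ?thesis
    unfolding assms(9) by (intro solution_Lk_hermite_lp_rate[OF assms(4,5,6) r _ assms(7)])
qed

end
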